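(* The symmetric sequence $\{\mathcal{C}act^1(k)\}_{k\ge 0}$ of normalized (spineless) cacti, together with the composition maps $\circ_i:\mathcal{C}act^1(k)\times\mathcal{C}act^1(j)\to\mathcal{C}act^1(k+j-1)$ of normalized cacti, extends to a $B\mathcal{O}$-algebra structure. That is, there is an algebra over the $\mathbb{N}$-colored topological operad $B\mathcal{O}$ with underlying spaces $\{\mathcal{C}act^1(k)\}_{k\ge 0}$ such that: (a) a labelled corolla in $B\mathcal{O}(n;n)\cong\Sigma_n$ acts on $\mathcal{C}act^1(n)$ by the corresponding relabelling of the lobes; and (b) if $T$ is the planar tree with exactly two vertices, the bottom one of arity $m$ and the other of arity $n$ attached to the $i$th input of the bottom one, with the bottom vertex labelled $1$, the other vertex labelled $2$, and the leaves labelled in planar order, then the element of $B\mathcal{O}(m+n-1;m,n)$ given by $T$ (with its only bracketing, the empty one) acts by $(x_1,x_2)\mapsto x_1\circ_i x_2$.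
   Context: **Trees.** A tree $T$ is a finite rooted tree with vertex set $V(T)$; external edges are the root and the leaves $L(T)$. Each vertex $v$ has one outgoing edge and $|v|\ge 0$ incoming edges. $\eta$ is the tree with one edge and no vertices; the corolla $C_n$ has one vertex and $n$ leaves. A planar tree has a chosen linear order on the incoming edges of each vertex. A subtree $S\subset T$ with $V(S)\neq\emptyset$ is determined by its (connected) vertex set and contains all edges of $T$ incident to these vertices. **The operad $\mathcal{O}$.** $\mathcal{O}$ is the $\mathbb{N}$-colored operad in sets for which $\mathcal{O}(n;m_1,\dots,m_k)$ is the set of isomorphism classes of triples $(T,\sigma,\tau)$, with $T$ a planar tree with $k$ vertices and $n$ leaves, $\sigma:\{1,\dots,k\}\to V(T)$ and $\tau:\{1,\dots,n\}\to L(T)$ bijections, and $|\sigma(i)|=m_i$. The composition $(T,\sigma,\tau)\circ_i(T',\sigma',\tau')$ (where $T'$ has $m_i$ leaves) substitutes $T'$ for the vertex $\sigma(i)$ of $T$, gluing the leaf of $T'$ labelled $a$ to the $a$th (in planar order) incoming edge of $\sigma(i)$; the leaves keep their $\tau$ labels and the vertices are ordered by inserting the order $\sigma'$ at place $i$ of $\sigma$. $\Sigma_k$ acts by relabelling vertices. The unit of color $n$ is $C_n$ with leaves labelled in planar order. Algebras over $\mathcal{O}$ are one-colored symmetric operads. **Bracketings and $B\mathcal{O}$.** A tree is large if it has at least two vertices. A bracketing of $T$ is a (possibly empty) set $B$ of large proper subtrees of $T$ which is nested: for $S,S'\in B$, $V(S)\cap V(S')$ is $V(S)$, $V(S')$ or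 $\emptyset$. $\mathcal{B}(T)$ is the poset of bracketings of $T$ under inclusion and $|\mathcal{B}(T)|$ is the geometric realization of its nerve. The operad $B\mathcal{O}$ is the $\mathbb{N}$-colored topological operad with $$B\mathcal{O}(n;m_1,\dots,m_k)=\coprod_{(T,\sigma,\tau)\in\mathcal{O}(n;m_1,\dots,m_k)}|\mathcal{B}(T)|,$$ whose composition is the realization of the poset maps $\mathcal{B}(T)\times\mathcal{B}(T')\to\mathcal{B}(T'')$ covering $(T,\sigma,\tau)\circ_i(T',\sigma',\tau')=(T'',\sigma'',\tau)$ in $\mathcal{O}$, sending $(B,B')$ to the set of those among the following subtrees of $T''$ that are large and proper: $\tilde S$ for $S\in B$ (where $\tilde S=S$ if $\sigma(i)\notin V(S)$, and $\tilde S$ is $S$ with $T'$ substituted for $\sigma(i)$ otherwise), the elements of $B'$, and $T'$ itself. Symmetric actions and units come from $\mathcal{O}$. An algebra over a $\mathfrak{C}$-colored operad $\mathcal{P}$ consists of spaces $X(c)$, $c\in\mathfrak{C}$, with maps $\mathcal{P}(c;c_1,\dots,c_k)\times X(c_1)\times\dots\times X(c_k)\to X(c)$ satisfying the usual associativity, unit and equivariance axioms. **Normalized cacti.** Let $S^1=[0,1]/0\sim1$. A normalized spineless cactus with $k$ lobes is a based, planar, treelike configuration of $k$ labelled circles (lobes) of length $1$; $\mathcal{C}act^1(k)$ is the space of these, and $\mathcal{C}act^1(0)$ is a point (no lobes). For $k\ge1$, $\mathcal{C}act^1(k)$ is homeomorphic to, and is identified with, the space $\mathcal{F}(k)$ of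 partitions $x=(I_1(x),\dots,I_k(x))$ of $S^1$ into closed $1$-dimensional submanifolds $I_j(x)$ of total length $\frac1k$ each, with pairwise disjoint interiors, such that there is no cyclically ordered $4$-tuple $(z_1;z_2;z_3;z_4)$ in $S^1$ with $z_1,z_3\in\mathring I_j(x)$ and $z_2,z_4\in\mathring I_i(x)$ for some $i\ne j$. The topology is given by the metric $d(x,y)=1-\sum_j\ell(I_j(x)\cap I_j(y))$, $\ell$ denoting length. $\Sigma_k$ acts by relabelling the $I_j$ (the lobes): if the $j$th leaf of $C_n$ in planar order has label $a$, the labelled corolla sends $x$ to the partition whose $a$th part is $I_j(x)$. For $x\in\mathcal{F}(k)$ let $c_x^r:S^1\to S^1$ be the map $c_x^r(t)=k\,\ell(I_r(x)\cap[0,t])\bmod 1$. The composition $x\circ_i y$ of normalized cacti rescales the $i$th lobe of $x$ to length $j$ and then identifies it with the outside circle of $y\in\mathcal{C}act^1(j)$, aligning basepoints. In terms of partitions: let $h:[0,1]\to[0,1]$ be the piecewise linear monotone surjection with slope $\frac{jk}{k+j-1}$ on $I_i(x)$ and slope $\frac{k}{k+j-1}$ on $I_r(x)$, $r\ne i$. Then $x\circ_iy\in\mathcal{F}(k+j-1)$ has parts $h(I_r(x))$ in position $r$ for $r<i$ and position $r+j-1$ for $r>i$, and, in position $i+s-1$ for $1\le s\le j$, the part $h\big(\overline{\mathring I_i(x)\cap(c_x^i)^{-1}(\mathring I_s(y))}\big)$. (When $j=0$ the $i$th lobe is rescaled to length $0$, i.e. collapsed; when $k+j-1=0$ the result is the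 unique point of $\mathcal{C}act^1(0)$.) This composition is not associative. *)

theory Defs
  imports "HOL-Analysis.Analysis" "HOL-Library.Product_Order"
begin

(* Everything is numbered from 0: vertices by 0..<k, leaves by 0..<n, operad inputs and lobes by
   positions in lists.  Composition at place i therefore puts the s-th of the inserted inputs at
   place i + s. *)

text \<open>\<open>op_act \<sigma> p\<close> is the right action of \<open>\<sigma>\<close>: its \<open>j\<close>-th input is the \<open>\<sigma> j\<close>-th input of \<open>p\<close>.\<close>

record ('c, 'p) colored_operad =
  op_space :: "'c \<Rightarrow> 'c list \<Rightarrow> 'p topology"
  op_unit :: "'c \<Rightarrow> 'p"
  op_comp :: "nat \<Rightarrow> 'p \<Rightarrow> 'p \<Rightarrow> 'p"
  op_act :: "(nat \<Rightarrow> nat) \<Rightarrow> 'p \<Rightarrow> 'p"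

definition insert_list :: "nat \<Rightarrow> 'a list \<Rightarrow> 'a list \<Rightarrow> 'a list" where
  "insert_list i xs ys = take i xs @ ys @ drop (Suc i) xs"

text \<open>\<open>\<theta> c cs p xs\<close> is the action of \<open>p \<in> P(c; cs)\<close> on a tuple \<open>xs\<close>. Tuples are lists; the
  topology on them is that of the product over the positions.\<close>

locale operad_algebra =
  fixes P :: "('c, 'p) colored_operad"
    and X :: "'c \<Rightarrow> 'a topology"
    and \<theta> :: "'c \<Rightarrow> 'c list \<Rightarrow> 'p \<Rightarrow> 'a list \<Rightarrow> 'a"
  assumes continuous_action:
    "continuous_map
       (prod_topology (op_space P c cs) (product_topology (\<lambda>j. X (cs ! j)) {..<length cs}))
       (X c) (\<lambda>(p, x). \<theta> c cs p (map x [0..<length cs]))"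
  and associative_action:
    "\<lbrakk>i < length cs; p \<in> topspace (op_space P c cs); q \<in> topspace (op_space P (cs ! i) ds);
      list_all2 (\<lambda>x a. x \<in> topspace (X a)) xs cs; list_all2 (\<lambda>y a. y \<in> topspace (X a)) ys ds\<rbrakk>
     \<Longrightarrow> \<theta> c (insert_list i cs ds) (op_comp P i p q) (insert_list i xs ys)
         = \<theta> c cs p (xs[i := \<theta> (cs ! i) ds q ys])"
  and unit_action:
    "x \<in> topspace (X c) \<Longrightarrow> \<theta> c [c] (op_unit P c) [x] = x"
  and equivariant_action:
    "\<lbrakk>\<sigma> permutes {..<length cs}; p \<in> topspace (op_space P c cs);
      list_all2 (\<lambda>x a. x \<in> topspace (X a)) xs cs\<rbrakk>
     \<Longrightarrow> \<theta> c (permute_list \<sigma> cs) (op_act P \<sigma> p) (permute_list \<sigma> xs) = \<theta> c cs p xs"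

text \<open>A planar tree has no nontrivial automorphisms, so an isomorphism class of a planar tree with
  labelled vertices and leaves is a term of this type. \<open>Leaf a\<close> as a whole term is the tree with
  one edge and no vertices.\<close>

datatype (vertices: 'v) ptree = Leaf nat | Vertex 'v "'v ptree list"
  for map: relabel

fun leaf_list :: "'v ptree \<Rightarrow> nat list" where
  "leaf_list (Leaf a) = [a]"
| "leaf_list (Vertex v ts) = concat (map leaf_list ts)"

fun arity_list :: "'v ptree \<Rightarrow> ('v \<times> nat) list" where
  "arity_list (Leaf a) = []"
| "arity_list (Vertex v ts) = (v, length ts) # concat (map arity_list ts)"

fun inner_edges :: "'v ptree \<Rightarrow> ('v \<times> 'v) set" where
  "inner_edges (Leaf a) = {}"
| "inner_edges (Vertex v ts) =
     {(v, w) | w us. Vertex w us \<in> set ts} \<union> (\<Union>t\<in>set ts. inner_edges t)"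

text \<open>The set \<open>\<O>(n; m\<^sub>0, \<dots>, m\<^bsub>k-1\<^esub>)\<close>.\<close>

definition tree_ops :: "nat \<Rightarrow> nat list \<Rightarrow> nat ptree set" where
  "tree_ops n ms = {T. distinct (leaf_list T) \<and> set (leaf_list T) = {..<n} \<and>
     distinct (map fst (arity_list T)) \<and>
     set (arity_list T) = {(v, ms ! v) | v. v < length ms}}"

definition corolla :: "nat list \<Rightarrow> nat ptree" where
  "corolla ls = Vertex 0 (map Leaf ls)"

fun graft :: "'v ptree \<Rightarrow> 'v ptree list \<Rightarrow> 'v ptree" where
  "graft (Leaf a) ts = ts ! a"
| "graft (Vertex v us) ts = Vertex v (map (\<lambda>u. graft u ts) us)"

text \<open>The new label of a vertex \<open>v \<noteq> i\<close> when \<open>l\<close> vertices are inserted at place \<open>i\<close>.\<close>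

definition shift :: "nat \<Rightarrow> nat \<Rightarrow> nat \<Rightarrow> nat" where
  "shift i l v = (if v < i then v else v + l - 1)"

fun tree_comp :: "nat \<Rightarrow> nat ptree \<Rightarrow> nat ptree \<Rightarrow> nat ptree" where
  "tree_comp i (Leaf a) U = Leaf a"
| "tree_comp i (Vertex v ts) U =
     (if v = i then graft (relabel ((+) i) U) (map (\<lambda>t. tree_comp i t U) ts)
      else Vertex (shift i (card (vertices U)) v) (map (\<lambda>t. tree_comp i t U) ts))"

text \<open>A subtree with at least one vertex is represented by its vertex set.\<close>

definition subtrees :: "'v ptree \<Rightarrow> 'v set set" where
  "subtrees T = {S. S \<noteq> {} \<and> S \<subseteq> vertices T \<and>
     (\<forall>v\<in>S. \<forall>w\<in>S. (v, w) \<in> ((inner_edges T \<union> (inner_edges T)\<inverse>) \<inter> S \<times> S)\<^sup>*)}"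

definition large_proper_subtrees :: "'v ptree \<Rightarrow> 'v set set" where
  "large_proper_subtrees T = {S \<in> subtrees T. 2 \<le> card S \<and> S \<noteq> vertices T}"

definition bracketings :: "'v ptree \<Rightarrow> 'v set set set" where
  "bracketings T = {B. B \<subseteq> large_proper_subtrees T \<and> (\<forall>S\<in>B. \<forall>S'\<in>B. S \<inter> S' \<in> {S, S', {}})}"

definition subst_subtree :: "nat \<Rightarrow> nat ptree \<Rightarrow> nat set \<Rightarrow> nat set" where
  "subst_subtree i U S =
     shift i (card (vertices U)) ` (S - {i}) \<union> (if i \<in> S then (+) i ` vertices U else {})"

definition bracketing_comp ::
    "nat \<Rightarrow> nat ptree \<Rightarrow> nat ptree \<Rightarrow> nat set set \<times> nat set set \<Rightarrow> nat set set" where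
  "bracketing_comp i T U = (\<lambda>(B, B').
     (subst_subtree i U ` B \<union> (`) ((+) i) ` B' \<union> {(+) i ` vertices U})
       \<inter> large_proper_subtrees (tree_comp i T U))"

text \<open>A point of the realization is given by barycentric coordinates: it lies in the interior of
  the simplex spanned by the chain of elements with nonzero coordinate. For finite \<open>P\<close> the
  topology of the realization is the topology of pointwise convergence.\<close>

definition realization :: "'a::order set \<Rightarrow> ('a \<Rightarrow> real) set" where
  "realization P = {u. (\<forall>a. 0 \<le> u a) \<and> (\<forall>a. a \<notin> P \<longrightarrow> u a = 0) \<and> sum u P = 1 \<and>
     (\<forall>a b. u a \<noteq> 0 \<longrightarrow> u b \<noteq> 0 \<longrightarrow> a \<le> b \<or> b \<le> a)}"

definition realize_map :: "('a \<Rightarrow> 'b) \<Rightarrow> ('a \<Rightarrow> real) \<Rightarrow> 'b \<Rightarrow> real" where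
  "realize_map f u = (\<lambda>b. \<Sum>a | u a \<noteq> 0 \<and> f a = b. u a)"

definition point_mass :: "'a \<Rightarrow> 'a \<Rightarrow> real" where
  "point_mass a = (\<lambda>b. if b = a then 1 else 0)"

text \<open>The canonical homeomorphism \<open>|P| \<times> |Q| \<rightarrow> |P \<times> Q|\<close>, inverse to the map given by the two
  projections; \<open>P \<times> Q\<close> carries the componentwise order.\<close>

definition realize_prod ::
    "'a::order set \<Rightarrow> 'b::order set \<Rightarrow> ('a \<Rightarrow> real) \<times> ('b \<Rightarrow> real) \<Rightarrow> 'a \<times> 'b \<Rightarrow> real" where
  "realize_prod P Q =
     the_inv_into (realization (P \<times> Q)) (\<lambda>w. (realize_map fst w, realize_map snd w))"

definition BO :: "(nat, nat ptree \<times> (nat set set \<Rightarrow> real)) colored_operad" where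
  "BO = \<lparr>
     op_space = (\<lambda>n ms. sum_topology (\<lambda>T. top_of_set (realization (bracketings T))) (tree_ops n ms)),
     op_unit = (\<lambda>n. (corolla [0..<n], point_mass {})),
     op_comp = (\<lambda>i (T, u) (U, v). (tree_comp i T U,
       realize_map (bracketing_comp i T U) (realize_prod (bracketings T) (bracketings U) (u, v)))),
     op_act = (\<lambda>\<sigma> (T, u). (relabel (inv \<sigma>) T, realize_map ((`) ((`) (inv \<sigma>))) u)) \<rparr>"

definition two_vertex_tree :: "nat \<Rightarrow> nat \<Rightarrow> nat \<Rightarrow> nat ptree" where
  "two_vertex_tree m n i =
     Vertex 0 (map Leaf [0..<i] @ [Vertex 1 (map Leaf [i..<i + n])] @ map Leaf [i + n..<m + n - 1])"

text \<open>\<open>S\<^sup>1 = [0,1]/0\<sim>1\<close> is the unit circle in the complex plane, parametrized by \<open>circ\<close>.\<close>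

definition circ :: "real \<Rightarrow> complex" where
  "circ t = cis (2 * pi * t)"

abbreviation S1 :: "complex set" where
  "S1 \<equiv> sphere 0 1"

definition circle_interior :: "complex set \<Rightarrow> complex set" where
  "circle_interior A = top_of_set S1 interior_of A"

text \<open>\<open>arc_length A t\<close> is the length of \<open>A \<inter> [0,t]\<close>.\<close>

definition arc_length :: "complex set \<Rightarrow> real \<Rightarrow> real" where
  "arc_length A t = measure lebesgue {s \<in> {0..t}. circ s \<in> A}"

text \<open>A submanifold may have boundary; the half-open interval models its boundary points.\<close>

definition closed_1_submanifold :: "complex set \<Rightarrow> bool" where
  "closed_1_submanifold A \<longleftrightarrow> A \<subseteq> S1 \<and> closed A \<and>
     (\<forall>z\<in>A. \<exists>U. z \<in> U \<and> openin (top_of_set A) U \<and>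
        (U homeomorphic {0<..<1::real} \<or> U homeomorphic {0..<1::real}))"

definition cyclically_ordered :: "complex \<Rightarrow> complex \<Rightarrow> complex \<Rightarrow> complex \<Rightarrow> bool" where
  "cyclically_ordered z1 z2 z3 z4 \<longleftrightarrow>
     (\<exists>t1 t2 t3 t4. t1 < t2 \<and> t2 < t3 \<and> t3 < t4 \<and> t4 < t1 + 1 \<and>
        z1 = circ t1 \<and> z2 = circ t2 \<and> z3 = circ t3 \<and> z4 = circ t4)"

text \<open>For \<open>k = 0\<close> there is the single cactus without lobes, which is not a partition of the
  circle.\<close>

definition cacti :: "nat \<Rightarrow> complex set list set" where
  "cacti k = (if k = 0 then {[]} else {x. length x = k \<and>
     (\<forall>j<k. closed_1_submanifold (x ! j) \<and> arc_length (x ! j) 1 = 1 / real k) \<and>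
     (\<Union>j<k. x ! j) = S1 \<and>
     (\<forall>i<k. \<forall>j<k. i \<noteq> j \<longrightarrow>
        circle_interior (x ! i) \<inter> circle_interior (x ! j) = {} \<and>
        \<not> (\<exists>z1 z2 z3 z4. cyclically_ordered z1 z2 z3 z4 \<and>
             z1 \<in> circle_interior (x ! j) \<and> z3 \<in> circle_interior (x ! j) \<and>
             z2 \<in> circle_interior (x ! i) \<and> z4 \<in> circle_interior (x ! i)))})"

text \<open>The first case makes the distance nonnegative on the whole type, as the library requires,
  and zero on the one-point space \<open>cacti 0\<close>.\<close>

definition cactus_dist :: "nat \<Rightarrow> complex set list \<Rightarrow> complex set list \<Rightarrow> real" where
  "cactus_dist k x y = (if k = 0 \<or> x \<notin> cacti k \<or> y \<notin> cacti k then 0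
     else 1 - (\<Sum>j<k. arc_length (x ! j \<inter> y ! j) 1))"

definition Cact :: "nat \<Rightarrow> complex set list topology" where
  "Cact k = Metric_space.mtopology (cacti k) (cactus_dist k)"

text \<open>\<open>lobe_map x r t\<close> is \<open>c\<^sub>x\<^sup>r\<close> at the point of the circle with parameter \<open>t\<close>.\<close>

definition lobe_map :: "complex set list \<Rightarrow> nat \<Rightarrow> real \<Rightarrow> complex" where
  "lobe_map x r t = circ (real (length x) * arc_length (x ! r) t)"

text \<open>The piecewise linear map with \<open>rescale i j x 0 = 0\<close> and slope \<open>jk/(k+j-1)\<close> on the \<open>i\<close>-th part
  of \<open>x\<close> and \<open>k/(k+j-1)\<close> on the other parts, where \<open>k\<close> is the number of parts.\<close>

definition rescale :: "nat \<Rightarrow> nat \<Rightarrow> complex set list \<Rightarrow> real \<Rightarrow> real" where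
  "rescale i j x t = (let k = length x in
     \<Sum>r<k. (if r = i then real (j * k) else real k) / real (k + j - 1) * arc_length (x ! r) t)"

definition circle_image :: "(real \<Rightarrow> real) \<Rightarrow> complex set \<Rightarrow> complex set" where
  "circle_image h A = {circ (h t) | t. t \<in> {0..1} \<and> circ t \<in> A}"

definition cactus_comp :: "nat \<Rightarrow> complex set list \<Rightarrow> complex set list \<Rightarrow> complex set list" where
  "cactus_comp i x y = (let h = rescale i (length y) x in
     insert_list i (map (circle_image h) x)
       (map (\<lambda>A. circle_image h (closure {circ t | t. t \<in> {0..1} \<and>
                 circ t \<in> circle_interior (x ! i) \<and> lobe_map x i t \<in> circle_interior A})) y))"

end

(* A normalized cactus with k lobes is determined by the k monotone functions that record the position
   on each lobe while the outside circle is traversed; their sum has slope k, at each time only one of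
   them moves, and no two of them cross. For cacti at the vertices of a tree T, following a point of the
   root circle up through T to a leaf again gives such functions, up to a reparametrization of the
   circles. Normalized composition reparametrizes by arc length on the composed cactus, and this is done
   for a bracket before the composite is inserted into the rest of the tree.

   A point u of the realization of the bracketings gives a bracket S the weight height T u S, the total
   mass of the bracketings containing S. The brackets of positive weight form a nested family, so those
   with root v are a chain. The circle at v is reparametrized by starting with its own parameter and
   clamping successively, for larger and larger brackets S in this chain, to distance at most 1 - t S from
   the arc length parameter of the cactus enclosed by S. The whole tree has weight 1 and so normalizes
   the result.

   Inserting (U, v) into (T, u) puts a bracket of weight 1 around U. Thus at the root of U, the brackets of
   U normalize the parameter before those of T are applied, which is associativity. If U is the tree
   without vertices, then brackets S and S + i become equal, and clamping twice around the same value
   amounts to clamping with the larger weight. *)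
theory Submission imports Defs begin

text \<open>Clamping takes the place of convex interpolation because of the units: two
  interpolations towards the same value with weights a and b compose to the weight a + b - a * b,
  whereas the composite bracketing gives the mass max a b, as the bracketings that carry mass form a
  chain. The other obstacle is that reparametrizations can be constant on intervals, for instance
  while the point runs along a lobe into which the cactus without lobes is inserted. They have no
  inverse, and the construction makes sense only because whatever is observed beyond a vertex is
  constant on these intervals too. The reason is a domination: the increments of the clamped
  parameter are at least those of the mean position at the exits of some bracket (or of the original
  parameter), and these control all other increments up to a factor that depends on the tree only.
  The same uniform Lipschitz constants yield continuity jointly in the bracketing and the
  cacti.\<close>

section \<open>Flows through trees of cacti\<close>

text \<open>For a chain \<open>K\<close> this is the result of starting with \<open>\<phi> {}\<close> and clamping successively, for larger
  and larger \<open>A\<close>, to the interval of radius \<open>1 - t A\<close> around \<open>\<phi> A\<close>. A set of weight \<open>0\<close> has no effect on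
  values in the unit interval, and one of weight \<open>1\<close> makes the smaller ones irrelevant.\<close>

definition mix :: "('v set \<Rightarrow> real) \<Rightarrow> 'v set set \<Rightarrow> ('v set \<Rightarrow> real) \<Rightarrow> real" where
  "mix t K \<phi> = (MAX A\<in>K. MIN B\<in>{B\<in>K. A \<subseteq> B}. min (\<phi> A - (1 - t A)) (\<phi> B + (1 - t B)))"

text \<open>The outer maximum is attained, so the max-min formula can be used through its lower
  bounds alone. All later comparisons of two values of \<open>mix\<close> translate a witness
  \<open>A\<close> from one chain to another.\<close>

lemma le_mix_iff:
  assumes "finite K" "K \<noteq> {}"
  shows "c \<le> mix t K \<phi> \<longleftrightarrow>
    (\<exists>A\<in>K. c \<le> \<phi> A - (1 - t A) \<and> (\<forall>B\<in>K. A \<subseteq> B \<longrightarrow> c \<le> \<phi> B + (1 - t B)))"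
proof -
  have "c \<le> (MIN B\<in>{B\<in>K. A \<subseteq> B}. min (\<phi> A - (1 - t A)) (\<phi> B + (1 - t B))) \<longleftrightarrow>
     c \<le> \<phi> A - (1 - t A) \<and> (\<forall>B\<in>K. A \<subseteq> B \<longrightarrow> c \<le> \<phi> B + (1 - t B))" if "A \<in> K" for A
  proof -
    have "{B \<in> K. A \<subseteq> B} \<noteq> {}" using that by auto
    then show ?thesis
      using assms that by (subst Min_ge_iff) auto
  qed
  then show ?thesis
    unfolding mix_def using assms by (subst Max_ge_iff) auto
qed

text \<open>The witness for the old value also serves for the new one. With \<open>d = 0\<close>
  this is monotonicity, with negative \<open>d\<close> a Lipschitz bound, and with \<open>d\<close>
  the smallest increment of the centres it shows that clamping moves the parameter at least as much
  as the slowest centre.\<close>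

lemma mix_shift:
  assumes "finite K" "K \<noteq> {}" "\<And>A. A \<in> K ==> \<phi> A + d \<le> \<phi>' A"
  shows "mix t K \<phi> + d \<le> mix t K \<phi>'"
proof -
  obtain A where A: "A \<in> K" "mix t K \<phi> \<le> \<phi> A - (1 - t A)"
      "\<And>B. B \<in> K ==> A \<subseteq> B ==> mix t K \<phi> \<le> \<phi> B + (1 - t B)"
    using le_mix_iff[OF assms(1,2), of "mix t K \<phi>" t \<phi>] by auto
  show ?thesis
    unfolding le_mix_iff[OF assms(1,2)]
  proof (intro bexI[OF _ A(1)] conjI ballI impI)
    show "mix t K \<phi> + d \<le> \<phi>' A - (1 - t A)" using A(1,2) assms(3)[of A] by linarith
    show "mix t K \<phi> + d \<le> \<phi>' B + (1 - t B)" if "B \<in> K" "A \<subseteq> B" for B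
      using A(3)[OF that] assms(3)[OF that(1)] by linarith
  qed
qed

definition weights :: "('v set \<Rightarrow> real) \<Rightarrow> bool" where
  "weights t \<longleftrightarrow> t {} = 1 \<and> (\<forall>A. 0 \<le> t A \<and> t A \<le> 1) \<and>
     (\<forall>A B. 0 < t A \<and> 0 < t B \<longrightarrow> A \<subseteq> B \<or> B \<subseteq> A \<or> A \<inter> B = {})"

lemma weightsD:
  assumes "weights t"
  shows "t {} = 1" "0 \<le> t A" "t A \<le> 1"
    "0 < t A ==> 0 < t B ==> A \<subseteq> B \<or> B \<subseteq> A \<or> A \<inter> B = {}"
  using assms unfolding weights_def by blast+

lemma mix_mem:
  assumes "finite K" "{} \<in> K" "weights t" "\<And>A. A \<in> K ==> 0 \<le> \<phi> A \<and> \<phi> A \<le> 1"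
  shows "0 \<le> mix t K \<phi>" "mix t K \<phi> \<le> 1"
proof -
  have K: "K \<noteq> {}" using assms(2) by auto
  note t = weightsD[OF assms(3)]
  show "0 \<le> mix t K \<phi>"
    unfolding le_mix_iff[OF assms(1) K]
    by (rule bexI[OF _ assms(2)]) (use assms(2,4) t in \<open>auto intro: add_nonneg_nonneg\<close>)
  obtain A where "A \<in> K" "mix t K \<phi> \<le> \<phi> A - (1 - t A)"
    using le_mix_iff[OF assms(1) K, of "mix t K \<phi>" t \<phi>] by auto
  then show "mix t K \<phi> \<le> 1" using assms(4)[of A] t(3)[of A] by linarith
qed

lemma mix_const:
  assumes "finite K" "{} \<in> K" "weights t" "\<And>A. A \<in> K ==> \<phi> A = z"
  shows "mix t K \<phi> = z"
proof (rule antisym)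
  have K: "K \<noteq> {}" using assms(2) by auto
  note t = weightsD[OF assms(3)]
  obtain A where "A \<in> K" "mix t K \<phi> \<le> \<phi> A - (1 - t A)"
    using le_mix_iff[OF assms(1) K, of "mix t K \<phi>" t \<phi>] by auto
  then show "mix t K \<phi> \<le> z" using assms(4)[of A] t(3)[of A] by linarith
  show "z \<le> mix t K \<phi>"
    unfolding le_mix_iff[OF assms(1) K]
    by (rule bexI[OF _ assms(2)]) (use assms(2,4) t in auto)
qed

lemma mix_top:
  assumes "finite K" "V \<in> K" "t V = 1" "\<And>A. A \<in> K ==> A \<subseteq> V"
  shows "mix t K \<phi> = \<phi> V"
proof -
  have K: "K \<noteq> {}" using assms(2) by auto
  have "mix t K \<phi> \<le> \<phi> V"
    using le_mix_iff[OF assms(1) K, of "mix t K \<phi>" t \<phi>] assms(2-4) by force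
  moreover have "\<phi> V \<le> mix t K \<phi>"
    unfolding le_mix_iff[OF assms(1) K]
  proof (intro bexI[OF _ assms(2)] conjI ballI impI)
    show "\<phi> V \<le> \<phi> B + (1 - t B)" if "B \<in> K" "V \<subseteq> B" for B
      using assms(3) assms(4)[OF that(1)] that(2) by (simp add: subset_antisym)
  qed (use assms in simp)
  ultimately show ?thesis by simp
qed

text \<open>The value does not change discontinuously when a bracket enters or leaves the family \<open>K\<close>,
  because its weight vanishes at that moment.\<close>

lemma mix_stable:
  assumes fin: "finite K" "finite K'" and ne: "{} \<in> K" "{} \<in> K'"
    and w: "weights t" "weights t'"
    and \<phi>: "\<And>A. A \<in> K ==> \<phi> A \<le> 1" "\<And>A. A \<in> K' ==> 0 \<le> \<phi>' A \<and> \<phi>' A \<le> 1"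
    and K: "\<And>A. A \<in> K ==> 0 < t' A ==> A \<in> K'" "\<And>A. A \<in> K' ==> 0 < t A ==> A \<in> K"
    and d: "\<And>A. \<bar>t A - t' A\<bar> \<le> e" "\<And>A. A \<in> K ==> A \<in> K' ==> \<bar>\<phi> A - \<phi>' A\<bar> \<le> d" "0 \<le> d" "0 \<le> e"
  shows "mix t K \<phi> \<le> mix t' K' \<phi>' + (e + d)"
proof (cases "mix t K \<phi> \<le> e + d")
  case True
  moreover have "0 \<le> mix t' K' \<phi>'" by (rule mix_mem(1)) (use fin ne w \<phi> in auto)
  ultimately show ?thesis by linarith
next
  case False
  have ne': "K \<noteq> {}" "K' \<noteq> {}" using ne by auto
  define c where "c = mix t K \<phi>"
  obtain A where A: "A \<in> K" "c \<le> \<phi> A - (1 - t A)"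
      "\<And>B. B \<in> K ==> A \<subseteq> B ==> c \<le> \<phi> B + (1 - t B)"
    using le_mix_iff[OF fin(1) ne'(1), of c t \<phi>] by (auto simp: c_def)
  \<comment> \<open>A value above the error forces its witness to have weight more than e under
    \<open>t\<close>, hence positive weight under \<open>t'\<close>, so that the witness belongs to
    the other family as well.\<close>
  have ce: "c > e + d" using False c_def by simp
  then have "t A > e" using \<phi>(1)[OF A(1)] A(2) d(3) by linarith
  then have "t' A > 0" using d(1)[of A] by linarith
  then have A': "A \<in> K'" using K(1) A(1) by simp
  have c1: "c \<le> 1" using A(2) \<phi>(1)[OF A(1)] weightsD(3)[OF w(1), of A] by linarith
  have "c - (e + d) \<le> mix t' K' \<phi>'"
    unfolding le_mix_iff[OF fin(2) ne'(2)]
  proof (intro bexI[OF _ A'] conjI ballI impI)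
    show "c - (e + d) \<le> \<phi>' A - (1 - t' A)"
      using A(2) d(1)[of A] d(2)[OF A(1) A'] by linarith
    show "c - (e + d) \<le> \<phi>' B + (1 - t' B)" if B: "B \<in> K'" "A \<subseteq> B" for B
    proof (cases "0 < t B")
      case True
      then have BK: "B \<in> K" using K(2) B(1) by simp
      then show ?thesis using A(3)[OF BK B(2)] d(1)[of B] d(2)[OF BK B(1)] by linarith
    next
      case False
      \<comment> \<open>A set without weight under \<open>t\<close> has weight at most e under
        \<open>t'\<close>. Its clamp has radius at least 1 - e and cannot push a value below c -
        e.\<close>
      then have "t' B \<le> e" using d(1)[of B] by linarith
      then show ?thesis using \<phi>(2)[OF B(1)] c1 d(3) by linarith
    qed
  qed
  then show ?thesis unfolding c_def by linarith
qed

section \<open>Exits, brackets rooted at a vertex, and the flow\<close>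

primrec exits :: "'v set \<Rightarrow> 'v ptree \<Rightarrow> nat" where
  "exits A (Leaf a) = 1"
| "exits A (Vertex v ts) = (if v \<in> A then sum_list (map (exits A) ts) else 1)"

text \<open>The chain of brackets rooted at \<open>v\<close>, where \<open>{}\<close> stands for the
  parameter of the circle at \<open>v\<close> itself. A bracket without exits encloses a cactus
  without lobes; it has no arc length parameter to clamp to and is left out.\<close>

definition family :: "('v set \<Rightarrow> real) \<Rightarrow> 'v \<Rightarrow> 'v ptree list \<Rightarrow> 'v set set" where
  "family t v ts = {A. A \<subseteq> vertices (Vertex v ts) \<and> 0 < t A \<and>
     (A = {} \<or> v \<in> A \<and> exits A (Vertex v ts) \<noteq> 0)}"

text \<open>The set and the boundary function come after the tree because the recursion at a vertex
  needs the flows of its children for several sets at once: the given one and every bracket rooted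
  at the vertex.\<close>

type_synonym 'v functional = "'v set \<Rightarrow> ('v ptree \<Rightarrow> real \<Rightarrow> real) \<Rightarrow> real \<Rightarrow> real"

definition branch_sum :: "('v \<Rightarrow> nat \<Rightarrow> real \<Rightarrow> real) \<Rightarrow> 'v \<Rightarrow> 'v functional list \<Rightarrow> 'v functional" where
  "branch_sum x v ws A F r = (\<Sum>j<length ws. (ws ! j) A F (x v j r))"

definition branch_mean ::
    "('v \<Rightarrow> nat \<Rightarrow> real \<Rightarrow> real) \<Rightarrow> 'v \<Rightarrow> 'v ptree list \<Rightarrow> 'v functional list \<Rightarrow> 'v set \<Rightarrow> real \<Rightarrow> real" where
  "branch_mean x v ts ws A r =
     (if A = {} then r else branch_sum x v ws A (\<lambda>_ s. s) r / real (exits A (Vertex v ts)))"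

text \<open>\<open>flow t x N A F s\<close> sends the point with parameter \<open>s\<close> through the cacti at the vertices in \<open>A\<close>
  that are connected to the root of \<open>N\<close>, and adds up the values of \<open>F\<close> at the points where it leaves
  them. The parameter is adjusted at each vertex by inverting \<open>repar\<close> below.\<close>

primrec flow ::
    "('v set \<Rightarrow> real) \<Rightarrow> ('v \<Rightarrow> nat \<Rightarrow> real \<Rightarrow> real) \<Rightarrow> 'v ptree \<Rightarrow> 'v functional" where
  "flow t x (Leaf a) = (\<lambda>A F s. F (Leaf a) s)"
| "flow t x (Vertex v ts) = (\<lambda>A F s. if v \<in> A
     then branch_sum x v (map (flow t x) ts) A F
       (inv_into {0..1} (\<lambda>r. mix t (family t v ts)
          (\<lambda>B. branch_mean x v ts (map (flow t x) ts) B r)) s)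
     else F (Vertex v ts) s)"

text \<open>With \<open>exit_mean\<close> and \<open>repar\<close>, these are the auxiliary
  functions of the recursion with \<open>flow\<close> itself put in for the list of functionals.
  Later arguments use only this form.\<close>

definition branches where
  "branches t x v ts A F r = (\<Sum>j<length ts. flow t x (ts ! j) A F (x v j r))"

definition exit_mean where
  "exit_mean t x v ts A r = (if A = {} then r
     else branches t x v ts A (\<lambda>_ s. s) r / real (exits A (Vertex v ts)))"

definition repar where
  "repar t x v ts r = mix t (family t v ts) (\<lambda>A. exit_mean t x v ts A r)"

abbreviation unrepar where
  "unrepar t x v ts \<equiv> inv_into {0..1} (repar t x v ts)"

lemma flow_Vertex:
  "flow t x (Vertex v ts) A F s = (if v \<in> A then branches t x v ts A F (unrepar t x v ts s) else F (Vertex v ts) s)"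
proof -
  have eq: "branch_sum x v (map (flow t x) ts) = branches t x v ts"
    by (auto simp: fun_eq_iff branch_sum_def branches_def)
  show ?thesis
    unfolding repar_def[abs_def] exit_mean_def flow.simps(2) branch_mean_def eq by (rule refl)
qed

declare flow.simps(2)[simp del]
lemmas flow_Vertex[simp]

text \<open>No bracket of positive weight straddles the boundary of \<open>A\<close>. The circle at
  a vertex of \<open>A\<close> is reparametrized by the brackets rooted there, and the domination
  argument for the exits of \<open>A\<close> works with brackets that stay inside
  \<open>A\<close>.\<close>

definition compatible :: "('v set \<Rightarrow> real) \<Rightarrow> 'v ptree \<Rightarrow> 'v set \<Rightarrow> bool" where
  "compatible t N A \<longleftrightarrow> (\<forall>S. S \<subseteq> vertices N \<and> 0 < t S \<and> S \<inter> A \<noteq> {} \<longrightarrow> S \<subseteq> A)"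

definition cactus_fun :: "nat \<Rightarrow> (nat \<Rightarrow> real \<Rightarrow> real) \<Rightarrow> bool" where
  "cactus_fun k f \<longleftrightarrow> (\<forall>j<k. mono_on {0..1} (f j) \<and> f j 0 = 0 \<and> f j 1 = 1) \<and>
     (\<forall>r\<in>{0..1}. (\<Sum>j<k. f j r) = real k * r)"

primrec fits :: "('v \<Rightarrow> nat \<Rightarrow> real \<Rightarrow> real) \<Rightarrow> 'v ptree \<Rightarrow> bool" where
  "fits x (Leaf a) \<longleftrightarrow> True"
| "fits x (Vertex v ts) \<longleftrightarrow> (length ts \<noteq> 0 \<longrightarrow> cactus_fun (length ts) (x v)) \<and>
     v \<notin> (\<Union>T\<in>set ts. vertices T) \<and> list_all (fits x) ts"

primrec subs :: "'v ptree \<Rightarrow> 'v ptree set" where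
  "subs (Leaf a) = {Leaf a}"
| "subs (Vertex v ts) = insert (Vertex v ts) (\<Union>(set (map subs ts)))"

lemma subs_refl[simp]: "N \<in> subs N" by (cases N) auto

lemma subs_trans: "N \<in> subs T ==> M \<in> subs N ==> M \<in> subs T"
  by (induction T) auto

lemma subs_nth: "j < length ts ==> ts ! j \<in> subs (Vertex v ts)"
  by (auto intro!: bexI[of _ "ts ! j"])

lemma vertices_subs: "N \<in> subs T ==> vertices N \<subseteq> vertices T"
  by (induction T) auto

lemma fits_subs: "N \<in> subs T ==> fits x T ==> fits x N"
  by (induction T) (auto simp: list_all_iff)

lemma finite_vertices[simp]: "finite (vertices (T :: 'v ptree))"
  by (induction T) auto

lemma finite_family[simp]: "finite (family t v ts)"
  by (rule finite_subset[of _ "Pow (vertices (Vertex v ts))"])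
    (auto simp: family_def simp del: ptree.set(2))

lemma empty_in_family[simp]: "weights t ==> {} \<in> family t v ts"
  unfolding family_def weights_def by simp

lemma family_nonempty: "weights t ==> family t v ts \<noteq> {}"
  by (metis empty_in_family empty_iff)

lemma compatible_subs: "N \<in> subs T ==> compatible t T A ==> compatible t N A"
  unfolding compatible_def using vertices_subs by blast

text \<open>A bracket inside \<open>N\<close> that meets \<open>A\<close> is nested with
  \<open>A\<close>, and it cannot contain \<open>A\<close> because \<open>v\<close> lies in
  \<open>A\<close> but not in \<open>N\<close>.\<close>

lemma compatible_family:
  assumes "weights t" "A \<in> family t v ts" "N \<in> set ts" "v \<notin> vertices N"
  shows "compatible t N A"
  unfolding compatible_def
proof (intro allI impI)
  fix S assume S: "S \<subseteq> vertices N \<and> 0 < t S \<and> S \<inter> A \<noteq> {}"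
  then have "A \<noteq> {}" by auto
  then have "v \<in> A" "0 < t A" using assms(2) unfolding family_def by auto
  then show "S \<subseteq> A" using weightsD(4)[OF assms(1), of S A] S assms(4) by auto
qed

lemma exits_Vertex: "v \<in> A ==> exits A (Vertex v ts) = (\<Sum>j<length ts. exits A (ts ! j))"
  by (simp add: sum_list_sum_nth atLeast0LessThan)

text \<open>The parameter chosen at a vertex does not depend on the set, so the flow through
  \<open>A\<close> can be interrupted at the exits of \<open>S\<close> and resumed there. This is
  how a set is compared with a bracket inside it.\<close>

lemma flow_flow:
  "S \<subseteq> A ==> flow t x N A F s = flow t x N S (\<lambda>M. flow t x M A F) s"
proof (induction N arbitrary: s)
  case (Vertex v ts)
  show ?case
  proof (cases "v \<in> S")
    case True
    then have "v \<in> A" using Vertex.prems by auto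
    then show ?thesis using True Vertex by (auto simp: branches_def intro!: sum.cong)
  qed simp
qed simp

lemma branches_flow:
  "S \<subseteq> A ==> branches t x v ts A F s = branches t x v ts S (\<lambda>M. flow t x M A F) s"
  unfolding branches_def by (intro sum.cong refl flow_flow)

section \<open>Monotone Lipschitz functions and their inverses\<close>

definition nice :: "real \<Rightarrow> (real \<Rightarrow> real) \<Rightarrow> bool" where
  "nice M f \<longleftrightarrow> (\<forall>a b. 0 \<le> a \<and> a \<le> b \<and> b \<le> 1 \<longrightarrow> f a \<le> f b \<and> f b - f a \<le> M * (b - a))"

lemma niceD:
  assumes "nice M f" "0 \<le> a" "a \<le> b" "b \<le> 1"
  shows "f a \<le> f b" "f b - f a \<le> M * (b - a)"
  using assms unfolding nice_def by auto

lemma nice_mono: "nice M f ==> M \<le> M' ==> nice M' f"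
  unfolding nice_def by (meson diff_ge_0_iff_ge mult_right_mono order_trans)

lemma nice_abs:
  assumes "nice M f" "a \<in> {0..1}" "b \<in> {0..1}"
  shows "\<bar>f a - f b\<bar> \<le> M * \<bar>a - b\<bar>"
  using niceD[OF assms(1), of a b] niceD[OF assms(1), of b a] assms(2,3)
  by (cases "a \<le> b") (auto simp: abs_if)

text \<open>All increments are nonnegative and add up to k times the length of the interval, so no
  single one exceeds that.\<close>

lemma cactus_fun_nice:
  assumes "cactus_fun k f" "j < k"
  shows "nice k (f j)"
  unfolding nice_def
proof (intro allI impI)
  fix a b :: real assume ab: "0 \<le> a \<and> a \<le> b \<and> b \<le> 1"
  have mono: "f i a \<le> f i b" if "i < k" for i
    using assms(1) that ab by (auto simp: cactus_fun_def mono_on_def)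
  have "f j b - f j a \<le> (\<Sum>i<k. f i b - f i a)"
    by (rule member_le_sum[where f = "\<lambda>i. f i b - f i a"]) (use assms(2) mono in auto)
  also have "\<dots> = real k * b - real k * a"
    using assms(1) ab by (simp add: cactus_fun_def sum_subtractf)
  finally show "f j a \<le> f j b \<and> f j b - f j a \<le> real k * (b - a)"
    using mono[OF assms(2)] by (simp add: algebra_simps)
qed

lemma cactus_fun_mem:
  assumes "cactus_fun k f" "j < k" "0 \<le> r" "r \<le> 1"
  shows "0 \<le> f j r" "f j r \<le> 1"
  using niceD(1)[OF cactus_fun_nice[OF assms(1,2)], of 0 r] niceD(1)[OF cactus_fun_nice[OF assms(1,2)], of r 1]
    assms by (auto simp: cactus_fun_def)

text \<open>Such a map may be constant on intervals, and \<open>inv_into\<close> returns an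
  arbitrary point of a fibre. That the choice has no influence on the flow is shown in
  \<open>branches_unrepar\<close>.\<close>

definition onto :: "(real \<Rightarrow> real) \<Rightarrow> bool" where
  "onto q \<longleftrightarrow> mono_on {0..1} q \<and> q ` {0..1} = {0..1}"

lemma ontoD:
  assumes "onto q" "0 \<le> s" "s \<le> 1"
  shows "0 \<le> inv_into {0..1} q s" "inv_into {0..1} q s \<le> 1" "q (inv_into {0..1} q s) = s"
proof -
  have "s \<in> q ` {0..1}" using assms unfolding onto_def by auto
  then show "0 \<le> inv_into {0..1} q s" "inv_into {0..1} q s \<le> 1" "q (inv_into {0..1} q s) = s"
    using inv_into_into[of s q "{0..1}"] f_inv_into_f[of s q "{0..1}"] by auto
qed

text \<open>If the order of the preimages were reversed, monotonicity of \<open>q\<close> would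
  force \<open>s = s'\<close>, and then the preimages agree.\<close>

lemma onto_inv_mono:
  assumes "onto q" "0 \<le> s" "s \<le> s'" "s' \<le> 1"
  shows "inv_into {0..1} q s \<le> inv_into {0..1} q s'"
proof (rule ccontr)
  assume "\<not> ?thesis"
  moreover have "0 \<le> inv_into {0..1} q s'" "inv_into {0..1} q s \<le> 1"
    using assms ontoD[OF assms(1), of s] ontoD[OF assms(1), of s'] by auto
  ultimately have "q (inv_into {0..1} q s') \<le> q (inv_into {0..1} q s)"
    using assms(1) unfolding onto_def mono_on_def by auto
  then have "s = s'" using ontoD(3)[OF assms(1), of s] ontoD(3)[OF assms(1), of s'] assms by simp
  with \<open>\<not> ?thesis\<close> show False by simp
qed

lemma nice_onto:
  assumes "nice M q" "q 0 = 0" "q 1 = 1"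
  shows "onto q"
  unfolding onto_def
proof
  show "mono_on {0..1} q" using assms(1) by (auto simp: mono_on_def nice_def)
  have "continuous_on {0..1} q"
  proof (rule lipschitz_on_continuous_on[of "max M 0"], rule lipschitz_onI)
    fix a b :: real assume "a \<in> {0..1}" "b \<in> {0..1}"
    then show "dist (q a) (q b) \<le> max M 0 * dist a b"
      using nice_abs[OF nice_mono[OF assms(1), of "max M 0"], of a b] by (simp add: dist_real_def)
  qed simp
  then have "{0..1} \<subseteq> q ` {0..1}"
    using IVT'[of q 0 _ 1] assms by fastforce
  moreover have "q ` {0..1} \<subseteq> {0..1}"
    using niceD(1)[OF assms(1), of 0] niceD(1)[OF assms(1), of _ 1] assms by auto
  ultimately show "q ` {0..1} = {0..1}" by auto
qed

section \<open>Lipschitz bounds for flows\<close>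

definition regular where
  "regular t x N \<longleftrightarrow> (\<forall>v ts. Vertex v ts \<in> subs N \<longrightarrow> onto (repar t x v ts))"

lemma regular_subs: "N \<in> subs T ==> regular t x T ==> regular t x N"
  unfolding regular_def using subs_trans by blast

text \<open>Both flows reach the same exits with the same parameters, and these increase with the
  starting point. So a bound on the increments of \<open>G\<close> can be applied at each exit
  separately.\<close>

lemma flow_diff_le:
  assumes "regular t x N" "fits x N"
    and "\<And>M a b. M \<in> subs N ==> 0 \<le> a ==> a \<le> b ==> b \<le> 1 ==> G M b - G M a \<le> K * (b - a)"
    and "0 \<le> a" "a \<le> b" "b \<le> 1"
  shows "flow t x N S G b - flow t x N S G a
    \<le> K * (flow t x N S (\<lambda>_ s. s) b - flow t x N S (\<lambda>_ s. s) a)"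
  using assms
proof (induction N arbitrary: a b)
  case (Leaf l)
  then show ?case by simp
next
  case (Vertex v ts)
  show ?case
  proof (cases "v \<in> S")
    case False
    then show ?thesis using Vertex.prems by simp
  next
    case True
    let ?u = "unrepar t x v ts"
    have q: "onto (repar t x v ts)" using Vertex.prems(1) unfolding regular_def by simp
    note u = ontoD[OF q, of a] ontoD[OF q, of b] onto_inv_mono[OF q, of a b]
    have "flow t x (ts ! j) S G (x v j (?u b)) - flow t x (ts ! j) S G (x v j (?u a))
      \<le> K * (flow t x (ts ! j) S (\<lambda>_ s. s) (x v j (?u b)) - flow t x (ts ! j) S (\<lambda>_ s. s) (x v j (?u a)))"
      if j: "j < length ts" for j
    proof -
      have c: "cactus_fun (length ts) (x v)" using Vertex.prems(2) j by auto
      show ?thesis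
      proof (rule Vertex.IH)
        show "ts ! j \<in> set ts" using j by simp
        show "regular t x (ts ! j)" using regular_subs[OF subs_nth[OF j] Vertex.prems(1)] .
        show "fits x (ts ! j)" using fits_subs[OF subs_nth[OF j] Vertex.prems(2)] .
        show "G M b - G M a \<le> K * (b - a)" if "M \<in> subs (ts ! j)" "0 \<le> a" "a \<le> b" "b \<le> 1" for M a b
          using Vertex.prems(3) subs_trans[OF subs_nth[OF j] that(1)] that(2-) by blast
      qed (use u cactus_fun_mem[OF c j] niceD(1)[OF cactus_fun_nice[OF c j]] Vertex.prems(4-) in auto)
    qed
    then have "branches t x v ts S G (?u b) - branches t x v ts S G (?u a)
       \<le> K * (branches t x v ts S (\<lambda>_ s. s) (?u b) - branches t x v ts S (\<lambda>_ s. s) (?u a))"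
      unfolding branches_def sum_subtractf[symmetric] sum_distrib_left by (intro sum_mono) auto
    then show ?thesis using True by simp
  qed
qed

primrec tree_size :: "'v ptree \<Rightarrow> nat" where
  "tree_size (Leaf a) = 1"
| "tree_size (Vertex v ts) = Suc (sum_list (map tree_size ts))"

text \<open>The first factor bounds the number of exits of any set, the second exceeds the Lipschitz
  constant of \<open>branches\<close>. The product depends on the tree only, so the estimates are
  uniform in weights and cacti.\<close>

primrec lip :: "'v ptree \<Rightarrow> nat" where
  "lip (Leaf a) = 1"
| "lip (Vertex v ts) = tree_size (Vertex v ts) * Suc (length ts * sum_list (map lip ts))"

lemma lip_child: "T \<in> set ts ==> lip T \<le> sum_list (map lip ts)"
  by (simp add: member_le_sum_list)

lemma lip_subs: "M \<in> subs N ==> lip M \<le> lip N"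
proof (induction N)
  case (Vertex v ts)
  show ?case
  proof (cases "M = Vertex v ts")
    case False
    then obtain T where T: "T \<in> set ts" "M \<in> subs T" using Vertex.prems by auto
    then have "lip M \<le> sum_list (map lip ts)" using Vertex.IH lip_child le_trans by blast
    also have "\<dots> \<le> length ts * sum_list (map lip ts)"
      using T(1) by (cases ts) auto
    finally show ?thesis by simp
  qed simp
qed simp

lemma exits_le: "exits A N \<le> tree_size N"
proof (induction N)
  case (Vertex v ts)
  then have "sum_list (map (exits A) ts) \<le> sum_list (map tree_size ts)"
    by (intro sum_list_mono) auto
  then show ?case by simp
qed simp

text \<open>The estimates are applied to the identity, which measures total length, to
  \<open>leaf_value\<close>, which singles out one leaf, and to the latter composed with an
  insertion of trees.\<close>

definition good :: "('v ptree \<Rightarrow> real \<Rightarrow> real) \<Rightarrow> bool" where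
  "good F \<longleftrightarrow> (\<forall>M. nice 1 (F M) \<and> F M 0 = 0)"

lemma good_id: "good (\<lambda>_ s. s)"
  unfolding good_def nice_def by simp

definition well_behaved where
  "well_behaved t x N \<longleftrightarrow> regular t x N \<and> (\<forall>A. compatible t N A \<longrightarrow>
     (\<forall>F. good F \<longrightarrow> nice (lip N) (flow t x N A F) \<and> flow t x N A F 0 = 0) \<and>
     flow t x N A (\<lambda>_ s. s) 1 = exits A N)"

lemma compatible_child: "T \<in> set ts ==> compatible t (Vertex v ts) A ==> compatible t T A"
  by (rule compatible_subs) (auto intro!: bexI[of _ T])

lemma branches_nice:
  assumes x: "length ts \<noteq> 0 \<longrightarrow> cactus_fun (length ts) (x v)"
    and IH: "\<And>T. T \<in> set ts ==> well_behaved t x T \<and> compatible t T A" and F: "good F"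
  shows "nice (real (length ts * sum_list (map lip ts))) (branches t x v ts A F)"
    and "branches t x v ts A F 0 = 0"
    and "v \<in> A ==> branches t x v ts A (\<lambda>_ s. s) 1 = exits A (Vertex v ts)"
proof -
  have wb: "nice (lip (ts ! j)) (flow t x (ts ! j) A F)" "flow t x (ts ! j) A F 0 = 0"
    "flow t x (ts ! j) A (\<lambda>_ s. s) 1 = exits A (ts ! j)" if "j < length ts" for j
    using IH[of "ts ! j"] F that by (auto simp: well_behaved_def)
  have c: "cactus_fun (length ts) (x v)" if "j < length ts" for j using x that by auto
  show "branches t x v ts A F 0 = 0"
    using wb c by (auto simp: branches_def cactus_fun_def)
  show "branches t x v ts A (\<lambda>_ s. s) 1 = exits A (Vertex v ts)" if "v \<in> A"
  proof -
    have "branches t x v ts A (\<lambda>_ s. s) 1 = (\<Sum>j<length ts. real (exits A (ts ! j)))"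
      unfolding branches_def by (intro sum.cong refl) (use wb c in \<open>auto simp: cactus_fun_def\<close>)
    then show ?thesis using exits_Vertex[OF that, of ts] by simp
  qed
  show "nice (real (length ts * sum_list (map lip ts))) (branches t x v ts A F)"
    unfolding nice_def
  proof (intro allI impI)
    fix a b :: real assume ab: "0 \<le> a \<and> a \<le> b \<and> b \<le> 1"
    let ?d = "\<lambda>j. flow t x (ts ! j) A F (x v j b) - flow t x (ts ! j) A F (x v j a)"
    have d: "0 \<le> ?d j" "?d j \<le> lip (ts ! j) * (length ts * (b - a))" if j: "j < length ts" for j
    proof -
      note cj = niceD[OF cactus_fun_nice[OF c[OF j] j], of a b]
      note wj = niceD[OF wb(1)[OF j], of "x v j a" "x v j b"]
      have m: "0 \<le> x v j a" "x v j b \<le> 1" using cactus_fun_mem[OF c[OF j] j] ab by auto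
      show "0 \<le> ?d j" using wj(1) m cj ab by auto
      have "?d j \<le> lip (ts ! j) * (x v j b - x v j a)" using wj(2) m cj ab by auto
      also have "\<dots> \<le> lip (ts ! j) * (length ts * (b - a))"
        by (intro mult_left_mono) (use cj ab in auto)
      finally show "?d j \<le> lip (ts ! j) * (length ts * (b - a))" .
    qed
    have eq: "branches t x v ts A F b - branches t x v ts A F a = (\<Sum>j<length ts. ?d j)"
      unfolding branches_def sum_subtractf by simp
    have "(\<Sum>j<length ts. ?d j) \<le> (\<Sum>j<length ts. lip (ts ! j) * (length ts * (b - a)))"
      by (intro sum_mono) (use d in auto)
    also have "\<dots> = real (length ts * sum_list (map lip ts)) * (b - a)"
      by (simp add: sum_list_sum_nth atLeast0LessThan sum_distrib_right sum_distrib_left mult_ac)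
    finally show "branches t x v ts A F a \<le> branches t x v ts A F b \<and>
      branches t x v ts A F b - branches t x v ts A F a
        \<le> real (length ts * sum_list (map lip ts)) * (b - a)"
      using sum_nonneg[of "{..<length ts}" ?d] d(1) eq by auto
  qed
qed

lemma exit_mean_nice:
  assumes x: "length ts \<noteq> 0 \<longrightarrow> cactus_fun (length ts) (x v)" and t: "weights t"
    and IH: "\<And>T. T \<in> set ts ==> well_behaved t x T \<and> v \<notin> vertices T" and A: "A \<in> family t v ts"
  shows "nice (Suc (length ts * sum_list (map lip ts))) (exit_mean t x v ts A)"
    and "exit_mean t x v ts A 0 = 0" and "exit_mean t x v ts A 1 = 1"
proof -
  let ?L = "length ts * sum_list (map lip ts)"
  have "nice (Suc ?L) (exit_mean t x v ts A) \<and> exit_mean t x v ts A 0 = 0 \<and> exit_mean t x v ts A 1 = 1"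
  proof (cases "A = {}")
    case True
    have "nice 1 (exit_mean t x v ts {})" unfolding nice_def exit_mean_def by simp
    then show ?thesis using True nice_mono[of 1 _ "Suc ?L"] by (auto simp: exit_mean_def)
  next
    case False
    then have v: "v \<in> A" "exits A (Vertex v ts) \<noteq> 0" using A unfolding family_def by blast+
    have "well_behaved t x T \<and> compatible t T A" if "T \<in> set ts" for T
      using IH[OF that] compatible_family[OF t A that] by simp
    note b = branches_nice[OF x this good_id]
    define n where "n = real (exits A (Vertex v ts))"
    have n: "n \<ge> 1" using v(2) unfolding n_def by linarith
    have "nice (Suc ?L) (\<lambda>r. branches t x v ts A (\<lambda>_ s. s) r / n)"
      unfolding nice_def
    proof (intro allI impI)
      fix a b :: real assume ab: "0 \<le> a \<and> a \<le> b \<and> b \<le> 1"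
      let ?D = "branches t x v ts A (\<lambda>_ s. s) b - branches t x v ts A (\<lambda>_ s. s) a"
      have D: "0 \<le> ?D" "?D \<le> real ?L * (b - a)" using niceD[OF b(1), of a b] ab by auto
      have "?D / n \<le> ?D" using D(1) n by (simp add: divide_le_eq mult_le_cancel_left1)
      also have "\<dots> \<le> Suc ?L * (b - a)" using D(2) ab by (simp add: algebra_simps)
      finally show "branches t x v ts A (\<lambda>_ s. s) a / n \<le> branches t x v ts A (\<lambda>_ s. s) b / n \<and>
        branches t x v ts A (\<lambda>_ s. s) b / n - branches t x v ts A (\<lambda>_ s. s) a / n \<le> Suc ?L * (b - a)"
        using D(1) n by (simp add: diff_divide_distrib divide_right_mono)
    qed
    moreover have "exit_mean t x v ts A = (\<lambda>r. branches t x v ts A (\<lambda>_ s. s) r / n)"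
      using False by (auto simp: exit_mean_def n_def)
    ultimately show ?thesis using b(2,3) v n by (simp add: n_def)
  qed
  then show "nice (Suc ?L) (exit_mean t x v ts A)" "exit_mean t x v ts A 0 = 0" "exit_mean t x v ts A 1 = 1"
    by auto
qed

text \<open>For the last claim the bracket is taken whose mean increases least from \<open>a\<close>
  to \<open>b\<close>; by \<open>mix_shift\<close> the clamped parameter increases at least as
  much.\<close>

lemma repar_nice:
  assumes x: "length ts \<noteq> 0 \<longrightarrow> cactus_fun (length ts) (x v)" and t: "weights t"
    and IH: "\<And>T. T \<in> set ts ==> well_behaved t x T \<and> v \<notin> vertices T"
  shows "nice (Suc (length ts * sum_list (map lip ts))) (repar t x v ts)"
    and "onto (repar t x v ts)"
    and "repar t x v ts 0 = 0" and "repar t x v ts 1 = 1"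
    and "\<lbrakk>0 \<le> a; a \<le> b; b \<le> 1\<rbrakk> \<Longrightarrow> \<exists>S\<in>family t v ts.
      exit_mean t x v ts S b - exit_mean t x v ts S a \<le> repar t x v ts b - repar t x v ts a"
proof -
  let ?K = "family t v ts" and ?\<phi> = "exit_mean t x v ts"
  note m = exit_mean_nice[where t = t and x = x and v = v and ts = ts, OF x t IH]
  note K = finite_family[of t v ts] family_nonempty[OF t, of v ts]
  show nice: "nice (Suc (length ts * sum_list (map lip ts))) (repar t x v ts)"
    unfolding nice_def
  proof (intro allI impI)
    fix a b :: real assume ab: "0 \<le> a \<and> a \<le> b \<and> b \<le> 1"
    have "mix t ?K (\<lambda>A. ?\<phi> A a) + 0 \<le> mix t ?K (\<lambda>A. ?\<phi> A b)"
      by (rule mix_shift[OF K]) (use niceD(1)[OF m(1)] ab in auto)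
    moreover have "mix t ?K (\<lambda>A. ?\<phi> A b) + - (Suc (length ts * sum_list (map lip ts)) * (b - a)) \<le> mix t ?K (\<lambda>A. ?\<phi> A a)"
      by (rule mix_shift[OF K]) (use niceD(2)[OF m(1), of _ a b] ab in force)
    ultimately show "repar t x v ts a \<le> repar t x v ts b \<and>
      repar t x v ts b - repar t x v ts a \<le> Suc (length ts * sum_list (map lip ts)) * (b - a)"
      unfolding repar_def by linarith
  qed
  show "repar t x v ts 0 = 0" "repar t x v ts 1 = 1"
    unfolding repar_def
    by (intro mix_const[OF K(1) empty_in_family[OF t] t] m(2,3); assumption)+
  then show "onto (repar t x v ts)" by (rule nice_onto[OF nice])
  assume ab: "0 \<le> a" "a \<le> b" "b \<le> 1"
  let ?d = "\<lambda>S. ?\<phi> S b - ?\<phi> S a"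
  have "Min (?d ` ?K) \<in> ?d ` ?K" by (rule Min_in) (use K in auto)
  then obtain S where S: "S \<in> ?K" "Min (?d ` ?K) = ?d S" by auto
  have "mix t ?K (\<lambda>A. ?\<phi> A a) + ?d S \<le> mix t ?K (\<lambda>A. ?\<phi> A b)"
  proof (rule mix_shift[OF K])
    fix A assume "A \<in> ?K"
    then have "?d S \<le> ?d A" using Min_le[of "?d ` ?K" "?d A"] S K by auto
    then show "?\<phi> A a + ?d S \<le> ?\<phi> A b" by linarith
  qed
  then show "\<exists>S\<in>?K. ?\<phi> S b - ?\<phi> S a \<le> repar t x v ts b - repar t x v ts a"
    using S(1) unfolding repar_def by (intro bexI[of _ S]) auto
qed

text \<open>If \<open>repar\<close> is constant somewhere, then so are all exit values, since it dominates the mean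
  of the exit values over one of the brackets.\<close>

lemma branches_le_repar:
  assumes x: "length ts \<noteq> 0 \<longrightarrow> cactus_fun (length ts) (x v)" and t: "weights t"
    and IH: "\<And>T M. T \<in> set ts ==> M \<in> subs T ==> well_behaved t x M"
    and fits: "fits x (Vertex v ts)"
    and A: "compatible t (Vertex v ts) A" "v \<in> A" and F: "good F" and ab: "0 \<le> a" "a \<le> b" "b \<le> 1"
  shows "branches t x v ts A F b - branches t x v ts A F a
    \<le> lip (Vertex v ts) * (repar t x v ts b - repar t x v ts a)"
proof -
  let ?L = "sum_list (map lip ts)" and ?n = "length ts"
  let ?D = "repar t x v ts b - repar t x v ts a"
  have cA: "compatible t T A" if "T \<in> set ts" for T
    using compatible_child[OF that A(1)] .
  have v: "v \<notin> vertices T" if "T \<in> set ts" for T using fits that by auto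
  note b = branches_nice[where A = A and t = t and x = x and v = v and ts = ts, OF x _ F]
  have wb: "well_behaved t x T \<and> v \<notin> vertices T" if "T \<in> set ts" for T
    using IH[OF that subs_refl] v[OF that] by simp
  note rn = repar_nice[where x = x and ts = ts and t = t and v = v, OF x t wb]
  obtain S where S: "S \<in> family t v ts" "exit_mean t x v ts S b - exit_mean t x v ts S a \<le> ?D"
    using rn(5)[OF _ ab] by blast
  have lip: "real (lip (Vertex v ts)) = real (tree_size (Vertex v ts)) * (1 + real ?n * real ?L)"
    unfolding lip.simps by (simp only: of_nat_mult of_nat_Suc add.commute)
  have sz: "real (tree_size (Vertex v ts)) \<ge> 1" by simp
  have D0: "0 \<le> ?D"
    using niceD(1)[OF rn(1) ab] by simp
  show ?thesis
  proof (cases "S = {}")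
    case True
    \<comment> \<open>The dominated mean is the parameter of the circle itself, so the Lipschitz
      bound of \<open>branches\<close> suffices.\<close>
    then have "b - a \<le> ?D" using S by (simp add: exit_mean_def)
    then have "(?n * ?L) * (b - a) \<le> (?n * ?L) * ?D" by (intro mult_left_mono) auto
    moreover have "branches t x v ts A F b - branches t x v ts A F a \<le> (?n * ?L) * (b - a)"
      using niceD(2)[OF b(1), of a b] IH cA ab by fastforce
    moreover have "(?n * ?L) * ?D \<le> lip (Vertex v ts) * ?D"
    proof (rule mult_right_mono[OF _ D0])
      have "1 * (real ?n * real ?L) \<le> real (tree_size (Vertex v ts)) * (1 + real ?n * real ?L)"
        by (intro mult_mono) auto
      then show "real (?n * ?L) \<le> real (lip (Vertex v ts))" unfolding lip by simp
    qed
    ultimately show ?thesis by linarith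
  next
    case False
    then have vS: "v \<in> S" "exits S (Vertex v ts) \<noteq> 0" "S \<subseteq> vertices (Vertex v ts)" "0 < t S"
      using S(1) unfolding family_def by blast+
    \<comment> \<open>By compatibility the exits of \<open>A\<close> lie at or beyond those of
      \<open>S\<close>. The flow through \<open>A\<close> is therefore controlled by the increments
      at the exits of \<open>S\<close>, whose sum is a multiple of the dominated mean.\<close>
    then have SA: "S \<subseteq> A" using A unfolding compatible_def by blast
    let ?G = "\<lambda>M. flow t x M A F"
    have "flow t x (ts ! j) S ?G (x v j b) - flow t x (ts ! j) S ?G (x v j a)
       \<le> ?L * (flow t x (ts ! j) S (\<lambda>_ s. s) (x v j b) - flow t x (ts ! j) S (\<lambda>_ s. s) (x v j a))"
      if j: "j < ?n" for j
    proof (rule flow_diff_le)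
      have c: "cactus_fun ?n (x v)" using x j by auto
      show "regular t x (ts ! j)" using IH[of "ts ! j" "ts ! j"] j by (auto simp: well_behaved_def)
      show "fits x (ts ! j)" using fits j by (auto simp: list_all_iff)
      show "0 \<le> x v j a" "x v j b \<le> 1" "x v j a \<le> x v j b"
        using cactus_fun_mem[OF c j] niceD(1)[OF cactus_fun_nice[OF c j], of a b] ab by auto
      fix M a b assume M: "M \<in> subs (ts ! j)" and ab: "0 \<le> a" "a \<le> b" "b \<le> (1::real)"
      have "compatible t M A" using compatible_subs[OF M] cA j by auto
      then have "nice (lip M) (?G M)" using IH[of "ts ! j" M] M j F by (auto simp: well_behaved_def)
      then have "?G M b - ?G M a \<le> lip M * (b - a)" using niceD(2) ab by blast
      also have "\<dots> \<le> ?L * (b - a)"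
        using lip_subs[OF M] lip_child[of "ts ! j" ts] j ab by (intro mult_right_mono) auto
      finally show "?G M b - ?G M a \<le> ?L * (b - a)" .
    qed
    then have "branches t x v ts A F b - branches t x v ts A F a
      \<le> ?L * (branches t x v ts S (\<lambda>_ s. s) b - branches t x v ts S (\<lambda>_ s. s) a)"
      unfolding branches_flow[OF SA, of t x v ts F] unfolding branches_def sum_subtractf[symmetric] sum_distrib_left
      by (intro sum_mono) auto
    also have "\<dots> = ?L * (exits S (Vertex v ts) * (exit_mean t x v ts S b - exit_mean t x v ts S a))"
      using False vS(2) by (simp add: exit_mean_def diff_divide_distrib[symmetric] del: exits.simps)
    also have "\<dots> \<le> ?L * (exits S (Vertex v ts) * ?D)"
      by (intro mult_left_mono S(2)) auto
    also have "\<dots> = (real ?L * real (exits S (Vertex v ts))) * ?D" by simp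
    also have "\<dots> \<le> lip (Vertex v ts) * ?D"
    proof (rule mult_right_mono[OF _ D0])
      show "real ?L * real (exits S (Vertex v ts)) \<le> lip (Vertex v ts)"
      proof (cases "?n = 0")
        case False
        then have "1 \<le> ?n" by linarith
        then have "1 * ?L \<le> ?n * ?L" by (rule mult_right_mono) simp
        then have "real ?L \<le> 1 + real ?n * real ?L" by (metis le_add2 mult_1 of_nat_le_iff of_nat_mult of_nat_Suc le_SucI plus_1_eq_Suc of_nat_add of_nat_1)
        then have "real (exits S (Vertex v ts)) * real ?L \<le> real (tree_size (Vertex v ts)) * (1 + real ?n * real ?L)"
          using exits_le[of S "Vertex v ts"] by (intro mult_mono) auto
        then show ?thesis unfolding lip by (simp add: mult.commute)
      qed simp
    qed
    finally show ?thesis .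
  qed
qed

text \<open>Where \<open>repar\<close> takes the same value twice, the preceding bound leaves no
  room for \<open>branches\<close> to increase in between. Hence the preimage chosen in the
  definition of the flow does not matter.\<close>

lemma branches_unrepar:
  assumes x: "length ts \<noteq> 0 \<longrightarrow> cactus_fun (length ts) (x v)" and t: "weights t"
    and IH: "\<And>T M. T \<in> set ts ==> M \<in> subs T ==> well_behaved t x M"
    and fits: "fits x (Vertex v ts)"
    and A: "compatible t (Vertex v ts) A" "v \<in> A" and F: "good F" and r: "0 \<le> r" "r \<le> 1" "0 \<le> r'" "r' \<le> 1"
    and eq: "repar t x v ts r = repar t x v ts r'"
  shows "branches t x v ts A F r = branches t x v ts A F r'"
proof -
  have cA: "compatible t T A" if "T \<in> set ts" for T
    using compatible_child[OF that A(1)] .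
  have wbA: "well_behaved t x T \<and> compatible t T A" if "T \<in> set ts" for T
    using IH[OF that subs_refl] cA[OF that] by simp
  have n: "nice (real (length ts * sum_list (map lip ts))) (branches t x v ts A F)"
    by (rule branches_nice(1)[OF x wbA F])
  have le: "branches t x v ts A F a = branches t x v ts A F b"
    if "0 \<le> a" "a \<le> b" "b \<le> 1" "repar t x v ts a = repar t x v ts b" for a b
  proof -
    have "branches t x v ts A F b - branches t x v ts A F a
        \<le> lip (Vertex v ts) * (repar t x v ts b - repar t x v ts a)"
      by (rule branches_le_repar[OF x t IH fits A F that(1-3)])
    then show ?thesis using niceD(1)[OF n that(1-3)] unfolding that(4) by simp
  qed
  show ?thesis
  proof (cases "r \<le> r'")
    case True
    show ?thesis by (rule le[OF r(1) True r(4) eq])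
  next
    case False
    show ?thesis by (rule le[symmetric, OF r(3) _ r(2) eq[symmetric]]) (use False in linarith)
  qed
qed

text \<open>Surjectivity of \<open>repar\<close> at a vertex rests on the Lipschitz bounds of the
  flows above it, and the bounds at the vertex rest on surjectivity there, so all properties go
  through one induction.\<close>

lemma well_behaved_subs:
  fixes N M :: "'v ptree"
  assumes "weights t" "fits x N" "M \<in> subs N"
  shows "well_behaved t x M"
  using assms(2,3)
proof (induction N arbitrary: M)
  case (Leaf a)
  then show ?case by (auto simp: well_behaved_def regular_def good_def)
next
  case (Vertex v ts)
  have IH: "well_behaved t x M" if "T \<in> set ts" "M \<in> subs T" for T M
    using Vertex.IH[OF that(1)] Vertex.prems(1) that by (auto simp: list_all_iff)
  show ?case
  proof (cases "M = Vertex v ts")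
    case False
    then show ?thesis using IH Vertex.prems(2) by auto
  next
    case True
    have x: "length ts \<noteq> 0 \<longrightarrow> cactus_fun (length ts) (x v)" using Vertex.prems(1) by auto
    have v: "v \<notin> vertices T" if "T \<in> set ts" for T using Vertex.prems(1) that by auto
    have wb: "well_behaved t x T \<and> v \<notin> vertices T" if "T \<in> set ts" for T
      using IH[OF that subs_refl] v[OF that] by simp
    have q: "onto (repar t x v ts)" using repar_nice(2)[where x = x and ts = ts and v = v, OF x assms(1) wb] .
    have reg: "regular t x (Vertex v ts)"
      unfolding regular_def using q IH unfolding well_behaved_def regular_def by auto
    have "(\<forall>F. good F \<longrightarrow> nice (lip (Vertex v ts)) (flow t x (Vertex v ts) A F) \<and> flow t x (Vertex v ts) A F 0 = 0) \<and>
       flow t x (Vertex v ts) A (\<lambda>_ s. s) 1 = exits A (Vertex v ts)" if A: "compatible t (Vertex v ts) A" for A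
    proof (cases "v \<in> A")
      case False
      have "1 \<le> lip (Vertex v ts)" by simp
      then have "(1::real) \<le> lip (Vertex v ts)" by linarith
      moreover have "flow t x (Vertex v ts) A F = F (Vertex v ts)" for F
        using False by (simp add: fun_eq_iff)
      ultimately show ?thesis
        using False nice_mono[of 1 _ "real (lip (Vertex v ts))"]
        by (auto simp: good_def simp del: lip.simps flow_Vertex)
    next
      case vA: True
      have cA: "compatible t T A" if "T \<in> set ts" for T
        using compatible_child[OF that A] .
      have wbA: "well_behaved t x T \<and> compatible t T A" if "T \<in> set ts" for T
        using IH[OF that subs_refl] cA[OF that] by simp
      note b = branches_nice[where x = x and ts = ts and v = v and t = t and A = A, OF x wbA]
      note u = branches_unrepar[where x = x and ts = ts and v = v and t = t and A = A, OF x assms(1) IH Vertex.prems(1) A vA]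
      have e: "branches t x v ts A F (unrepar t x v ts s) = branches t x v ts A F r"
        if "good F" "0 \<le> r" "r \<le> 1" "0 \<le> s" "s \<le> 1" "repar t x v ts r = s" for F r s
        by (rule u) (use that ontoD[OF q, of s] in auto)
      note q01 = repar_nice(3,4)[where x = x and ts = ts and v = v, OF x assms(1) wb]
      show ?thesis
      proof (intro conjI allI impI)
        show "flow t x (Vertex v ts) A (\<lambda>_ s. s) 1 = exits A (Vertex v ts)"
          using e[OF good_id, of 1 1] q01 b(3)[OF _ good_id vA] vA by simp
        fix F :: "'v ptree \<Rightarrow> real \<Rightarrow> real" assume F: "good F"
        show "flow t x (Vertex v ts) A F 0 = 0"
          using e[OF F, of 0 0] q01 b(2)[OF _ F] vA by simp
        show "nice (lip (Vertex v ts)) (flow t x (Vertex v ts) A F)"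
          unfolding nice_def
        proof (intro allI impI)
          fix a b :: real assume ab: "0 \<le> a \<and> a \<le> b \<and> b \<le> 1"
          let ?u = "unrepar t x v ts"
          have u: "0 \<le> ?u a" "?u a \<le> ?u b" "?u b \<le> 1" "repar t x v ts (?u b) = b" "repar t x v ts (?u a) = a"
            using ontoD[OF q] onto_inv_mono[OF q] ab by auto
          show "flow t x (Vertex v ts) A F a \<le> flow t x (Vertex v ts) A F b \<and>
            flow t x (Vertex v ts) A F b - flow t x (Vertex v ts) A F a \<le> lip (Vertex v ts) * (b - a)"
          proof -
            have "branches t x v ts A F (?u b) - branches t x v ts A F (?u a)
                \<le> lip (Vertex v ts) * (repar t x v ts (?u b) - repar t x v ts (?u a))"
              by (rule branches_le_repar[OF x assms(1) IH Vertex.prems(1) A vA F u(1-3)])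
            then show ?thesis
              using niceD(1)[OF b(1)[OF _ F] u(1-3)] vA unfolding u(4,5) flow_Vertex by simp
          qed
        qed
      qed
    qed
    then show ?thesis unfolding True well_behaved_def using reg by blast
  qed
qed

lemma fits_Vertex:
  assumes "fits x (Vertex v ts)" "T \<in> set ts"
  shows "fits x T" "v \<notin> vertices T" "cactus_fun (length ts) (x v)"
  using assms by (auto simp: list_all_iff)

lemma well_behaved: "weights t ==> fits x N ==> well_behaved t x N"
  using well_behaved_subs subs_refl by blast

lemma flow_nice:
  assumes "weights t" "fits x N" "compatible t N A"
  shows "good F ==> nice (lip N) (flow t x N A F)" "good F ==> flow t x N A F 0 = 0"
    and "flow t x N A (\<lambda>_ s. s) 1 = exits A N"
  using well_behaved[OF assms(1,2)] assms(3) unfolding well_behaved_def by auto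

section \<open>The flow at a single vertex\<close>

context
  fixes t :: "'v set \<Rightarrow> real" and x and v :: 'v and ts
  assumes t: "weights t" and fits: "fits x (Vertex v ts)"
begin

lemma wb_children: "T \<in> set ts ==> well_behaved t x T \<and> v \<notin> vertices T"
  using well_behaved[OF t] fits_Vertex[OF fits] by blast

lemma cactus_fun_root: "length ts \<noteq> 0 \<longrightarrow> cactus_fun (length ts) (x v)"
  using fits by simp

lemmas exit_mean_nice' = exit_mean_nice[where x = x and ts = ts and v = v, OF cactus_fun_root t wb_children]
lemmas repar_nice' = repar_nice[where x = x and ts = ts and v = v, OF cactus_fun_root t wb_children]

lemma repar_onto: "onto (repar t x v ts)"
  by (rule repar_nice')

lemma repar_mem: "0 \<le> r ==> r \<le> 1 ==> 0 \<le> repar t x v ts r \<and> repar t x v ts r \<le> 1"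
  using repar_onto by (auto simp: onto_def)

lemma exit_mean_mem:
  assumes "A \<in> family t v ts" "0 \<le> r" "r \<le> 1"
  shows "0 \<le> exit_mean t x v ts A r" "exit_mean t x v ts A r \<le> 1"
  using niceD(1)[OF exit_mean_nice'(1)[OF _ assms(1)], of 0 r] niceD(1)[OF exit_mean_nice'(1)[OF _ assms(1)], of r 1]
    exit_mean_nice'(2,3)[OF _ assms(1)] assms(2,3) by auto

text \<open>As \<open>repar\<close> is onto, this determines the flow without reference to the
  chosen preimages; it is the form in which the flow at a vertex is handled later.\<close>

lemma flow_repar:
  assumes "compatible t (Vertex v ts) A" "v \<in> A" "good F" "0 \<le> r" "r \<le> 1"
  shows "flow t x (Vertex v ts) A F (repar t x v ts r) = branches t x v ts A F r"
proof -
  have "branches t x v ts A F (unrepar t x v ts (repar t x v ts r)) = branches t x v ts A F r"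
  proof (rule branches_unrepar[OF cactus_fun_root t _ fits assms(1-3)])
    show "well_behaved t x M" if "T \<in> set ts" "M \<in> subs T" for T M
      by (rule well_behaved_subs[OF t fits_Vertex(1)[OF fits that(1)] that(2)])
  qed (use assms ontoD[OF repar_onto] repar_mem in auto)
  then show ?thesis using assms by simp
qed

end

section \<open>Dependence on the weights and the cacti\<close>

definition close where
  "close e x x' N \<longleftrightarrow> (\<forall>v ts j r. Vertex v ts \<in> subs N \<and> j < length ts \<and> 0 \<le> r \<and> r \<le> (1::real) \<longrightarrow>
     \<bar>x v j r - x' v j r\<bar> \<le> (e::real))"

lemma close_subs: "M \<in> subs N ==> close e x x' N ==> close e x x' M"
  unfolding close_def using subs_trans by blast

text \<open>The inverses of two reparametrizations are never compared. With u a preimage of s for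
  the first data, the flow at s is \<open>branches\<close> at u; for the second data,
  \<open>branches\<close> at u is the flow at \<open>repar\<close> of u, which is close to s. The
  constant depends on the tree only.\<close>

lemma flow_stable:
  fixes N :: "'v ptree"
  shows "\<exists>\<kappa>\<ge>0. \<forall>t t' x x' A F e s. weights t \<and> weights t' \<and> fits x N \<and> fits x' N \<and>
    compatible t N A \<and> compatible t' N A \<and> good F \<and> 0 \<le> e \<and> (\<forall>S. \<bar>t S - t' S\<bar> \<le> e) \<and> close e x x' N \<and>
    0 \<le> s \<and> s \<le> 1 \<longrightarrow> \<bar>flow t x N A F s - flow t' x' N A F s\<bar> \<le> \<kappa> * e"
proof (induction N)
  case (Leaf a)
  then show ?case by (intro exI[of _ 0]) auto
next
  case (Vertex v ts)
  then have "\<forall>T\<in>set ts. \<exists>\<kappa>\<ge>0. \<forall>t t' x x' A F e s. weights t \<and> weights t' \<and> fits x T \<and> fits x' T \<and>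
    compatible t T A \<and> compatible t' T A \<and> good F \<and> 0 \<le> e \<and> (\<forall>S. \<bar>t S - t' S\<bar> \<le> e) \<and> close e x x' T \<and>
    0 \<le> s \<and> s \<le> 1 \<longrightarrow> \<bar>flow t x T A F s - flow t' x' T A F s\<bar> \<le> \<kappa> * e" by blast
  from bchoice[OF this] obtain \<kappa> where \<kappa>: "\<And>T. T \<in> set ts ==> \<kappa> T \<ge> 0"
    "\<And>T t t' x x' A F e s. T \<in> set ts ==> weights t ==> weights t' ==> fits x T ==> fits x' T ==>
      compatible t T A ==> compatible t' T A ==> good F ==> 0 \<le> e ==> (\<And>S. \<bar>t S - t' S\<bar> \<le> e) ==> close e x x' T ==>
      0 \<le> s ==> s \<le> 1 ==> \<bar>flow t x T A F s - flow t' x' T A F s\<bar> \<le> \<kappa> T * e"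
    by (elim exE) (erule_tac x = f in meta_allE | metis)+
  \<comment> \<open>\<open>B\<close> bounds the change of \<open>branches\<close>: for each child
    the change of its flow, plus its Lipschitz constant for the change of the lobe function.
    \<open>C\<close> adds the Lipschitz constant of the tree times the change of
    \<open>repar\<close>, which is at most e + B * e.\<close>
  define B where "B = (\<Sum>j<length ts. \<kappa> (ts ! j) + lip (ts ! j))"
  have B0: "0 \<le> B" unfolding B_def by (intro sum_nonneg) (use \<kappa>(1) in auto)
  define C where "C = B + lip (Vertex v ts) * (1 + B)"
  have "\<bar>flow t x (Vertex v ts) A F s - flow t' x' (Vertex v ts) A F s\<bar> \<le> C * e"
    if t: "weights t" and t': "weights t'" and x: "fits x (Vertex v ts)" and x': "fits x' (Vertex v ts)"
      and A: "compatible t (Vertex v ts) A" "compatible t' (Vertex v ts) A"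
      and F: "good F" and e: "0 \<le> e" "\<And>S. \<bar>t S - t' S\<bar> \<le> e" "close e x x' (Vertex v ts)"
      and s: "0 \<le> s" "s \<le> 1" for t t' x x' A F e s
  proof (cases "v \<in> A")
    case False
    then show ?thesis using B0 e by (simp add: C_def)
  next
    case vA: True
    have br: "\<bar>branches t x v ts S G r - branches t' x' v ts S G r\<bar> \<le> B * e"
      if G: "good G" and r: "0 \<le> r" "r \<le> 1"
        and S: "\<And>T. T \<in> set ts ==> compatible t T S \<and> compatible t' T S" for S G r
    proof -
      have "\<bar>flow t x (ts ! j) S G (x v j r) - flow t' x' (ts ! j) S G (x' v j r)\<bar> \<le> (\<kappa> (ts ! j) + lip (ts ! j)) * e"
        if j: "j < length ts" for j
      proof -
        have T: "ts ! j \<in> set ts" using j by simp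
        have m: "0 \<le> x v j r" "x v j r \<le> 1" "0 \<le> x' v j r" "x' v j r \<le> 1"
          using cactus_fun_mem[OF fits_Vertex(3)[OF x T] j] cactus_fun_mem[OF fits_Vertex(3)[OF x' T] j] r by auto
        have c: "\<bar>x v j r - x' v j r\<bar> \<le> e" using e(3) j r by (auto simp: close_def)
        have "\<bar>flow t x (ts ! j) S G (x v j r) - flow t' x' (ts ! j) S G (x v j r)\<bar> \<le> \<kappa> (ts ! j) * e"
          by (rule \<kappa>(2)[OF T t t' fits_Vertex(1)[OF x T] fits_Vertex(1)[OF x' T]])
            (use S[OF T] G e m close_subs[OF subs_nth[OF j]] in auto)
        moreover have "\<bar>flow t' x' (ts ! j) S G (x v j r) - flow t' x' (ts ! j) S G (x' v j r)\<bar> \<le> lip (ts ! j) * \<bar>x v j r - x' v j r\<bar>"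
          by (rule nice_abs[OF flow_nice(1)[OF t' fits_Vertex(1)[OF x' T]]]) (use S[OF T] G m in auto)
        moreover have "lip (ts ! j) * \<bar>x v j r - x' v j r\<bar> \<le> lip (ts ! j) * e"
          using c by (intro mult_left_mono) auto
        ultimately show ?thesis by (simp add: algebra_simps)
      qed
      then have "(\<Sum>j<length ts. \<bar>flow t x (ts ! j) S G (x v j r) - flow t' x' (ts ! j) S G (x' v j r)\<bar>) \<le> B * e"
        unfolding B_def sum_distrib_right by (intro sum_mono) auto
      then show ?thesis
        unfolding branches_def sum_subtractf[symmetric] by (rule order_trans[OF sum_abs])
    qed
    have sym: "\<bar>branches t x v ts S G r - branches t' x' v ts S G r\<bar> = \<bar>branches t' x' v ts S G r - branches t x v ts S G r\<bar>"
      for S G r by (rule abs_minus_commute)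
    have em: "\<bar>exit_mean t x v ts S r - exit_mean t' x' v ts S r\<bar> \<le> B * e"
      if S: "S \<in> family t v ts" "S \<in> family t' v ts" and r: "0 \<le> r" "r \<le> 1" for S r
    proof (cases "S = {}")
      case True
      then show ?thesis using B0 e by (simp add: exit_mean_def)
    next
      case False
      define n where "n = real (exits S (Vertex v ts))"
      have "exits S (Vertex v ts) \<noteq> 0" using False S unfolding family_def by blast
      then have n: "1 \<le> n" unfolding n_def by linarith
      let ?d = "branches t x v ts S (\<lambda>_ s. s) r - branches t' x' v ts S (\<lambda>_ s. s) r"
      have "\<bar>?d / n\<bar> = \<bar>?d\<bar> / n" using n by simp
      also have "\<dots> \<le> \<bar>?d\<bar>" using n by (simp add: divide_le_eq mult_le_cancel_left1)
      also have "\<dots> \<le> B * e"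
        by (rule br[OF good_id r]) (use compatible_family[OF t S(1)] compatible_family[OF t' S(2)] fits_Vertex(2)[OF x] in auto)
      finally show ?thesis using False by (simp add: exit_mean_def n_def diff_divide_distrib del: exits.simps)
    qed
    have rp: "\<bar>repar t x v ts r - repar t' x' v ts r\<bar> \<le> e + B * e" if r: "0 \<le> r" "r \<le> 1" for r
    proof -
      have Be: "0 \<le> B * e" using B0 e(1) by simp
      have fam: "S \<in> family t' v ts" if "S \<in> family t v ts" "0 < t' S" for S
        using that unfolding family_def by blast
      have fam': "S \<in> family t v ts" if "S \<in> family t' v ts" "0 < t S" for S
        using that unfolding family_def by blast
      have e': "\<bar>t' S - t S\<bar> \<le> e" for S using e(2)[of S] by linarith
      have em': "\<bar>exit_mean t' x' v ts S r - exit_mean t x v ts S r\<bar> \<le> B * e"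
        if "S \<in> family t' v ts" "S \<in> family t v ts" for S using em[OF that(2,1) r] by linarith
      have "repar t x v ts r \<le> repar t' x' v ts r + (e + B * e)"
        unfolding repar_def
        by (rule mix_stable[OF finite_family finite_family empty_in_family[OF t] empty_in_family[OF t'] t t'])
          (use exit_mean_mem[OF t x _ r] exit_mean_mem[OF t' x' _ r] fam fam' e em r Be in auto)
      moreover have "repar t' x' v ts r \<le> repar t x v ts r + (e + B * e)"
        unfolding repar_def
        by (rule mix_stable[OF finite_family finite_family empty_in_family[OF t'] empty_in_family[OF t] t' t])
          (use exit_mean_mem[OF t x _ r] exit_mean_mem[OF t' x' _ r] fam fam' e' e(1) em' r Be in auto)
      ultimately show ?thesis by linarith
    qed
    define u where "u = unrepar t x v ts s"
    have u: "0 \<le> u" "u \<le> 1" "repar t x v ts u = s"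
      using ontoD[OF repar_onto[OF t x] s] by (auto simp: u_def)
    have "flow t x (Vertex v ts) A F s = branches t x v ts A F u" using vA by (simp add: u_def)
    moreover have "\<bar>branches t x v ts A F u - branches t' x' v ts A F u\<bar> \<le> B * e"
      by (rule br[OF F u(1,2)]) (use compatible_child[OF _ A(1)] compatible_child[OF _ A(2)] in simp)
    moreover have "branches t' x' v ts A F u = flow t' x' (Vertex v ts) A F (repar t' x' v ts u)"
      using flow_repar[OF t' x' A(2) vA F u(1,2)] by simp
    moreover have "\<bar>flow t' x' (Vertex v ts) A F (repar t' x' v ts u) - flow t' x' (Vertex v ts) A F s\<bar>
       \<le> lip (Vertex v ts) * \<bar>repar t' x' v ts u - s\<bar>"
      by (rule nice_abs[OF flow_nice(1)[OF t' x' A(2) F]]) (use repar_mem[OF t' x'] u s in auto)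
    moreover have "lip (Vertex v ts) * \<bar>repar t' x' v ts u - s\<bar> \<le> lip (Vertex v ts) * (e + B * e)"
      using rp[OF u(1,2)] u(3) by (intro mult_left_mono) (auto simp: abs_minus_commute)
    ultimately have "\<bar>flow t x (Vertex v ts) A F s - flow t' x' (Vertex v ts) A F s\<bar>
        \<le> B * e + lip (Vertex v ts) * (e + B * e)" by linarith
    also have "\<dots> = C * e" by (simp add: C_def algebra_simps)
    finally show ?thesis .
  qed
  moreover have "0 \<le> C" using B0 by (simp add: C_def)
  ultimately show ?case by blast
qed

section \<open>Positions at the leaves\<close>

definition leaf_value :: "nat \<Rightarrow> 'v ptree \<Rightarrow> real \<Rightarrow> real" where
  "leaf_value b M s = (case M of Leaf a \<Rightarrow> if a = b then s else 0 | Vertex v ts \<Rightarrow> 0)"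

lemma leaf_value_simps[simp]:
  "leaf_value b (Leaf a) s = (if a = b then s else 0)" "leaf_value b (Vertex v ts) s = 0"
  by (auto simp: leaf_value_def)

lemma good_leaf_value: "good (leaf_value b)"
  unfolding good_def nice_def leaf_value_def by (auto split: ptree.splits)

lemma vertices_nth: "j < length ts ==> vertices (Vertex v ts) \<subseteq> A ==> vertices (ts ! j) \<subseteq> A"
  using nth_mem[of j ts] by fastforce

lemma leaf_list_nth: "j < length ts ==> a \<in> set (leaf_list (ts ! j)) ==> a \<in> set (leaf_list (Vertex v ts))"
  using nth_mem[of j ts] by fastforce

lemma flow_cong_leaves:
  "\<lbrakk>vertices N \<subseteq> A; \<And>a r. a \<in> set (leaf_list N) ==> F (Leaf a) r = G (Leaf a) r\<rbrakk>
    \<Longrightarrow> flow t x N A F s = flow t x N A G s"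
proof (induction N arbitrary: s)
  case (Vertex v ts)
  have "flow t x (ts ! j) A F r = flow t x (ts ! j) A G r" if "j < length ts" for j r
    by (rule Vertex.IH) (use that Vertex.prems vertices_nth[OF that] leaf_list_nth[OF that] in \<open>auto simp del: leaf_list.simps ptree.set\<close>)
  then show ?case using Vertex.prems(1) by (auto simp: branches_def)
qed simp

lemma flow_leaf_value_eq_0:
  "vertices N \<subseteq> A ==> b \<notin> set (leaf_list N) ==> flow t x N A (leaf_value b) s = 0"
proof (induction N arbitrary: s)
  case (Vertex v ts)
  have "flow t x (ts ! j) A (leaf_value b) r = 0" if "j < length ts" for j r
    by (rule Vertex.IH) (use that Vertex.prems vertices_nth[OF that] leaf_list_nth[OF that] in \<open>auto simp del: leaf_list.simps ptree.set\<close>)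
  then show ?case by (auto simp: branches_def)
qed simp

lemma distinct_concat_nth:
  "\<lbrakk>distinct (concat (map f ts)); i < length ts; j < length ts; i \<noteq> j\<rbrakk>
    \<Longrightarrow> set (f (ts ! i)) \<inter> set (f (ts ! j)) = {}"
proof (induction ts arbitrary: i j)
  case (Cons T ts)
  show ?case
  proof (cases i; cases j)
    fix i' j' assume "i = Suc i'" "j = Suc j'"
    then show ?thesis using Cons.IH[of i' j'] Cons.prems by auto
  next
    fix j' assume "i = 0" "j = Suc j'"
    then show ?thesis using Cons.prems by (auto dest: nth_mem)
  next
    fix i' assume "i = Suc i'" "j = 0"
    then show ?thesis using Cons.prems by (auto dest: nth_mem)
  qed (use Cons.prems in auto)
qed simp

lemma distinct_concat_child: "distinct (concat (map f ts)) ==> T \<in> set ts ==> distinct (f T)"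
  by (induction ts) auto

lemma set_leaf_list_Vertex: "set (leaf_list (Vertex v ts)) = (\<Union>j<length ts. set (leaf_list (ts ! j)))"
proof -
  have "set ts = (!) ts ` {..<length ts}" by (auto simp: set_conv_nth)
  then show ?thesis by (simp del: image_is_empty)
qed

lemma branches_leaf_value:
  assumes "distinct (leaf_list (Vertex v ts))" "vertices (Vertex v ts) \<subseteq> A"
    "j < length ts" "b \<in> set (leaf_list (ts ! j))"
  shows "branches t x v ts A (leaf_value b) r = flow t x (ts ! j) A (leaf_value b) (x v j r)"
proof -
  have "flow t x (ts ! i) A (leaf_value b) (x v i r) = 0" if i: "i < length ts" "i \<noteq> j" for i
  proof (rule flow_leaf_value_eq_0)
    show "vertices (ts ! i) \<subseteq> A" using vertices_nth[OF i(1) assms(2)] .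
    show "b \<notin> set (leaf_list (ts ! i))"
      using distinct_concat_nth[of leaf_list ts i j] assms i by auto
  qed
  then show ?thesis
    unfolding branches_def using assms(3) by (subst sum.remove[of _ j]) auto
qed

lemma branches_leaves_step:
  assumes "vertices (Vertex v ts) \<subseteq> A" "distinct (leaf_list (Vertex v ts))"
    and IH: "\<And>j r. j < length ts ==>
      flow t x (ts ! j) A G r = (\<Sum>a\<in>set (leaf_list (ts ! j)). G (Leaf a) (flow t x (ts ! j) A (leaf_value a) r))"
  shows "branches t x v ts A G r
    = (\<Sum>a\<in>set (leaf_list (Vertex v ts)). G (Leaf a) (branches t x v ts A (leaf_value a) r))"
proof -
  have d: "distinct (concat (map leaf_list ts))" using assms(2) by simp
  have "flow t x (ts ! j) A G (x v j r)
      = (\<Sum>a\<in>set (leaf_list (ts ! j)). G (Leaf a) (branches t x v ts A (leaf_value a) r))"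
    if j: "j < length ts" for j
    using branches_leaf_value[OF assms(2,1) j] IH[OF j] by simp
  then have "branches t x v ts A G r = (\<Sum>j<length ts. \<Sum>a\<in>set (leaf_list (ts ! j)).
      G (Leaf a) (branches t x v ts A (leaf_value a) r))"
    unfolding branches_def[of _ _ _ _ _ G] by (intro sum.cong) auto
  also have "\<dots> = (\<Sum>a\<in>set (leaf_list (Vertex v ts)). G (Leaf a) (branches t x v ts A (leaf_value a) r))"
    unfolding set_leaf_list_Vertex
    by (subst sum.UNION_disjoint) (use distinct_concat_nth[OF d] in auto)
  finally show ?thesis .
qed

text \<open>A leaf is reached along a single path, so \<open>leaf_value\<close> reports its position
  without contributions from the other leaves. A boundary function thus enters only through its
  values at these positions.\<close>

lemma flow_leaves:
  "\<lbrakk>vertices N \<subseteq> A; distinct (leaf_list N)\<rbrakk> \<Longrightarrow>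
    flow t x N A G s = (\<Sum>a\<in>set (leaf_list N). G (Leaf a) (flow t x N A (leaf_value a) s))"
proof (induction N arbitrary: s)
  case (Vertex v ts)
  have "branches t x v ts A G (unrepar t x v ts s) = (\<Sum>a\<in>set (leaf_list (Vertex v ts)).
      G (Leaf a) (branches t x v ts A (leaf_value a) (unrepar t x v ts s)))"
  proof (rule branches_leaves_step[OF Vertex.prems])
    have d: "distinct (concat (map leaf_list ts))" using Vertex.prems(2) by simp
    show "flow t x (ts ! j) A G r = (\<Sum>a\<in>set (leaf_list (ts ! j)). G (Leaf a) (flow t x (ts ! j) A (leaf_value a) r))"
      if j: "j < length ts" for j r
      by (rule Vertex.IH) (use j vertices_nth[OF j Vertex.prems(1)] distinct_concat_child[OF d] in auto)
  qed
  then show ?case using Vertex.prems(1) by simp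
qed simp

lemma branches_leaves:
  assumes "vertices (Vertex v ts) \<subseteq> A" "distinct (leaf_list (Vertex v ts))"
  shows "branches t x v ts A G r
    = (\<Sum>a\<in>set (leaf_list (Vertex v ts)). G (Leaf a) (branches t x v ts A (leaf_value a) r))"
proof (rule branches_leaves_step[OF assms])
  have d: "distinct (concat (map leaf_list ts))" using assms(2) by simp
  show "flow t x (ts ! j) A G r = (\<Sum>a\<in>set (leaf_list (ts ! j)). G (Leaf a) (flow t x (ts ! j) A (leaf_value a) r))"
    if j: "j < length ts" for j r
    by (rule flow_leaves) (use j vertices_nth[OF j assms(1)] distinct_concat_child[OF d] in auto)
qed

lemma exits_all: "vertices N \<subseteq> A ==> exits A N = length (leaf_list N)"
proof (induction N)
  case (Vertex v ts)
  then have "map (exits A) ts = map (\<lambda>T. length (leaf_list T)) ts" by (force intro!: map_cong)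
  then show ?case using Vertex.prems by (simp add: length_concat comp_def del: map_eq_conv)
qed simp

lemma compatible_all: "vertices N \<subseteq> A ==> compatible t N A"
  unfolding compatible_def by blast

lemma flow_leaf_value_1:
  assumes t: "weights t"
  shows "\<lbrakk>fits x N; vertices N \<subseteq> A; distinct (leaf_list N); b \<in> set (leaf_list N)\<rbrakk>
    \<Longrightarrow> flow t x N A (leaf_value b) 1 = 1"
proof (induction N)
  case (Vertex v ts)
  obtain j where j: "j < length ts" "b \<in> set (leaf_list (ts ! j))"
    using Vertex.prems(4) unfolding set_leaf_list_Vertex by auto
  have T: "ts ! j \<in> set ts" using j by simp
  have d: "distinct (concat (map leaf_list ts))" using Vertex.prems(3) by simp
  have "flow t x (Vertex v ts) A (leaf_value b) 1 = branches t x v ts A (leaf_value b) 1"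
    using flow_repar[OF t Vertex.prems(1) compatible_all[OF Vertex.prems(2)] _ good_leaf_value, where r = 1]
      repar_nice'(4)[OF t Vertex.prems(1)] Vertex.prems(2) by simp
  also have "\<dots> = flow t x (ts ! j) A (leaf_value b) 1"
    using branches_leaf_value[OF Vertex.prems(3,2) j] fits_Vertex(3)[OF Vertex.prems(1) T] j
    by (simp add: cactus_fun_def)
  also have "\<dots> = 1"
    by (rule Vertex.IH[OF T]) (use j fits_Vertex(1)[OF Vertex.prems(1) T] vertices_nth[OF j(1) Vertex.prems(2)] T distinct_concat_child[OF d] in auto)
  finally show ?case .
qed simp

text \<open>At weight \<open>1\<close> a bracket is traversed with the arclength of the cactus it encloses.\<close>

lemma repar_normalized:
  assumes t: "weights t" "t (vertices (Vertex v ts)) = 1" and n: "leaf_list (Vertex v ts) \<noteq> []"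
  shows "repar t x v ts r = exit_mean t x v ts (vertices (Vertex v ts)) r"
  unfolding repar_def
proof (rule mix_top)
  show "vertices (Vertex v ts) \<in> family t v ts"
    using t exits_all[of "Vertex v ts" "vertices (Vertex v ts)"] n unfolding family_def by auto
qed (use assms in \<open>auto simp: family_def\<close>)

text \<open>The whole tree has weight 1, so the parameter at its root is the mean of the leaf
  positions, and this is the condition on the sum. For a single leaf the sum has one term.\<close>

lemma flow_cactus_fun:
  assumes t: "weights t" "t (vertices T) = 1" and x: "fits x T"
    and T: "distinct (leaf_list T)" "set (leaf_list T) = {..<n}" and n: "n \<noteq> 0"
  shows "cactus_fun n (\<lambda>b. flow t x T (vertices T) (leaf_value b))"
proof -
  let ?f = "\<lambda>b. flow t x T (vertices T) (leaf_value b)"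
  note c = compatible_all[of T "vertices T" t, OF order.refl]
  have "mono_on {0..1} (?f b) \<and> ?f b 0 = 0 \<and> ?f b 1 = 1" if "b < n" for b
    using flow_nice(1,2)[OF t(1) x c good_leaf_value, of b] flow_leaf_value_1[OF t(1) x order.refl T(1), of b] T(2) that
    by (auto simp: mono_on_def nice_def)
  moreover have "(\<Sum>b<n. ?f b r) = real n * r" if r: "r \<in> {0..1}" for r
  proof -
    have len: "length (leaf_list T) = n" using distinct_card[OF T(1)] T(2) by simp
    have "(\<Sum>b<n. ?f b r) = flow t x T (vertices T) (\<lambda>_ s. s) r"
      using flow_leaves[OF order.refl T(1), of t x "\<lambda>_ s. s" r] T(2) by simp
    also have "\<dots> = real n * r"
    proof (cases T)
      case (Leaf a)
      then show ?thesis using len by simp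
    next
      case (Vertex v ts)
      let ?u = "unrepar t x v ts r"
      have u: "repar t x v ts ?u = r" using ontoD(3)[OF repar_onto[OF t(1) x[unfolded Vertex]]] r by simp
      have ne: "leaf_list (Vertex v ts) \<noteq> []" using len n Vertex by auto
      have "exit_mean t x v ts (vertices (Vertex v ts)) ?u = r"
        using repar_normalized[OF t[unfolded Vertex] ne] u by metis
      then have "branches t x v ts (vertices (Vertex v ts)) (\<lambda>_ s. s) ?u = real (exits (vertices (Vertex v ts)) (Vertex v ts)) * r"
        using exits_all[of "Vertex v ts" "vertices (Vertex v ts)"] ne
        by (auto simp: exit_mean_def field_simps simp del: exits.simps leaf_list.simps)
      then show ?thesis
        using exits_all[of "Vertex v ts" "vertices (Vertex v ts)"] len Vertex
        by (simp del: exits.simps leaf_list.simps)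
    qed
    finally show ?thesis .
  qed
  ultimately show ?thesis unfolding cactus_fun_def by blast
qed

section \<open>Tree-like families of functions\<close>

definition axis_parallel :: "'i set \<Rightarrow> ('i \<Rightarrow> real \<Rightarrow> real) \<Rightarrow> bool" where
  "axis_parallel I f \<longleftrightarrow> (\<exists>P. finite P \<and> (\<forall>a b i j. 0 \<le> a \<longrightarrow> a < b \<longrightarrow> b \<le> 1 \<longrightarrow> {a<..<b} \<inter> P = {} \<longrightarrow>
     i \<in> I \<longrightarrow> j \<in> I \<longrightarrow> i \<noteq> j \<longrightarrow> f i a = f i b \<or> f j a = f j b))"

definition noncrossing :: "'i set \<Rightarrow> ('i \<Rightarrow> real \<Rightarrow> real) \<Rightarrow> bool" where
  "noncrossing I f \<longleftrightarrow> (\<forall>i\<in>I. \<forall>j\<in>I. \<forall>a b c d e. i \<noteq> j \<and> 0 \<le> a \<and> a \<le> b \<and> b \<le> c \<and> c \<le> d \<and> d \<le> e \<and> e \<le> 1 \<longrightarrow>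
     \<not> (f i a < f i b \<and> f j b < f j c \<and> f i c < f i d \<and> f j d < f j e))"

text \<open>For a \<open>cactus_fun\<close> the first condition says that the circle is cut into
  finitely many arcs, each running along one lobe. The second excludes the forbidden cyclically
  ordered 4-tuples, with increments in place of interior points. Cutting the circle at 0 is
  harmless, since rotating a 4-tuple at most exchanges its two lobes.\<close>

definition treelike :: "'i set \<Rightarrow> ('i \<Rightarrow> real \<Rightarrow> real) \<Rightarrow> bool" where
  "treelike I f \<longleftrightarrow> axis_parallel I f \<and> noncrossing I f"

lemma noncrossingD:
  assumes "noncrossing I f" "i \<in> I" "j \<in> I" "i \<noteq> j" "0 \<le> a" "a \<le> b" "b \<le> c" "c \<le> d" "d \<le> e" "e \<le> 1"
    "f i a < f i b" "f j b < f j c" "f i c < f i d" "f j d < f j e"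
  shows False
  using assms unfolding noncrossing_def by blast

lemma treelike_mono:
  assumes "treelike I f" "J \<subseteq> I"
  shows "treelike J f"
proof -
  have "axis_parallel J f"
    using assms unfolding treelike_def axis_parallel_def by (meson subsetD)
  moreover have "noncrossing J f"
    unfolding noncrossing_def
  proof (intro ballI allI impI notI)
    fix i j a b c d e assume *: "i \<in> J" "j \<in> J"
      "i \<noteq> j \<and> 0 \<le> a \<and> a \<le> b \<and> b \<le> c \<and> c \<le> d \<and> d \<le> e \<and> e \<le> 1"
      "f i a < f i b \<and> f j b < f j c \<and> f i c < f i d \<and> f j d < f j e"
    show False
      by (rule noncrossingD[of I f i j a b c d e]) (use assms * in \<open>auto simp: treelike_def\<close>)
  qed
  ultimately show ?thesis unfolding treelike_def by simp
qed

text \<open>Functions over the same index inherit both properties from \<open>g\<close>, precomposed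
  with a monotone map. Functions over different indices inherit them from \<open>h\<close>, because
  the composite can move only when the inner function does.\<close>

lemma treelike_subst:
  fixes h :: "'j \<Rightarrow> real \<Rightarrow> real"
  assumes J: "finite J" and h: "treelike J h" "\<And>j. j \<in> J ==> onto (h j)"
    and g: "\<And>j. j \<in> J ==> treelike {b\<in>I. p b = j} g"
    and p: "\<And>b. b \<in> I ==> p b \<in> J"
    and gm: "\<And>b. b \<in> I ==> mono_on {0..1} (g b)"
  shows "treelike I (\<lambda>b r. g b (h (p b) r))"
proof -
  have hm: "0 \<le> h j r \<and> h j r \<le> 1" if "j \<in> J" "0 \<le> r" "r \<le> 1" for j r
    using h(2)[OF that(1)] that(2,3) unfolding onto_def by auto
  have hmono: "h j r \<le> h j s" if "j \<in> J" "0 \<le> r" "r \<le> s" "s \<le> 1" for j r s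
    using h(2)[OF that(1)] that(2-) unfolding onto_def mono_on_def by auto
  have "axis_parallel J h" using h(1) unfolding treelike_def by simp
  then obtain P where P0: "finite P" "\<forall>a b i j. 0 \<le> a \<longrightarrow> a < b \<longrightarrow> b \<le> 1 \<longrightarrow> {a<..<b} \<inter> P = {} \<longrightarrow>
     i \<in> J \<longrightarrow> j \<in> J \<longrightarrow> i \<noteq> j \<longrightarrow> h i a = h i b \<or> h j a = h j b"
    unfolding axis_parallel_def by (elim exE conjE)
  note P = P0(1) P0(2)[rule_format]
  have "\<forall>j\<in>J. \<exists>R. finite R \<and> (\<forall>a b i i'. 0 \<le> a \<longrightarrow> a < b \<longrightarrow> b \<le> 1 \<longrightarrow> {a<..<b} \<inter> R = {} \<longrightarrow> i \<in> I \<longrightarrow>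
     i' \<in> I \<longrightarrow> p i = j \<longrightarrow> p i' = j \<longrightarrow> i \<noteq> i' \<longrightarrow> g i a = g i b \<or> g i' a = g i' b)"
  proof
    fix j assume "j \<in> J"
    then have "axis_parallel {b\<in>I. p b = j} g" using g by (simp add: treelike_def)
    then obtain R where R: "finite R" "\<forall>a b i i'. 0 \<le> a \<longrightarrow> a < b \<longrightarrow> b \<le> 1 \<longrightarrow> {a<..<b} \<inter> R = {} \<longrightarrow>
        i \<in> {b\<in>I. p b = j} \<longrightarrow> i' \<in> {b\<in>I. p b = j} \<longrightarrow> i \<noteq> i' \<longrightarrow> g i a = g i b \<or> g i' a = g i' b"
      unfolding axis_parallel_def by (elim exE conjE)
    show "\<exists>R. finite R \<and> (\<forall>a b i i'. 0 \<le> a \<longrightarrow> a < b \<longrightarrow> b \<le> 1 \<longrightarrow> {a<..<b} \<inter> R = {} \<longrightarrow> i \<in> I \<longrightarrow>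
     i' \<in> I \<longrightarrow> p i = j \<longrightarrow> p i' = j \<longrightarrow> i \<noteq> i' \<longrightarrow> g i a = g i b \<or> g i' a = g i' b)"
      by (intro exI[of _ R] conjI allI impI R(1) R(2)[rule_format]) auto
  qed
  from bchoice[OF this] obtain R where R': "\<forall>j\<in>J. finite (R j) \<and> (\<forall>a b i i'. 0 \<le> a \<longrightarrow> a < b \<longrightarrow> b \<le> 1 \<longrightarrow> {a<..<b} \<inter> R j = {} \<longrightarrow> i \<in> I \<longrightarrow>
     i' \<in> I \<longrightarrow> p i = j \<longrightarrow> p i' = j \<longrightarrow> i \<noteq> i' \<longrightarrow> g i a = g i b \<or> g i' a = g i' b)"
    by (elim exE)
  have R: "finite (R j)"
    "\<lbrakk>0 \<le> a; a < b; b \<le> 1; {a<..<b} \<inter> R j = {}; i \<in> I; i' \<in> I; p i = j; p i' = j; i \<noteq> i'\<rbrakk>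
      \<Longrightarrow> g i a = g i b \<or> g i' a = g i' b" if "j \<in> J" for j a b i i'
    using R'[rule_format, OF that] by simp_all
  \<comment> \<open>One preimage for each break point is enough: by monotonicity, an interval whose
    end points are mapped to either side of the break point contains all its preimages.\<close>
  define P' where "P' = P \<union> (\<Union>j\<in>J. inv_into {0..1} (h j) ` R j)"
  have "axis_parallel I (\<lambda>b r. g b (h (p b) r))"
    unfolding axis_parallel_def
  proof (intro exI[of _ P'] conjI allI impI)
    show "finite P'" unfolding P'_def using P(1) R(1) J by auto
    fix a b i i' assume "0 \<le> a" "a < b" "b \<le> 1" "{a<..<b} \<inter> P' = {}" and i: "i \<in> I" "i' \<in> I" "i \<noteq> i'"
    then have ab: "0 \<le> a \<and> a < b \<and> b \<le> 1 \<and> {a<..<b} \<inter> P' = {}" by simp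
    show "g i (h (p i) a) = g i (h (p i) b) \<or> g i' (h (p i') a) = g i' (h (p i') b)"
    proof (cases "p i = p i'")
      case False
      then show ?thesis using P(2)[of a b "p i" "p i'"] ab i p unfolding P'_def by fastforce
    next
      case True
      let ?j = "p i"
      have j: "?j \<in> J" using p i by blast
      show ?thesis
      proof (cases "h ?j a < h ?j b")
        case False
        then have "h ?j a = h ?j b" using hmono[OF j, of a b] ab by linarith
        then show ?thesis by simp
      next
        case lt: True
        have "{h ?j a<..<h ?j b} \<inter> R ?j = {}"
        proof (rule ccontr)
          assume "\<not> ?thesis"
          then obtain c where c: "h ?j a < c" "c < h ?j b" "c \<in> R ?j" by auto
          let ?u = "inv_into {0..1} (h ?j) c"
          have "0 \<le> c" "c \<le> 1" using c hm[OF j, of a] hm[OF j, of b] ab by auto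
          then have u: "0 \<le> ?u" "?u \<le> 1" "h ?j ?u = c" using ontoD[OF h(2)[OF j]] by auto
          have "a < ?u" using hmono[OF j, of ?u a] u c ab by (smt (verit))
          moreover have "?u < b" using hmono[OF j, of b ?u] u c ab by (smt (verit))
          moreover have "?u \<in> P'" unfolding P'_def using j c by auto
          ultimately show False using ab by auto
        qed
        then have "g i (h ?j a) = g i (h ?j b) \<or> g i' (h ?j a) = g i' (h ?j b)"
          by (intro R(2)[OF j]) (use lt hm[OF j, of a] hm[OF j, of b] i True ab in simp_all)
        then show ?thesis using True by simp
      qed
    qed
  qed
  moreover have "noncrossing I (\<lambda>b r. g b (h (p b) r))"
    unfolding noncrossing_def
  proof (intro ballI allI impI notI)
    fix i j a b c d e
    assume i: "i \<in> I" "j \<in> I" and abc: "i \<noteq> j \<and> 0 \<le> a \<and> a \<le> b \<and> b \<le> c \<and> c \<le> d \<and> d \<le> e \<and> e \<le> 1"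
      and lt: "g i (h (p i) a) < g i (h (p i) b) \<and> g j (h (p j) b) < g j (h (p j) c) \<and>
          g i (h (p i) c) < g i (h (p i) d) \<and> g j (h (p j) d) < g j (h (p j) e)"
    show False
    proof (cases "p i = p j")
      case True
      let ?h = "h (p i)"
      have "p i \<in> J" using p i by blast
      note m = hm[OF this] hmono[OF this]
      have "noncrossing {b\<in>I. p b = p i} g" using g[OF \<open>p i \<in> J\<close>] by (simp add: treelike_def)
      then show False
        by (rule noncrossingD[of _ g i j "?h a" "?h b" "?h c" "?h d" "?h e"])
          (use i True abc lt m(1)[of a] m(1)[of e] m(2)[of a b] m(2)[of b c] m(2)[of c d] m(2)[of d e] in auto)
    next
      case False
      have lt': "h (p k) r < h (p k) s" if "k \<in> I" "g k (h (p k) r) < g k (h (p k) s)" "0 \<le> r" "r \<le> s" "s \<le> 1" for k r s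
        using hmono[OF p[OF that(1)] that(3-5)] that(2) by (cases "h (p k) r = h (p k) s") auto
      have "h (p i) a < h (p i) b" "h (p j) b < h (p j) c" "h (p i) c < h (p i) d" "h (p j) d < h (p j) e"
        using lt'[OF i(1), of a b] lt'[OF i(2), of b c] lt'[OF i(1), of c d] lt'[OF i(2), of d e] lt abc by auto
      then show False using noncrossingD[of J h "p i" "p j" a b c d e] h(1) p[OF i(1)] p[OF i(2)] False abc
        unfolding treelike_def by simp
    qed
  qed
  ultimately show ?thesis unfolding treelike_def by blast
qed

text \<open>A monotone choice of preimages carries test points for \<open>f\<close> to test points
  for \<open>g\<close>. Only the break points need care, as \<open>q\<close> may collapse
  intervals.\<close>

lemma treelike_repar:
  assumes q: "onto q" and f: "\<And>i. i \<in> I ==> nice M (f i)"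
    and fq: "\<And>i r. i \<in> I ==> 0 \<le> r ==> r \<le> 1 ==> f i (q r) = g i r" and g: "treelike I g"
  shows "treelike I f"
proof -
  let ?u = "inv_into {0..1} q"
  have fg: "f i s = g i (?u s)" if "i \<in> I" "0 \<le> s" "s \<le> 1" for i s
    using fq[OF that(1), of "?u s"] ontoD[OF q that(2,3)] by simp
  have "axis_parallel I g" using g unfolding treelike_def by simp
  then obtain P where P0: "finite P" "\<forall>a b i j. 0 \<le> a \<longrightarrow> a < b \<longrightarrow> b \<le> 1 \<longrightarrow> {a<..<b} \<inter> P = {} \<longrightarrow>
     i \<in> I \<longrightarrow> j \<in> I \<longrightarrow> i \<noteq> j \<longrightarrow> g i a = g i b \<or> g j a = g j b"
    unfolding axis_parallel_def by (elim exE conjE)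
  note P = P0(1) P0(2)[rule_format]
  have "axis_parallel I f"
    unfolding axis_parallel_def
  proof (intro exI[of _ "q ` P"] conjI allI impI)
    show "finite (q ` P)" using P by simp
    fix a b i j assume "0 \<le> a" "a < b" "b \<le> 1" "{a<..<b} \<inter> q ` P = {}" and i: "i \<in> I" "j \<in> I" "i \<noteq> j"
    then have ab: "0 \<le> a \<and> a < b \<and> b \<le> 1 \<and> {a<..<b} \<inter> q ` P = {}" by simp
    show "f i a = f i b \<or> f j a = f j b"
    proof (rule ccontr)
      assume neg: "\<not> ?thesis"
      define D where "D = min (f i b - f i a) (f j b - f j a)"
      have D: "D > 0" "D \<le> f i b - f i a" "D \<le> f j b - f j a"
        using neg niceD(1)[OF f[OF i(1)], of a b] niceD(1)[OF f[OF i(2)], of a b] ab by (auto simp: D_def)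
      \<comment> \<open>A break point between the preimages of \<open>a\<close> and \<open>b\<close>
        may be mapped by \<open>q\<close> to \<open>a\<close> or \<open>b\<close> itself. Moving
        both ends inwards by \<delta> excludes this, and the Lipschitz bound limits the loss to D /
        4 at each end, so both functions still increase.\<close>
      define \<delta> where "\<delta> = min ((b - a) / 4) (D / (4 * (\<bar>M\<bar> + 1)))"
      have \<delta>: "\<delta> > 0" "\<delta> \<le> (b - a) / 4" unfolding \<delta>_def using D(1) ab by (simp_all only: min_less_iff_conj min.cobounded1) (simp add: add_nonneg_pos)
      have "(\<bar>M\<bar> + 1) * \<delta> \<le> (\<bar>M\<bar> + 1) * (D / (4 * (\<bar>M\<bar> + 1)))"
        by (intro mult_left_mono) (auto simp: \<delta>_def)
      also have "\<dots> = D / 4" by (simp add: field_simps)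
      finally have "(\<bar>M\<bar> + 1) * \<delta> \<le> D / 4" .
      moreover have "M * \<delta> \<le> (\<bar>M\<bar> + 1) * \<delta>" using \<delta> by (intro mult_right_mono) auto
      ultimately have M: "M * \<delta> \<le> D / 4" by linarith
      define a' b' where "a' = a + \<delta>" and "b' = b - \<delta>"
      have ab': "a < a'" "a' < b'" "b' < b" "0 \<le> a'" "b' \<le> 1" using \<delta> ab by (auto simp: a'_def b'_def)
      have lt: "f k a' < f k b'" if "k \<in> I" "D \<le> f k b - f k a" for k
        using niceD(2)[OF f[OF that(1)], of a a'] niceD(2)[OF f[OF that(1)], of b' b] M D(1) that(2) ab ab'
        by (auto simp: a'_def b'_def)
      let ?r = "?u a'" and ?r' = "?u b'"
      have r: "0 \<le> ?r" "?r' \<le> 1" "?r \<le> ?r'" "q ?r = a'" "q ?r' = b'" "?r \<le> 1" "0 \<le> ?r'"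
        using ontoD[OF q] onto_inv_mono[OF q, of a' b'] ab' by auto
      then have "?r < ?r'" using ab' by (cases "?r = ?r'") auto
      moreover have "{?r<..<?r'} \<inter> P = {}"
      proof (rule ccontr)
        assume "\<not> ?thesis"
        then obtain c where c: "?r < c" "c < ?r'" "c \<in> P" by auto
        have qm: "q y \<le> q z" if "0 \<le> y" "y \<le> z" "z \<le> 1" for y z
          using q that unfolding onto_def mono_on_def by auto
        have "q ?r \<le> q c" "q c \<le> q ?r'"
          by (rule qm; use c r(1,2) in linarith)+
        then have "q c \<in> {a<..<b} \<inter> q ` P" using r(4,5) ab' c by auto
        then show False using ab by blast
      qed
      ultimately have "g i ?r = g i ?r' \<or> g j ?r = g j ?r'" using P(2) r i by blast
      then have "f i a' = f i b' \<or> f j a' = f j b'" using fg i ab' by auto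
      then show False using lt i D by fastforce
    qed
  qed
  moreover have "noncrossing I f"
    unfolding noncrossing_def
  proof (intro ballI allI impI notI)
    fix i j a b c d e
    assume i: "i \<in> I" "j \<in> I" and abc: "i \<noteq> j \<and> 0 \<le> a \<and> a \<le> b \<and> b \<le> c \<and> c \<le> d \<and> d \<le> e \<and> e \<le> 1"
      and lt: "f i a < f i b \<and> f j b < f j c \<and> f i c < f i d \<and> f j d < f j e"
    have "noncrossing I g" using g by (simp add: treelike_def)
    then show False
      by (rule noncrossingD[of _ g i j "?u a" "?u b" "?u c" "?u d" "?u e"])
        (use i abc lt fg[OF i(1)] fg[OF i(2)] ontoD(1)[OF q, of a] ontoD(2)[OF q, of e]
        onto_inv_mono[OF q, of a b] onto_inv_mono[OF q, of b c] onto_inv_mono[OF q, of c d] onto_inv_mono[OF q, of d e] in auto)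
  qed
  ultimately show ?thesis unfolding treelike_def by blast
qed

lemma cactus_fun_onto: "cactus_fun k f ==> j < k ==> onto (f j)"
  by (rule nice_onto[OF cactus_fun_nice]) (auto simp: cactus_fun_def)

lemma flow_treelike:
  assumes t: "weights t"
  shows "\<lbrakk>fits x N; vertices N \<subseteq> A; distinct (leaf_list N);
    \<And>v ts. Vertex v ts \<in> subs N ==> treelike {..<length ts} (x v)\<rbrakk>
    \<Longrightarrow> treelike (set (leaf_list N)) (\<lambda>b. flow t x N A (leaf_value b))"
proof (induction N)
  case (Leaf a)
  then show ?case by (auto simp: treelike_def axis_parallel_def noncrossing_def)
next
  case (Vertex v ts)
  let ?I = "set (leaf_list (Vertex v ts))"
  define p where "p b = (SOME j. j < length ts \<and> b \<in> set (leaf_list (ts ! j)))" for b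
  have p: "p b < length ts \<and> b \<in> set (leaf_list (ts ! p b))" if "b \<in> ?I" for b
    unfolding p_def by (rule someI_ex) (use that[unfolded set_leaf_list_Vertex] in auto)
  have d: "distinct (concat (map leaf_list ts))" using Vertex.prems(3) by simp
  let ?g = "\<lambda>b r. flow t x (ts ! p b) A (leaf_value b) r"
  have ch: "fits x (ts ! j)" "vertices (ts ! j) \<subseteq> A" "cactus_fun (length ts) (x v)" "ts ! j \<in> set ts" if "j < length ts" for j
    using that fits_Vertex[OF Vertex.prems(1), of "ts ! j"] vertices_nth[OF that Vertex.prems(2)] by simp_all
  have "treelike ?I (\<lambda>b r. ?g b (x v (p b) r))"
  proof (rule treelike_subst[where J = "{..<length ts}" and h = "x v"])
    show "treelike {..<length ts} (x v)" using Vertex.prems(4) by simp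
    show "onto (x v j)" if "j \<in> {..<length ts}" for j
      using cactus_fun_onto[OF ch(3)] that by auto
    show "p b \<in> {..<length ts}" if "b \<in> ?I" for b using p that by auto
    show "mono_on {0..1} (?g b)" if "b \<in> ?I" for b
    proof -
      have "nice (lip (ts ! p b)) (?g b)"
        using p[OF that] by (intro flow_nice(1)[OF t ch(1) compatible_all[OF ch(2)] good_leaf_value]) auto
      then show ?thesis by (auto simp: mono_on_def nice_def)
    qed
    show "treelike {b \<in> ?I. p b = j} ?g" if j: "j \<in> {..<length ts}" for j
    proof -
      have "treelike (set (leaf_list (ts ! j))) (\<lambda>b. flow t x (ts ! j) A (leaf_value b))"
      proof (rule Vertex.IH)
        show "treelike {..<length us} (x w)" if "Vertex w us \<in> subs (ts ! j)" for w us
          by (rule Vertex.prems(4)[OF subs_trans[OF subs_nth that]]) (use j in simp)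
      qed (use j ch distinct_concat_child[OF d] in auto)
      then have 1: "treelike {b \<in> ?I. p b = j} (\<lambda>b. flow t x (ts ! j) A (leaf_value b))"
        by (rule treelike_mono) (use p in auto)
      show ?thesis
      proof (rule treelike_repar[OF _ _ _ 1, where q = "\<lambda>r. r" and M = "lip (ts ! j)"])
        show "onto (\<lambda>r. r)" by (auto simp: onto_def mono_on_def)
        show "nice (lip (ts ! j)) (?g b)" if "b \<in> {b \<in> ?I. p b = j}" for b
          using that j by (auto intro!: flow_nice(1)[OF t ch(1) compatible_all[OF ch(2)] good_leaf_value])
      qed simp
    qed
  qed auto
  show ?case
  proof (rule treelike_repar[OF repar_onto[OF t Vertex.prems(1)]])
    show "treelike ?I (\<lambda>b r. ?g b (x v (p b) r))" by fact
    show "nice (lip (Vertex v ts)) (flow t x (Vertex v ts) A (leaf_value b))" for b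
      by (rule flow_nice(1)[OF t Vertex.prems(1) compatible_all[OF Vertex.prems(2)] good_leaf_value])
    show "flow t x (Vertex v ts) A (leaf_value b) (repar t x v ts r) = ?g b (x v (p b) r)"
      if "b \<in> ?I" "0 \<le> r" "r \<le> 1" for b r
      using flow_repar[OF t Vertex.prems(1) compatible_all[OF Vertex.prems(2)] _ good_leaf_value that(2,3)]
        branches_leaf_value[OF Vertex.prems(3,2)] p[OF that(1)] Vertex.prems(2) by simp
  qed
qed

section \<open>Insertion of trees\<close>

text \<open>Sets identified by \<open>h\<close> have the same centre, and the narrowest of their
  clamps, the one of largest weight, subsumes the others. The conditions on \<open>t'\<close> say
  that the image carries this largest weight. For injective \<open>h\<close> the lemma is a mere
  transport.\<close>

lemma mix_merge:
  assumes K: "finite K" "K \<noteq> {}" and w: "\<And>A. t A \<le> 1"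
    and h: "\<And>A B. A \<in> K ==> B \<in> K ==> A \<subseteq> B ==> h A \<subseteq> h B"
      "\<And>A B. A \<in> K ==> B \<in> K ==> h A \<subseteq> h B ==> A \<subseteq> B \<or> h A = h B"
    and \<phi>: "\<And>A. A \<in> K ==> \<phi>' (h A) = \<phi> A"
    and t: "\<And>A. A \<in> K ==> t A \<le> t' (h A)" "\<And>A. A \<in> K ==> \<exists>B\<in>K. h B = h A \<and> t B = t' (h A)"
  shows "mix t' (h ` K) \<phi>' = mix t K \<phi>"
proof -
  have hK: "finite (h ` K)" "h ` K \<noteq> {}" using K by auto
  have "c \<le> mix t' (h ` K) \<phi>' \<longleftrightarrow> c \<le> mix t K \<phi>" for c
  proof
    assume "c \<le> mix t' (h ` K) \<phi>'"
    then obtain A0 where A0: "A0 \<in> K" "c \<le> \<phi>' (h A0) - (1 - t' (h A0))"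
        "\<And>B. B \<in> K ==> h A0 \<subseteq> h B ==> c \<le> \<phi>' (h B) + (1 - t' (h B))"
      unfolding le_mix_iff[OF hK] by blast
    obtain A where A: "A \<in> K" "h A = h A0" "t A = t' (h A0)" using t(2)[OF A0(1)] by blast
    show "c \<le> mix t K \<phi>"
      unfolding le_mix_iff[OF K]
    proof (intro bexI[OF _ A(1)] conjI ballI impI)
      show "c \<le> \<phi> A - (1 - t A)" using A0(2) A \<phi>[OF A(1)] by simp
      fix B assume B: "B \<in> K" "A \<subseteq> B"
      then have "h A0 \<subseteq> h B" using h(1)[OF A(1)] A(2) by auto
      then show "c \<le> \<phi> B + (1 - t B)" using A0(3)[OF B(1)] \<phi>[OF B(1)] t(1)[OF B(1)] by linarith
    qed
  next
    assume "c \<le> mix t K \<phi>"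
    then obtain A where A: "A \<in> K" "c \<le> \<phi> A - (1 - t A)"
        "\<And>B. B \<in> K ==> A \<subseteq> B ==> c \<le> \<phi> B + (1 - t B)"
      unfolding le_mix_iff[OF K] by blast
    show "c \<le> mix t' (h ` K) \<phi>'"
      unfolding le_mix_iff[OF hK]
    proof (intro bexI[of _ "h A"] conjI ballI impI)
      show "c \<le> \<phi>' (h A) - (1 - t' (h A))" using A(2) \<phi>[OF A(1)] t(1)[OF A(1)] by linarith
      fix C assume C: "C \<in> h ` K" "h A \<subseteq> C"
      then obtain B where B: "B \<in> K" "C = h B" "t B = t' C" using t(2) by force
      show "c \<le> \<phi>' C + (1 - t' C)"
      proof (cases "A \<subseteq> B")
        case True
        then show ?thesis using A(3)[OF B(1)] \<phi>[OF B(1)] B by simp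
      next
        case False
        then have "h A = h B" using h(2)[OF A(1) B(1)] C(2) B(2) by simp
        then have "\<phi> A = \<phi> B" using \<phi>[OF A(1)] \<phi>[OF B(1)] by simp
        then show ?thesis using A(2) w[of A] w[of B] \<phi>[OF B(1)] B by simp
      qed
    qed (use A in simp)
  qed
  then show ?thesis by (meson order.refl order_antisym)
qed

lemma le_repar_iff:
  "weights t ==> c \<le> repar t x v ts r \<longleftrightarrow> (\<exists>A\<in>family t v ts. c \<le> exit_mean t x v ts A r - (1 - t A) \<and>
     (\<forall>B\<in>family t v ts. A \<subseteq> B \<longrightarrow> c \<le> exit_mean t x v ts B r + (1 - t B)))"
  unfolding repar_def by (rule le_mix_iff[OF finite_family family_nonempty])

lemma inv_into_cong: "(\<And>r. r \<in> A ==> q r = q' r) ==> inv_into A q s = inv_into A q' s"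
  unfolding inv_into_def by (metis (no_types, lifting))

text \<open>Counting exits by a flow makes statements on flows available for the numbers of
  exits.\<close>

lemma flow_1: "flow t x N A (\<lambda>_ _. 1) s = real (exits A N)"
proof (induction N arbitrary: s)
  case (Vertex v ts)
  then show ?case
    by (cases "v \<in> A") (auto simp: branches_def exits_Vertex simp del: exits.simps, simp add: exits.simps)
qed simp

lemma branches_1: "v \<in> A ==> branches t x v ts A (\<lambda>_ _. 1) s = real (exits A (Vertex v ts))"
  using flow_1[of t x "Vertex v ts" A 0] unfolding branches_def by (simp add: flow_1 exits_Vertex del: exits.simps)

lemma flow_disjoint: "vertices N \<inter> A = {} ==> flow t x N A F s = F N s"
  by (cases N) auto

lemma repar_transfer:
  assumes w: "weights t" and w': "weights t'"
    and fam: "family t' v' ts' = h ` family t v ts"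
    and h: "\<And>A B. A \<in> family t v ts ==> B \<in> family t v ts ==> A \<subseteq> B ==> h A \<subseteq> h B"
      "\<And>A B. A \<in> family t v ts ==> B \<in> family t v ts ==> h A \<subseteq> h B ==> A \<subseteq> B \<or> h A = h B"
      "\<And>A. A \<in> family t v ts ==> h A = {} \<longleftrightarrow> A = {}"
    and br: "\<And>A. A \<in> family t v ts ==> A \<noteq> {} ==>
      branches t' x' v' ts' (h A) (\<lambda>_ s. s) r = branches t x v ts A (\<lambda>_ s. s) r"
      "\<And>A. A \<in> family t v ts ==> A \<noteq> {} ==> exits (h A) (Vertex v' ts') = exits A (Vertex v ts)"
    and t: "\<And>A. A \<in> family t v ts ==> t A \<le> t' (h A)"
      "\<And>A. A \<in> family t v ts ==> \<exists>B\<in>family t v ts. h B = h A \<and> t B = t' (h A)"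
  shows "repar t' x' v' ts' r = repar t x v ts r"
  unfolding repar_def fam
proof (rule mix_merge[OF finite_family family_nonempty[OF w] weightsD(3)[OF w] h(1,2) _ t])
  show "exit_mean t' x' v' ts' (h A) r = exit_mean t x v ts A r" if "A \<in> family t v ts" for A
    using h(3)[OF that] br[OF that] by (simp add: exit_mean_def del: exits.simps)
qed

lemma shift_inj: "v \<noteq> i ==> v' \<noteq> i ==> shift i l v = shift i l v' \<longleftrightarrow> v = v'"
  unfolding shift_def by (auto split: if_splits)

lemma shift_new: "v \<noteq> i ==> u < l ==> shift i l v \<noteq> i + u"
  unfolding shift_def by (auto split: if_splits)

lemma leaf_list_relabel[simp]: "leaf_list (relabel g U) = leaf_list U"
proof (induction U)
  case (Vertex v ts)
  then have "map (\<lambda>T. leaf_list (relabel g T)) ts = map leaf_list ts" by (auto intro!: map_cong)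
  then show ?case by (simp add: comp_def del: map_eq_conv)
qed simp

lemma vertices_graft:
  "vertices (graft N ts) = vertices N \<union> (\<Union>a\<in>set (leaf_list N). vertices (ts ! a))"
  by (induction N) auto

text \<open>The support condition on \<open>t'\<close> confines the brackets rooted at the copy of a
  vertex to the image of \<open>V\<close>, so they correspond to brackets of \<open>U\<close> with
  the same weights, and the grafted trees are not entered. The set \<open>V\<close> may exceed the
  vertices of \<open>U\<close> because the lemma is also applied to the branches of an inserted
  tree.\<close>

lemma flow_embed:
  assumes w: "weights t" "weights t'" and fits: "fits x U" and inj: "inj_on g V" and V: "vertices U \<subseteq> V"
    and t_new: "\<And>S. S \<subseteq> V ==> t' (g ` S) = t S"
    and x_new: "\<And>u. u \<in> vertices U ==> x' (g u) = x u"
    and disj: "\<And>a. a \<in> set (leaf_list U) ==> vertices (ts' ! a) \<inter> g ` V = {}"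
    and supp: "\<And>A u ns. \<lbrakk>Vertex u ns \<in> subs U; A \<subseteq> vertices (graft (relabel g (Vertex u ns)) ts'); 0 < t' A; g u \<in> A\<rbrakk>
      \<Longrightarrow> \<exists>B\<subseteq>V. A = g ` B"
    and S: "S \<subseteq> V" and s: "0 \<le> s" "s \<le> 1"
    and F: "\<And>M r. M \<in> subs U ==> F' (graft (relabel g M) ts') r = F M r"
  shows "flow t' x' (graft (relabel g U) ts') (g ` S) F' s = flow t x U S F s"
  using fits V x_new disj supp S s F
proof (induction U arbitrary: S s F F')
  case (Leaf a)
  then have "vertices (ts' ! a) \<inter> g ` S = {}" by fastforce
  then have "flow t' x' (ts' ! a) (g ` S) F' s = F' (ts' ! a) s" by (rule flow_disjoint)
  then show ?case using Leaf.prems(9)[of "Leaf a"] by simp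
next
  case (Vertex u ns)
  note fits = Vertex.prems(1) and VV = Vertex.prems(2) and x_new = Vertex.prems(3) and disj = Vertex.prems(4)
    and supp = Vertex.prems(5)
  let ?G = "\<lambda>N. graft (relabel g N) ts'"
  have G: "?G (Vertex u ns) = Vertex (g u) (map ?G ns)" by simp
  have uV: "u \<in> V" "u \<in> vertices (Vertex u ns)" using VV by auto
  have IH: "flow t' x' (?G (ns ! j)) (g ` S) F' s = flow t x (ns ! j) S F s"
    if j: "j < length ns" and S: "S \<subseteq> V" and s: "0 \<le> s" "s \<le> 1"
      and F: "\<And>M r. M \<in> subs (Vertex u ns) ==> F' (?G M) r = F M r" for j S F F' s
  proof (rule Vertex.IH[OF _ _ _ _ _ _ S s])
    show "ns ! j \<in> set ns" using j by simp
    then show "fits x (ns ! j)" by (rule fits_Vertex(1)[OF fits])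
    show vj: "vertices (ns ! j) \<subseteq> V" by (rule vertices_nth[OF j VV])
    show "x' (g u') = x u'" if "u' \<in> vertices (ns ! j)" for u'
      by (rule x_new) (use that vertices_nth[OF j order.refl] in blast)
    show "vertices (ts' ! a) \<inter> g ` V = {}" if "a \<in> set (leaf_list (ns ! j))" for a
      by (rule disj) (rule leaf_list_nth[OF j that])
    show "\<exists>B\<subseteq>V. A = g ` B" if "Vertex u' ns' \<in> subs (ns ! j)" "A \<subseteq> vertices (?G (Vertex u' ns'))" "0 < t' A" "g u' \<in> A"
      for A u' ns'
      by (rule supp[OF subs_trans[OF subs_nth[OF j] that(1)] that(2-4)])
    show "F' (?G M) r = F M r" if "M \<in> subs (ns ! j)" for M r
      by (rule F[OF subs_trans[OF subs_nth[OF j] that]])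
  qed
  have br: "branches t' x' (g u) (map ?G ns) (g ` S) F' r = branches t x u ns S F r"
    if "S \<subseteq> V" "0 \<le> r" "r \<le> 1" "\<And>M r. M \<in> subs (Vertex u ns) ==> F' (?G M) r = F M r" for S F F' r
  proof -
    have "flow t' x' (?G (ns ! j)) (g ` S) F' (x u j r) = flow t x (ns ! j) S F (x u j r)" if j: "j < length ns" for j
      by (rule IH[OF j \<open>S \<subseteq> V\<close>])
        (use that cactus_fun_mem[OF fits_Vertex(3)[OF fits, of "ns ! j"] j \<open>0 \<le> r\<close> \<open>r \<le> 1\<close>] \<open>\<And>M r. M \<in> subs (Vertex u ns) ==> F' (?G M) r = F M r\<close> in auto)
    then show ?thesis unfolding branches_def x_new[OF uV(2)] by (auto intro!: sum.cong)
  qed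
  have ex: "exits (g ` S) (Vertex (g u) (map ?G ns)) = exits S (Vertex u ns)"
    if S: "S \<subseteq> V" "u \<in> S" for S
  proof -
    have gu: "g u \<in> g ` S" using S by auto
    have "real (exits (g ` S) (Vertex (g u) (map ?G ns))) = real (exits S (Vertex u ns))"
      using br[OF S(1), of 0 "\<lambda>_ _. 1" "\<lambda>_ _. 1"]
        branches_1[of "g u" "g ` S" t' x' "map ?G ns" 0, OF gu] branches_1[OF S(2), of t x ns 0]
      by (simp del: exits.simps)
    then show ?thesis by linarith
  qed
  have vG: "vertices (?G (Vertex u ns)) \<inter> g ` V = g ` vertices (Vertex u ns)"
    using VV disj unfolding vertices_graft ptree.set_map leaf_list_relabel by blast
  have g_le: "g ` A \<subseteq> g ` B \<longleftrightarrow> A \<subseteq> B" if "A \<subseteq> V" "B \<subseteq> V" for A B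
    using inj that by (meson inj_on_image_subset_iff)
  have fam: "family t' (g u) (map ?G ns) = (`) g ` family t u ns"
  proof (intro set_eqI iffI)
    fix A assume A: "A \<in> family t' (g u) (map ?G ns)"
    show "A \<in> (`) g ` family t u ns"
    proof (cases "A = {}")
      case True
      then show ?thesis using empty_in_family[OF w(1), of u ns] by (auto intro!: image_eqI[of _ _ "{}"])
    next
      case False
      then have A': "A \<subseteq> vertices (?G (Vertex u ns))" "0 < t' A" "g u \<in> A" "exits A (Vertex (g u) (map ?G ns)) \<noteq> 0"
        using A unfolding family_def G by blast+
      obtain B where B: "B \<subseteq> V" "A = g ` B" using supp[OF subs_refl A'(1-3)] by blast
      have "g ` B \<subseteq> g ` vertices (Vertex u ns)" using vG A'(1) B by blast
      then have BV: "B \<subseteq> vertices (Vertex u ns)" using g_le[OF B(1) VV] by blast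
      have uB: "u \<in> B" using A'(3) B inj uV(1) by (auto simp: inj_on_image_mem_iff)
      have "B \<in> family t u ns"
        unfolding family_def using BV uB A' t_new[OF B(1)] ex[OF B(1) uB] B(2) by (auto simp del: exits.simps ptree.set)
      then show ?thesis using B by blast
    qed
  next
    fix A assume "A \<in> (`) g ` family t u ns"
    then obtain B where B: "A = g ` B" "B \<in> family t u ns" by blast
    show "A \<in> family t' (g u) (map ?G ns)"
    proof (cases "B = {}")
      case True
      then show ?thesis using B empty_in_family[OF w(2)] by simp
    next
      case False
      then have B': "B \<subseteq> vertices (Vertex u ns)" "0 < t B" "u \<in> B" "exits B (Vertex u ns) \<noteq> 0"
        using B(2) unfolding family_def by blast+
      have BU: "B \<subseteq> V" using B'(1) VV by blast
      have "A \<subseteq> vertices (Vertex (g u) (map ?G ns))" using vG B'(1) B(1) unfolding G by blast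
      then show ?thesis
        unfolding family_def using B(1) B'(2-4) t_new[OF BU] ex[OF BU B'(3)] by (auto simp del: exits.simps ptree.set)
    qed
  qed
  have rp: "repar t' x' (g u) (map ?G ns) r = repar t x u ns r" if r: "r \<in> {0..1}" for r
  proof (rule repar_transfer[OF w fam])
    fix A assume A: "A \<in> family t u ns"
    then have AU: "A \<subseteq> V" using VV unfolding family_def by blast
    show "A \<noteq> {} ==> branches t' x' (g u) (map ?G ns) (g ` A) (\<lambda>_ s. s) r = branches t x u ns A (\<lambda>_ s. s) r"
      by (rule br[OF AU]) (use r in auto)
    show "A \<noteq> {} ==> exits (g ` A) (Vertex (g u) (map ?G ns)) = exits A (Vertex u ns)"
      using ex[OF AU] A unfolding family_def by blast
    show "t A \<le> t' (g ` A)" using t_new[OF AU] by simp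
    show "\<exists>B\<in>family t u ns. g ` B = g ` A \<and> t B = t' (g ` A)"
      using t_new[OF AU] A by (intro bexI[OF _ A]) simp
    show "A \<subseteq> B \<or> g ` A = g ` B" if B: "B \<in> family t u ns" "g ` A \<subseteq> g ` B" for B
      using B(2) g_le[OF AU, of B] B(1) VV unfolding family_def by blast
  qed auto
  have un: "unrepar t' x' (g u) (map ?G ns) s = unrepar t x u ns s" by (rule inv_into_cong[OF rp])
  show ?case
  proof (cases "u \<in> S")
    case True
    have s: "0 \<le> unrepar t x u ns s" "unrepar t x u ns s \<le> 1"
      using ontoD[OF repar_onto[OF w(1) fits] Vertex.prems(7,8)] by auto
    show ?thesis unfolding G using br[OF Vertex.prems(6) s, of F' F] Vertex.prems(9) True by (simp add: un)
  next
    case False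
    then have "g u \<notin> g ` S" using inj Vertex.prems(6) uV(1) by (simp add: inj_on_image_mem_iff)
    then show ?thesis using False Vertex.prems(9)[of "Vertex u ns"] by simp
  qed
qed

section \<open>Vertex sets under insertion\<close>

definition arity_fits :: "nat \<Rightarrow> nat ptree \<Rightarrow> nat ptree \<Rightarrow> bool" where
  "arity_fits i U N \<longleftrightarrow> (\<forall>ts. Vertex i ts \<in> subs N \<longrightarrow> set (leaf_list U) = {..<length ts})"

lemma arity_fits_subs: "M \<in> subs N ==> arity_fits i U N ==> arity_fits i U M"
  unfolding arity_fits_def using subs_trans by blast

lemma vertices_tree_comp:
  "arity_fits i U N ==> vertices (tree_comp i N U) = subst_subtree i U (vertices N)"
proof (induction N)
  case (Vertex v ts)
  have IH: "vertices (tree_comp i T U) = subst_subtree i U (vertices T)" if "T \<in> set ts" for T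
    by (rule Vertex.IH[OF that], rule arity_fits_subs[OF _ Vertex.prems]) (use that in \<open>auto intro: bexI[of _ T]\<close>)
  show ?case
  proof (cases "v = i")
    case False
    then show ?thesis using IH by (auto simp: subst_subtree_def split: if_splits)
  next
    case True
    have "set (leaf_list U) = {..<length ts}" using Vertex.prems True by (auto simp: arity_fits_def)
    then have "vertices (tree_comp i (Vertex v ts) U) = (+) i ` vertices U \<union> (\<Union>a<length ts. vertices (tree_comp i (ts ! a) U))"
      using True by (auto simp: vertices_graft ptree.set_map)
    also have "(\<Union>a<length ts. vertices (tree_comp i (ts ! a) U)) = (\<Union>T\<in>set ts. subst_subtree i U (vertices T))"
      using IH by (auto simp: set_conv_nth)
    finally have eq: "vertices (tree_comp i (Vertex v ts) U)
      = (+) i ` vertices U \<union> (\<Union>T\<in>set ts. subst_subtree i U (vertices T))" .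
    have "x \<in> vertices (tree_comp i (Vertex v ts) U) \<longleftrightarrow> x \<in> subst_subtree i U (vertices (Vertex v ts))" for x
      unfolding eq using True by (cases "x \<in> (+) i ` vertices U") (auto simp: subst_subtree_def)
    then show ?thesis by blast
  qed
qed (simp add: subst_subtree_def)

lemma tree_comp_subs:
  "\<lbrakk>Vertex i ts \<in> subs T; fits x T\<rbrakk> \<Longrightarrow> tree_comp i (Vertex i ts) U \<in> subs (tree_comp i T U)"
proof (induction T)
  case (Vertex p ps)
  show ?case
  proof (cases "Vertex i ts = Vertex p ps")
    case False
    then obtain M where M: "M \<in> set ps" "Vertex i ts \<in> subs M" using Vertex.prems(1) by auto
    have "i \<in> vertices M" using vertices_subs[OF M(2)] by auto
    then have "p \<noteq> i" using fits_Vertex(2)[OF Vertex.prems(2) M(1)] by auto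
    then show ?thesis
      using Vertex.IH[OF M fits_Vertex(1)[OF Vertex.prems(2) M(1)]] M(1)
      by (auto simp del: tree_comp.simps simp: tree_comp.simps(2)[of _ p])
  qed (simp del: tree_comp.simps)
qed simp

locale tree_substitution =
  fixes i :: nat and T U :: "nat ptree"
  assumes arity: "arity_fits i U T" and vU: "vertices U = {..<card (vertices U)}"
begin

abbreviation "sub \<equiv> subst_subtree i U"
abbreviation "f \<equiv> shift i (card (vertices U))"

lemma new_less: "u \<in> vertices U ==> u < card (vertices U)"
  using vU by blast

lemma f_in_sub: "v \<noteq> i ==> f v \<in> sub S \<longleftrightarrow> v \<in> S"
proof -
  assume v: "v \<noteq> i"
  have "f v \<notin> (+) i ` vertices U"
    using new_less shift_new[OF v] by blast
  moreover have "f v \<in> f ` (S - {i}) \<longleftrightarrow> v \<in> S"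
  proof
    assume "f v \<in> f ` (S - {i})"
    then obtain v' where "v' \<in> S" "v' \<noteq> i" "f v = f v'" by blast
    then show "v \<in> S" using shift_inj[OF v] by metis
  qed (use v in blast)
  ultimately show ?thesis by (auto simp: subst_subtree_def)
qed

lemma new_in_sub: "u \<in> vertices U ==> i + u \<in> sub S \<longleftrightarrow> i \<in> S"
proof -
  assume u: "u \<in> vertices U"
  then have "u < card (vertices U)" using vU by blast
  then have "i + u \<notin> f ` (S - {i})" using shift_new[of _ i u] by force
  then show ?thesis using u by (auto simp: subst_subtree_def)
qed

lemma sub_mono: "A \<subseteq> B ==> sub A \<subseteq> sub B"
  by (auto simp: subst_subtree_def)

text \<open>The new vertices record whether \<open>i\<close> belongs to the set. For an inserted
  tree without vertices, sets that differ only by \<open>i\<close> have the same image, which is why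
  that case is treated separately.\<close>

lemma sub_le_iff:
  assumes "vertices U \<noteq> {}"
  shows "sub A \<subseteq> sub B \<longleftrightarrow> A \<subseteq> B"
proof
  assume le: "sub A \<subseteq> sub B"
  show "A \<subseteq> B"
  proof
    fix v assume v: "v \<in> A"
    show "v \<in> B"
    proof (cases "v = i")
      case True
      then show ?thesis using assms le v new_in_sub by blast
    next
      case False
      then show ?thesis using le v f_in_sub by blast
    qed
  qed
qed (rule sub_mono)

lemma sub_empty[simp]: "sub {} = {}"
  by (simp add: subst_subtree_def)

lemma sub_leD: "sub A \<subseteq> sub B ==> A - {i} \<subseteq> B"
  using f_in_sub by blast

lemma vertices_comp: "N \<in> subs T ==> vertices (tree_comp i N U) = sub (vertices N)"
  using vertices_tree_comp arity_fits_subs[OF _ arity] by blast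

lemma vertices_comp_new:
  assumes "N \<in> subs T" "i \<notin> vertices N"
  shows "vertices (tree_comp i N U) \<inter> (+) i ` vertices U = {}"
  using vertices_comp[OF assms(1)] new_in_sub assms(2) by auto

end

text \<open>Here \<open>t\<close> and \<open>x\<close> belong to \<open>T\<close>, \<open>tU\<close>
  and \<open>xU\<close> to the inserted tree, and the primed data to the composite tree. The vertex
  \<open>i\<close> carries the leaf functions of the flow through \<open>U\<close>, so associativity
  becomes an equality between the flow through \<open>T\<close> and the flow through the
  composite.\<close>

locale insertion = tree_substitution i T U for t x tU xU t' x' i T U +
  assumes w: "weights t" "weights tU" "weights t'"
    and fits: "fits x T" "fits xU U" "fits x' (tree_comp i T U)"
    and dU: "distinct (leaf_list U)"
    and x_old: "\<And>v. v \<in> vertices T ==> v \<noteq> i ==> x' (shift i (card (vertices U)) v) = x v"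
    and x_new: "\<And>u. u \<in> vertices U ==> x' (i + u) = xU u"
    and x_i: "x i = (\<lambda>a. flow tU xU U (vertices U) (leaf_value a))"

locale nonleaf_insertion = insertion +
  fixes w0 us
  assumes U: "U = Vertex w0 us"
    and t_sub: "\<And>S. S \<subseteq> vertices T ==> t' (sub S) = t S"
    and t_new: "\<And>S. S \<subseteq> vertices U ==> t' ((+) i ` S) = tU S"
    and t_supp: "\<And>S. 0 < t' S ==> (\<exists>S0\<subseteq>vertices T. S = sub S0) \<or> (\<exists>S0\<subseteq>vertices U. S = (+) i ` S0)"
    and t_U: "tU (vertices U) = 1"
begin

lemma U_ne: "vertices U \<noteq> {}" and w0: "w0 \<in> vertices U"
  using U by auto

text \<open>A bracket that comes from \<open>T\<close> and contains one vertex of \<open>U\<close>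
  contains all of them, in particular the root \<open>w0\<close>. It is never rooted strictly above
  \<open>w0\<close> inside \<open>U\<close>, so only the brackets of \<open>U\<close> itself act
  there.\<close>

lemma flow_inside:
  assumes "ts' = map (\<lambda>M. tree_comp i M U) ts" "Vertex i ts \<in> subs T"
    and N: "N \<in> subs U" "w0 \<notin> vertices N" and S: "S \<subseteq> vertices U" and s: "0 \<le> s" "s \<le> 1"
    and F: "\<And>M r. M \<in> subs N ==> F' (graft (relabel ((+) i) M) ts') r = F M r"
  shows "flow t' x' (graft (relabel ((+) i) N) ts') ((+) i ` S) F' s = flow tU xU N S F s"
proof (rule flow_embed[where U = N and V = "vertices U"])
  have disj: "vertices (ts' ! a) \<inter> (+) i ` vertices U = {}" if "a \<in> set (leaf_list N)" for a
  proof -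
    have "a \<in> set (leaf_list U)" using N(1) that by (induction U) auto
    then have a: "a < length ts" using arity assms(2) by (auto simp: arity_fits_def)
    have "ts ! a \<in> subs T" "i \<notin> vertices (ts ! a)"
      using subs_trans[OF assms(2) subs_nth[OF a]] fits_Vertex(2)[OF fits_subs[OF assms(2) fits(1)]] a by auto
    then show ?thesis using vertices_comp_new[of "ts ! a"] a assms(1) by simp
  qed
  then show "\<And>a. a \<in> set (leaf_list N) ==> vertices (ts' ! a) \<inter> (+) i ` vertices U = {}" .
  show "\<exists>B\<subseteq>vertices U. A = (+) i ` B"
    if A: "Vertex u ns \<in> subs N" "A \<subseteq> vertices (graft (relabel ((+) i) (Vertex u ns)) ts')" "0 < t' A" "i + u \<in> A" for A u ns
    using t_supp[OF A(3)]
  proof (elim disjE exE conjE)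
    fix S0 assume S0: "S0 \<subseteq> vertices T" "A = sub S0"
    have "u \<in> vertices U" using vertices_subs[OF A(1)] vertices_subs[OF N(1)] by auto
    then have "i \<in> S0" using A(4) S0 new_in_sub by blast
    then have "i + w0 \<in> A" using S0 new_in_sub w0 by blast
    moreover have "i + w0 \<notin> vertices (ts' ! a)" if "a \<in> set (leaf_list (Vertex u ns))" for a
    proof -
      have "a \<in> set (leaf_list N)" using A(1) that by (induction N) auto
      then show ?thesis using disj w0 by blast
    qed
    ultimately have "i + w0 \<in> (+) i ` vertices (Vertex u ns)"
      using A(2) unfolding vertices_graft ptree.set_map leaf_list_relabel by blast
    then show ?thesis using N(2) vertices_subs[OF A(1)] by auto
  qed auto
qed (use w N S s F t_new x_new fits_subs[OF N(1) fits(2)] vertices_subs[OF N(1)] in auto)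

lemma sum_list_concat: "sum_list (concat xss) = sum_list (map sum_list xss)"
  by (induction xss) auto

lemma exits_graft:
  "vertices N \<subseteq> A ==> exits A (graft N ts) = sum_list (map (\<lambda>a. exits A (ts ! a)) (leaf_list N))"
proof (induction N)
  case (Vertex v ns)
  have "map (\<lambda>M. exits A (graft M ts)) ns = map (\<lambda>M. sum_list (map (\<lambda>a. exits A (ts ! a)) (leaf_list M))) ns"
    using Vertex by (force intro!: map_cong)
  then show ?case using Vertex.prems by (simp add: comp_def map_concat sum_list_concat del: map_eq_conv)
qed simp

lemma exits_comp: "N \<in> subs T ==> exits (sub S) (tree_comp i N U) = exits S N"
proof (induction N)
  case (Vertex v ts)
  have IH: "exits (sub S) (tree_comp i M U) = exits S M" if "M \<in> set ts" for M
    by (rule Vertex.IH[OF that], rule subs_trans[OF Vertex.prems]) (use that in \<open>auto intro: bexI[of _ M]\<close>)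
  show ?case
  proof (cases "v = i")
    case False
    have "map (\<lambda>M. exits (sub S) (tree_comp i M U)) ts = map (exits S) ts"
      using IH by (intro map_cong) auto
    then show ?thesis using False f_in_sub[OF False] by (simp add: comp_def del: map_eq_conv)
  next
    case True
    show ?thesis
    proof (cases "i \<in> S")
      case False
      then have "i + w0 \<notin> sub S" using new_in_sub[OF w0] by simp
      then show ?thesis using True False by (simp add: U)
    next
      case iS: True
      have set: "set (leaf_list U) = {..<length ts}" using arity Vertex.prems True by (auto simp: arity_fits_def)
      have "vertices (relabel ((+) i) U) \<subseteq> sub S" using iS by (auto simp: ptree.set_map subst_subtree_def)
      then have "exits (sub S) (tree_comp i (Vertex v ts) U)
          = sum_list (map (\<lambda>a. exits (sub S) (map (\<lambda>M. tree_comp i M U) ts ! a)) (leaf_list U))"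
        using True by (simp add: exits_graft)
      also have "\<dots> = (\<Sum>a<length ts. exits (sub S) (map (\<lambda>M. tree_comp i M U) ts ! a))"
        using dU set by (simp add: sum_list_distinct_conv_sum_set)
      also have "\<dots> = (\<Sum>a<length ts. exits S (ts ! a))" using IH by (intro sum.cong) auto
      also have "\<dots> = exits S (Vertex v ts)" using exits_Vertex[of v S ts] iS True by simp
      finally show ?thesis .
    qed
  qed
qed simp

lemma family_sub:
  assumes N: "Vertex v ts \<in> subs T" and S: "S \<in> family t v ts" "S \<noteq> {}"
  shows "S \<subseteq> vertices T" "v \<in> S" "S \<subseteq> vertices (Vertex v ts)" "0 < t S" "exits S (Vertex v ts) \<noteq> 0"
  using S vertices_subs[OF N] unfolding family_def by blast+

lemma compatible_family_child:
  assumes "Vertex v ts \<in> subs T" "S \<in> family t v ts" "j < length ts"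
  shows "compatible t (ts ! j) S"
  using compatible_family[OF w(1) assms(2)] fits_Vertex(2)[OF fits_subs[OF assms(1) fits(1)]] assms(3) by simp

lemma supp_sub:
  assumes N: "Vertex v ts \<in> subs T" and S: "S \<subseteq> vertices (tree_comp i (Vertex v ts) U)" "0 < t' S"
    and v: "v \<noteq> i" "f v \<in> S"
  shows "\<exists>S0. S = sub S0 \<and> S0 \<subseteq> vertices (Vertex v ts) \<and> v \<in> S0"
  using t_supp[OF S(2)]
proof (elim disjE exE conjE)
  fix S0 assume S0: "S0 \<subseteq> vertices T" "S = sub S0"
  then have "sub S0 \<subseteq> sub (vertices (Vertex v ts))" using S(1) vertices_comp[OF N] by simp
  then have "S0 \<subseteq> vertices (Vertex v ts)" using sub_le_iff[OF U_ne] by blast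
  then show ?thesis using S0 v f_in_sub by blast
next
  fix S0 assume "S0 \<subseteq> vertices U" "S = (+) i ` S0"
  then have "f v \<in> (+) i ` vertices U" using v by blast
  then show ?thesis using shift_new[OF v(1)] new_less by blast
qed

text \<open>At the root of the inserted tree the brackets of that tree come first. They end with the
  whole inserted tree, which has weight \<open>1\<close> and so normalizes the parameter before the brackets
  of the outer tree are applied.\<close>

lemma flow_insertion:
  "\<lbrakk>N \<in> subs T; S \<subseteq> vertices T; compatible t N S; good F; 0 \<le> s; s \<le> 1;
    \<And>M r. M \<in> subs N ==> F' (tree_comp i M U) r = F M r\<rbrakk>
   \<Longrightarrow> flow t' x' (tree_comp i N U) (sub S) F' s = flow t x N S F s"
proof (induction N arbitrary: S s F F')
  case (Leaf a)
  then show ?case using Leaf.prems(7)[of "Leaf a"] by simp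
next
  case (Vertex v ts)
  let ?N = "Vertex v ts"
  let ?ts = "map (\<lambda>M. tree_comp i M U) ts"
  note N = Vertex.prems(1)
  have vT: "v \<in> vertices T" using vertices_subs[OF N] by auto
  note nf = fits_subs[OF N fits(1)]
  have IH: "flow t' x' (?ts ! j) (sub S) F' s = flow t x (ts ! j) S F s"
    if "j < length ts" "S \<subseteq> vertices T" "compatible t (ts ! j) S" "good F" "0 \<le> s" "s \<le> 1"
      "\<And>M r. M \<in> subs ?N ==> F' (tree_comp i M U) r = F M r" for j S F F' s
  proof -
    have "flow t' x' (tree_comp i (ts ! j) U) (sub S) F' s = flow t x (ts ! j) S F s"
    proof (rule Vertex.IH)
      show "ts ! j \<in> set ts" using that by simp
      show "ts ! j \<in> subs T" using subs_trans[OF N subs_nth[OF that(1)]] .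
      show "F' (tree_comp i M U) r = F M r" if "M \<in> subs (ts ! j)" for M r
        using \<open>\<And>M r. M \<in> subs ?N ==> F' (tree_comp i M U) r = F M r\<close> subs_trans[OF subs_nth[OF \<open>j < length ts\<close>] that] by blast
    qed (use that in auto)
    then show ?thesis using that(1) by simp
  qed
  have cc: "compatible t (ts ! j) S" if "j < length ts" for j
    using compatible_child[OF _ Vertex.prems(3)] that by simp
  show ?case
  proof (cases "v = i")
    case False
    have eq: "tree_comp i ?N U = Vertex (f v) ?ts" using False by simp
    have br: "branches t' x' (f v) ?ts (sub S) F' r = branches t x v ts S F r"
      if "S \<subseteq> vertices T" "\<And>j. j < length ts ==> compatible t (ts ! j) S" "good F" "0 \<le> r" "r \<le> 1"
        "\<And>M r. M \<in> subs ?N ==> F' (tree_comp i M U) r = F M r" for S F F' r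
    proof -
      have "flow t' x' (?ts ! j) (sub S) F' (x v j r) = flow t x (ts ! j) S F (x v j r)" if j: "j < length ts" for j
        by (rule IH[OF j \<open>S \<subseteq> vertices T\<close>])
          (use that \<open>\<And>j. j < length ts ==> compatible t (ts ! j) S\<close> \<open>good F\<close>
             cactus_fun_mem[OF fits_Vertex(3)[OF nf, of "ts ! j"] j \<open>0 \<le> r\<close> \<open>r \<le> 1\<close>]
             \<open>\<And>M r. M \<in> subs ?N ==> F' (tree_comp i M U) r = F M r\<close> in auto)
      then show ?thesis unfolding branches_def x_old[OF vT False] by (auto intro!: sum.cong)
    qed
    have ex: "exits (sub S) (Vertex (f v) ?ts) = exits S ?N" for S
      using exits_comp[OF N, of S] unfolding eq .
    \<comment> \<open>Away from \<open>i\<close> the brackets rooted at \<open>f v\<close> are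
      exactly the images of those rooted at \<open>v\<close>; no bracket inside \<open>U\<close>
      contains \<open>f v\<close>.\<close>
    have fam: "family t' (f v) ?ts = sub ` family t v ts"
    proof (intro set_eqI iffI)
      fix A assume A: "A \<in> family t' (f v) ?ts"
      show "A \<in> sub ` family t v ts"
      proof (cases "A = {}")
        case True
        then show ?thesis using empty_in_family[OF w(1), of v ts] by (intro image_eqI[of _ _ "{}"]) auto
      next
        case ne: False
        then have A': "A \<subseteq> vertices (Vertex (f v) ?ts)" "0 < t' A" "f v \<in> A" "exits A (Vertex (f v) ?ts) \<noteq> 0"
          using A unfolding family_def by blast+
        obtain S0 where S0: "A = sub S0" "S0 \<subseteq> vertices ?N" "v \<in> S0"
          using supp_sub[OF N _ A'(2) False A'(3)] A'(1) eq by auto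
        have "S0 \<in> family t v ts"
          unfolding family_def using S0 A' ex[of S0] t_sub[of S0] vertices_subs[OF N] by (auto simp del: exits.simps ptree.set)
        then show ?thesis using S0(1) by blast
      qed
    next
      fix A assume "A \<in> sub ` family t v ts"
      then obtain B where B: "A = sub B" "B \<in> family t v ts" by blast
      show "A \<in> family t' (f v) ?ts"
      proof (cases "B = {}")
        case True
        then show ?thesis using B empty_in_family[OF w(3)] by simp
      next
        case ne: False
        note B' = family_sub[OF N B(2) ne]
        have "A \<subseteq> vertices (Vertex (f v) ?ts)"
          using sub_mono[OF B'(3)] B(1) vertices_comp[OF N] unfolding eq by simp
        moreover have "f v \<in> A" using f_in_sub[OF False] B'(2) B(1) by blast
        ultimately show ?thesis
          unfolding family_def using B(1) B' t_sub[OF B'(1)] ex[of B] by (auto simp del: exits.simps ptree.set)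
      qed
    qed
    have rp: "repar t' x' (f v) ?ts r = repar t x v ts r" if r: "r \<in> {0..1}" for r
    proof (rule repar_transfer[OF w(1) w(3) fam])
      fix A assume A: "A \<in> family t v ts"
      then have AT: "A \<subseteq> vertices T" using vertices_subs[OF N] unfolding family_def by blast
      show "A \<noteq> {} ==> branches t' x' (f v) ?ts (sub A) (\<lambda>_ s. s) r = branches t x v ts A (\<lambda>_ s. s) r"
        by (rule br[OF AT]) (use r good_id compatible_family_child[OF N A] in auto)
      show "exits (sub A) (Vertex (f v) ?ts) = exits A ?N" by (rule ex)
      show "t A \<le> t' (sub A)" using t_sub[OF AT] by simp
      show "\<exists>B\<in>family t v ts. sub B = sub A \<and> t B = t' (sub A)"
        using t_sub[OF AT] A by (intro bexI[OF _ A]) simp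
      show "sub A = {} \<longleftrightarrow> A = {}" using sub_le_iff[OF U_ne, of A "{}"] by auto
      show "sub A \<subseteq> sub B ==> A \<subseteq> B \<or> sub A = sub B" for B using sub_le_iff[OF U_ne] by blast
    qed (rule sub_mono)
    have un: "unrepar t' x' (f v) ?ts s = unrepar t x v ts s" by (rule inv_into_cong[OF rp])
    show ?thesis
    proof (cases "v \<in> S")
      case True
      have s: "0 \<le> unrepar t x v ts s" "unrepar t x v ts s \<le> 1"
        using ontoD[OF repar_onto[OF w(1) nf] Vertex.prems(5,6)] by auto
      show ?thesis unfolding eq using br[OF Vertex.prems(2) cc Vertex.prems(4) s, of F'] Vertex.prems(7) True f_in_sub[OF False]
        by (simp add: un)
    next
      case vS: False
      then show ?thesis using f_in_sub[OF False] Vertex.prems(7)[of ?N] unfolding eq by simp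
    qed
  next
    case v: True
    note Ni = N[unfolded v]
    let ?us = "map (\<lambda>M. graft (relabel ((+) i) M) ?ts) us"
    let ?\<phi> = "repar tU xU w0 us"
    let ?V = "vertices U"
    have eq: "tree_comp i ?N U = Vertex (i + w0) ?us" using v by (simp add: U)
    have set: "set (leaf_list U) = {..<length ts}" using arity Ni by (auto simp: arity_fits_def)
    have w0': "w0 \<notin> vertices (us ! j)" if "j < length us" for j
      using fits_Vertex(2)[OF fits(2)[unfolded U]] that by simp
    have \<phi>_mem: "0 \<le> ?\<phi> r" "?\<phi> r \<le> 1" if "0 \<le> r" "r \<le> 1" for r
      using repar_mem[OF w(2) fits(2)[unfolded U]] that by auto
    have inside: "branches t' x' (i + w0) ?us ((+) i ` B) F' r = branches tU xU w0 us B F r"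
      if "B \<subseteq> ?V" "0 \<le> r" "r \<le> 1"
        "\<And>M r. F' (graft (relabel ((+) i) M) ?ts) r = F M r" for B F F' r
    proof -
      have "flow t' x' (graft (relabel ((+) i) (us ! j)) ?ts) ((+) i ` B) F' (xU w0 j r) = flow tU xU (us ! j) B F (xU w0 j r)"
        if j: "j < length us" for j
      proof (rule flow_inside[OF refl Ni])
        show "us ! j \<in> subs U" unfolding U by (rule subs_nth[OF j])
        show "0 \<le> xU w0 j r" "xU w0 j r \<le> 1"
          using cactus_fun_mem[OF fits_Vertex(3)[OF fits(2)[unfolded U], of "us ! j"] j] \<open>0 \<le> r\<close> \<open>r \<le> 1\<close> j by auto
      qed (use that w0'[OF j] \<open>B \<subseteq> ?V\<close> \<open>\<And>M r. F' (graft (relabel ((+) i) M) ?ts) r = F M r\<close> in auto)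
      then show ?thesis unfolding branches_def x_new[OF w0] by (auto intro!: sum.cong)
    qed
    have cact: "cactus_fun (length ts) (x i)" if "a < length ts" for a
      using fits_Vertex(3)[OF nf[unfolded v], of "ts ! a"] that by simp
    \<comment> \<open>The flow is interrupted at the leaves of \<open>U\<close>. By
      \<open>flow_repar\<close> the positions there are given by the functions at the vertex
      \<open>i\<close>, taken at the parameter that the brackets of \<open>U\<close> produce; then
      it goes on in the children of \<open>i\<close>.\<close>
    have br: "branches t' x' (i + w0) ?us (sub S) F' r = branches t x i ts S F (?\<phi> r)"
      if "S \<subseteq> vertices T" "i \<in> S" "\<And>j. j < length ts ==> compatible t (ts ! j) S" "good F" "0 \<le> r" "r \<le> 1"
        "\<And>M r. M \<in> subs ?N ==> F' (tree_comp i M U) r = F M r" for S F F' r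
    proof -
      have "(+) i ` ?V \<subseteq> sub S" using that(2) by (auto simp: subst_subtree_def)
      then have "branches t' x' (i + w0) ?us (sub S) F' r
          = branches t' x' (i + w0) ?us ((+) i ` ?V) (\<lambda>M. flow t' x' M (sub S) F') r"
        by (rule branches_flow)
      also have "\<dots> = branches tU xU w0 us ?V (\<lambda>M. flow t' x' (graft (relabel ((+) i) M) ?ts) (sub S) F') r"
        by (rule inside[OF order.refl that(5,6)]) (rule refl)
      also have "\<dots> = (\<Sum>a<length ts. flow t' x' (?ts ! a) (sub S) F' (branches tU xU w0 us ?V (leaf_value a) r))"
        using branches_leaves[of w0 us ?V tU xU "\<lambda>M. flow t' x' (graft (relabel ((+) i) M) ?ts) (sub S) F'" r] dU set
        unfolding U by (simp del: leaf_list.simps ptree.set map_map)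
      also have "\<dots> = (\<Sum>a<length ts. flow t x (ts ! a) S F (x i a (?\<phi> r)))"
      proof (rule sum.cong[OF refl])
        fix a assume "a \<in> {..<length ts}"
        then have a: "a < length ts" by simp
        have "branches tU xU w0 us ?V (leaf_value a) r = x i a (?\<phi> r)"
          using flow_repar[OF w(2) fits(2)[unfolded U] compatible_all[OF order.refl] _ good_leaf_value that(5,6)]
          unfolding x_i U by simp
        then show "flow t' x' (?ts ! a) (sub S) F' (branches tU xU w0 us ?V (leaf_value a) r) = flow t x (ts ! a) S F (x i a (?\<phi> r))"
          using IH[OF a that(1) that(3)[OF a] that(4), of "x i a (?\<phi> r)" F'] cactus_fun_mem[OF cact[OF a] a \<phi>_mem[OF that(5,6)]] that(7)
          by simp
      qed
      finally show ?thesis by (simp add: branches_def)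
    qed
    have ex: "exits (sub S) (Vertex (i + w0) ?us) = exits S ?N" for S
      using exits_comp[OF N, of S] unfolding eq .
    show ?thesis
    proof (cases "i \<in> S")
      case False
      then show ?thesis using new_in_sub[OF w0] Vertex.prems(7)[of ?N] v unfolding eq by simp
    next
      case iS: True
      let ?u = "unrepar t' x' (i + w0) ?us s"
      have fit': "fits x' (Vertex (i + w0) ?us)"
      proof -
        have "Vertex (i + w0) ?us \<in> subs (tree_comp i T U)"
          using tree_comp_subs[OF Ni fits(1), of U] unfolding eq[unfolded v] .
        then show ?thesis by (rule fits_subs[OF _ fits(3)])
      qed
      have u: "0 \<le> ?u" "?u \<le> 1" "repar t' x' (i + w0) ?us ?u = s"
        using ontoD[OF repar_onto[OF w(3) fit'] Vertex.prems(5,6)] by auto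
      have L: "flow t' x' (tree_comp i ?N U) (sub S) F' s = branches t x i ts S F (?\<phi> ?u)"
        unfolding eq using br[OF Vertex.prems(2) iS cc Vertex.prems(4) u(1,2), of F'] Vertex.prems(7) new_in_sub[OF w0] iS by simp
      show ?thesis
      proof (cases "length ts = 0")
        case True
        then show ?thesis using L iS v by (simp add: branches_def)
      next
        case ne: False
        have leaves: "leaf_list (Vertex w0 us) \<noteq> []"
          using set ne unfolding U by (metis empty_set lessThan_empty_iff)
        have VU: "(+) i ` ?V = sub {i}" by (auto simp: subst_subtree_def)
        have iT: "{i} \<subseteq> vertices T" using vT v by simp
        have ti: "t {i} = 1" using t_sub[OF iT] t_new[OF order.refl] t_U VU by simp
        have i_fam: "{i} \<in> family t i ts"
        proof -
          have "exits {i} (Vertex i ts) \<noteq> 0"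
          proof -
            have 0: "ts ! 0 \<in> set ts" using ne by simp
            have "exits {i} (ts ! 0) = 1"
              using fits_Vertex(2)[OF nf[unfolded v] 0] by (cases "ts ! 0") auto
            then show ?thesis using 0 by (auto intro!: bexI[of _ "ts ! 0"])
          qed
          then show ?thesis using ti unfolding family_def by (simp del: exits.simps)
        qed
        \<comment> \<open>A cactus is parametrized by its own arc length, so the bracket
          \<open>{i}\<close> induces the same parameter as \<open>{}\<close>.\<close>
        have mean_i: "exit_mean t x i ts {i} y = y" if y: "0 \<le> y" "y \<le> 1" for y
        proof -
          have d: "vertices (ts ! j) \<inter> {i} = {}" if "j < length ts" for j
            using fits_Vertex(2)[OF nf[unfolded v], of "ts ! j"] that by simp
          have "exits {i} (ts ! j) = 1" if "j < length ts" for j using d[OF that] by (cases "ts ! j") auto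
          then have "exits {i} (Vertex i ts) = length ts" using exits_Vertex[of i "{i}" ts] by simp
          moreover have "branches t x i ts {i} (\<lambda>_ s. s) y = length ts * y"
            unfolding branches_def using d cact[of 0] ne y by (simp add: flow_disjoint cactus_fun_def)
          ultimately show ?thesis using ne by (simp add: exit_mean_def del: exits.simps)
        qed
        have \<phi>V: "exit_mean t' x' (i + w0) ?us (sub {i}) r = ?\<phi> r" if r: "0 \<le> r" "r \<le> 1" for r
        proof -
          have "sub {i} \<noteq> {}" using U_ne VU by auto
          then have "exit_mean t' x' (i + w0) ?us (sub {i}) r = exit_mean t x i ts {i} (?\<phi> r)"
            using br[OF iT _ compatible_family_child[OF Ni i_fam] good_id r, of "\<lambda>_ s. s"] ex[of "{i}"] v
            by (simp add: exit_mean_def del: exits.simps)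
          then show ?thesis using mean_i[OF \<phi>_mem[OF r]] by simp
        qed
        let ?K = "family t i ts" and ?K' = "family t' (i + w0) ?us"
        have mean: "exit_mean t' x' (i + w0) ?us (sub A) r = exit_mean t x i ts A (?\<phi> r)"
          if A: "A \<in> ?K" "A \<noteq> {}" and r: "0 \<le> r" "r \<le> 1" for A r
        proof -
          note A' = family_sub[OF Ni A]
          have "sub A \<noteq> {}" using sub_le_iff[OF U_ne, of A "{}"] A(2) by auto
          then show ?thesis
            using br[OF A'(1,2) compatible_family_child[OF Ni A(1)] good_id r, of "\<lambda>_ s. s"] ex[of A] A(2) v
            by (simp add: exit_mean_def del: exits.simps)
        qed
        have K'_I: "sub A \<in> ?K'" if A: "A \<in> ?K" "A \<noteq> {}" for A
        proof -
          note A' = family_sub[OF Ni A]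
          have "sub A \<subseteq> vertices (Vertex (i + w0) ?us)"
            using sub_mono[OF A'(3)] vertices_comp[OF N] v unfolding eq by simp
          then show ?thesis
            unfolding family_def using A' t_sub[OF A'(1)] ex[of A] v new_in_sub[OF w0] by (auto simp del: exits.simps ptree.set)
        qed
        have K'_E: "A \<subseteq> sub {i} \<or> (\<exists>B\<in>?K. B \<noteq> {} \<and> A = sub B)" if A: "A \<in> ?K'" for A
        proof (cases "A = {}")
          case False
          then have A': "A \<subseteq> vertices (tree_comp i ?N U)" "0 < t' A" "i + w0 \<in> A" "exits A (Vertex (i + w0) ?us) \<noteq> 0"
            using A unfolding family_def eq by blast+
          from t_supp[OF A'(2)] show ?thesis
          proof (elim disjE exE conjE)
            fix S0 assume S0: "S0 \<subseteq> vertices T" "A = sub S0"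
            then have "S0 \<subseteq> vertices (Vertex i ts)"
              using A'(1) vertices_comp[OF N] sub_le_iff[OF U_ne] v by simp
            moreover have "i \<in> S0" using A'(3) S0 new_in_sub[OF w0] by blast
            ultimately have "S0 \<in> ?K"
              unfolding family_def using S0 A' ex[of S0] t_sub[OF S0(1)] v by (auto simp del: exits.simps ptree.set)
            then show ?thesis using \<open>i \<in> S0\<close> S0(2) by blast
          qed (use VU in auto)
        qed simp
        have t'V: "t' (sub {i}) = 1" using ti t_sub[OF iT] by simp
        have Vin: "sub {i} \<in> ?K'" using K'_I[OF i_fam] by simp
        have mean0: "exit_mean t x i ts {} y = y" for y by (simp add: exit_mean_def)
        have t0: "t {} = 1" using weightsD(1)[OF w(1)] .
        \<comment> \<open>The chain at \<open>i + w0\<close> consists of brackets inside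
          \<open>U\<close>, ending with \<open>U\<close> at weight 1, and then of images of brackets
          rooted at \<open>i\<close>. Its first section produces \<open>?\<phi> r\<close>, the
          starting parameter at \<open>i\<close>.\<close>
        have rp: "repar t' x' (i + w0) ?us r = repar t x i ts (?\<phi> r)" if r: "0 \<le> r" "r \<le> 1" for r
        proof -
          have "c \<le> repar t' x' (i + w0) ?us r \<longleftrightarrow> c \<le> repar t x i ts (?\<phi> r)" for c
          proof
            assume "c \<le> repar t' x' (i + w0) ?us r"
            then obtain A where A: "A \<in> ?K'" "c \<le> exit_mean t' x' (i + w0) ?us A r - (1 - t' A)"
                "\<And>B. B \<in> ?K' ==> A \<subseteq> B ==> c \<le> exit_mean t' x' (i + w0) ?us B r + (1 - t' B)"
              unfolding le_repar_iff[OF w(3)] by blast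
            have up: "c \<le> exit_mean t x i ts B (?\<phi> r) + (1 - t B)" if "B \<in> ?K" "B \<noteq> {}" "A \<subseteq> sub B" for B
              using A(3)[OF K'_I[OF that(1,2)] that(3)] mean[OF that(1,2) r] t_sub[OF family_sub(1)[OF Ni that(1,2)]] by simp
            show "c \<le> repar t x i ts (?\<phi> r)"
              unfolding le_repar_iff[OF w(1)]
            proof (cases "A \<subseteq> sub {i}")
              case True
              have c: "c \<le> ?\<phi> r" using A(3)[OF Vin True] \<phi>V[OF r] t'V by simp
              show "\<exists>A\<in>?K. c \<le> exit_mean t x i ts A (?\<phi> r) - (1 - t A) \<and>
                 (\<forall>B\<in>?K. A \<subseteq> B \<longrightarrow> c \<le> exit_mean t x i ts B (?\<phi> r) + (1 - t B))"
              proof (intro bexI[of _ "{}"] conjI ballI impI)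
                show "c \<le> exit_mean t x i ts {} (?\<phi> r) - (1 - t {})" using c mean0 t0 by simp
                fix B assume B: "B \<in> ?K"
                show "c \<le> exit_mean t x i ts B (?\<phi> r) + (1 - t B)"
                proof (cases "B = {}")
                  case True
                  then show ?thesis using c mean0 t0 by simp
                next
                  case False
                  then have "{i} \<subseteq> B" using family_sub(2)[OF Ni B] by simp
                  then have "A \<subseteq> sub B" using \<open>A \<subseteq> sub {i}\<close> sub_mono by blast
                  then show ?thesis by (rule up[OF B False])
                qed
              qed (use empty_in_family[OF w(1)] in simp)
            next
              case False
              then obtain B where B: "B \<in> ?K" "B \<noteq> {}" "A = sub B" using K'_E[OF A(1)] by blast
              show "\<exists>A\<in>?K. c \<le> exit_mean t x i ts A (?\<phi> r) - (1 - t A) \<and>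
                 (\<forall>B\<in>?K. A \<subseteq> B \<longrightarrow> c \<le> exit_mean t x i ts B (?\<phi> r) + (1 - t B))"
              proof (intro bexI[OF _ B(1)] conjI ballI impI)
                show "c \<le> exit_mean t x i ts B (?\<phi> r) - (1 - t B)"
                  using A(2) mean[OF B(1,2) r] t_sub[OF family_sub(1)[OF Ni B(1,2)]] B(3) by simp
                fix C assume C: "C \<in> ?K" "B \<subseteq> C"
                show "c \<le> exit_mean t x i ts C (?\<phi> r) + (1 - t C)"
                  by (rule up[OF C(1)]) (use C B sub_mono in auto)
              qed
            qed
          next
            assume "c \<le> repar t x i ts (?\<phi> r)"
            then obtain A where A: "A \<in> ?K" "c \<le> exit_mean t x i ts A (?\<phi> r) - (1 - t A)"
                "\<And>B. B \<in> ?K ==> A \<subseteq> B ==> c \<le> exit_mean t x i ts B (?\<phi> r) + (1 - t B)"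
              unfolding le_repar_iff[OF w(1)] by blast
            \<comment> \<open>In the composite tree \<open>{}\<close> stands for the parameter
              before the brackets of \<open>U\<close> act. The starting value at \<open>i\<close> is
              therefore attributed to \<open>{i}\<close>, which has the same centre and
              weight.\<close>
            define A1 where "A1 = (if A = {} then {i} else A)"
            have A1: "A1 \<in> ?K" "A1 \<noteq> {}" "A \<subseteq> A1" "i \<in> A1"
              using A(1) i_fam family_sub(2)[OF Ni A(1)] by (auto simp: A1_def)
            have m1: "exit_mean t' x' (i + w0) ?us (sub B) r + (1 - t' (sub B)) = exit_mean t x i ts B (?\<phi> r) + (1 - t B)"
              "exit_mean t' x' (i + w0) ?us (sub B) r - (1 - t' (sub B)) = exit_mean t x i ts B (?\<phi> r) - (1 - t B)"
              if "B \<in> ?K" "B \<noteq> {}" for B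
              using mean[OF that r] t_sub[OF family_sub(1)[OF Ni that]] by auto
            show "c \<le> repar t' x' (i + w0) ?us r"
              unfolding le_repar_iff[OF w(3)]
            proof (intro bexI[OF _ K'_I[OF A1(1,2)]] conjI ballI impI)
              show "c \<le> exit_mean t' x' (i + w0) ?us (sub A1) r - (1 - t' (sub A1))"
                unfolding m1(2)[OF A1(1,2)] using A(2) mean0 t0 ti mean_i[OF \<phi>_mem[OF r]] by (auto simp: A1_def)
              fix C assume C: "C \<in> ?K'" "sub A1 \<subseteq> C"
              from K'_E[OF C(1)] show "c \<le> exit_mean t' x' (i + w0) ?us C r + (1 - t' C)"
              proof (elim disjE bexE conjE)
                assume "C \<subseteq> sub {i}"
                then have "sub A1 \<subseteq> sub {i}" using C(2) by simp
                then have "A1 \<subseteq> {i}" by (rule sub_le_iff[OF U_ne, THEN iffD1])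
                then have e1: "A1 = {i}" using A1(4) by blast
                have e: "C = sub A1"
                  using \<open>C \<subseteq> sub {i}\<close> C(2) unfolding e1 by (rule equalityI)
                show ?thesis unfolding e m1(1)[OF A1(1,2)] by (rule A(3)[OF A1(1,3)])
              next
                fix B assume B: "B \<in> ?K" "B \<noteq> {}" "C = sub B"
                have "A1 \<subseteq> B" by (rule sub_le_iff[OF U_ne, THEN iffD1, OF C(2)[unfolded B(3)]])
                then show ?thesis unfolding B(3) m1(1)[OF B(1,2)] using A(3)[OF B(1)] A1(3) by blast
              qed
            qed
          qed
          then show ?thesis by (meson order.refl order_antisym)
        qed
        have "flow t x (Vertex i ts) S F (repar t x i ts (?\<phi> ?u)) = branches t x i ts S F (?\<phi> ?u)"
          by (rule flow_repar[OF w(1) nf[unfolded v] Vertex.prems(3)[unfolded v] iS Vertex.prems(4) \<phi>_mem[OF u(1,2)]])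
        moreover have "repar t x i ts (?\<phi> ?u) = s" using rp[OF u(1,2)] u(3) by simp
        ultimately show ?thesis using L unfolding v by (simp del: flow_Vertex tree_comp.simps)
      qed
    qed
  qed
qed

end

section \<open>Insertion of the tree without vertices\<close>

primrec rooted :: "'v ptree \<Rightarrow> 'v set \<Rightarrow> bool" where
  "rooted (Leaf a) S = True"
| "rooted (Vertex v ts) S = (if v \<in> S then list_all (\<lambda>M. rooted M S) ts else S \<inter> vertices (Vertex v ts) = {})"

lemma exits_disjoint: "vertices N \<inter> A = {} ==> exits A N = 1"
  by (cases N) auto

lemma tree_size_child: "M \<in> set ts ==> tree_size M < tree_size (Vertex v ts)"
  using member_le_sum_list[of "tree_size M" "map tree_size ts"] by simp

text \<open>A unary vertex \<open>i\<close> is deleted. The last two assumptions express that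
  brackets are connected: a bracket enters the tree above one of its vertices only through the root
  of a child, and a bracket that contains a vertex without being confined to the tree above it
  contains the parent. This matters because the deletion brings together what lies below and above
  \<open>i\<close>.\<close>

locale leaf_insertion = insertion +
  assumes U: "U = Leaf 0" and iT: "i \<in> vertices T"
    and t_merge: "\<And>S. S \<subseteq> vertices T - {i} ==> t' (sub S) = max (t S) (t (insert i S))"
    and t_supp: "\<And>S. 0 < t' S ==> \<exists>S0\<subseteq>vertices T - {i}. S = sub S0"
    and conn_down: "\<And>S v ts M. \<lbrakk>0 < t S; Vertex v ts \<in> subs T; v \<in> S; M \<in> set ts\<rbrakk> \<Longrightarrow> rooted M S"
    and conn_up: "\<And>S p ps v ts. \<lbrakk>0 < t S; Vertex p ps \<in> subs T; Vertex v ts \<in> set ps; v \<in> S;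
      \<not> S \<subseteq> vertices (Vertex v ts)\<rbrakk> \<Longrightarrow> p \<in> S"
begin

lemma sub_eq: "sub S = f ` (S - {i})"
  by (simp add: subst_subtree_def U)

lemma sub_minus: "sub (S - {i}) = sub S"
  by (simp add: sub_eq)

lemma unary: "Vertex i ts \<in> subs T ==> \<exists>N. ts = [N]"
proof -
  assume "Vertex i ts \<in> subs T"
  then have "{..<length ts} = {0}" using arity by (auto simp: arity_fits_def U)
  then have "card {..<length ts} = 1" by simp
  then show ?thesis by (auto simp: length_Suc_conv)
qed

lemma x_unit: "x i 0 r = r"
  by (simp add: x_i U)

lemma t_le: "A \<subseteq> vertices T ==> t A \<le> t' (sub A)"
  using t_merge[of "A - {i}"] sub_minus[of A] by (cases "i \<in> A") (force simp: insert_absorb)+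

lemma exits_comp_leaf: "\<lbrakk>N \<in> subs T; rooted N S\<rbrakk> \<Longrightarrow> exits (sub S) (tree_comp i N U) = exits S N"
proof (induction N)
  case (Vertex v ts)
  have sT: "M \<in> subs T" if "M \<in> set ts" for M
    by (rule subs_trans[OF Vertex.prems(1)]) (use that in \<open>auto intro: bexI[of _ M]\<close>)
  have IH: "exits (sub S) (tree_comp i M U) = exits S M" if "M \<in> set ts" "v \<in> S" for M
    by (rule Vertex.IH[OF that(1) sT[OF that(1)]]) (use that Vertex.prems(2) in \<open>auto simp: list_all_iff\<close>)
  show ?case
  proof (cases "v = i")
    case False
    have "map (\<lambda>M. exits (sub S) (tree_comp i M U)) ts = map (exits S) ts" if "v \<in> S"
      using IH that by (intro map_cong) auto
    then show ?thesis using False f_in_sub[OF False] by (auto simp: comp_def simp del: map_eq_conv)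
  next
    case True
    obtain N where N: "ts = [N]" using unary Vertex.prems(1) True by blast
    have eq: "tree_comp i (Vertex v ts) U = tree_comp i N U" using True N by (simp add: U)
    show ?thesis
    proof (cases "i \<in> S")
      case iS: True
      then show ?thesis using IH[of N] True N unfolding eq by simp
    next
      case False
      then have "S \<inter> vertices N = {}" using Vertex.prems(2) True N by auto
      then have "vertices (tree_comp i N U) \<inter> sub S = {}"
        unfolding vertices_comp[OF sT[of N, unfolded N, simplified]] using f_in_sub by (auto simp: sub_eq)
      then show ?thesis using exits_disjoint True False unfolding eq by simp
    qed
  qed
qed simp

text \<open>If \<open>N\<close> is the child of \<open>i\<close>, brackets rooted at
  \<open>i\<close> turn into brackets rooted at the root of \<open>N\<close>, and the family there
  grows. This is excluded here: unless \<open>i\<close> lies in \<open>N\<close>, no bracket of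
  positive weight consists of \<open>i\<close> and vertices of \<open>N\<close> that include its
  root.\<close>

definition detached :: "nat ptree \<Rightarrow> bool" where
  "detached N \<longleftrightarrow> (\<forall>v ts. N = Vertex v ts \<longrightarrow> i \<in> vertices N \<or>
     (\<forall>B\<subseteq>vertices N. v \<in> B \<longrightarrow> \<not> 0 < t (insert i B)))"

context
  fixes v ts
  assumes N: "Vertex v ts \<in> subs T" and v: "v \<noteq> i"
begin

lemma rooted_at: "0 < t A ==> v \<in> A ==> rooted (Vertex v ts) A"
  using conn_down[OF _ N] by (auto simp: list_all_iff)

lemma comp_eq: "tree_comp i (Vertex v ts) U = Vertex (f v) (map (\<lambda>M. tree_comp i M U) ts)"
  using v by simp

lemma family_memD:
  assumes "A \<in> family t v ts" "A \<noteq> {}"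
  shows "A \<subseteq> vertices T" "v \<in> A" "A \<subseteq> vertices (Vertex v ts)" "0 < t A" "exits A (Vertex v ts) \<noteq> 0"
  using assms vertices_subs[OF N] unfolding family_def by blast+

lemma exits_comp_at: "0 < t A ==> v \<in> A ==>
    exits (sub A) (Vertex (f v) (map (\<lambda>M. tree_comp i M U) ts)) = exits A (Vertex v ts)"
  using exits_comp_leaf[OF N rooted_at] unfolding comp_eq by blast

lemma sub_family:
  assumes "A \<in> family t v ts"
  shows "sub A \<in> family t' (f v) (map (\<lambda>M. tree_comp i M U) ts)"
proof (cases "A = {}")
  case True
  then show ?thesis using empty_in_family[OF w(3)] by simp
next
  case False
  note A = family_memD[OF assms False]
  have "sub A \<subseteq> vertices (Vertex (f v) (map (\<lambda>M. tree_comp i M U) ts))"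
    using sub_mono[OF A(3)] vertices_comp[OF N] unfolding comp_eq by simp
  moreover have "0 < t' (sub A)" using t_le[OF A(1)] A(4) by linarith
  ultimately show ?thesis
    unfolding family_def using A(2,5) exits_comp_at[OF A(4,2)] f_in_sub[OF v] by (auto simp del: exits.simps ptree.set)
qed

text \<open>The bracket of larger weight among the two that become equal when the vertex \<open>i\<close> disappears.\<close>

lemma family_preimage:
  assumes "C \<in> family t' (f v) (map (\<lambda>M. tree_comp i M U) ts)" "C \<noteq> {}"
  shows "\<exists>B. sub B = C \<and> t B = t' C \<and> 0 < t B \<and> v \<in> B \<and> B \<subseteq> vertices T \<and> B - {i} \<subseteq> vertices (Vertex v ts) \<and>
     exits B (Vertex v ts) \<noteq> 0"
proof -
  have C: "C \<subseteq> vertices (Vertex (f v) (map (\<lambda>M. tree_comp i M U) ts))" "0 < t' C" "f v \<in> C"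
    "exits C (Vertex (f v) (map (\<lambda>M. tree_comp i M U) ts)) \<noteq> 0"
    using assms unfolding family_def by blast+
  obtain S0 where S0: "S0 \<subseteq> vertices T - {i}" "C = sub S0" using t_supp[OF C(2)] by blast
  have "sub S0 \<subseteq> sub (vertices (Vertex v ts))" using C(1) vertices_comp[OF N] S0 unfolding comp_eq by simp
  then have le: "S0 \<subseteq> vertices (Vertex v ts)" using sub_leD S0(1) by blast
  have vS: "v \<in> S0" using C(3) S0(2) f_in_sub[OF v] by blast
  have sub_i: "sub (insert i S0) = sub S0" using S0(1) by (auto simp: sub_eq)
  define B where "B = (if t (insert i S0) \<le> t S0 then S0 else insert i S0)"
  have B: "sub B = C" "t B = t' C" "v \<in> B" "B - {i} \<subseteq> vertices (Vertex v ts)"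
    using t_merge[OF S0(1)] S0 sub_i vS le by (auto simp: B_def)
  have tB: "0 < t B" using B(2) C(2) by simp
  have "B \<subseteq> vertices T" using iT tB S0(1) by (auto simp: B_def split: if_splits)
  moreover have "exits B (Vertex v ts) \<noteq> 0" using exits_comp_at[OF tB B(3)] C(4) B(1) by simp
  ultimately show ?thesis using B tB by blast
qed

lemma exit_mean_comp:
  assumes A: "0 < t A" "v \<in> A"
    and br: "branches t' x' (f v) (map (\<lambda>M. tree_comp i M U) ts) (sub A) (\<lambda>_ s. s) r = branches t x v ts A (\<lambda>_ s. s) r"
  shows "exit_mean t' x' (f v) (map (\<lambda>M. tree_comp i M U) ts) (sub A) r = exit_mean t x v ts A r"
proof -
  have "A \<noteq> {}" "sub A \<noteq> {}" using A(2) f_in_sub[OF v, of A] by auto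
  then show ?thesis using br exits_comp_at[OF A] by (simp add: exit_mean_def del: exits.simps)
qed

end

text \<open>Brackets of positive weight with a common vertex are comparable; if the inclusion goes
  the wrong way, the images coincide.\<close>

lemma nested_sub:
  assumes "0 < t A" "0 < t B" "a \<in> A" "a \<in> B" "sub A \<subseteq> sub B"
  shows "A \<subseteq> B \<or> sub A = sub B"
proof -
  have "A \<subseteq> B \<or> B \<subseteq> A" using weightsD(4)[OF w(1) assms(1,2)] assms(3,4) by blast
  then show ?thesis using sub_mono[of B A] assms(5) by blast
qed

text \<open>Of two brackets that become equal, \<open>detached\<close> ensures that the one of
  larger weight lies in the tree at \<open>v\<close>. So every set of the new family carries the
  weight of one of its preimages, and the clamps merge.\<close>

lemma repar_leaf_comp:
  assumes N: "Vertex v ts \<in> subs T" and v: "v \<noteq> i" and det: "detached (Vertex v ts)"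
    and br: "\<And>A. A \<in> family t v ts ==> A \<noteq> {} ==>
      branches t' x' (f v) (map (\<lambda>M. tree_comp i M U) ts) (sub A) (\<lambda>_ s. s) r = branches t x v ts A (\<lambda>_ s. s) r"
  shows "repar t' x' (f v) (map (\<lambda>M. tree_comp i M U) ts) r = repar t x v ts r"
proof -
  let ?ts = "map (\<lambda>M. tree_comp i M U) ts"
  have pre: "\<exists>B\<in>family t v ts. sub B = C \<and> t B = t' C" if C: "C \<in> family t' (f v) ?ts" for C
  proof (cases "C = {}")
    case True
    then show ?thesis using empty_in_family[OF w(1)] weightsD(1)[OF w(1)] weightsD(1)[OF w(3)]
      by (intro bexI[of _ "{}"]) auto
  next
    case False
    obtain B where B: "sub B = C" "t B = t' C" "0 < t B" "v \<in> B" "B \<subseteq> vertices T" "B - {i} \<subseteq> vertices (Vertex v ts)"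
        "exits B (Vertex v ts) \<noteq> 0"
      using family_preimage[OF N v C False] by blast
    have "B \<subseteq> vertices (Vertex v ts)"
    proof (cases "i \<in> B")
      case True
      then have "insert i (B - {i}) = B" by blast
      then have "i \<in> vertices (Vertex v ts)"
        using det B(3,4,6) v unfolding detached_def by (metis Diff_iff singletonD)
      then show ?thesis using B(6) by blast
    qed (use B(6) in auto)
    then show ?thesis using B unfolding family_def by (intro bexI[of _ B]) (auto simp del: exits.simps)
  qed
  have fam: "family t' (f v) ?ts = sub ` family t v ts"
    using pre sub_family[OF N v] by blast
  show ?thesis
  proof (rule repar_transfer[OF w(1) w(3) fam])
    fix A assume A: "A \<in> family t v ts"
    show "A \<noteq> {} ==> branches t' x' (f v) ?ts (sub A) (\<lambda>_ s. s) r = branches t x v ts A (\<lambda>_ s. s) r"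
      by (rule br[OF A])
    show "A \<noteq> {} ==> exits (sub A) (Vertex (f v) ?ts) = exits A (Vertex v ts)"
      using exits_comp_at[OF N v] family_memD[OF N v A] by blast
    show "sub A = {} \<longleftrightarrow> A = {}"
      using family_memD(2)[OF N v A] f_in_sub[OF v, of A] by auto
    show "t A \<le> t' (sub A)"
      using t_le[of A] family_memD(1)[OF N v A] weightsD(1)[OF w(3)] weightsD(3)[OF w(1), of A] by (cases "A = {}") auto
    show "\<exists>B\<in>family t v ts. sub B = sub A \<and> t B = t' (sub A)"
      by (rule pre[OF sub_family[OF N v A]])
    show "A \<subseteq> B \<or> sub A = sub B" if B: "B \<in> family t v ts" "sub A \<subseteq> sub B" for B
    proof (cases "A = {}")
      case False
      then have vA: "v \<in> A" using family_memD(2)[OF N v A] by blast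
      then have vB: "v \<in> B" using B(2) f_in_sub[OF v] by blast
      then show ?thesis using nested_sub[OF _ _ vA vB B(2)] family_memD(4)[OF N v A False] family_memD(4)[OF N v B(1)] by blast
    qed simp
  qed (rule sub_mono)
qed

text \<open>A unary vertex carrying the unit cactus disappears; the brackets rooted at it become brackets
  rooted at its only child, and come after the brackets already rooted there.\<close>

lemma repar_leaf_comp_unary:
  assumes Ni: "Vertex i [Vertex v ts] \<in> subs T" and v: "v \<noteq> i"
    and br: "\<And>A. 0 < t A ==> v \<in> A ==> A \<subseteq> vertices T ==> compatible t (Vertex v ts) A \<or> A \<in> family t v ts ==>
      branches t' x' (f v) (map (\<lambda>M. tree_comp i M U) ts) (sub A) (\<lambda>_ s. s) r = branches t x v ts A (\<lambda>_ s. s) r"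
    and r: "0 \<le> r" "r \<le> 1"
  shows "repar t' x' (f v) (map (\<lambda>M. tree_comp i M U) ts) r = repar t x i [Vertex v ts] (repar t x v ts r)"
proof -
  let ?ts = "map (\<lambda>M. tree_comp i M U) ts" and ?N = "Vertex v ts"
  let ?K' = "family t' (f v) ?ts" and ?K = "family t v ts" and ?Ki = "family t i [?N]"
  let ?m' = "\<lambda>C. exit_mean t' x' (f v) ?ts C r"
  let ?y = "repar t x v ts r"
  have N: "?N \<in> subs T" using subs_trans[OF Ni] by auto
  note fi = fits_subs[OF Ni fits(1)]
  note fv = fits_subs[OF N fits(1)]
  have iN: "i \<notin> vertices ?N" using fits_Vertex(2)[OF fi, of ?N] by simp
  note fam = family_memD[OF N v]
  have fami: "A \<subseteq> vertices T" "i \<in> A" "A \<subseteq> vertices (Vertex i [?N])" "0 < t A" "exits A (Vertex i [?N]) \<noteq> 0"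
    if "A \<in> ?Ki" "A \<noteq> {}" for A
    using that vertices_subs[OF Ni] unfolding family_def by blast+
  have y: "0 \<le> ?y" "?y \<le> 1" using repar_mem[OF w(1) fv r] by auto
  have mean0: "exit_mean t x u us {} z = z" "exit_mean t' x' u us {} z = z" for u us z by (simp_all add: exit_mean_def)
  have t0: "t {} = 1" "t' {} = 1" using weightsD(1) w by auto
  have mean_v: "?m' (sub A) = exit_mean t x v ts A r" if A: "A \<in> ?K" "A \<noteq> {}" for A
    by (rule exit_mean_comp[OF N v fam(4,2)[OF A] br]) (use fam[OF A] A in auto)
  have cAi: "compatible t ?N A" if "A \<in> ?Ki" for A
    by (rule compatible_family[OF w(1) that]) (use iN in auto)
  \<comment> \<open>By connectedness a bracket rooted at \<open>i\<close> that avoids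
    \<open>v\<close> avoids the whole tree above \<open>i\<close>. It is empty or \<open>{i}\<close>
    and does not change the parameter.\<close>
  have sing: "A \<inter> vertices ?N = {}" if "A \<in> ?Ki" "v \<notin> A" for A
  proof (cases "A = {}")
    case False
    have "rooted ?N A" by (rule conn_down[OF fami(4)[OF that(1) False] Ni fami(2)[OF that(1) False]]) simp
    then show ?thesis using that(2) by simp
  qed simp
  have mean_i: "?m' (sub A) = exit_mean t x i [?N] A ?y" if A: "A \<in> ?Ki" "v \<in> A" for A
  proof -
    have ne: "A \<noteq> {}" using A(2) by auto
    have "?m' (sub A) = exit_mean t x v ts A r"
      by (rule exit_mean_comp[OF N v fami(4)[OF A(1) ne] A(2) br]) (use fami[OF A(1) ne] A cAi[OF A(1)] in auto)
    also have "\<dots> = exit_mean t x i [?N] A ?y"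
      using flow_repar[OF w(1) fv cAi[OF A(1)] A(2) good_id r] ne A(2) fami(2)[OF A(1) ne]
      by (simp add: exit_mean_def branches_def[of t x i] x_unit del: flow_Vertex)
    finally show ?thesis .
  qed
  have mean_y: "exit_mean t x i [?N] A ?y = ?y" if A: "A \<in> ?Ki" "v \<notin> A" for A
  proof (cases "A = {}")
    case False
    then show ?thesis
      using flow_disjoint[of ?N A t x] sing[OF A] exits_disjoint[of ?N A] fami(2)[OF A(1) False] A(2)
      by (simp add: exit_mean_def branches_def x_unit)
  qed (simp add: mean0)
  have K'_I: "sub A \<in> ?K'" if A: "A \<in> ?Ki" "v \<in> A" for A
  proof -
    have ne: "A \<noteq> {}" using A(2) by auto
    have "sub A \<subseteq> sub (vertices ?N)" using fami(3)[OF A(1) ne] by (auto simp: sub_eq)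
    then have "sub A \<subseteq> vertices (Vertex (f v) ?ts)" using vertices_comp[OF N] v by simp
    moreover have "0 < t' (sub A)" using t_le[OF fami(1)[OF A(1) ne]] fami(4)[OF A(1) ne] by linarith
    moreover have "exits (sub A) (Vertex (f v) ?ts) \<noteq> 0"
      using exits_comp_at[OF N v fami(4)[OF A(1) ne] A(2)] fami(2,5)[OF A(1) ne] by simp
    ultimately show ?thesis unfolding family_def using f_in_sub[OF v] A(2) by (simp del: exits.simps ptree.set)
  qed
  have pre: "\<exists>A. sub A = C \<and> t A = t' C \<and> v \<in> A \<and> (A \<in> ?K \<or> A \<in> ?Ki)" if C: "C \<in> ?K'" "C \<noteq> {}" for C
  proof -
    obtain B where B: "sub B = C" "t B = t' C" "0 < t B" "v \<in> B" "B \<subseteq> vertices T" "B - {i} \<subseteq> vertices ?N"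
        "exits B ?N \<noteq> 0"
      using family_preimage[OF N v C] by blast
    have "B \<in> ?K \<or> B \<in> ?Ki"
    proof (cases "i \<in> B")
      case True
      then show ?thesis using B unfolding family_def by auto
    next
      case False
      then show ?thesis using B unfolding family_def by auto
    qed
    then show ?thesis using B by blast
  qed
  have tpos: "0 < t A" "A \<subseteq> vertices T" if "A \<in> ?K \<or> A \<in> ?Ki" "v \<in> A" for A
  proof -
    have "A \<noteq> {}" using that(2) by auto
    then show "0 < t A" "A \<subseteq> vertices T" using fam(1,4)[of A] fami(1,4)[of A] that(1) by blast+
  qed
  \<comment> \<open>All clamps of brackets rooted at \<open>v\<close> come before those of brackets
    rooted at \<open>i\<close> that contain \<open>v\<close>: the two kinds are nested, and only the
    latter contain \<open>i\<close>.\<close>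
  have below: "A \<subseteq> B" if "A \<in> ?K" "B \<in> ?Ki" "v \<in> B" for A B
  proof (cases "A = {}")
    case False
    have "A \<subseteq> B \<or> B \<subseteq> A"
      using weightsD(4)[OF w(1), of A B] fam[OF that(1) False] tpos[of B] that by blast
    moreover have "i \<in> B" "i \<notin> A" using fami(2)[OF that(2)] fam(3)[OF that(1) False] that(3) iN by auto
    ultimately show ?thesis by blast
  qed simp
  have lo': "?m' (sub A) - (1 - t A) \<le> ?m' (sub A) - (1 - t' (sub A))"
    "?m' (sub A) + (1 - t' (sub A)) \<le> ?m' (sub A) + (1 - t A)" if "A \<in> ?K \<or> A \<in> ?Ki" "v \<in> A" for A
    using t_le[OF tpos(2)[OF that]] by auto
  have "c \<le> repar t' x' (f v) ?ts r \<longleftrightarrow> c \<le> repar t x i [?N] ?y" for c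
  proof
    assume "c \<le> repar t' x' (f v) ?ts r"
    then obtain C where C: "C \<in> ?K'" "c \<le> ?m' C - (1 - t' C)" "\<And>D. D \<in> ?K' ==> C \<subseteq> D ==> c \<le> ?m' D + (1 - t' D)"
      unfolding le_repar_iff[OF w(3)] by blast
    have up_i: "c \<le> exit_mean t x i [?N] B ?y + (1 - t B)" if "B \<in> ?Ki" "v \<in> B" "C \<subseteq> sub B" for B
      using C(3)[OF K'_I[OF that(1,2)] that(3)] mean_i[OF that(1,2)] lo'(2)[of B] that by linarith
    have up_v: "c \<le> exit_mean t x v ts B r + (1 - t B)" if "B \<in> ?K" "B \<noteq> {}" "C \<subseteq> sub B" for B
      using C(3)[OF sub_family[OF N v that(1)] that(3)] mean_v[OF that(1,2)] lo'(2)[of B] that fam(2)[OF that(1,2)] by force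
    \<comment> \<open>If \<open>C\<close> lies below the images of all brackets rooted at
      \<open>i\<close> that contain \<open>v\<close>, a bound for the intermediate value
      \<open>?y\<close> suffices, with \<open>{}\<close> as the witness at \<open>i\<close>.\<close>
    have from_y: "c \<le> repar t x i [?N] ?y" if cy: "c \<le> ?y" and le: "\<And>B. B \<in> ?Ki ==> v \<in> B ==> C \<subseteq> sub B"
      unfolding le_repar_iff[OF w(1), of c x i "[?N]"]
    proof (intro bexI[of _ "{}"] conjI ballI impI)
      show "c \<le> exit_mean t x i [?N] B ?y + (1 - t B)" if "B \<in> ?Ki" for B
        using up_i[OF that _ le[OF that]] mean_y[OF that] cy weightsD(3)[OF w(1), of B] by (cases "v \<in> B") auto
    qed (use cy mean0 t0 empty_in_family[OF w(1)] in auto)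
    show "c \<le> repar t x i [?N] ?y"
    proof (cases "C = {}")
      case True
      have "c \<le> ?y"
        unfolding le_repar_iff[OF w(1)]
      proof (intro bexI[of _ "{}"] conjI ballI impI)
        have c: "c \<le> r" using C(2) True mean0 t0 by simp
        then show "c \<le> exit_mean t x v ts {} r - (1 - t {})" using mean0 t0 by simp
        show "c \<le> exit_mean t x v ts B r + (1 - t B)" if "B \<in> ?K" for B
          using up_v[OF that] True c mean0 t0 by (cases "B = {}") auto
      qed (use empty_in_family[OF w(1)] in auto)
      then show ?thesis by (rule from_y) (use True in simp)
    next
      case False
      obtain A where A: "sub A = C" "t A = t' C" "v \<in> A" "A \<in> ?K \<or> A \<in> ?Ki" using pre[OF C(1) False] by blast
      have Ane: "A \<noteq> {}" using A(3) by auto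
      show ?thesis
      proof (cases "A \<in> ?K")
        case True
        have "c \<le> ?y"
          unfolding le_repar_iff[OF w(1)]
        proof (intro bexI[OF _ True] conjI ballI impI)
          show "c \<le> exit_mean t x v ts A r - (1 - t A)" using C(2) mean_v[OF True Ane] A by simp
          fix B assume B: "B \<in> ?K" "A \<subseteq> B"
          then show "c \<le> exit_mean t x v ts B r + (1 - t B)"
            using up_v[OF B(1)] Ane A(1) sub_mono[OF B(2)] by auto
        qed
        then show ?thesis by (rule from_y) (use below[OF True] A(1) sub_mono in blast)
      next
        case False
        then have Ai: "A \<in> ?Ki" using A(4) by blast
        show ?thesis
          unfolding le_repar_iff[OF w(1), of c x i "[?N]"]
        proof (intro bexI[OF _ Ai] conjI ballI impI)
          show "c \<le> exit_mean t x i [?N] A ?y - (1 - t A)" using C(2) mean_i[OF Ai A(3)] A by simp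
          fix B assume B: "B \<in> ?Ki" "A \<subseteq> B"
          show "c \<le> exit_mean t x i [?N] B ?y + (1 - t B)"
            by (rule up_i[OF B(1)]) (use A B(2) sub_mono in auto)
        qed
      qed
    qed
  next
    assume "c \<le> repar t x i [?N] ?y"
    then obtain A where A: "A \<in> ?Ki" "c \<le> exit_mean t x i [?N] A ?y - (1 - t A)"
        "\<And>B. B \<in> ?Ki ==> A \<subseteq> B ==> c \<le> exit_mean t x i [?N] B ?y + (1 - t B)"
      unfolding le_repar_iff[OF w(1), of c x i "[?N]"] by blast
    have same: "c \<le> ?m' D + (1 - t' D)" if "c \<le> ?m' D - (1 - t E)" for D E
      using that weightsD(3)[OF w(1), of E] weightsD(3)[OF w(3), of D] by linarith
    show "c \<le> repar t' x' (f v) ?ts r"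
    proof (cases "v \<in> A")
      case True
      show ?thesis
        unfolding le_repar_iff[OF w(3)]
      proof (intro bexI[OF _ K'_I[OF A(1) True]] conjI ballI impI)
        show "c \<le> ?m' (sub A) - (1 - t' (sub A))" using A(1,2) mean_i[OF A(1) True] lo'(1)[of A] True by auto
        fix D assume D: "D \<in> ?K'" "sub A \<subseteq> D"
        have "D \<noteq> {}" using D(2) True f_in_sub[OF v] by blast
        then obtain B where B: "sub B = D" "t B = t' D" "v \<in> B" "B \<in> ?K \<or> B \<in> ?Ki" using pre[OF D(1)] by blast
        have "A \<subseteq> B \<or> sub A = sub B"
          by (rule nested_sub[of A B v]) (use tpos[of A] tpos[of B] A(1) True B D in auto)
        then show "c \<le> ?m' D + (1 - t' D)"
        proof
          assume "A \<subseteq> B"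
          moreover have "B \<in> ?Ki"
            using \<open>A \<subseteq> B\<close> fami(2)[OF A(1)] True B(4) fam(3)[of B] iN by blast
          ultimately show ?thesis using A(3) mean_i[of B] B by metis
        next
          assume "sub A = sub B"
          then show ?thesis using same[of D A] A(2) mean_i[OF A(1) True] B(1) by simp
        qed
      qed
    next
      case False
      \<comment> \<open>The witness at \<open>i\<close> is \<open>{}\<close> or \<open>{i}\<close>,
        so the bound concerns the intermediate value, and a witness \<open>A1\<close> for that value
        among the brackets rooted at \<open>v\<close> takes over.\<close>
      have cy: "c \<le> ?y" using A(2) mean_y[OF A(1) False] weightsD(3)[OF w(1), of A] by linarith
      then obtain A1 where A1: "A1 \<in> ?K" "c \<le> exit_mean t x v ts A1 r - (1 - t A1)"
          "\<And>B. B \<in> ?K ==> A1 \<subseteq> B ==> c \<le> exit_mean t x v ts B r + (1 - t B)"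
        unfolding le_repar_iff[OF w(1)] by blast
      have Ai: "A \<subseteq> {i}"
      proof (cases "A = {}")
        case False
        then show ?thesis using fami(3)[OF A(1)] sing[OF A(1) \<open>v \<notin> A\<close>] by auto
      qed simp
      have m1: "?m' (sub A1) = exit_mean t x v ts A1 r"
        using mean_v[OF A1(1)] mean0 by (cases "A1 = {}") auto
      show ?thesis
        unfolding le_repar_iff[OF w(3)]
      proof (intro bexI[OF _ sub_family[OF N v A1(1)]] conjI ballI impI)
        show "c \<le> ?m' (sub A1) - (1 - t' (sub A1))"
          using A1(1,2) m1 lo'(1)[of A1] fam(2)[OF A1(1)] t0 by (cases "A1 = {}") auto
        fix D assume D: "D \<in> ?K'" "sub A1 \<subseteq> D"
        show "c \<le> ?m' D + (1 - t' D)"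
        proof (cases "D = {}")
          case True
          then have "A1 = {}" using D(2) fam(2)[OF A1(1)] f_in_sub[OF v, of A1] by auto
          then show ?thesis using A1(2) True mean0 t0 by simp
        next
          case Dne: False
          obtain B where B: "sub B = D" "t B = t' D" "v \<in> B" "B \<in> ?K \<or> B \<in> ?Ki" using pre[OF D(1) Dne] by blast
          show ?thesis
          proof (cases "B \<in> ?Ki")
            case True
            have "A \<subseteq> B" using Ai fami(2)[OF True] B(3) by blast
            then show ?thesis using A(3)[OF True] mean_i[OF True B(3)] B by simp
          next
            case False
            then have BK: "B \<in> ?K" "B \<noteq> {}" using B by auto
            show ?thesis
            proof (cases "A1 \<subseteq> B")
              case True
              then show ?thesis using A1(3)[OF BK(1)] mean_v[OF BK] B by simp
            next
              case False
              then have ne: "A1 \<noteq> {}" by auto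
              have "A1 \<subseteq> B \<or> sub A1 = sub B"
                by (rule nested_sub[of A1 B v]) (use tpos[of A1] tpos[of B] A1(1) BK fam(2)[OF A1(1) ne] B D in auto)
              then show ?thesis using False same[of D A1] A1(2) m1 B(1) by simp
            qed
          qed
        qed
      qed
    qed
  qed
  then show ?thesis by (meson order.refl order_antisym)
qed

text \<open>The induction is on the size of the tree because \<open>i\<close> and its only child are
  treated together, and the argument resumes at the grandchildren.\<close>

lemma flow_leaf_insertion:
  "\<lbrakk>N \<in> subs T; S \<subseteq> vertices T; compatible t N S; rooted N S; detached N; good F; 0 \<le> s; s \<le> 1;
    \<And>M r. M \<in> subs N ==> F' (tree_comp i M U) r = F M r\<rbrakk>
   \<Longrightarrow> flow t' x' (tree_comp i N U) (sub S) F' s = flow t x N S F s"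
proof (induction N arbitrary: S s F F' rule: measure_induct_rule[where f = tree_size])
  case (less N)
  have fits_comp: "fits x' (tree_comp i (Vertex u us) U)" if "Vertex u us \<in> subs N" "u \<noteq> i" for u us
  proof -
    have "tree_comp i M U \<in> subs (tree_comp i T' U)" if "M \<in> subs T'" "fits x T'" "arity_fits i U T'" for M T'
      using that
    proof (induction T')
      case (Vertex p ps)
      show ?case
      proof (cases "M = Vertex p ps")
        case False
        then obtain M' where M': "M' \<in> set ps" "M \<in> subs M'" using Vertex.prems(1) by auto
        have ar: "arity_fits i U M'" by (rule arity_fits_subs[OF _ Vertex.prems(3)]) (use M' in \<open>auto intro: bexI[of _ M']\<close>)
        have IH: "tree_comp i M U \<in> subs (tree_comp i M' U)"
          by (rule Vertex.IH[OF M' fits_Vertex(1)[OF Vertex.prems(2) M'(1)] ar])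
        show ?thesis
        proof (cases "p = i")
          case False
          then show ?thesis using IH M'(1) by auto
        next
          case True
          then have "{..<length ps} = {0}" using Vertex.prems(3) by (auto simp: arity_fits_def U)
          then have "card {..<length ps} = 1" by simp
          then have "ps = [M']" using M'(1) by (auto simp: length_Suc_conv)
          then show ?thesis using IH True by (simp add: U)
        qed
      qed simp
    qed simp
    then have "tree_comp i (Vertex u us) U \<in> subs (tree_comp i T U)"
      using subs_trans[OF less.prems(1) that(1)] fits(1) arity by blast
    then show ?thesis by (rule fits_subs[OF _ fits(3)])
  qed
  have br: "branches t' x' (f u) (map (\<lambda>M. tree_comp i M U) us) (sub A) G' r = branches t x u us A G r"
    if u: "Vertex u us \<in> subs N" "u \<noteq> i" "tree_size (Vertex u us) \<le> tree_size N"
      and A: "A \<subseteq> vertices T" "u \<in> A" "rooted (Vertex u us) A" "\<And>M. M \<in> set us ==> compatible t M A"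
      and G: "good G" "0 \<le> r" "r \<le> 1" "\<And>M r. M \<in> subs (Vertex u us) ==> G' (tree_comp i M U) r = G M r"
    for u us A G G' r
  proof -
    note uT = subs_trans[OF less.prems(1) u(1)]
    have uV: "u \<in> vertices T" using vertices_subs[OF uT] by auto
    have "flow t' x' (tree_comp i (us ! j) U) (sub A) G' (x u j r) = flow t x (us ! j) A G (x u j r)" if j: "j < length us" for j
    proof (rule less.IH)
      have M: "us ! j \<in> set us" using j by simp
      show "tree_size (us ! j) < tree_size N" using tree_size_child[OF M, of u] u(3) by linarith
      show "us ! j \<in> subs T" by (rule subs_trans[OF uT subs_nth[OF j]])
      show "rooted (us ! j) A" using A(2,3) M by (simp add: list_all_iff)
      show "compatible t (us ! j) A" by (rule A(4)[OF M])
      show "detached (us ! j)"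
        unfolding detached_def
      proof (intro allI impI disjCI ccontr[of "i \<in> _"])
        fix q qs assume q0: "us ! j = Vertex q qs" "i \<notin> vertices (us ! j)"
          "\<not> (\<forall>B\<subseteq>vertices (us ! j). q \<in> B \<longrightarrow> \<not> 0 < t (insert i B))"
        then obtain B where q: "us ! j = Vertex q qs" "i \<notin> vertices (us ! j)" "B \<subseteq> vertices (us ! j)" "q \<in> B" "0 < t (insert i B)"
          by blast
        \<comment> \<open>A bracket that contains \<open>i\<close> and the root of this child is not
          confined to the child, so by connectedness it contains the parent \<open>u\<close>. But
          \<open>u\<close> is neither \<open>i\<close> nor in the child.\<close>
        have "u \<in> insert i B"
          by (rule conn_up[OF q(5) uT]) (use q M in auto)
        then have "u \<in> vertices (us ! j)" using u(2) q(3) by auto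
        then show False using fits_Vertex(2)[OF fits_subs[OF uT fits(1)] M] by simp
      qed
      show "0 \<le> x u j r" "x u j r \<le> 1"
        using cactus_fun_mem[OF fits_Vertex(3)[OF fits_subs[OF uT fits(1)] M] j G(2,3)] by auto
      show "G' (tree_comp i M U) r = G M r" if "M \<in> subs (us ! j)" for M r
        by (rule G(4)[OF subs_trans[OF subs_nth[OF j] that]])
    qed (use A G in auto)
    then show ?thesis unfolding branches_def x_old[OF uV u(2)] by (auto intro!: sum.cong)
  qed
  show ?case
  proof (cases N)
    case (Leaf a)
    then show ?thesis using less.prems(9)[of N] by simp
  next
    case (Vertex v ts)
    note NT = less.prems(1)[unfolded Vertex]
    note nf = fits_subs[OF NT fits(1)]
    let ?ts = "map (\<lambda>M. tree_comp i M U) ts"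
    have cc: "compatible t M S" if "M \<in> set ts" for M
      using compatible_child[OF that] less.prems(3) unfolding Vertex .
    show ?thesis
    proof (cases "v = i")
      case False
      have eq: "tree_comp i N U = Vertex (f v) ?ts" using False Vertex by simp
      have rp: "repar t' x' (f v) ?ts r = repar t x v ts r" if r: "r \<in> {0..1}" for r
      proof (rule repar_leaf_comp[OF NT False less.prems(5)[unfolded Vertex]])
        fix A assume A: "A \<in> family t v ts" "A \<noteq> {}"
        note A' = family_memD[OF NT False A]
        show "branches t' x' (f v) ?ts (sub A) (\<lambda>_ s. s) r = branches t x v ts A (\<lambda>_ s. s) r"
        proof (rule br)
          show "compatible t M A" if "M \<in> set ts" for M
            by (rule compatible_family[OF w(1) A(1) that fits_Vertex(2)[OF nf that]])
        qed (use Vertex False A' r good_id rooted_at[OF NT False A'(4,2)] in auto)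
      qed
      have un: "unrepar t' x' (f v) ?ts s = unrepar t x v ts s" by (rule inv_into_cong[OF rp])
      show ?thesis
      proof (cases "v \<in> S")
        case True
        have s: "0 \<le> unrepar t x v ts s" "unrepar t x v ts s \<le> 1"
          using ontoD[OF repar_onto[OF w(1) nf] less.prems(7,8)] by auto
        have "branches t' x' (f v) ?ts (sub S) F' (unrepar t x v ts s) = branches t x v ts S F (unrepar t x v ts s)"
          by (rule br) (use Vertex False True less.prems cc s in auto)
        then show ?thesis unfolding eq using Vertex True f_in_sub[OF False] by (simp add: un)
      next
        case vS: False
        then show ?thesis using f_in_sub[OF False] less.prems(9)[of N] Vertex unfolding eq by simp
      qed
    next
      case v: True
      note Ni = NT[unfolded v]
      obtain N1 where N1: "ts = [N1]" using unary[OF Ni] by blast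
      have eq: "tree_comp i N U = tree_comp i N1 U" using v N1 Vertex by (simp add: U)
      have N1T: "N1 \<in> subs T" using subs_trans[OF Ni] N1 by auto
      have iN1: "i \<notin> vertices N1" using fits_Vertex(2)[OF nf, of N1] N1 v by simp
      have F_N1: "F' (tree_comp i N1 U) r = F N1 r" "F N r = F N1 r" for r
        using less.prems(9)[of N1] less.prems(9)[of N] eq N1 Vertex by auto
      show ?thesis
      proof (cases "i \<in> S")
        case False
        then have "S \<inter> vertices N1 = {}" using less.prems(4) Vertex v N1 by auto
        then have "vertices (tree_comp i N1 U) \<inter> sub S = {}"
          unfolding vertices_comp[OF N1T] using f_in_sub by (auto simp: sub_eq)
        then have "flow t' x' (tree_comp i N1 U) (sub S) F' s = F' (tree_comp i N1 U) s" by (rule flow_disjoint)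
        then show ?thesis using F_N1 False Vertex v unfolding eq by simp
      next
        case iS: True
        have q: "onto (repar t x i [N1])" using repar_onto[OF w(1) nf] v N1 by simp
        let ?u = "unrepar t x i [N1] s"
        have u: "0 \<le> ?u" "?u \<le> 1" "repar t x i [N1] ?u = s" using ontoD[OF q less.prems(7,8)] by auto
        have R: "flow t x N S F s = flow t x N1 S F ?u"
          using iS Vertex v N1 by (simp add: branches_def x_unit)
        show ?thesis
        proof (cases "(\<exists>a. N1 = Leaf a) \<or> (\<exists>w us. N1 = Vertex w us \<and> w \<notin> S)")
          case True
          \<comment> \<open>Compatibility keeps the brackets rooted at \<open>i\<close> inside
            \<open>S\<close>, and by connectedness they enter the child only through its root. So
            they do not meet the child, and \<open>repar\<close> at \<open>i\<close> is the
            identity.\<close>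
          have triv: "A \<inter> vertices N1 = {}" if A: "A \<in> family t i [N1]" for A
          proof (cases "A = {}")
            case False
            then have A': "0 < t A" "i \<in> A" "A \<subseteq> vertices (Vertex i [N1])" using A unfolding family_def by blast+
            have "A \<subseteq> S" using less.prems(3) A' iS Vertex v N1 unfolding compatible_def by blast
            moreover have "rooted N1 A" by (rule conn_down[OF A'(1) Ni A'(2)]) (simp add: N1)
            ultimately show ?thesis using True
            proof (elim disjE exE conjE)
              fix p ps assume "A \<subseteq> S" "rooted N1 A" "N1 = Vertex p ps" "p \<notin> S"
              then show ?thesis by (metis rooted.simps(2) subsetD)
            qed simp
          qed simp
          have rz: "repar t x i [N1] z = z" for z
          proof -
            have m: "exit_mean t x i [N1] A z = z" if "A \<in> family t i [N1]" for A
            proof (cases "A = {}")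
              case False
              then have "i \<in> A" using that unfolding family_def by blast
              then show ?thesis using flow_disjoint[of N1 A t x] triv[OF that] exits_disjoint[of N1 A]
                by (simp add: exit_mean_def branches_def x_unit Int_commute)
            qed (simp add: exit_mean_def)
            show "repar t x i [N1] z = z"
              unfolding repar_def by (rule mix_const[OF finite_family empty_in_family[OF w(1)] w(1) m])
          qed
          have us: "?u = s" using u(3) rz by simp
          have "flow t x N1 S F s = F N1 s" using True by auto
          moreover have "flow t' x' (tree_comp i N1 U) (sub S) F' s = F' (tree_comp i N1 U) s"
            using True
          proof (elim disjE exE conjE)
            fix p ps assume p: "N1 = Vertex p ps" "p \<notin> S"
            then have "p \<noteq> i" using iN1 by auto
            then show ?thesis using p f_in_sub by simp
          qed simp
          ultimately show ?thesis using F_N1 R us unfolding eq by simp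
        next
          case False
          then obtain p ps where p: "N1 = Vertex p ps" "p \<in> S" by (cases N1) auto
          have pi: "p \<noteq> i" using iN1 p by auto
          have pN: "Vertex p ps \<in> subs N" using Vertex N1 p by simp
          have size: "tree_size (Vertex p ps) \<le> tree_size N" using Vertex N1 p by simp
          note pT = N1T[unfolded p]
          note pf = fits_subs[OF pT fits(1)]
          let ?ps = "map (\<lambda>M. tree_comp i M U) ps"
          have rp: "repar t' x' (f p) ?ps r = repar t x i [Vertex p ps] (repar t x p ps r)" if r: "r \<in> {0..1}" for r
          proof (rule repar_leaf_comp_unary[OF _ pi])
            show "Vertex i [Vertex p ps] \<in> subs T" using Ni N1 p by simp
            fix A assume A: "0 < t A" "p \<in> A" "A \<subseteq> vertices T" "compatible t (Vertex p ps) A \<or> A \<in> family t p ps"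
            show "branches t' x' (f p) ?ps (sub A) (\<lambda>_ s. s) r = branches t x p ps A (\<lambda>_ s. s) r"
            proof (rule br[OF pN pi size A(3,2) rooted_at[OF pT pi A(1,2)]])
              show "compatible t M A" if "M \<in> set ps" for M
                using A(4) compatible_child[OF that] compatible_family[OF w(1) _ that fits_Vertex(2)[OF pf that]] by blast
            qed (use r good_id in auto)
          qed (use r in auto)
          have eqp: "tree_comp i N1 U = Vertex (f p) ?ps" using p pi by simp
          have pf': "fits x' (Vertex (f p) ?ps)" using fits_comp[OF pN pi] pi by simp
          let ?u' = "unrepar t' x' (f p) ?ps s"
          have u': "0 \<le> ?u'" "?u' \<le> 1" "repar t' x' (f p) ?ps ?u' = s"
            using ontoD[OF repar_onto[OF w(3) pf'] less.prems(7,8)] by auto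
          let ?y = "repar t x p ps ?u'"
          have y: "0 \<le> ?y" "?y \<le> 1" using repar_mem[OF w(1) pf u'(1,2)] by auto
          have rS: "rooted (Vertex p ps) S" using less.prems(4) Vertex v N1 p iS by simp
          have cS: "compatible t (Vertex p ps) S" using cc[of N1] N1 p by simp
          have F9: "F' (tree_comp i M U) r = F M r" if "M \<in> subs (Vertex p ps)" for M r
            by (rule less.prems(9)[OF subs_trans[OF pN that]])
          \<comment> \<open>The single reparametrization at \<open>f p\<close> is traded for two
            successive ones, at \<open>p\<close> and at \<open>i\<close>.\<close>
          have "flow t' x' (tree_comp i N U) (sub S) F' s = branches t' x' (f p) ?ps (sub S) F' ?u'"
            unfolding eq eqp using f_in_sub[OF pi] p by simp
          also have "\<dots> = branches t x p ps S F ?u'"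
            by (rule br[OF pN pi size less.prems(2) p(2) rS _ less.prems(6) u'(1,2) F9]) (use compatible_child[OF _ cS] in auto)
          also have "\<dots> = flow t x (Vertex p ps) S F ?y"
            using flow_repar[OF w(1) pf cS p(2) less.prems(6) u'(1,2)] by simp
          also have "\<dots> = branches t x i [Vertex p ps] S F ?y"
            by (simp add: branches_def[of t x i] x_unit del: flow_Vertex)
          also have "\<dots> = flow t x (Vertex i [Vertex p ps]) S F (repar t x i [Vertex p ps] ?y)"
            using flow_repar[of t x i "[Vertex p ps]" S F ?y] w(1) nf less.prems(3,6) iS y Vertex v N1 p by simp
          also have "repar t x i [Vertex p ps] ?y = s" using rp[of ?u'] u' by simp
          finally show ?thesis using Vertex v N1 p by simp
        qed
      qed
    qed
  qed
qed

end

section \<open>Cacti as families of functions\<close>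

lemma circ_add: "circ (t + of_int n) = circ t"
proof -
  have "2 * pi * (t + of_int n) = 2 * pi * t + 2 * pi * of_int n" by (simp add: algebra_simps)
  then show ?thesis using cis_multiple_2pi[of "of_int n"] by (simp add: circ_def cis_mult[symmetric])
qed

lemma circ_eq_iff: "circ s = circ t \<longleftrightarrow> (\<exists>n::int. s = t + of_int n)"
proof
  assume "circ s = circ t"
  then have "sin (2 * pi * s) = sin (2 * pi * t) \<and> cos (2 * pi * s) = cos (2 * pi * t)"
    by (simp add: circ_def complex_eq_iff)
  then obtain n where "2 * pi * s = 2 * pi * t + 2 * pi * of_int n"
    unfolding sin_cos_eq_iff by (auto simp: mult_ac)
  then have "2 * pi * s = 2 * pi * (t + of_int n)" by (simp add: algebra_simps)
  then show "\<exists>n::int. s = t + of_int n" by (intro exI[of _ n]) simp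
qed (use circ_add in auto)

lemma circ_1[simp]: "circ 1 = circ 0"
  using circ_add[of 0 1] by simp

lemma circ_add_1: "circ (t + 1) = circ t" "circ (t - 1) = circ t"
  using circ_add[of t 1] circ_add[of t "-1"] by simp_all

lemma circ_inj:
  assumes "circ s = circ t" "\<bar>s - t\<bar> < 1"
  shows "s = t"
proof -
  obtain n :: int where n: "s = t + of_int n" using assms(1) circ_eq_iff by blast
  then have "\<bar>real_of_int n\<bar> < 1" using assms(2) by simp
  then have "n = 0" by linarith
  then show ?thesis using n by simp
qed

lemma norm_circ[simp]: "cmod (circ t) = 1"
  by (simp add: circ_def)

lemma circ_in_S1: "circ t \<in> S1"
  by simp

lemma continuous_circ: "continuous_on A circ"
  unfolding circ_def[abs_def] by (intro continuous_intros)

lemma circ_surj: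
  assumes "z \<in> S1"
  obtains t where "0 \<le> t" "t < 1" "circ t = z"
proof -
  obtain \<theta> where \<theta>: "0 \<le> \<theta>" "\<theta> < 2 * pi" "z = exp (\<i> * of_real \<theta>)"
  proof -
    have "z = exp (\<i> * of_real (Arg2pi z))"
      using assms Arg2pi_eq[of z] by (metis dist_0_norm mem_sphere mult.left_neutral of_real_1)
    then show ?thesis using that[of "Arg2pi z"] Arg2pi[of z] by blast
  qed
  have "circ (\<theta> / (2 * pi)) = z" using \<theta>(3) by (simp add: circ_def cis_conv_exp)
  then show ?thesis using that[of "\<theta> / (2 * pi)"] \<theta> by (simp add: divide_less_eq)
qed

text \<open>The complement in the circle is the image of the compact interval from \<open>b\<close>
  to \<open>a + 1\<close>.\<close>

lemma openin_arc:
  assumes "b - a \<le> 1"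
  shows "openin (top_of_set S1) (circ ` {a<..<b})"
proof -
  have "circ ` {a<..<b} = S1 - circ ` {b..a + 1}"
  proof (intro equalityI subsetI)
    fix z assume "z \<in> circ ` {a<..<b}"
    then obtain s where s: "z = circ s" "a < s" "s < b" by auto
    have False if "circ s = circ t" "b \<le> t" "t \<le> a + 1" for t
      using circ_inj[OF that(1)] that s assms by (auto simp: abs_if split: if_splits)
    then have "z \<notin> circ ` {b..a + 1}" using s(1) by (metis atLeastAtMost_iff imageE)
    then show "z \<in> S1 - circ ` {b..a + 1}" using s(1) by simp
  next
    fix z assume z: "z \<in> S1 - circ ` {b..a + 1}"
    then obtain t where t: "circ t = z" using circ_surj by blast
    define n where "n = \<lceil>a - t\<rceil>"
    define s where "s = t + of_int n"
    have s: "circ s = z" "a \<le> s" "s < a + 1" using t circ_add by (auto simp: s_def n_def) linarith+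
    have "s < b" using z s by force
    moreover have "a \<noteq> s"
    proof
      assume "a = s"
      then have "z = circ (a + 1)" using s(1) circ_add_1(1)[of a] by simp
      moreover have "a + 1 \<in> {b..a + 1}" using assms by simp
      ultimately show False using z by blast
    qed
    ultimately show "z \<in> circ ` {a<..<b}" using s by force
  qed
  moreover have "closed (circ ` {b..a + 1})"
    by (intro compact_imp_closed compact_continuous_image continuous_circ) auto
  ultimately show ?thesis by (simp add: Diff_eq openin_open_Int open_Compl)
qed

lemma circle_interior_iff: "circ u \<in> circle_interior A \<longleftrightarrow> (\<exists>e>0. circ ` {u - e<..<u + e} \<subseteq> A)"
proof
  assume "circ u \<in> circle_interior A"
  then obtain W where W: "openin (top_of_set S1) W" "circ u \<in> W" "W \<subseteq> A"
    unfolding circle_interior_def interior_of_def by auto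
  then obtain Z where Z: "open Z" "W = S1 \<inter> Z" by (auto simp: openin_open)
  have "open (circ -` Z)" using Z(1) continuous_circ by (simp add: continuous_on_open_vimage open_vimage)
  then obtain e where "e > 0" "ball u e \<subseteq> circ -` Z" using Z W open_contains_ball by blast
  then have "circ s \<in> A" if "s \<in> {u - e<..<u + e}" for s
    using that W(3) Z(2) circ_in_S1[of s] unfolding ball_eq_greaterThanLessThan by blast
  then show "\<exists>e>0. circ ` {u - e<..<u + e} \<subseteq> A"
    using \<open>e > 0\<close> by (intro exI[of _ e]) auto
next
  assume "\<exists>e>0. circ ` {u - e<..<u + e} \<subseteq> A"
  then obtain e where e: "e > 0" "circ ` {u - e<..<u + e} \<subseteq> A" by blast
  define d where "d = min e (1/2)"
  have "openin (top_of_set S1) (circ ` {u - d<..<u + d})" by (rule openin_arc) (auto simp: d_def)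
  moreover have "circ u \<in> circ ` {u - d<..<u + d}" using e by (intro imageI) (auto simp: d_def)
  moreover have "{u - d<..<u + d} \<subseteq> {u - e<..<u + e}" by (auto simp: d_def)
  then have "circ ` {u - d<..<u + d} \<subseteq> A" using e(2) by blast
  ultimately show "circ u \<in> circle_interior A"
    unfolding circle_interior_def interior_of_def by blast
qed

text \<open>A continuous injection of a compact interval is a homeomorphism onto its image and
  restricts to \<open>T\<close>. A negative \<open>d\<close> runs through the arc backwards, so that
  an arc ending at a boundary point also becomes an interval closed at 0.\<close>

lemma homeomorphic_arc:
  assumes "d \<noteq> 0" "\<bar>d\<bar> < 1" "T \<subseteq> {0..1::real}"
  shows "(\<lambda>s. circ (c + d * s)) ` T homeomorphic T"
proof -
  let ?\<gamma> = "\<lambda>s. circ (c + d * s)"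
  have inj: "inj_on ?\<gamma> {0..1}"
  proof (rule inj_onI)
    fix s t :: real assume st: "s \<in> {0..1}" "t \<in> {0..1}" "?\<gamma> s = ?\<gamma> t"
    have "\<bar>(c + d * s) - (c + d * t)\<bar> = \<bar>d\<bar> * \<bar>s - t\<bar>" by (simp add: abs_mult[symmetric] algebra_simps)
    also have "\<dots> \<le> \<bar>d\<bar> * 1" using st by (intro mult_left_mono) auto
    finally have "c + d * s = c + d * t" using circ_inj[OF st(3)] assms(2) by linarith
    then show "s = t" using assms(1) by simp
  qed
  have "continuous_on {0..1} ?\<gamma>"
    by (rule continuous_on_compose2[OF continuous_circ[of UNIV]]) (auto intro!: continuous_intros)
  then obtain g where g: "homeomorphism {0..1} (?\<gamma> ` {0..1}) ?\<gamma> g"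
    using homeomorphism_compact[OF _ _ refl inj] by auto
  have "homeomorphism T (?\<gamma> ` T) ?\<gamma> g"
    by (rule homeomorphism_of_subsets[OF g assms(3) empty_subsetI refl])
  then show ?thesis unfolding homeomorphic_def using homeomorphism_sym by blast
qed

text \<open>Local structure of a 1-dimensional submanifold: both sides of every point lie inside or
  outside, and no point of it is isolated.\<close>

definition sided :: "complex set \<Rightarrow> real \<Rightarrow> real \<Rightarrow> bool" where
  "sided A u e \<longleftrightarrow> e > 0 \<and>
     (circ ` {u<..<u + e} \<subseteq> A \<or> circ ` {u<..<u + e} \<inter> A = {}) \<and>
     (circ ` {u - e<..<u} \<subseteq> A \<or> circ ` {u - e<..<u} \<inter> A = {}) \<and>
     (circ u \<in> A \<longrightarrow> circ ` {u<..<u + e} \<subseteq> A \<or> circ ` {u - e<..<u} \<subseteq> A)"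

lemma sided_mono: "sided A u e ==> 0 < d ==> d \<le> e ==> sided A u d"
proof -
  assume *: "sided A u e" "0 < d" "d \<le> e"
  then have "{u<..<u + d} \<subseteq> {u<..<u + e}" "{u - d<..<u} \<subseteq> {u - e<..<u}" by auto
  then have le: "circ ` {u<..<u + d} \<subseteq> circ ` {u<..<u + e}" "circ ` {u - d<..<u} \<subseteq> circ ` {u - e<..<u}"
    by blast+
  have "circ ` {u<..<u + d} \<subseteq> A \<or> circ ` {u<..<u + d} \<inter> A = {}"
    "circ ` {u - d<..<u} \<subseteq> A \<or> circ ` {u - d<..<u} \<inter> A = {}"
    "circ u \<in> A \<longrightarrow> circ ` {u<..<u + d} \<subseteq> A \<or> circ ` {u - d<..<u} \<subseteq> A"
    using *(1)[unfolded sided_def] le by (meson disjoint_iff subset_iff)+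
  then show ?thesis using *(2) unfolding sided_def by simp
qed

text \<open>If along one side the set were left, entered and left again, the open arc between the
  two outside points would cut a nonempty clopen piece without \<open>u\<close> out of the connected
  neighbourhood \<open>U\<close>. The number \<sigma> selects the side.\<close>

lemma one_sided_from_connected:
  assumes U: "connected U" "circ u \<in> U" "U \<subseteq> A" "A \<subseteq> S1" and \<sigma>: "\<sigma> = 1 \<or> \<sigma> = -1"
    and e: "0 < e" "e \<le> 1/2" "\<And>s. \<bar>s\<bar> < e ==> circ (u + s) \<in> A ==> circ (u + s) \<in> U"
  shows "\<exists>d>0. d \<le> e \<and> ((\<forall>s. 0 < s \<and> s < d \<longrightarrow> circ (u + \<sigma> * s) \<in> A) \<or> (\<forall>s. 0 < s \<and> s < d \<longrightarrow> circ (u + \<sigma> * s) \<notin> A))"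
proof -
  let ?\<gamma> = "\<lambda>s. circ (u + \<sigma> * s)"
  have as: "\<bar>\<sigma> * s\<bar> = \<bar>s\<bar>" for s using \<sigma> by auto
  have gap: False if q: "0 < q1" "q1 < p" "p < q2" "q2 < e" "?\<gamma> p \<in> A" "?\<gamma> q1 \<notin> A" "?\<gamma> q2 \<notin> A" for q1 p q2
  proof -
    define a b where "a = (if \<sigma> = 1 then u + q1 else u - q2)" and "b = (if \<sigma> = 1 then u + q2 else u - q1)"
    let ?V = "circ ` {a<..<b}"
    have ab: "b - a \<le> 1" "a < b" "\<bar>a - u\<bar> < 1/2" "\<bar>b - u\<bar> < 1/2" "{a, b} = {u + \<sigma> * q1, u + \<sigma> * q2}"
      using \<sigma> q e by (auto simp: a_def b_def)
    have pV: "?\<gamma> p \<in> ?V" using \<sigma> q by (auto simp: a_def b_def)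
    have uV: "circ u \<notin> ?V"
    proof
      assume "circ u \<in> ?V"
      then obtain t where t: "a < t" "t < b" "circ u = circ t" by auto
      then have "u = t" using circ_inj[OF t(3)] ab by linarith
      then show False using t \<sigma> q by (auto simp: a_def b_def split: if_splits)
    qed
    have pU: "?\<gamma> p \<in> U" using e(3)[of "\<sigma> * p"] as[of p] q by auto
    have "circ a \<notin> U" "circ b \<notin> U" using q(6,7) U(3) ab(5) by (auto simp: doubleton_eq_iff)
    have closedV: "U \<inter> ?V = U \<inter> circ ` {a..b}"
    proof -
      have "{a..b} = insert a (insert b {a<..<b})" using ab(2) by auto
      then have "circ ` {a..b} = insert (circ a) (insert (circ b) ?V)" by simp
      then show ?thesis using \<open>circ a \<notin> U\<close> \<open>circ b \<notin> U\<close> by simp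
    qed
    obtain Z where Z: "open Z" "?V = S1 \<inter> Z" using openin_arc[OF ab(1)] by (auto simp: openin_open)
    have "openin (top_of_set U) (U \<inter> ?V)"
    proof -
      have "U \<inter> ?V = U \<inter> Z" using Z(2) U(3,4) by blast
      then show ?thesis using Z(1) by (simp add: openin_open_Int)
    qed
    moreover have "closedin (top_of_set U) (U \<inter> ?V)"
      unfolding closedV by (intro closedin_closed_Int compact_imp_closed compact_continuous_image continuous_circ) auto
    ultimately have "U \<inter> ?V = {} \<or> U \<inter> ?V = U" using U(1) connected_clopen by blast
    then show False using pU pV uV U(2) by blast
  qed
  show ?thesis
  proof (cases "\<forall>s. 0 < s \<and> s < e \<longrightarrow> ?\<gamma> s \<in> A")
    case True
    then show ?thesis using e by blast
  next
    case False
    then obtain q where q: "0 < q" "q < e" "?\<gamma> q \<notin> A" by blast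
    show ?thesis
    proof (cases "\<forall>s. 0 < s \<and> s < q \<longrightarrow> ?\<gamma> s \<notin> A")
      case True
      then show ?thesis using q by (intro exI[of _ q]) auto
    next
      case False
      then obtain p where p: "0 < p" "p < q" "?\<gamma> p \<in> A" by blast
      then have "\<forall>s. 0 < s \<and> s < p \<longrightarrow> ?\<gamma> s \<in> A" using gap[of _ p q] q by blast
      then show ?thesis using p q by (intro exI[of _ p]) auto
    qed
  qed
qed

lemma submanifold_sided:
  assumes A: "closed_1_submanifold A"
  shows "\<exists>e. sided A u e"
proof (cases "circ u \<in> A")
  case False
  have "open (- (circ -` A))"
    using A continuous_circ[of UNIV] by (metis closed_1_submanifold_def closed_vimage open_Compl)
  then obtain e where e: "e > 0" "ball u e \<subseteq> - (circ -` A)" using False open_contains_ball by blast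
  then have "circ ` {u<..<u + e} \<inter> A = {}" "circ ` {u - e<..<u} \<inter> A = {}"
    by (auto simp: ball_eq_greaterThanLessThan subset_iff)
  then show ?thesis using e False unfolding sided_def by blast
next
  case True
  have AS: "A \<subseteq> S1" using A by (simp add: closed_1_submanifold_def)
  obtain U where U: "circ u \<in> U" "openin (top_of_set A) U" "U homeomorphic {0<..<1::real} \<or> U homeomorphic {0..<1::real}"
    using A True unfolding closed_1_submanifold_def by blast
  have conn: "connected U"
    using U(3) homeomorphic_connectedness[of U "{0<..<1::real}"] homeomorphic_connectedness[of U "{0..<1::real}"] by auto
  have inf: "infinite U"
  proof
    assume "finite U"
    then show False
      using U(3) homeomorphic_finite[of U "{0<..<1::real}"] homeomorphic_finite[of U "{0..<1::real}"]
      by (metis homeomorphic_finite homeomorphic_sym infinite_Ico infinite_Ioo zero_less_one)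
  qed
  obtain Z where Z: "open Z" "U = A \<inter> Z" using U(2) by (auto simp: openin_open)
  have UA: "U \<subseteq> A" using Z by blast
  have "open (circ -` Z)" using Z(1) continuous_circ by (simp add: open_vimage)
  then obtain e0 where e0: "e0 > 0" "ball u e0 \<subseteq> circ -` Z" using Z U open_contains_ball by blast
  define e where "e = min e0 (1/2)"
  have e: "0 < e" "e \<le> 1/2" using e0 by (auto simp: e_def)
  have eU: "circ (u + s) \<in> U" if "\<bar>s\<bar> < e" "circ (u + s) \<in> A" for s
  proof -
    have "u + s \<in> ball u e0" using that(1) by (auto simp: e_def dist_real_def)
    then show ?thesis using e0(2) that(2) Z(2) by blast
  qed
  obtain d1 where d1: "d1 > 0" "d1 \<le> e" "(\<forall>s. 0 < s \<and> s < d1 \<longrightarrow> circ (u + 1 * s) \<in> A) \<or> (\<forall>s. 0 < s \<and> s < d1 \<longrightarrow> circ (u + 1 * s) \<notin> A)"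
    using one_sided_from_connected[OF conn U(1) UA AS _ e eU, of 1] by blast
  obtain d2 where d2: "d2 > 0" "d2 \<le> e" "(\<forall>s. 0 < s \<and> s < d2 \<longrightarrow> circ (u + -1 * s) \<in> A) \<or> (\<forall>s. 0 < s \<and> s < d2 \<longrightarrow> circ (u + -1 * s) \<notin> A)"
    using one_sided_from_connected[OF conn U(1) UA AS _ e eU, of "-1"] by blast
  define d where "d = min d1 d2"
  have d: "0 < d" "d \<le> e" using d1 d2 by (auto simp: d_def)
  have R: "(\<forall>t. u < t \<and> t < u + d \<longrightarrow> circ t \<in> A) \<or> (\<forall>t. u < t \<and> t < u + d \<longrightarrow> circ t \<notin> A)"
    using d1(3)
  proof
    assume *: "\<forall>s. 0 < s \<and> s < d1 \<longrightarrow> circ (u + 1 * s) \<in> A"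
    have "circ t \<in> A" if "u < t" "t < u + d" for t using *[rule_format, of "t - u"] that by (simp add: d_def)
    then show ?thesis by blast
  next
    assume *: "\<forall>s. 0 < s \<and> s < d1 \<longrightarrow> circ (u + 1 * s) \<notin> A"
    have "circ t \<notin> A" if "u < t" "t < u + d" for t using *[rule_format, of "t - u"] that by (simp add: d_def)
    then show ?thesis by blast
  qed
  have L: "(\<forall>t. u - d < t \<and> t < u \<longrightarrow> circ t \<in> A) \<or> (\<forall>t. u - d < t \<and> t < u \<longrightarrow> circ t \<notin> A)"
    using d2(3)
  proof
    assume *: "\<forall>s. 0 < s \<and> s < d2 \<longrightarrow> circ (u + -1 * s) \<in> A"
    have "circ t \<in> A" if "u - d < t" "t < u" for t using *[rule_format, of "u - t"] that by (simp add: d_def)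
    then show ?thesis by blast
  next
    assume *: "\<forall>s. 0 < s \<and> s < d2 \<longrightarrow> circ (u + -1 * s) \<notin> A"
    have "circ t \<notin> A" if "u - d < t" "t < u" for t using *[rule_format, of "u - t"] that by (simp add: d_def)
    then show ?thesis by blast
  qed
  \<comment> \<open>With both sides outside, \<open>u\<close> would be isolated and, by
    connectedness, the only point of \<open>U\<close>; but \<open>U\<close> is homeomorphic to an
    interval and infinite.\<close>
  have "\<not> ((\<forall>t. u < t \<and> t < u + d \<longrightarrow> circ t \<notin> A) \<and> (\<forall>t. u - d < t \<and> t < u \<longrightarrow> circ t \<notin> A))"
  proof
    assume out: "(\<forall>t. u < t \<and> t < u + d \<longrightarrow> circ t \<notin> A) \<and> (\<forall>t. u - d < t \<and> t < u \<longrightarrow> circ t \<notin> A)"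
    have "U \<inter> circ ` {u - d<..<u + d} = {circ u}"
    proof (intro equalityI subsetI)
      fix z assume z: "z \<in> U \<inter> circ ` {u - d<..<u + d}"
      then obtain t where t: "u - d < t" "t < u + d" "z = circ t" by auto
      then have "t = u" using out z UA by (cases t u rule: linorder_cases) auto
      then show "z \<in> {circ u}" using t by simp
    qed (use U(1) d in auto)
    moreover have "openin (top_of_set S1) (circ ` {u - d<..<u + d})" by (rule openin_arc) (use d e in auto)
    then obtain W where W: "open W" "circ ` {u - d<..<u + d} = S1 \<inter> W" by (auto simp: openin_open)
    ultimately have "U \<inter> W = {circ u}" using UA AS by blast
    then have "openin (top_of_set U) {circ u}" using W(1) by (metis openin_open_Int)
    moreover have "closedin (top_of_set U) {circ u}" using U(1) by (simp add: closed_subset)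
    ultimately have "{circ u} = U" using conn connected_clopen by blast
    then show False using inf by (metis finite.emptyI finite.insertI)
  qed
  then have N: "(\<forall>t. u < t \<and> t < u + d \<longrightarrow> circ t \<in> A) \<or> (\<forall>t. u - d < t \<and> t < u \<longrightarrow> circ t \<in> A)" using R L by blast
  have "circ ` {u<..<u + d} \<subseteq> A \<or> circ ` {u<..<u + d} \<inter> A = {}" using R by (elim disjE) auto
  moreover have "circ ` {u - d<..<u} \<subseteq> A \<or> circ ` {u - d<..<u} \<inter> A = {}" using L by (elim disjE) auto
  moreover have "circ ` {u<..<u + d} \<subseteq> A \<or> circ ` {u - d<..<u} \<subseteq> A" using N by (elim disjE) auto
  ultimately show ?thesis using d unfolding sided_def by blast
qed

lemma ivl_sub: "{0..<1::real} \<subseteq> {0..1}" "{0<..<1::real} \<subseteq> {0..1}"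
  by auto

text \<open>Conversely, two sides inside give an interior point and one side inside a boundary
  point, while an isolated point is excluded by \<open>sided\<close>.\<close>

lemma sided_submanifold:
  assumes A: "A \<subseteq> S1" "closed A" and sd: "\<And>u. 0 \<le> u ==> u < 1 ==> circ u \<in> A ==> \<exists>e. sided A u e"
  shows "closed_1_submanifold A"
  unfolding closed_1_submanifold_def
proof (intro conjI A ballI)
  fix z assume z: "z \<in> A"
  then obtain u where u: "0 \<le> u" "u < 1" "circ u = z" using circ_surj A(1) by blast
  obtain e0 where e0: "sided A u e0" using sd[OF u(1,2)] u(3) z by blast
  \<comment> \<open>A quarter of the circle on each side keeps the arc shorter than the circle, so
    that its parametrization is injective.\<close>
  define e where "e = min e0 (1/4)"
  have e: "sided A u e" "0 < e" "e \<le> 1/4"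
    using sided_mono[OF e0, of e] e0 by (auto simp: e_def sided_def)
  let ?W = "circ ` {u - e<..<u + e}"
  have W: "openin (top_of_set A) (A \<inter> ?W)"
  proof -
    have "openin (top_of_set S1) ?W" by (rule openin_arc) (use e in auto)
    then obtain Z where "open Z" "?W = S1 \<inter> Z" by (auto simp: openin_open)
    then show ?thesis using A(1) by (metis Int_absorb2 Int_assoc openin_open_Int)
  qed
  have zU: "z \<in> A \<inter> ?W" using z u e by auto
  have split: "{u - e<..<u + e} = {u - e<..<u} \<union> {u} \<union> {u<..<u + e}" using e by auto
  have AW: "A \<inter> ?W = (A \<inter> circ ` {u - e<..<u}) \<union> {z} \<union> (A \<inter> circ ` {u<..<u + e})"
    unfolding split using u(3) z by auto
  have "A \<inter> ?W homeomorphic {0<..<1::real} \<or> A \<inter> ?W homeomorphic {0..<1::real}"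
  proof -
    consider "circ ` {u - e<..<u} \<subseteq> A" "circ ` {u<..<u + e} \<subseteq> A"
      | "circ ` {u - e<..<u} \<inter> A = {}" "circ ` {u<..<u + e} \<subseteq> A"
      | "circ ` {u - e<..<u} \<subseteq> A" "circ ` {u<..<u + e} \<inter> A = {}"
      using e(1) z u(3) unfolding sided_def by blast
    then show ?thesis
    proof cases
      case 1
      have "{u - e<..<u + e} = (\<lambda>s. (u - e) + (2 * e) * s) ` {0<..<1}"
      proof (intro equalityI subsetI)
        fix t assume "t \<in> {u - e<..<u + e}"
        then show "t \<in> (\<lambda>s. (u - e) + (2 * e) * s) ` {0<..<1}"
          using e(2) by (intro image_eqI[of _ _ "(t - (u - e)) / (2 * e)"]) (auto simp: field_simps)
      qed (use e(2) in \<open>auto simp: algebra_simps\<close>)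
      then have "?W = (\<lambda>s. circ ((u - e) + (2 * e) * s)) ` {0<..<1}" by (simp add: image_image)
      moreover have "?W \<subseteq> A" unfolding split using 1 z u(3) by auto
      then have "A \<inter> ?W = ?W" by blast
      ultimately show ?thesis using homeomorphic_arc[of "2 * e" "{0<..<1}" "u - e", OF _ _ ivl_sub(2)] e by auto
    next
      case 2
      have "{u..<u + e} = (\<lambda>s. u + e * s) ` {0..<1}"
      proof (intro equalityI subsetI)
        fix t assume "t \<in> {u..<u + e}"
        then show "t \<in> (\<lambda>s. u + e * s) ` {0..<1}"
          using e(2) by (intro image_eqI[of _ _ "(t - u) / e"]) (auto simp: field_simps)
      qed (use e(2) in auto)
      then have im: "circ ` {u..<u + e} = (\<lambda>s. circ (u + e * s)) ` {0..<1}" by (simp add: image_image)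
      have sp: "{u..<u + e} = insert u {u<..<u + e}" using e by auto
      have "A \<inter> ?W = circ ` {u..<u + e}" unfolding AW sp using 2 u(3) by auto
      then show ?thesis using im homeomorphic_arc[of e "{0..<1}" u, OF _ _ ivl_sub(1)] e by auto
    next
      case 3
      have "{u - e<..u} = (\<lambda>s. u + (- e) * s) ` {0..<1}"
      proof (intro equalityI subsetI)
        fix t assume "t \<in> {u - e<..u}"
        then show "t \<in> (\<lambda>s. u + (- e) * s) ` {0..<1}"
          using e(2) by (intro image_eqI[of _ _ "(u - t) / e"]) (auto simp: field_simps)
      qed (use e(2) in auto)
      then have im: "circ ` {u - e<..u} = (\<lambda>s. circ (u + (- e) * s)) ` {0..<1}" by (simp add: image_image)
      have sp: "{u - e<..u} = insert u {u - e<..<u}" using e by auto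
      have "A \<inter> ?W = circ ` {u - e<..u}" unfolding AW sp using 3 u(3) by auto
      then show ?thesis using im homeomorphic_arc[of "- e" "{0..<1}" u, OF _ _ ivl_sub(1)] e by auto
    qed
  qed
  then show "\<exists>U. z \<in> U \<and> openin (top_of_set A) U \<and> (U homeomorphic {0<..<1::real} \<or> U homeomorphic {0..<1::real})"
    by (intro exI[of _ "A \<inter> ?W"] conjI zU W)
qed

section \<open>Finite decompositions into arcs\<close>

definition pieces :: "real set \<Rightarrow> complex set \<Rightarrow> bool" where
  "pieces P A \<longleftrightarrow> finite P \<and> (\<forall>a b. 0 \<le> a \<and> a < b \<and> b \<le> 1 \<and> {a<..<b} \<inter> P = {} \<longrightarrow>
     circ ` {a<..<b} \<subseteq> A \<or> circ ` {a<..<b} \<inter> A = {})"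

text \<open>Compactness selects finitely many centres of two-sided neighbourhoods. On an interval
  without centres, every point lies strictly on one side of a centre, so membership in
  \<open>A\<close> is locally constant and hence constant.\<close>

lemma submanifold_pieces:
  assumes A: "closed_1_submanifold A"
  shows "\<exists>P. pieces P A"
proof -
  define e where "e u = (SOME e. sided A u e)" for u
  have e: "sided A u (e u)" for u unfolding e_def using submanifold_sided[OF A] by (rule someI_ex)
  then have e0: "0 < e u" for u by (simp add: sided_def)
  have "compact {0..1::real}" by simp
  then obtain P where P: "P \<subseteq> {0..1}" "finite P" "{0..1} \<subseteq> (\<Union>u\<in>P. ball u (e u))"
  proof (rule compactE_image[of _ "{0..1}" "\<lambda>u. ball u (e u)"])
    show "{0..1} \<subseteq> (\<Union>u\<in>{0..1}. ball u (e u))" using e0 by fastforce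
  qed auto
  have "circ ` {a<..<b} \<subseteq> A \<or> circ ` {a<..<b} \<inter> A = {}" if ab: "0 \<le> a" "a < b" "b \<le> 1" "{a<..<b} \<inter> P = {}" for a b
  proof -
    let ?S = "{t \<in> {a<..<b}. circ t \<in> A}" and ?S' = "{t \<in> {a<..<b}. circ t \<notin> A}"
    have loc: "\<exists>d>0. \<forall>t. \<bar>t - p\<bar> < d \<longrightarrow> a < t \<and> t < b \<and> (circ t \<in> A \<longleftrightarrow> circ p \<in> A)" if p: "a < p" "p < b" for p
    proof -
      have "p \<in> {0..1}" using p ab by auto
      then obtain u where u: "u \<in> P" "\<bar>u - p\<bar> < e u" using P(3) by (auto simp: dist_real_def)
      have "u \<noteq> p" using u p ab(4) by auto
      define d where "d = Min {\<bar>u - p\<bar>, e u - \<bar>u - p\<bar>, p - a, b - p}"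
      have d: "0 < d" "d \<le> \<bar>u - p\<bar>" "d \<le> e u - \<bar>u - p\<bar>" "d \<le> p - a" "d \<le> b - p"
        using \<open>u \<noteq> p\<close> u p by (auto simp: d_def)
      show ?thesis
      proof (intro exI[of _ d] conjI allI impI)
        fix t assume t: "\<bar>t - p\<bar> < d"
        show "a < t" "t < b" using t d by linarith+
        show "circ t \<in> A \<longleftrightarrow> circ p \<in> A"
        proof (cases "u < p")
          case True
          then have "t \<in> {u<..<u + e u}" "p \<in> {u<..<u + e u}" using t d u by auto
          then show ?thesis using e[of u] unfolding sided_def by blast
        next
          case False
          then have "t \<in> {u - e u<..<u}" "p \<in> {u - e u<..<u}" using t d u \<open>u \<noteq> p\<close> by auto
          then show ?thesis using e[of u] unfolding sided_def by blast
        qed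
      qed (use d in auto)
    qed
    have "open ?S" "open ?S'"
      unfolding open_dist using loc by (auto simp: dist_real_def) (metis abs_minus_commute)+
    then have "?S \<inter> {a<..<b} = {} \<or> ?S' \<inter> {a<..<b} = {}"
      by (rule connectedD[OF connected_Ioo]) blast+
    then show ?thesis by auto
  qed
  then show ?thesis unfolding pieces_def by (intro exI[of _ P] conjI allI impI P(2)) simp
qed

text \<open>For u = 0 the left side of the point is the left side of the parameter 1, so break
  points near 1 have to be avoided as well.\<close>

lemma pieces_sided:
  assumes P: "pieces P A" and u: "0 \<le> u" "u < 1"
  obtains e where "0 < e" "e \<le> 1" "u + e \<le> 1" "circ ` {u<..<u + e} \<subseteq> A \<or> circ ` {u<..<u + e} \<inter> A = {}"
    "circ ` {u - e<..<u} \<subseteq> A \<or> circ ` {u - e<..<u} \<inter> A = {}"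
    "0 < u ==> e \<le> u" "{u<..<u + e} \<inter> P = {}" "0 < u ==> {u - e<..<u} \<inter> P = {}" "u = 0 ==> {1 - e<..<1} \<inter> P = {}"
proof -
  have fin: "finite P" using P by (simp add: pieces_def)
  obtain d1 where d1: "d1 > 0" "\<And>x. x \<in> P ==> x \<noteq> u ==> d1 \<le> dist u x" using finite_set_avoid[OF fin, of u] by blast
  obtain d2 where d2: "d2 > 0" "\<And>x. x \<in> P ==> x \<noteq> 1 ==> d2 \<le> dist 1 x" using finite_set_avoid[OF fin, of 1] by blast
  define e where "e = Min {d1, d2, 1 - u, if 0 < u then u else 1}"
  have e: "0 < e" "e \<le> d1" "e \<le> d2" "e \<le> 1 - u" "0 < u ==> e \<le> u" "e \<le> 1"
    using d1 d2 u by (auto simp: e_def)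
  have f1: "{u<..<u + e} \<inter> P = {}" and f2: "{u - e<..<u} \<inter> P = {}" and f3: "{1 - e<..<1} \<inter> P = {}"
    using d1(2) d2(2) e by (force simp: dist_real_def)+
  have r: "circ ` {u<..<u + e} \<subseteq> A \<or> circ ` {u<..<u + e} \<inter> A = {}"
    using P f1 e u unfolding pieces_def by simp
  have l: "circ ` {u - e<..<u} \<subseteq> A \<or> circ ` {u - e<..<u} \<inter> A = {}"
  proof (cases "0 < u")
    case True
    then show ?thesis using P f2 e u unfolding pieces_def by simp
  next
    case False
    then have u0: "u = 0" using u by simp
    have "circ ` {u - e<..<u} = circ ` {1 - e<..<1}"
    proof (intro equalityI subsetI)
      fix z assume "z \<in> circ ` {u - e<..<u}"
      then obtain t where "z = circ t" "u - e < t" "t < u" by auto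
      then show "z \<in> circ ` {1 - e<..<1}" using u0 circ_add_1(1)[of t] by (intro image_eqI[of _ _ "t + 1"]) auto
    next
      fix z assume "z \<in> circ ` {1 - e<..<1}"
      then obtain t where "z = circ t" "1 - e < t" "t < 1" by auto
      then show "z \<in> circ ` {u - e<..<u}" using u0 circ_add_1(2)[of t] by (intro image_eqI[of _ _ "t - 1"]) auto
    qed
    then show ?thesis using P f3 e unfolding pieces_def by simp
  qed
  show ?thesis using that[of e] e r l f1 f2 f3 by auto
qed

text \<open>This serves exact identities, with \<eta> = 0, and the estimate of the metric, where
  each arc of a decomposition contributes a small error.\<close>

lemma step_le:
  fixes g :: "real \<Rightarrow> real"
  assumes P: "finite P" and step: "\<And>a b. \<lbrakk>0 \<le> a; a < b; b \<le> 1; {a<..<b} \<inter> P = {}\<rbrakk> \<Longrightarrow> g b - g a \<le> \<eta>"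
    and \<eta>: "0 \<le> \<eta>" and t: "0 \<le> t" "t \<le> 1"
  shows "g t - g 0 \<le> \<eta> * (card P + 1)"
proof -
  have "g t - g 0 \<le> \<eta> * (card (P \<inter> {0<..<t}) + 1)" if "0 \<le> t" "t \<le> 1" for t
    using that
  proof (induction "card (P \<inter> {0<..<t})" arbitrary: t rule: less_induct)
    case less
    show ?case
    proof (cases "P \<inter> {0<..<t} = {}")
      case True
      then show ?thesis using step[of 0 t] \<eta> less.prems by (cases "t = 0") auto
    next
      case False
      define c where "c = Max (P \<inter> {0<..<t})"
      have fin: "finite (P \<inter> {0<..<t})" using P by simp
      have c: "c \<in> P" "0 < c" "c < t" using Max_in[OF fin False] by (auto simp: c_def)
      have "{c<..<t} \<inter> P = {}"
      proof (rule ccontr)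
        assume "{c<..<t} \<inter> P \<noteq> {}"
        then obtain d where "c < d" "d < t" "d \<in> P" by auto
        then show False using Max_ge[OF fin, of d] c by (auto simp: c_def)
      qed
      then have 1: "g t - g c \<le> \<eta>" using step[of c t] c less.prems by auto
      have "P \<inter> {0<..<c} \<subset> P \<inter> {0<..<t}" using c by auto
      then have lt: "card (P \<inter> {0<..<c}) < card (P \<inter> {0<..<t})" by (rule psubset_card_mono[OF fin])
      have "g c - g 0 \<le> \<eta> * (card (P \<inter> {0<..<c}) + 1)" by (rule less.hyps[OF lt]) (use c less.prems in auto)
      also have "\<dots> \<le> \<eta> * card (P \<inter> {0<..<t})" using lt \<eta> by (intro mult_left_mono) auto
      finally show ?thesis using 1 by (simp add: algebra_simps)
    qed
  qed
  from this[OF t] have "g t - g 0 \<le> \<eta> * (card (P \<inter> {0<..<t}) + 1)" .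
  also have "\<dots> \<le> \<eta> * (card P + 1)"
    using card_mono[OF P, of "P \<inter> {0<..<t}"] \<eta> by (intro mult_left_mono) auto
  finally show ?thesis .
qed

lemma step_eq:
  fixes g :: "real \<Rightarrow> real"
  assumes P: "finite P" and step: "\<And>a b. \<lbrakk>0 \<le> a; a < b; b \<le> 1; {a<..<b} \<inter> P = {}\<rbrakk> \<Longrightarrow> g b = g a"
    and t: "0 \<le> t" "t \<le> 1"
  shows "g t = g 0"
  using step_le[OF P, of g 0 t] step_le[OF P, of "\<lambda>t. - g t" 0 t] step t by force

section \<open>Arc length\<close>

lemma arc_set: "{s \<in> {0..t}. circ s \<in> A} = {0..t} \<inter> circ -` A"
  by auto

lemma closed_preimage: "closed A ==> closed (circ -` A)"
  by (rule closed_vimage[OF _ continuous_circ])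

lemma lmeasurable_arc: "closed A ==> {a..b} \<inter> circ -` A \<in> lmeasurable"
  by (intro lmeasurable_compact compact_Int_closed closed_preimage) auto

lemma arc_length_0[simp]: "arc_length A 0 = 0"
proof -
  have "negligible {s \<in> {0..0}. circ s \<in> A}" by (rule negligible_subset[of "{0}"]) auto
  then show ?thesis unfolding arc_length_def by (rule negligible_imp_measure0)
qed

lemma arc_length_diff:
  assumes "closed A" "0 \<le> s" "s \<le> t"
  shows "arc_length A t - arc_length A s = measure lebesgue ({s<..t} \<inter> circ -` A)"
    and "{s<..t} \<inter> circ -` A \<in> lmeasurable"
proof -
  have eq: "{s<..t} \<inter> circ -` A = {0..t} \<inter> circ -` A - {0..s} \<inter> circ -` A" using assms by auto
  show "{s<..t} \<inter> circ -` A \<in> lmeasurable"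
    unfolding eq by (intro fmeasurable_Diff lmeasurable_arc assms fmeasurableD)
  have "{0..s} \<inter> circ -` A \<subseteq> {0..t} \<inter> circ -` A" using assms by auto
  then show "arc_length A t - arc_length A s = measure lebesgue ({s<..t} \<inter> circ -` A)"
    unfolding eq arc_length_def arc_set
    using measurable_measure_Diff[OF lmeasurable_arc[OF assms(1)] fmeasurableD[OF lmeasurable_arc[OF assms(1)]]] by simp
qed

lemma arc_length_mono: "closed A ==> 0 \<le> s ==> s \<le> t ==> arc_length A s \<le> arc_length A t"
  using arc_length_diff(1)[of A s t] measure_nonneg[of lebesgue "{s<..t} \<inter> circ -` A"] by linarith

lemma arc_length_in:
  assumes "closed A" "0 \<le> s" "s \<le> t" "circ ` {s<..<t} \<subseteq> A"
  shows "arc_length A t - arc_length A s = t - s"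
proof (rule antisym)
  have "measure lebesgue ({s<..t} \<inter> circ -` A) \<le> measure lebesgue {s..t}"
    by (rule measure_mono_fmeasurable) (use arc_length_diff(2)[OF assms(1-3)] in auto)
  then show "arc_length A t - arc_length A s \<le> t - s"
    using arc_length_diff(1)[OF assms(1-3)] assms(3) by simp
  have "measure lebesgue {s<..<t} \<le> measure lebesgue ({s<..t} \<inter> circ -` A)"
    by (rule measure_mono_fmeasurable) (use arc_length_diff(2)[OF assms(1-3)] assms(4) in auto)
  then show "t - s \<le> arc_length A t - arc_length A s"
    using arc_length_diff(1)[OF assms(1-3)] assms(3) by simp
qed

lemma arc_length_out:
  assumes "closed A" "0 \<le> s" "s \<le> t" "circ ` {s<..<t} \<inter> A = {}"
  shows "arc_length A t = arc_length A s"
proof -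
  have "circ u \<notin> A" if "s < u" "u < t" for u
  proof -
    have "circ u \<in> circ ` {s<..<t}" using that by (intro imageI) simp
    then show ?thesis using assms(4) by blast
  qed
  then have "{s<..t} \<inter> circ -` A \<subseteq> {t}" by force
  then have "negligible ({s<..t} \<inter> circ -` A)" by (rule negligible_subset[rotated]) simp
  then have "measure lebesgue ({s<..t} \<inter> circ -` A) = 0" by (rule negligible_imp_measure0)
  then show ?thesis using arc_length_diff(1)[OF assms(1-3)] by simp
qed

section \<open>From cacti to functions\<close>

definition lobe :: "complex set list \<Rightarrow> nat \<Rightarrow> real \<Rightarrow> real" where
  "lobe x r t = real (length x) * arc_length (x ! r) t"

text \<open>The points of increase of \<open>f\<close>, that is, the support of the measure with
  distribution function \<open>f\<close>. Intervals are truncated at 0 and 1; the two ends are glued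
  only when \<open>circ\<close> is applied.\<close>

definition supp :: "(real \<Rightarrow> real) \<Rightarrow> real set" where
  "supp f = {u \<in> {0..1}. \<forall>e>0. f (max 0 (u - e)) < f (min 1 (u + e))}"

definition cactus_of :: "nat \<Rightarrow> (nat \<Rightarrow> real \<Rightarrow> real) \<Rightarrow> complex set list" where
  "cactus_of k f = map (\<lambda>r. circ ` supp (f r)) [0..<k]"

lemma closed_supp:
  assumes m: "\<And>s t. 0 \<le> s ==> s \<le> t ==> t \<le> 1 ==> f s \<le> f t"
  shows "closed (supp f)"
proof -
  have "open (- supp f)"
    unfolding open_dist
  proof
    fix u assume u: "u \<in> - supp f"
    show "\<exists>e>0. \<forall>y. dist y u < e \<longrightarrow> y \<in> - supp f"
    proof (cases "0 \<le> u \<and> u \<le> 1")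
      case False
      then show ?thesis
        by (intro exI[of _ "if u < 0 then - u else u - 1"]) (auto simp: supp_def dist_real_def)
    next
      case True
      then obtain e where e: "e > 0" "\<not> f (max 0 (u - e)) < f (min 1 (u + e))" using u by (auto simp: supp_def)
      show ?thesis
      proof (intro exI[of _ "e / 2"] conjI allI impI)
        fix y assume y: "dist y u < e / 2"
        show "y \<in> - supp f"
        proof
          assume ys: "y \<in> supp f"
          then have y01: "0 \<le> y" "y \<le> 1" by (auto simp: supp_def)
          have yb: "u - e \<le> y - e / 2" "y + e / 2 \<le> u + e" using y unfolding dist_real_def by linarith+
          have "f (max 0 (y - e / 2)) < f (min 1 (y + e / 2))" using ys e(1) by (auto simp: supp_def)
          moreover have "f (max 0 (u - e)) \<le> f (max 0 (y - e / 2))"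
            by (rule m) (use yb e(1) y01 True in auto)
          moreover have "f (min 1 (y + e / 2)) \<le> f (min 1 (u + e))"
            by (rule m) (use yb e(1) y01 True in auto)
          ultimately show False using e(2) by linarith
        qed
      qed (use e in simp)
    qed
  qed
  then show ?thesis by (simp add: closed_def)
qed

lemma cactus_of_cong:
  assumes "\<And>r t. r < k ==> 0 \<le> t ==> t \<le> 1 ==> f r t = g r t"
  shows "cactus_of k f = cactus_of k g"
proof -
  have "supp (f r) = supp (g r)" if "r < k" for r
    unfolding supp_def using assms[OF that] by auto
  then show ?thesis by (simp add: cactus_of_def)
qed

context
  fixes x k
  assumes x: "x \<in> cacti k" and k: "k \<noteq> 0"
begin

lemma cactus_length: "length x = k"
  using x k by (simp add: cacti_def)

lemma cactus_part: "r < k ==> closed_1_submanifold (x ! r)" "r < k ==> arc_length (x ! r) 1 = 1 / k"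
  using x k by (simp_all add: cacti_def)

lemma cactus_interiors:
  assumes "i < k" "j < k" "i \<noteq> j"
  shows "circle_interior (x ! i) \<inter> circle_interior (x ! j) = {}"
    and "\<not> (\<exists>z1 z2 z3 z4. cyclically_ordered z1 z2 z3 z4 \<and>
             z1 \<in> circle_interior (x ! j) \<and> z3 \<in> circle_interior (x ! j) \<and>
             z2 \<in> circle_interior (x ! i) \<and> z4 \<in> circle_interior (x ! i))"
proof -
  note * = x[unfolded cacti_def if_not_P[OF k] mem_Collect_eq, THEN conjunct2, THEN conjunct2, THEN conjunct2,
      rule_format, OF assms]
  show "circle_interior (x ! i) \<inter> circle_interior (x ! j) = {}" by (rule *[THEN conjunct1])
  show "\<not> (\<exists>z1 z2 z3 z4. cyclically_ordered z1 z2 z3 z4 \<and>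
             z1 \<in> circle_interior (x ! j) \<and> z3 \<in> circle_interior (x ! j) \<and>
             z2 \<in> circle_interior (x ! i) \<and> z4 \<in> circle_interior (x ! i))" by (rule *[THEN conjunct2])
qed

lemmas cactus_no_cross = cactus_interiors(2)

lemma cactus_part_closed: "r < k ==> closed (x ! r)" "r < k ==> x ! r \<subseteq> S1"
  using cactus_part(1)[of r] by (simp_all add: closed_1_submanifold_def)

text \<open>The midpoint of an arc without break points lies in some part, as the parts cover the
  circle, and then the whole arc does. A second part containing the arc would share interior points
  with the first.\<close>

lemma cactus_pieces:
  "\<exists>P. finite P \<and> (\<forall>r<k. pieces P (x ! r)) \<and> (\<forall>a b. 0 \<le> a \<longrightarrow> a < b \<longrightarrow> b \<le> 1 \<longrightarrow> {a<..<b} \<inter> P = {} \<longrightarrow>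
     (\<exists>r<k. circ ` {a<..<b} \<subseteq> x ! r \<and> (\<forall>j<k. j \<noteq> r \<longrightarrow> circ ` {a<..<b} \<inter> x ! j = {})))"
proof -
  have "\<forall>r\<in>{..<k}. \<exists>P. pieces P (x ! r)" using cactus_part(1) submanifold_pieces by simp
  from bchoice[OF this] obtain Q where Q: "\<And>r. r < k ==> pieces (Q r) (x ! r)" by auto
  define P where "P = (\<Union>r<k. Q r)"
  have fin: "finite P" using Q by (auto simp: P_def pieces_def)
  have pc: "circ ` {a<..<b} \<subseteq> x ! r \<or> circ ` {a<..<b} \<inter> x ! r = {}"
    if "r < k" "0 \<le> a" "a < b" "b \<le> 1" "{a<..<b} \<inter> P = {}" for r a b
  proof -
    have "{a<..<b} \<inter> Q r = {}" using that by (auto simp: P_def)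
    then show ?thesis using Q[OF that(1)] that unfolding pieces_def by simp
  qed
  have "\<exists>r<k. circ ` {a<..<b} \<subseteq> x ! r \<and> (\<forall>j<k. j \<noteq> r \<longrightarrow> circ ` {a<..<b} \<inter> x ! j = {})"
    if ab: "0 \<le> a" "a < b" "b \<le> 1" "{a<..<b} \<inter> P = {}" for a b
  proof -
    let ?m = "(a + b) / 2"
    have m: "circ ?m \<in> circ ` {a<..<b}" using ab by auto
    have "circ ?m \<in> (\<Union>j<k. x ! j)" using x k circ_in_S1[of ?m] by (simp add: cacti_def del: mem_sphere_0)
    then obtain r where r: "r < k" "circ ?m \<in> x ! r" by auto
    have rin: "circ ` {a<..<b} \<subseteq> x ! r" using pc[OF r(1) ab] r(2) m by auto
    have "circ ` {a<..<b} \<inter> x ! j = {}" if j: "j < k" "j \<noteq> r" for j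
    proof (rule ccontr)
      assume "circ ` {a<..<b} \<inter> x ! j \<noteq> {}"
      then have jin: "circ ` {a<..<b} \<subseteq> x ! j" using pc[OF j(1) ab] by blast
      have "{?m - (b - a) / 2<..<?m + (b - a) / 2} = {a<..<b}" by (auto simp: field_simps)
      then have "circ ?m \<in> circle_interior (x ! j)" "circ ?m \<in> circle_interior (x ! r)"
        unfolding circle_interior_iff using rin jin ab by (auto intro!: exI[of _ "(b - a) / 2"])
      moreover have "circle_interior (x ! j) \<inter> circle_interior (x ! r) = {}" by (rule cactus_interiors(1)[OF j(1) r(1) j(2)])
      ultimately show False by blast
    qed
    then show ?thesis using r(1) rin by blast
  qed
  moreover have "pieces P (x ! r)" if "r < k" for r
    unfolding pieces_def using fin pc[OF that] by simp
  ultimately show ?thesis using fin by blast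
qed

lemma lobe_mono: "r < k ==> 0 \<le> s ==> s \<le> t ==> lobe x r s \<le> lobe x r t"
  unfolding lobe_def by (intro mult_left_mono arc_length_mono cactus_part_closed) auto

lemma lobe_sum: "0 \<le> t ==> t \<le> 1 ==> (\<Sum>r<k. lobe x r t) = real k * t"
  and lobe_axis: "axis_parallel {..<k} (lobe x)"
proof -
  obtain P where P: "finite P" "\<And>a b. \<lbrakk>0 \<le> a; a < b; b \<le> 1; {a<..<b} \<inter> P = {}\<rbrakk> \<Longrightarrow>
     \<exists>r<k. circ ` {a<..<b} \<subseteq> x ! r \<and> (\<forall>j<k. j \<noteq> r \<longrightarrow> circ ` {a<..<b} \<inter> x ! j = {})"
    using cactus_pieces by metis
  show "axis_parallel {..<k} (lobe x)"
    unfolding axis_parallel_def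
  proof (intro exI[of _ P] conjI P(1) allI impI)
    fix a b :: real and i j
    assume ab: "0 \<le> a" "a < b" "b \<le> 1" "{a<..<b} \<inter> P = {}" and ij: "i \<in> {..<k}" "j \<in> {..<k}" "i \<noteq> j"
    obtain r where r: "\<And>j. j < k ==> j \<noteq> r ==> circ ` {a<..<b} \<inter> x ! j = {}" using P(2)[OF ab] by blast
    have "lobe x j a = lobe x j b" if "j < k" "j \<noteq> r" for j
      using arc_length_out[OF cactus_part_closed(1)[OF that(1)] ab(1) _ r[OF that]] ab by (simp add: lobe_def)
    then show "lobe x i a = lobe x i b \<or> lobe x j a = lobe x j b" using ij by (cases "i = r") auto
  qed
  assume t: "0 \<le> t" "t \<le> 1"
  have "(\<Sum>r<k. arc_length (x ! r) t) - t = (\<Sum>r<k. arc_length (x ! r) 0) - 0"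
  proof (rule step_eq[OF P(1) _ t, where g = "\<lambda>t. (\<Sum>r<k. arc_length (x ! r) t) - t"])
    fix a b :: real assume ab: "0 \<le> a" "a < b" "b \<le> 1" "{a<..<b} \<inter> P = {}"
    obtain r where r: "r < k" "circ ` {a<..<b} \<subseteq> x ! r" "\<And>j. j < k ==> j \<noteq> r ==> circ ` {a<..<b} \<inter> x ! j = {}"
      using P(2)[OF ab] by blast
    have "(\<Sum>j<k. arc_length (x ! j) b - arc_length (x ! j) a) = (\<Sum>j<k. if j = r then b - a else 0)"
    proof (rule sum.cong[OF refl])
      fix j assume j: "j \<in> {..<k}"
      show "arc_length (x ! j) b - arc_length (x ! j) a = (if j = r then b - a else 0)"
        using arc_length_in[OF cactus_part_closed(1) ab(1) _ r(2)] arc_length_out[OF cactus_part_closed(1) ab(1) _ r(3)] ab r(1) j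
        by auto
    qed
    also have "\<dots> = b - a" using r(1) by simp
    finally show "(\<Sum>r<k. arc_length (x ! r) b) - b = (\<Sum>r<k. arc_length (x ! r) a) - a" by (simp add: sum_subtractf)
  qed
  then have "(\<Sum>r<k. arc_length (x ! r) t) = t" by simp
  then show "(\<Sum>r<k. lobe x r t) = real k * t"
    unfolding lobe_def cactus_length sum_distrib_left[symmetric] by simp
qed

lemma lobe_cactus_fun: "cactus_fun k (lobe x)"
  unfolding cactus_fun_def mono_on_def
  using lobe_mono lobe_sum cactus_part(2) cactus_length k by (auto simp: lobe_def)

text \<open>Without interior points in between, no arc of the decomposition lies in the part there,
  and its arc length would not grow.\<close>

lemma interior_between:
  assumes r: "r < k" and ab: "0 \<le> a" "b \<le> 1" "lobe x r a < lobe x r b"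
  shows "\<exists>u. a < u \<and> u < b \<and> circ u \<in> circle_interior (x ! r)"
proof (rule ccontr)
  assume no: "\<not> ?thesis"
  have "\<not> b \<le> a"
  proof
    assume "b \<le> a"
    show False
    proof (cases "0 \<le> b")
      case True
      then show False using lobe_mono[OF r True \<open>b \<le> a\<close>] ab by simp
    next
      case False
      then have "{s \<in> {0..b}. circ s \<in> x ! r} = {}" by auto
      then have "lobe x r b = 0" unfolding lobe_def arc_length_def by (simp only: measure_empty mult_zero_right)
      moreover have "0 \<le> lobe x r a" by (simp add: lobe_def arc_length_def)
      ultimately show False using ab by simp
    qed
  qed
  then have lt: "a < b" by simp
  obtain P where P: "pieces P (x ! r)" using cactus_pieces r by blast
  \<comment> \<open>Clamping the parameter to the interval from \<open>a\<close> to \<open>b\<close>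
    makes the piecewise argument on the unit interval applicable.\<close>
  let ?c = "\<lambda>t. max a (min b t)"
  have cl: "closed (x ! r)" using cactus_part_closed r by blast
  have "arc_length (x ! r) (?c 1) = arc_length (x ! r) (?c 0)"
  proof (rule step_eq[where g = "\<lambda>t. arc_length (x ! r) (?c t)" and P = "insert a (insert b P)"])
    show "finite (insert a (insert b P))" using P by (simp add: pieces_def)
    fix c d :: real assume cd: "0 \<le> c" "c < d" "d \<le> 1" "{c<..<d} \<inter> insert a (insert b P) = {}"
    show "arc_length (x ! r) (?c d) = arc_length (x ! r) (?c c)"
    proof (cases "d \<le> a \<or> b \<le> c")
      case True
      then have "?c d = ?c c" using cd lt by auto
      then show ?thesis by simp
    next
      case False
      have ac: "a \<le> c" "d \<le> b" using False cd(2,4) by (force simp: not_le)+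
      have "{c<..<d} \<inter> P = {}" using cd(4) by auto
      then have "circ ` {c<..<d} \<subseteq> x ! r \<or> circ ` {c<..<d} \<inter> x ! r = {}" using P cd by (simp add: pieces_def)
      then show ?thesis
      proof
        assume sub: "circ ` {c<..<d} \<subseteq> x ! r"
        have "{(c + d) / 2 - (d - c) / 2<..<(c + d) / 2 + (d - c) / 2} = {c<..<d}" by (auto simp: field_simps)
        then have "circ ((c + d) / 2) \<in> circle_interior (x ! r)"
          unfolding circle_interior_iff using sub cd by (auto intro!: exI[of _ "(d - c) / 2"])
        moreover have "a < (c + d) / 2" "(c + d) / 2 < b" using ac cd by auto
        ultimately show ?thesis using no by blast
      next
        assume "circ ` {c<..<d} \<inter> x ! r = {}"
        then show ?thesis using arc_length_out[OF cl, of c d] ac cd lt by (simp add: max_def min_def)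
      qed
    qed
  qed auto
  then show False using ab lt by (simp add: lobe_def)
qed

lemma lobe_treelike: "treelike {..<k} (lobe x)"
proof -
  have "noncrossing {..<k} (lobe x)"
    unfolding noncrossing_def
  proof (intro ballI allI impI notI)
    fix i j and a b c d e :: real
    assume ij: "i \<in> {..<k}" "j \<in> {..<k}" and o: "i \<noteq> j \<and> 0 \<le> a \<and> a \<le> b \<and> b \<le> c \<and> c \<le> d \<and> d \<le> e \<and> e \<le> 1"
      and lt: "lobe x i a < lobe x i b \<and> lobe x j b < lobe x j c \<and> lobe x i c < lobe x i d \<and> lobe x j d < lobe x j e"
    have ij': "i < k" "j < k" using ij by auto
    obtain u1 where u1: "a < u1" "u1 < b" "circ u1 \<in> circle_interior (x ! i)" using interior_between[OF ij'(1), of a b] o lt by auto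
    obtain u2 where u2: "b < u2" "u2 < c" "circ u2 \<in> circle_interior (x ! j)" using interior_between[OF ij'(2), of b c] o lt by auto
    obtain u3 where u3: "c < u3" "u3 < d" "circ u3 \<in> circle_interior (x ! i)" using interior_between[OF ij'(1), of c d] o lt by auto
    obtain u4 where u4: "d < u4" "u4 < e" "circ u4 \<in> circle_interior (x ! j)" using interior_between[OF ij'(2), of d e] o lt by auto
    have "cyclically_ordered (circ u1) (circ u2) (circ u3) (circ u4)"
      unfolding cyclically_ordered_def using u1 u2 u3 u4 o by (intro exI[of _ u1] exI[of _ u2] exI[of _ u3] exI[of _ u4]) auto
    then show False using cactus_no_cross[OF ij'(2,1)] o u1(3) u2(3) u3(3) u4(3) by blast
  qed
  then show ?thesis using lobe_axis by (simp add: treelike_def)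
qed

text \<open>Every point of a submanifold has a side inside, along which the arc length increases.
  For the base point with only its left side inside, the parameter 1 has to be used in place of
  0.\<close>

lemma cactus_supp:
  assumes r: "r < k"
  shows "x ! r = circ ` supp (lobe x r)"
proof (intro equalityI subsetI)
  note cl = cactus_part_closed[OF r]
  have k0: "real (length x) > 0" using cactus_length k by simp
  have lt: "lobe x r a < lobe x r b" if "0 \<le> a" "a \<le> c" "c < d" "d \<le> b" "circ ` {c<..<d} \<subseteq> x ! r" for a b c d
  proof -
    have "arc_length (x ! r) d - arc_length (x ! r) c = d - c" by (rule arc_length_in[OF cl(1)]) (use that in auto)
    then have "arc_length (x ! r) c < arc_length (x ! r) d" using that by linarith
    then have "arc_length (x ! r) a < arc_length (x ! r) b"
      using arc_length_mono[OF cl(1), of a c] arc_length_mono[OF cl(1), of d b] that by linarith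
    then show ?thesis unfolding lobe_def using k0 by simp
  qed
  {
    fix z assume z: "z \<in> x ! r"
    then obtain u where u: "0 \<le> u" "u < 1" "circ u = z" using circ_surj cl(2) by blast
    obtain e where e: "sided (x ! r) u e" using submanifold_sided[OF cactus_part(1)[OF r]] by blast
    then have e0: "0 < e" by (simp add: sided_def)
    from e z u(3) have "circ ` {u<..<u + e} \<subseteq> x ! r \<or> circ ` {u - e<..<u} \<subseteq> x ! r" unfolding sided_def by blast
    then show "z \<in> circ ` supp (lobe x r)"
    proof
      assume R: "circ ` {u<..<u + e} \<subseteq> x ! r"
      have "u \<in> supp (lobe x r)"
        unfolding supp_def
      proof (intro CollectI conjI allI impI)
        fix e' :: real assume e': "0 < e'"
        define d where "d = min (min 1 (u + e')) (u + e)"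
        have "{u<..<d} \<subseteq> {u<..<u + e}" by (auto simp: d_def)
        then have "circ ` {u<..<d} \<subseteq> x ! r" using R by blast
        then show "lobe x r (max 0 (u - e')) < lobe x r (min 1 (u + e'))"
          by (rule lt[where c = u and d = d, rotated 4]) (use u e' e0 in \<open>auto simp: d_def\<close>)
      qed (use u in auto)
      then show ?thesis using u(3) by blast
    next
      assume L: "circ ` {u - e<..<u} \<subseteq> x ! r"
      define v where "v = (if u = 0 then 1 else u)"
      have v: "0 < v" "v \<le> 1" "circ v = z" using u by (auto simp: v_def)
      have "circ ` {v - e<..<v} \<subseteq> x ! r"
      proof (cases "u = 0")
        case True
        have "circ t \<in> x ! r" if "v - e < t" "t < v" for t
        proof -
          have "t - 1 \<in> {u - e<..<u}" using that True by (auto simp: v_def)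
          then show ?thesis using L circ_add_1(2)[of t] by (metis image_subset_iff)
        qed
        then show ?thesis by auto
      qed (use L in \<open>simp add: v_def\<close>)
      note L' = this
      have "v \<in> supp (lobe x r)"
        unfolding supp_def
      proof (intro CollectI conjI allI impI)
        fix e' :: real assume e': "0 < e'"
        define c where "c = max (max 0 (v - e')) (v - e)"
        have "{c<..<v} \<subseteq> {v - e<..<v}" by (auto simp: c_def)
        then have "circ ` {c<..<v} \<subseteq> x ! r" using L' by blast
        then show "lobe x r (max 0 (v - e')) < lobe x r (min 1 (v + e'))"
          by (rule lt[where c = c and d = v, rotated 4]) (use v e' e0 in \<open>auto simp: c_def\<close>)
      qed (use v in auto)
      then show ?thesis using v(3) by blast
    qed
  next
    fix z assume "z \<in> circ ` supp (lobe x r)"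
    then obtain u where u: "u \<in> supp (lobe x r)" "z = circ u" by blast
    then have u01: "0 \<le> u" "u \<le> 1" by (auto simp: supp_def)
    show "z \<in> x ! r"
    proof (rule ccontr)
      assume "z \<notin> x ! r"
      then have "u \<in> - (circ -` (x ! r))" using u by simp
      moreover have "open (- (circ -` (x ! r)))" using closed_preimage[OF cl(1)] by (simp add: open_Compl)
      ultimately obtain e where e: "e > 0" "ball u e \<subseteq> - (circ -` (x ! r))" using open_contains_ball by blast
      have "circ ` {max 0 (u - e)<..<min 1 (u + e)} \<inter> x ! r = {}"
      proof -
        have "circ t \<notin> x ! r" if "max 0 (u - e) < t" "t < min 1 (u + e)" for t
        proof -
          have "t \<in> ball u e" using that by (auto simp: dist_real_def)
          then show ?thesis using e by blast
        qed
        then show ?thesis by auto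
      qed
      then have "lobe x r (min 1 (u + e)) = lobe x r (max 0 (u - e))"
        using arc_length_out[OF cl(1), of "max 0 (u - e)" "min 1 (u + e)"] u01 e(1) by (simp add: lobe_def)
      moreover have "lobe x r (max 0 (u - e)) < lobe x r (min 1 (u + e))" using u(1) e(1) by (simp add: supp_def)
      ultimately show False by simp
    qed
  }
qed

lemma cactus_of_lobe: "cactus_of k (lobe x) = x"
  by (rule nth_equalityI) (use cactus_length cactus_supp in \<open>auto simp: cactus_of_def\<close>)

end

section \<open>From functions to cacti\<close>

definition axis_pieces :: "nat \<Rightarrow> (nat \<Rightarrow> real \<Rightarrow> real) \<Rightarrow> real set \<Rightarrow> bool" where
  "axis_pieces k f P \<longleftrightarrow> finite P \<and> (\<forall>r<k. pieces P (circ ` supp (f r))) \<and>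
    (\<forall>r a b. r < k \<longrightarrow> 0 \<le> a \<longrightarrow> a < b \<longrightarrow> b \<le> 1 \<longrightarrow> {a<..<b} \<inter> P = {} \<longrightarrow>
      (circ ` {a<..<b} \<subseteq> circ ` supp (f r) \<and> f r b - f r a = real k * (b - a)) \<or>
      (circ ` {a<..<b} \<inter> circ ` supp (f r) = {} \<and> f r b = f r a)) \<and>
    (\<forall>i j a b. i < k \<longrightarrow> j < k \<longrightarrow> i \<noteq> j \<longrightarrow> 0 \<le> a \<longrightarrow> a < b \<longrightarrow> b \<le> 1 \<longrightarrow> {a<..<b} \<inter> P = {} \<longrightarrow>
      f i a = f i b \<or> f j a = f j b)"

lemma axis_piecesD:
  assumes "axis_pieces k f P"
  shows "finite P" "r < k ==> pieces P (circ ` supp (f r))"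
    "\<lbrakk>r < k; 0 \<le> a; a < b; b \<le> 1; {a<..<b} \<inter> P = {}\<rbrakk> \<Longrightarrow>
      (circ ` {a<..<b} \<subseteq> circ ` supp (f r) \<and> f r b - f r a = real k * (b - a)) \<or>
      (circ ` {a<..<b} \<inter> circ ` supp (f r) = {} \<and> f r b = f r a)"
    "\<lbrakk>i < k; j < k; i \<noteq> j; 0 \<le> a; a < b; b \<le> 1; {a<..<b} \<inter> P = {}\<rbrakk> \<Longrightarrow> f i a = f i b \<or> f j a = f j b"
  using assms unfolding axis_pieces_def by simp_all

context
  fixes f :: "nat \<Rightarrow> real \<Rightarrow> real" and k :: nat
  assumes f: "cactus_fun k f" and tl: "treelike {..<k} f" and k: "k \<noteq> 0"
begin

lemma fun_mono: "r < k ==> 0 \<le> s ==> s \<le> t ==> t \<le> 1 ==> f r s \<le> f r t"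
  using f unfolding cactus_fun_def mono_on_def by auto

text \<open>The sum of the functions has slope k, so on an interval where at most one of them moves,
  exactly one does, with slope k.\<close>

lemma fun_pieces:
  "\<exists>P. finite P \<and> (\<forall>a b. 0 \<le> a \<longrightarrow> a < b \<longrightarrow> b \<le> 1 \<longrightarrow> {a<..<b} \<inter> P = {} \<longrightarrow>
     (\<exists>r<k. (\<forall>s t. a \<le> s \<longrightarrow> s \<le> t \<longrightarrow> t \<le> b \<longrightarrow> f r t - f r s = real k * (t - s)) \<and> (\<forall>j<k. j \<noteq> r \<longrightarrow> f j a = f j b)))"
proof -
  obtain P where P: "finite P" "\<forall>a b i j. 0 \<le> a \<longrightarrow> a < b \<longrightarrow> b \<le> 1 \<longrightarrow> {a<..<b} \<inter> P = {} \<longrightarrow>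
     i \<in> {..<k} \<longrightarrow> j \<in> {..<k} \<longrightarrow> i \<noteq> j \<longrightarrow> f i a = f i b \<or> f j a = f j b"
    using tl unfolding treelike_def axis_parallel_def by (elim exE conjE)
  show ?thesis
  proof (intro exI[of _ P] conjI P(1) allI impI)
    fix a b :: real assume ab: "0 \<le> a" "a < b" "b \<le> 1" "{a<..<b} \<inter> P = {}"
    have sum: "(\<Sum>j<k. f j t) = real k * t" if "0 \<le> t" "t \<le> 1" for t using f that by (simp add: cactus_fun_def)
    have "\<exists>r<k. f r a \<noteq> f r b"
    proof (rule ccontr)
      assume "\<not> ?thesis"
      then have "(\<Sum>j<k. f j a) = (\<Sum>j<k. f j b)" by (intro sum.cong) auto
      then show False using sum[of a] sum[of b] ab k by simp
    qed
    then obtain r where r: "r < k" "f r a \<noteq> f r b" by blast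
    have oth: "f j a = f j b" if "j < k" "j \<noteq> r" for j using P(2)[rule_format, of a b j r] ab that r by auto
    have "f r t - f r s = real k * (t - s)" if st: "a \<le> s" "s \<le> t" "t \<le> b" for s t
    proof -
      have "f j s = f j t" if j: "j < k" "j \<noteq> r" for j
        using oth[OF j] fun_mono[OF j(1), of a s] fun_mono[OF j(1), of s t] fun_mono[OF j(1), of t b] st ab by linarith
      then have "(\<Sum>j\<in>{..<k} - {r}. f j s) = (\<Sum>j\<in>{..<k} - {r}. f j t)" by (intro sum.cong) auto
      then show ?thesis
        using sum[of s] sum[of t] st ab r(1) sum.remove[of "{..<k}" r "\<lambda>j. f j s"] sum.remove[of "{..<k}" r "\<lambda>j. f j t"]
        by (simp add: algebra_simps)
    qed
    then show "\<exists>r<k. (\<forall>s t. a \<le> s \<longrightarrow> s \<le> t \<longrightarrow> t \<le> b \<longrightarrow> f r t - f r s = real k * (t - s)) \<and> (\<forall>j<k. j \<noteq> r \<longrightarrow> f j a = f j b)"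
      using r(1) oth by blast
  qed
qed

lemma supp_in:
  assumes r: "r < k" and ab: "0 \<le> a" "b \<le> 1" "\<And>s t. a \<le> s ==> s \<le> t ==> t \<le> b ==> f r t - f r s = real k * (t - s)"
  shows "{a<..<b} \<subseteq> supp (f r)"
proof
  fix u assume u: "u \<in> {a<..<b}"
  show "u \<in> supp (f r)"
    unfolding supp_def
  proof (intro CollectI conjI allI impI)
    fix e :: real assume e: "0 < e"
    define s where "s = max a (u - e)"
    have s: "a \<le> s" "s < u" "max 0 (u - e) \<le> s" using u e ab by (auto simp: s_def)
    have "f r u - f r s = real k * (u - s)" by (rule ab(3)) (use u s in auto)
    moreover have "real k * (u - s) > 0" using s k by simp
    moreover have "f r (max 0 (u - e)) \<le> f r s" by (rule fun_mono[OF r]) (use s u ab in auto)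
    moreover have "f r u \<le> f r (min 1 (u + e))" by (rule fun_mono[OF r]) (use e u ab in auto)
    ultimately show "f r (max 0 (u - e)) < f r (min 1 (u + e))" by linarith
  qed (use u ab in auto)
qed

lemma supp_out:
  assumes r: "r < k" and ab: "0 \<le> a" "b \<le> 1" "f r a = f r b"
  shows "{a<..<b} \<inter> supp (f r) = {}"
proof -
  have False if u: "a < u" "u < b" "u \<in> supp (f r)" for u
  proof -
    define e where "e = min (u - a) (b - u)"
    have e: "0 < e" "a \<le> u - e" "u + e \<le> b" using u by (auto simp: e_def)
    have "f r (max 0 (u - e)) < f r (min 1 (u + e))" using u(3) e(1) by (simp add: supp_def)
    moreover have "f r a \<le> f r (max 0 (u - e))" by (rule fun_mono[OF r]) (use e ab u in auto)
    moreover have "f r (min 1 (u + e)) \<le> f r b" by (rule fun_mono[OF r]) (use e ab u in auto)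
    ultimately show False using ab(3) by linarith
  qed
  then show ?thesis by auto
qed

lemma circ_supp_disjoint:
  assumes "0 \<le> a" "b \<le> 1" "{a<..<b} \<inter> supp g = {}"
  shows "circ ` {a<..<b} \<inter> circ ` supp g = {}"
proof -
  have False if "a < t" "t < b" "u \<in> supp g" "circ t = circ u" for t u
  proof -
    have "t = u" using circ_inj[OF that(4)] that assms(1,2) by (auto simp: supp_def)
    then show False using that assms(3) by auto
  qed
  then show ?thesis by auto
qed

lemma fun_pieces_supp: "\<exists>P. axis_pieces k f P"
proof -
  obtain P where P: "finite P" "\<And>a b. \<lbrakk>0 \<le> a; a < b; b \<le> 1; {a<..<b} \<inter> P = {}\<rbrakk> \<Longrightarrow>
     \<exists>r<k. (\<forall>s t. a \<le> s \<longrightarrow> s \<le> t \<longrightarrow> t \<le> b \<longrightarrow> f r t - f r s = real k * (t - s)) \<and> (\<forall>j<k. j \<noteq> r \<longrightarrow> f j a = f j b)"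
    using fun_pieces by metis
  have d: "(circ ` {a<..<b} \<subseteq> circ ` supp (f r) \<and> f r b - f r a = real k * (b - a)) \<or>
      (circ ` {a<..<b} \<inter> circ ` supp (f r) = {} \<and> f r b = f r a)"
    if r: "r < k" and ab: "0 \<le> a" "a < b" "b \<le> 1" "{a<..<b} \<inter> P = {}" for r a b
  proof -
    obtain q where q: "q < k" "\<And>s t. a \<le> s ==> s \<le> t ==> t \<le> b ==> f q t - f q s = real k * (t - s)" "\<And>j. j < k ==> j \<noteq> q ==> f j a = f j b"
      using P(2)[OF ab] by metis
    show ?thesis
    proof (cases "r = q")
      case True
      then have "circ ` {a<..<b} \<subseteq> circ ` supp (f r)" using supp_in[OF r ab(1,3)] q(2) by (intro image_mono) auto
      then show ?thesis using q(2)[of a b] ab True by simp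
    next
      case False
      then show ?thesis using circ_supp_disjoint[OF ab(1,3) supp_out[OF r ab(1,3)]] q(3)[OF r] by simp
    qed
  qed
  have "pieces P (circ ` supp (f r))" if "r < k" for r
    unfolding pieces_def using P(1) d[OF that] by blast
  moreover have "f i a = f i b \<or> f j a = f j b" if "i < k" "j < k" "i \<noteq> j" "0 \<le> a" "a < b" "b \<le> 1" "{a<..<b} \<inter> P = {}" for i j a b
    using P(2)[OF that(4-7)] that(1-3) by metis
  ultimately show ?thesis unfolding axis_pieces_def
    by (intro exI[of _ P] conjI allI impI P(1) d)
qed

lemma closed_part: "r < k ==> closed (circ ` supp (f r))"
proof -
  assume r: "r < k"
  have "compact ({0..1} \<inter> supp (f r))" using closed_supp[of "f r", OF fun_mono[OF r]] by (simp add: compact_Int_closed)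
  moreover have "{0..1} \<inter> supp (f r) = supp (f r)" by (auto simp: supp_def)
  ultimately show ?thesis by (simp add: compact_imp_closed compact_continuous_image continuous_circ)
qed

text \<open>If neither side of a point of the part lay in the part, the function would be constant
  on both sides, and the point not one of increase. The base point needs care, as it may stem from
  the parameter 1 while its representative is 0.\<close>

lemma part_submanifold:
  assumes r: "r < k"
  shows "closed_1_submanifold (circ ` supp (f r))"
proof (rule sided_submanifold)
  show "circ ` supp (f r) \<subseteq> S1" by auto
  show "closed (circ ` supp (f r))" by (rule closed_part[OF r])
  obtain P where ap: "axis_pieces k f P" using fun_pieces_supp by blast
  note P = axis_piecesD(1)[OF ap] axis_piecesD(2)[OF ap r] axis_piecesD(3)[OF ap r]
  let ?A = "circ ` supp (f r)"
  fix u assume u: "0 \<le> u" "u < 1" "circ u \<in> ?A"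
  obtain e where e: "0 < e" "e \<le> 1" "u + e \<le> 1" "circ ` {u<..<u + e} \<subseteq> ?A \<or> circ ` {u<..<u + e} \<inter> ?A = {}"
    "circ ` {u - e<..<u} \<subseteq> ?A \<or> circ ` {u - e<..<u} \<inter> ?A = {}"
    "0 < u ==> e \<le> u" "{u<..<u + e} \<inter> P = {}" "0 < u ==> {u - e<..<u} \<inter> P = {}" "u = 0 ==> {1 - e<..<1} \<inter> P = {}"
    using pieces_sided[OF P(2) u(1,2)] by blast
  have eq: "f r b = f r a" if "0 \<le> a" "a < b" "b \<le> 1" "{a<..<b} \<inter> P = {}" "circ ((a + b) / 2) \<notin> ?A" for a b
  proof -
    have "circ ((a + b) / 2) \<in> circ ` {a<..<b}" using that by auto
    then show ?thesis using P(3)[OF that(1-4)] that(5) by blast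
  qed
  have "circ ` {u<..<u + e} \<subseteq> ?A \<or> circ ` {u - e<..<u} \<subseteq> ?A"
  proof (rule ccontr)
    assume "\<not> ?thesis"
    then have out: "circ ` {u<..<u + e} \<inter> ?A = {}" "circ ` {u - e<..<u} \<inter> ?A = {}" using e(4,5) by blast+
    have R: "f r (u + e) = f r u"
    proof (rule eq)
      have "circ ((u + (u + e)) / 2) \<in> circ ` {u<..<u + e}" using e(1) by (intro imageI) auto
      then show "circ ((u + (u + e)) / 2) \<notin> ?A" using out(1) by blast
    qed (use u e in auto)
    obtain v where v: "v \<in> supp (f r)" "circ u = circ v" using u(3) by auto
    have v01: "0 \<le> v" "v \<le> 1" using v(1) by (auto simp: supp_def)
    have inc: "f r (max 0 (v - e)) < f r (min 1 (v + e))" using v(1) e(1) by (simp add: supp_def)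
    show False
    proof (cases "v = u")
      case True
      show False
      proof (cases "u = 0")
        case True
        then show False using inc R \<open>v = u\<close> e(1,3) by (simp add: min_def max_def)
      next
        case False
        then have u0: "0 < u" using u(1) by simp
        have "f r u = f r (u - e)"
        proof (rule eq)
          have "circ ((u - e + u) / 2) \<in> circ ` {u - e<..<u}" using e(1) by (intro imageI) auto
          then show "circ ((u - e + u) / 2) \<notin> ?A" using out(2) by blast
        qed (use u0 u e(1) e(6)[OF u0] e(8)[OF u0] in auto)
        then show False using inc R \<open>v = u\<close> e(1,3) e(6)[OF u0] by (simp add: min_def max_def)
      qed
    next
      case False
      then have uv: "u = 0" "v = 1"
      proof -
        have "\<not> \<bar>u - v\<bar> < 1" using circ_inj[OF v(2)] False by auto
        then show "u = 0" "v = 1" using u v01 by linarith+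
      qed
      have "f r 1 = f r (1 - e)"
      proof (rule eq)
        have "circ ((1 - e + 1) / 2) = circ ((1 - e + 1) / 2 - 1)" using circ_add_1(2) by simp
        also have "\<dots> \<in> circ ` {u - e<..<u}" using e(1) uv by (intro imageI) (auto simp: field_simps)
        finally show "circ ((1 - e + 1) / 2) \<notin> ?A" using out(2) by blast
      qed (use e(1,2) e(9)[OF uv(1)] in auto)
      then show False using inc uv e(1,2) by (simp add: min_def max_def)
    qed
  qed
  then show "\<exists>e. sided ?A u e" using e(1,4,5) unfolding sided_def by blast
qed

lemma arc_length_part:
  assumes r: "r < k" and t: "0 \<le> t" "t \<le> 1"
  shows "real k * arc_length (circ ` supp (f r)) t = f r t"
proof -
  obtain P where ap: "axis_pieces k f P" using fun_pieces_supp by blast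
  note P = axis_piecesD(1)[OF ap] axis_piecesD(3)[OF ap r]
  note cl = closed_part[OF r]
  let ?h = "\<lambda>t. real k * arc_length (circ ` supp (f r)) t - f r t"
  have "?h t = ?h 0"
  proof (rule step_eq[OF P(1) _ t])
    fix a b :: real assume ab: "0 \<le> a" "a < b" "b \<le> 1" "{a<..<b} \<inter> P = {}"
    from P(2)[OF ab] show "?h b = ?h a"
    proof (elim disjE conjE)
      assume *: "circ ` {a<..<b} \<subseteq> circ ` supp (f r)" "f r b - f r a = real k * (b - a)"
      have "arc_length (circ ` supp (f r)) b = arc_length (circ ` supp (f r)) a + (b - a)"
        using arc_length_in[OF cl ab(1) _ *(1)] ab(2) by simp
      then have "real k * arc_length (circ ` supp (f r)) b = real k * arc_length (circ ` supp (f r)) a + real k * (b - a)"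
        by (simp add: distrib_left)
      then show ?thesis using *(2) by linarith
    next
      assume *: "circ ` {a<..<b} \<inter> circ ` supp (f r) = {}" "f r b = f r a"
      show ?thesis using arc_length_out[OF cl ab(1) _ *(1)] ab(2) *(2) by simp
    qed
  qed
  then show ?thesis using f r by (simp add: cactus_fun_def)
qed

lemma interior_increasing:
  assumes r: "r < k" and u: "circ u \<in> circle_interior (circ ` supp (f r))" "0 \<le> u" "u < b" "b \<le> 1"
  shows "f r u < f r b"
proof -
  obtain P where ap: "axis_pieces k f P" using fun_pieces_supp by blast
  note P = axis_piecesD(1)[OF ap] axis_piecesD(2)[OF ap r] axis_piecesD(3)[OF ap r]
  obtain e1 where e1: "e1 > 0" "circ ` {u - e1<..<u + e1} \<subseteq> circ ` supp (f r)" using u(1) circle_interior_iff by blast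
  have u1: "u < 1" using u by simp
  obtain e where e: "0 < e" "u + e \<le> 1" "{u<..<u + e} \<inter> P = {}" using pieces_sided[OF P(2) u(2) u1] by metis
  define d where "d = min b (min (u + e) (u + e1))"
  have d: "u < d" "d \<le> b" "d \<le> u + e" "d \<le> u + e1" using u e(1) e1(1) by (auto simp: d_def)
  have free: "{u<..<d} \<inter> P = {}"
  proof -
    have "{u<..<d} \<subseteq> {u<..<u + e}" using d by auto
    then show ?thesis using e(3) by blast
  qed
  have "circ ((u + d) / 2) \<in> circ ` {u<..<d}" "circ ((u + d) / 2) \<in> circ ` {u - e1<..<u + e1}"
    by (intro imageI; use d e1(1) in \<open>simp add: field_simps\<close>)+
  then have "f r d - f r u = real k * (d - u)"
    using P(3)[of u d] free u(2,4) d(1,2) e1(2) by (metis disjoint_iff order_trans subsetD)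
  moreover have "real k * (d - u) > 0" using d k by simp
  moreover have "f r d \<le> f r b" by (rule fun_mono[OF r]) (use d u in auto)
  ultimately show ?thesis by linarith
qed

text \<open>Around a point outside all supports every function would be constant, against the slope
  k of their sum.\<close>

lemma parts_cover: "(\<Union>r<k. circ ` supp (f r)) = S1"
proof (intro equalityI subsetI)
  fix z assume "z \<in> S1"
  then obtain u where u: "0 \<le> u" "u < 1" "circ u = z" using circ_surj by blast
  have "\<exists>r<k. u \<in> supp (f r)"
  proof (rule ccontr)
    assume "\<not> ?thesis"
    then have "\<forall>r\<in>{..<k}. \<exists>e>0. \<not> f r (max 0 (u - e)) < f r (min 1 (u + e))" using u by (auto simp: supp_def)
    from bchoice[OF this] obtain e where e: "\<And>r. r < k ==> e r > 0" "\<And>r. r < k ==> \<not> f r (max 0 (u - e r)) < f r (min 1 (u + e r))"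
      by auto
    define d where "d = Min (e ` {..<k})"
    have d: "d > 0" "\<And>r. r < k ==> d \<le> e r" using e(1) k by (auto simp: d_def Min_gr_iff lessThan_empty_iff)
    have "f r (max 0 (u - d)) = f r (min 1 (u + d))" if r: "r < k" for r
    proof (rule antisym)
      show "f r (max 0 (u - d)) \<le> f r (min 1 (u + d))" by (rule fun_mono[OF r]) (use u d in auto)
      have "f r (min 1 (u + d)) \<le> f r (min 1 (u + e r))" by (rule fun_mono[OF r]) (use u d(1) d(2)[OF r] in auto)
      also have "\<dots> \<le> f r (max 0 (u - e r))" using e(2)[OF r] by simp
      also have "\<dots> \<le> f r (max 0 (u - d))" by (rule fun_mono[OF r]) (use u d(1) d(2)[OF r] in auto)
      finally show "f r (min 1 (u + d)) \<le> f r (max 0 (u - d))" .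
    qed
    then have "(\<Sum>r<k. f r (max 0 (u - d))) = (\<Sum>r<k. f r (min 1 (u + d)))" by (intro sum.cong) auto
    moreover have "(\<Sum>r<k. f r t) = real k * t" if "0 \<le> t" "t \<le> 1" for t using f that by (simp add: cactus_fun_def)
    ultimately have "k * max 0 (u - d) = k * min 1 (u + d)" using u d(1) by simp
    then show False using u d(1) k by (auto simp: max_def min_def split: if_splits)
  qed
  then show "z \<in> (\<Union>r<k. circ ` supp (f r))" using u(3) by auto
qed auto

lemma interiors_no_cross:
  assumes ij: "i < k" "j < k" "i \<noteq> j" and abcd: "0 \<le> a" "a < b" "b < c" "c < d" "d < 1"
    "circ a \<in> circle_interior (circ ` supp (f i))" "circ b \<in> circle_interior (circ ` supp (f j))"
    "circ c \<in> circle_interior (circ ` supp (f i))" "circ d \<in> circle_interior (circ ` supp (f j))"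
  shows False
proof (rule noncrossingD[of "{..<k}" f i j a b c d 1])
  show "noncrossing {..<k} f" using tl by (simp add: treelike_def)
  show "f i a < f i b" "f j b < f j c" "f i c < f i d" "f j d < f j 1"
    by (rule interior_increasing; use ij abcd in simp)+
qed (use ij abcd in auto)

lemma cactus_of_in_cacti: "cactus_of k f \<in> cacti k"
proof -
  have int: "circle_interior (circ ` supp (f i)) \<inter> circle_interior (circ ` supp (f j)) = {}"
    if ij: "i < k" "j < k" "i \<noteq> j" for i j
  proof (rule ccontr)
    assume "\<not> ?thesis"
    then obtain z where z: "z \<in> circle_interior (circ ` supp (f i))" "z \<in> circle_interior (circ ` supp (f j))" by blast
    have "z \<in> S1" using z(1) unfolding circle_interior_def using interior_of_subset_topspace by fastforce
    then obtain u where u: "0 \<le> u" "u < 1" "circ u = z" using circ_surj by blast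
    obtain P where ap: "axis_pieces k f P" using fun_pieces_supp by blast
    note P = axis_piecesD(1,2,4)[OF ap]
    obtain e where e: "0 < e" "u + e \<le> 1" "{u<..<u + e} \<inter> P = {}" using pieces_sided[OF P(2)[OF ij(1)] u(1,2)] by metis
    have "f i u < f i (u + e)" "f j u < f j (u + e)"
      by (rule interior_increasing; use ij z u e in simp)+
    moreover have "f i u = f i (u + e) \<or> f j u = f j (u + e)" by (rule P(3)) (use ij u e in auto)
    ultimately show False by linarith
  qed
  have cross: "\<not> (\<exists>z1 z2 z3 z4. cyclically_ordered z1 z2 z3 z4 \<and>
             z1 \<in> circle_interior (circ ` supp (f j)) \<and> z3 \<in> circle_interior (circ ` supp (f j)) \<and>
             z2 \<in> circle_interior (circ ` supp (f i)) \<and> z4 \<in> circle_interior (circ ` supp (f i)))"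
    if ij: "i < k" "j < k" "i \<noteq> j" for i j
  proof
    assume "\<exists>z1 z2 z3 z4. cyclically_ordered z1 z2 z3 z4 \<and>
             z1 \<in> circle_interior (circ ` supp (f j)) \<and> z3 \<in> circle_interior (circ ` supp (f j)) \<and>
             z2 \<in> circle_interior (circ ` supp (f i)) \<and> z4 \<in> circle_interior (circ ` supp (f i))"
    then obtain s1 s2 s3 s4 where s: "s1 < s2" "s2 < s3" "s3 < s4" "s4 < s1 + 1"
      "circ s1 \<in> circle_interior (circ ` supp (f j))" "circ s3 \<in> circle_interior (circ ` supp (f j))"
      "circ s2 \<in> circle_interior (circ ` supp (f i))" "circ s4 \<in> circle_interior (circ ` supp (f i))"
      unfolding cyclically_ordered_def by blast
    define n where "n = \<lfloor>s1\<rfloor>"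
    define t1 t2 t3 t4 where "t1 = s1 - n" and "t2 = s2 - n" and "t3 = s3 - n" and "t4 = s4 - n"
    have ct: "circ (s - of_int n) = circ s" for s using circ_add[of s "- n"] by simp
    have t: "t1 < t2" "t2 < t3" "t3 < t4" "t4 < t1 + 1" "0 \<le> t1" "t1 < 1"
      using s(1-4) by (auto simp: t1_def t2_def t3_def t4_def n_def) linarith
    have c: "circ t1 \<in> circle_interior (circ ` supp (f j))" "circ t3 \<in> circle_interior (circ ` supp (f j))"
      "circ t2 \<in> circle_interior (circ ` supp (f i))" "circ t4 \<in> circle_interior (circ ` supp (f i))"
      using s(5-8) ct by (simp_all add: t1_def t2_def t3_def t4_def)
    note c' = c[folded circ_add_1(2)[of t1] circ_add_1(2)[of t2] circ_add_1(2)[of t3] circ_add_1(2)[of t4]]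
    have m: "circ (t - 1) = circ t" for t by (rule circ_add_1(2))
    \<comment> \<open>Points with parameter at least 1 are moved back by 1, which rotates the
      4-tuple; rotation by one or three places exchanges the two lobes.\<close>
    consider "t4 < 1" | "t3 < 1" "1 \<le> t4" | "t2 < 1" "1 \<le> t3" | "1 \<le> t2" by linarith
    then show False
    proof cases
      case 1
      show False by (rule interiors_no_cross[OF ij(2,1) _ t(5) t(1-3) 1]) (use ij c in auto)
    next
      case 2
      show False
        by (rule interiors_no_cross[of i j "t4 - 1" t1 t2 t3]) (use 2 t ij c m in auto)
    next
      case 3
      show False
        by (rule interiors_no_cross[of j i "t3 - 1" "t4 - 1" t1 t2]) (use 3 t ij c m in auto)
    next
      case 4
      show False
        by (rule interiors_no_cross[of i j "t2 - 1" "t3 - 1" "t4 - 1" t1]) (use 4 t ij c m in auto)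
    qed
  qed
  have len: "arc_length (circ ` supp (f r)) 1 = 1 / k" if "r < k" for r
    using arc_length_part[OF that, of 1] f that k by (simp add: cactus_fun_def field_simps)
  have nth: "cactus_of k f ! r = circ ` supp (f r)" if "r < k" for r using that by (simp add: cactus_of_def)
  have union: "(\<Union>j<k. cactus_of k f ! j) = S1" using parts_cover nth by simp
  show ?thesis
    unfolding cacti_def if_not_P[OF k] mem_Collect_eq
  proof (intro conjI allI impI union)
    show "length (cactus_of k f) = k" by (simp add: cactus_of_def)
    show "closed_1_submanifold (cactus_of k f ! r)" "arc_length (cactus_of k f ! r) 1 = 1 / k" if "r < k" for r
      unfolding nth[OF that] by (rule part_submanifold[OF that]) (rule len[OF that])
    fix i j assume ij: "i < k" "j < k" "i \<noteq> j"
    show "circle_interior (cactus_of k f ! i) \<inter> circle_interior (cactus_of k f ! j) = {}"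
      unfolding nth[OF ij(1)] nth[OF ij(2)] by (rule int[OF ij])
    show "\<not> (\<exists>z1 z2 z3 z4. cyclically_ordered z1 z2 z3 z4 \<and>
             z1 \<in> circle_interior (cactus_of k f ! j) \<and> z3 \<in> circle_interior (cactus_of k f ! j) \<and>
             z2 \<in> circle_interior (cactus_of k f ! i) \<and> z4 \<in> circle_interior (cactus_of k f ! i))"
      unfolding nth[OF ij(1)] nth[OF ij(2)] by (rule cross[OF ij])
  qed
qed

lemma lobe_cactus_of: "r < k ==> 0 \<le> t ==> t \<le> 1 ==> lobe (cactus_of k f) r t = f r t"
  using arc_length_part by (simp add: lobe_def cactus_of_def)

end

section \<open>The metric on cacti\<close>

definition excess :: "complex set \<Rightarrow> complex set \<Rightarrow> real" where
  "excess A B = measure lebesgue ({0..1} \<inter> circ -` A - circ -` B)"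

lemma excess_eq:
  assumes "closed A" "closed B"
  shows "excess A B = arc_length A 1 - arc_length (A \<inter> B) 1"
proof -
  have "excess A B = measure lebesgue ({0..1} \<inter> circ -` A - {0..1} \<inter> circ -` (A \<inter> B))"
    unfolding excess_def by (rule arg_cong[where f = "measure lebesgue"]) auto
  also have "\<dots> = measure lebesgue ({0..1} \<inter> circ -` A) - measure lebesgue ({0..1} \<inter> circ -` (A \<inter> B))"
    by (rule measurable_measure_Diff)
      (use assms in \<open>auto intro!: lmeasurable_arc fmeasurableD[OF lmeasurable_arc] simp del: vimage_Int\<close>)
  finally show ?thesis unfolding arc_length_def arc_set .
qed

lemma excess_lmeasurable: "closed A ==> closed B ==> {0..1} \<inter> circ -` A - circ -` B \<in> lmeasurable"
proof -
  assume AB: "closed A" "closed B"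
  have "{0..1} \<inter> circ -` A - circ -` B = {0..1} \<inter> circ -` A - {0..1} \<inter> circ -` B" by auto
  then show ?thesis
    using fmeasurable_Diff[OF lmeasurable_arc[OF AB(1)] fmeasurableD[OF lmeasurable_arc[OF AB(2)]]] by metis
qed

lemma excess_triangle:
  assumes "closed A" "closed B" "closed C"
  shows "excess A C \<le> excess A B + excess B C"
proof -
  have "excess A C \<le> measure lebesgue (({0..1} \<inter> circ -` A - circ -` B) \<union> ({0..1} \<inter> circ -` B - circ -` C))"
    unfolding excess_def
    by (rule measure_mono_fmeasurable)
      (use assms in \<open>auto intro!: excess_lmeasurable fmeasurableD[OF excess_lmeasurable] fmeasurable.Un\<close>)
  also have "\<dots> \<le> excess A B + excess B C"
    unfolding excess_def by (rule measure_Un_le) (use assms in \<open>auto intro!: fmeasurableD[OF excess_lmeasurable]\<close>)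
  finally show ?thesis .
qed

lemma arc_length_excess:
  assumes "closed A" "closed B" "0 \<le> t" "t \<le> 1"
  shows "arc_length A t \<le> arc_length B t + excess A B"
proof -
  have "arc_length A t \<le> measure lebesgue (({0..t} \<inter> circ -` B) \<union> ({0..1} \<inter> circ -` A - circ -` B))"
    unfolding arc_length_def arc_set
    by (rule measure_mono_fmeasurable)
      (use assms in \<open>auto intro!: lmeasurable_arc fmeasurableD[OF lmeasurable_arc] excess_lmeasurable fmeasurable.Un\<close>)
  also have "\<dots> \<le> arc_length B t + excess A B"
    unfolding excess_def arc_length_def arc_set
    by (rule measure_Un_le) (use assms in \<open>auto intro!: fmeasurableD[OF excess_lmeasurable] fmeasurableD[OF lmeasurable_arc]\<close>)
  finally show ?thesis .
qed

text \<open>All parts have length 1 / k, so the symmetric formula is a sum of one-sided differences,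
  for which the triangle inequality comes from an inclusion of sets.\<close>

lemma cactus_dist_eq:
  assumes "x \<in> cacti k" "y \<in> cacti k" "k \<noteq> 0"
  shows "cactus_dist k x y = (\<Sum>r<k. excess (x ! r) (y ! r))"
proof -
  have "(\<Sum>r<k. excess (x ! r) (y ! r)) = (\<Sum>r<k. 1 / k - arc_length (x ! r \<inter> y ! r) 1)"
    by (intro sum.cong refl)
      (use assms excess_eq cactus_part_closed(1) cactus_part(2) in auto)
  also have "\<dots> = 1 - (\<Sum>r<k. arc_length (x ! r \<inter> y ! r) 1)" using assms(3) by (simp add: sum_subtractf)
  finally show ?thesis using assms by (simp add: cactus_dist_def)
qed

lemma lobe_dist:
  assumes x: "x \<in> cacti k" and y: "y \<in> cacti k" and r: "r < k" and t: "0 \<le> t" "t \<le> 1"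
  shows "\<bar>lobe x r t - lobe y r t\<bar> \<le> k * cactus_dist k x y"
proof -
  have k: "k \<noteq> 0" using r by simp
  have le: "arc_length (x ! r) t - arc_length (y ! r) t \<le> cactus_dist k x y"
    if x: "x \<in> cacti k" and y: "y \<in> cacti k" for x y
  proof -
    have "arc_length (x ! r) t - arc_length (y ! r) t \<le> excess (x ! r) (y ! r)"
      using arc_length_excess[OF cactus_part_closed(1)[OF x k r] cactus_part_closed(1)[OF y k r] t] by simp
    also have "\<dots> \<le> (\<Sum>r<k. excess (x ! r) (y ! r))"
      by (rule member_le_sum) (use r in \<open>auto simp: excess_def\<close>)
    finally show ?thesis using cactus_dist_eq[OF x y k] by simp
  qed
  have "cactus_dist k y x = cactus_dist k x y" by (simp add: cactus_dist_def Int_commute)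
  then have "\<bar>arc_length (x ! r) t - arc_length (y ! r) t\<bar> \<le> cactus_dist k x y"
    using le[OF x y] le[OF y x] by linarith
  moreover have "lobe x r t - lobe y r t = k * (arc_length (x ! r) t - arc_length (y ! r) t)"
    using cactus_length[OF x k] cactus_length[OF y k] by (simp add: lobe_def algebra_simps)
  ultimately show ?thesis by (simp add: abs_mult mult_left_mono)
qed

lemma Metric_space_cacti: "Metric_space (cacti k) (cactus_dist k)"
proof (cases "k = 0")
  case True
  then show ?thesis by unfold_locales (auto simp: cactus_dist_def cacti_def)
next
  case k: False
  show ?thesis
  proof
    fix x y
    show "0 \<le> cactus_dist k x y"
    proof (cases "x \<in> cacti k \<and> y \<in> cacti k")
      case True
      then show ?thesis using cactus_dist_eq[of x k y] k by (auto intro!: sum_nonneg simp: excess_def)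
    qed (auto simp: cactus_dist_def)
    show "cactus_dist k x y = cactus_dist k y x" by (simp add: cactus_dist_def Int_commute)
  next
    fix x y assume x: "x \<in> cacti k" and y: "y \<in> cacti k"
    show "cactus_dist k x y = 0 \<longleftrightarrow> x = y"
    proof
      assume "cactus_dist k x y = 0"
      then have "cactus_of k (lobe x) = cactus_of k (lobe y)"
        using lobe_dist[OF x y] by (intro cactus_of_cong) fastforce
      then show "x = y" using cactus_of_lobe x y k by metis
    next
      assume "x = y"
      then show "cactus_dist k x y = 0" using cactus_dist_eq[OF x y k] by (simp add: excess_def Int_Diff)
    qed
  next
    fix x y z assume x: "x \<in> cacti k" and y: "y \<in> cacti k" and z: "z \<in> cacti k"
    show "cactus_dist k x z \<le> cactus_dist k x y + cactus_dist k y z"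
      unfolding cactus_dist_eq[OF x z k] cactus_dist_eq[OF x y k] cactus_dist_eq[OF y z k] sum.distrib[symmetric]
      by (intro sum_mono excess_triangle cactus_part_closed(1)[OF x k] cactus_part_closed(1)[OF y k] cactus_part_closed(1)[OF z k]) auto
  qed
qed

text \<open>The number of arcs of \<open>x\<close> enters \<delta>: on each arc the excess of a part
  of \<open>x\<close> grows by at most 2 * \<delta>, which adds up to \<epsilon> / 2 over all arcs
  and all k parts.\<close>

lemma cactus_dist_small:
  assumes x: "x \<in> cacti k" and k: "k \<noteq> 0" and \<epsilon>: "\<epsilon> > 0"
  shows "\<exists>\<delta>>0. \<forall>y\<in>cacti k. (\<forall>r<k. \<forall>t. 0 \<le> t \<and> t \<le> 1 \<longrightarrow> \<bar>lobe x r t - lobe y r t\<bar> \<le> \<delta>) \<longrightarrow> cactus_dist k x y < \<epsilon>"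
proof -
  obtain P where P: "finite P" "\<And>r. r < k ==> pieces P (x ! r)" using cactus_pieces[OF x k] by blast
  define C where "C = real (card P + 1)"
  define \<delta> where "\<delta> = \<epsilon> / (4 * C * k)"
  have C: "C > 0" by (simp add: C_def)
  have \<delta>: "\<delta> > 0" using \<epsilon> C k by (simp add: \<delta>_def)
  have "cactus_dist k x y < \<epsilon>"
    if y: "y \<in> cacti k" and close: "\<And>r t. r < k ==> 0 \<le> t ==> t \<le> 1 ==> \<bar>lobe x r t - lobe y r t\<bar> \<le> \<delta>" for y
  proof -
    have "excess (x ! r) (y ! r) \<le> 2 * \<delta> * C" if r: "r < k" for r
    proof -
      note cx = cactus_part_closed(1)[OF x k r] and cy = cactus_part_closed(1)[OF y k r]
      have cxy: "closed (x ! r \<inter> y ! r)" using cx cy by (rule closed_Int)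
      let ?g = "\<lambda>t. arc_length (x ! r) t - arc_length (x ! r \<inter> y ! r) t"
      have "?g 1 - ?g 0 \<le> 2 * \<delta> * (card P + 1)"
      proof (rule step_le[OF P(1)])
        fix a b :: real assume ab: "0 \<le> a" "a < b" "b \<le> 1" "{a<..<b} \<inter> P = {}"
        have "circ ` {a<..<b} \<subseteq> x ! r \<or> circ ` {a<..<b} \<inter> x ! r = {}" using P(2)[OF r] ab by (simp add: pieces_def)
        then show "?g b - ?g a \<le> 2 * \<delta>"
        proof
          assume sub: "circ ` {a<..<b} \<subseteq> x ! r"
          \<comment> \<open>Along an arc inside the part of \<open>x\<close>, the part of
            \<open>y\<close> lies in that of \<open>x\<close> up to the end point, so the excess
            grows by at most the difference of the two lengths.\<close>
          have "{a<..b} \<inter> circ -` (y ! r) \<subseteq> insert b ({a<..b} \<inter> circ -` (x ! r \<inter> y ! r))"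
          proof
            fix t assume t: "t \<in> {a<..b} \<inter> circ -` (y ! r)"
            show "t \<in> insert b ({a<..b} \<inter> circ -` (x ! r \<inter> y ! r))"
            proof (cases "t = b")
              case False
              then have "circ t \<in> circ ` {a<..<b}" using t by (intro imageI) auto
              then show ?thesis using t sub by auto
            qed simp
          qed
          moreover have lb: "{b} \<in> lmeasurable" by (simp add: lmeasurable_compact)
          ultimately have "measure lebesgue ({a<..b} \<inter> circ -` (y ! r))
              \<le> measure lebesgue ({a<..b} \<inter> circ -` (x ! r \<inter> y ! r) \<union> {b})"
            by (intro measure_mono_fmeasurable fmeasurable.Un fmeasurableD[OF arc_length_diff(2)] arc_length_diff(2))
              (use cy cxy ab in auto)
          also have "\<dots> \<le> measure lebesgue ({a<..b} \<inter> circ -` (x ! r \<inter> y ! r)) + measure lebesgue {b}"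
            by (rule measure_Un_le) (use arc_length_diff(2)[OF cxy ab(1)] ab lb in \<open>auto intro!: fmeasurableD\<close>)
          finally have "arc_length (y ! r) b - arc_length (y ! r) a \<le> arc_length (x ! r \<inter> y ! r) b - arc_length (x ! r \<inter> y ! r) a"
            using arc_length_diff(1)[OF cy ab(1)] arc_length_diff(1)[OF cxy ab(1)] ab(2) by simp
          moreover have "\<bar>arc_length (x ! r) t - arc_length (y ! r) t\<bar> \<le> \<delta>" if t: "0 \<le> t" "t \<le> 1" for t
          proof -
            have "real k * \<bar>arc_length (x ! r) t - arc_length (y ! r) t\<bar> = \<bar>lobe x r t - lobe y r t\<bar>"
              using cactus_length[OF x k] cactus_length[OF y k] by (simp add: lobe_def abs_mult right_diff_distrib[symmetric])
            moreover have "1 * \<bar>arc_length (x ! r) t - arc_length (y ! r) t\<bar> \<le> real k * \<bar>arc_length (x ! r) t - arc_length (y ! r) t\<bar>"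
              by (rule mult_right_mono) (use k in auto)
            ultimately show ?thesis using close[OF r t] by (metis mult_1 order.trans)
          qed
          from this[of a] this[of b] have "\<bar>arc_length (x ! r) a - arc_length (y ! r) a\<bar> \<le> \<delta>"
            "\<bar>arc_length (x ! r) b - arc_length (y ! r) b\<bar> \<le> \<delta>" using ab by auto
          ultimately show ?thesis by linarith
        next
          assume out: "circ ` {a<..<b} \<inter> x ! r = {}"
          show ?thesis
            using arc_length_out[OF cx ab(1) less_imp_le[OF ab(2)] out]
              arc_length_mono[OF cxy ab(1) less_imp_le[OF ab(2)]] \<delta> by linarith
        qed
      qed (use \<delta> in auto)
      then show ?thesis using excess_eq[OF cx cy] by (simp add: C_def)
    qed
    then have "cactus_dist k x y \<le> (\<Sum>r<k. 2 * \<delta> * C)"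
      unfolding cactus_dist_eq[OF x y k] by (intro sum_mono) auto
    also have "\<dots> = \<epsilon> / 2" using C k by (simp add: \<delta>_def field_simps)
    finally show ?thesis using \<epsilon> by simp
  qed
  then show ?thesis using \<delta> by blast
qed

section \<open>Normalized composition in terms of functions\<close>

lemma supp_repar:
  assumes h: "nice M h" "h 0 = 0" "h 1 = 1" and f: "\<And>s t. 0 \<le> s ==> s \<le> t ==> t \<le> 1 ==> f s \<le> f t"
    and g: "\<And>t. 0 \<le> t ==> t \<le> 1 ==> g t = f (h t)"
  shows "supp f = h ` supp g"
proof -
  have hm: "h s \<le> h t" if "0 \<le> s" "s \<le> t" "t \<le> 1" for s t using niceD(1)[OF h(1)] that by auto
  have h01: "0 \<le> h t" "h t \<le> 1" if "0 \<le> t" "t \<le> 1" for t using hm[of 0 t] hm[of t 1] h that by auto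
  have cont: "continuous_on {0..1} h"
  proof (rule lipschitz_on_continuous_on[of "max M 0"], rule lipschitz_onI)
    fix a b :: real assume "a \<in> {0..1}" "b \<in> {0..1}"
    then show "dist (h a) (h b) \<le> max M 0 * dist a b"
      using nice_abs[OF nice_mono[OF h(1), of "max M 0"], of a b] by (simp add: dist_real_def)
  qed simp
  show ?thesis
  proof (intro equalityI subsetI)
    fix u assume u: "u \<in> supp f"
    then have u01: "0 \<le> u" "u \<le> 1" by (auto simp: supp_def)
    \<comment> \<open>The fibre over a point of increase of \<open>f\<close> is a closed interval.
      If neither end were a point of increase of \<open>g\<close>, then \<open>f\<close> would be
      constant around \<open>u\<close>.\<close>
    let ?F = "{t \<in> {0..1}. h t = u}"
    have cF: "compact ?F"
    proof -
      have "closedin (top_of_set {0..1}) ({0..1} \<inter> h -` {u})"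
        by (rule continuous_closedin_preimage[OF cont]) simp
      then have "compact ({0..1} \<inter> h -` {u})" by (rule closedin_compact[rotated]) simp
      moreover have "{0..1} \<inter> h -` {u} = ?F" by auto
      ultimately show ?thesis by simp
    qed
    have nF: "?F \<noteq> {}" using IVT'[of h 0 u 1] cont h u01 by auto
    obtain t1 where t1: "t1 \<in> ?F" "\<And>t. t \<in> ?F ==> t1 \<le> t" using compact_attains_inf[OF cF nF] by blast
    obtain t2 where t2: "t2 \<in> ?F" "\<And>t. t \<in> ?F ==> t \<le> t2" using compact_attains_sup[OF cF nF] by blast
    have "t1 \<in> supp g \<or> t2 \<in> supp g"
    proof (rule ccontr)
      assume "\<not> ?thesis"
      then obtain e1 e2 where e: "e1 > 0" "\<not> g (max 0 (t1 - e1)) < g (min 1 (t1 + e1))"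
          "e2 > 0" "\<not> g (max 0 (t2 - e2)) < g (min 1 (t2 + e2))"
        using t1(1) t2(1) by (auto simp: supp_def)
      let ?a = "max 0 (t1 - e1)" and ?b = "min 1 (t2 + e2)"
      have ab: "0 \<le> ?a" "?a \<le> t1" "t1 \<le> t2" "t2 \<le> ?b" "?b \<le> 1" "t1 \<le> 1" "0 \<le> t2" using t1 t2 e(1,3) by auto
      have gm: "g s \<le> g t" if "0 \<le> s" "s \<le> t" "t \<le> 1" for s t
        using f[OF h01(1)[of s] hm[OF that] h01(2)[of t]] g that by simp
      have "g t1 \<le> g ?a" using e(2) gm[of t1 "min 1 (t1 + e1)"] ab e(1) t1(1) by auto
      moreover have "g ?b \<le> g t2" using e(4) gm[of "max 0 (t2 - e2)" t2] ab e(3) t2(1) by auto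
      moreover have "g t1 = g t2" using g t1(1) t2(1) by auto
      ultimately have fab: "f (h ?b) \<le> f (h ?a)" using g[of ?a] g[of ?b] ab by auto
      have ha: "h ?a < u \<or> u = 0"
      proof (cases "t1 = 0")
        case True
        then show ?thesis using t1(1) h(2) by auto
      next
        case False
        then have "?a < t1" using t1(1) e(1) by auto
        then have "?a \<notin> ?F" using t1(2)[of ?a] by auto
        then have "h ?a \<noteq> u" using ab by auto
        then show ?thesis using hm[of ?a t1] ab t1(1) by auto
      qed
      have hb: "u < h ?b \<or> u = 1"
      proof (cases "t2 = 1")
        case True
        then show ?thesis using t2(1) h(3) by auto
      next
        case False
        then have "t2 < ?b" using t2(1) e(3) by auto
        then have "?b \<notin> ?F" using t2(2)[of ?b] by auto
        then have "h ?b \<noteq> u" using ab by auto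
        then show ?thesis using hm[of t2 ?b] ab t2(1) by auto
      qed
      \<comment> \<open>At an end of the unit interval only one side counts; the default 1 replaces
        a gap that would be 0.\<close>
      define d where "d = min (if u = 0 then 1 else u - h ?a) (if u = 1 then 1 else h ?b - u)"
      have d: "d > 0" using ha hb by (auto simp: d_def)
      have "f (max 0 (u - d)) < f (min 1 (u + d))" using u d by (simp add: supp_def)
      moreover have "f (h ?a) \<le> f (max 0 (u - d))"
        by (rule f) (use h01[of ?a] ab u01 d hm[of ?a t1] t1(1) in \<open>auto simp: d_def\<close>)
      moreover have "f (min 1 (u + d)) \<le> f (h ?b)"
        by (rule f) (use h01[of ?b] ab u01 d hm[of t2 ?b] t2(1) in \<open>auto simp: d_def\<close>)
      ultimately show False using fab by linarith
    qed
    then show "u \<in> h ` supp g"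
    proof
      assume "t1 \<in> supp g"
      then show ?thesis using t1(1) by (intro image_eqI[of _ _ t1]) auto
    next
      assume "t2 \<in> supp g"
      then show ?thesis using t2(1) by (intro image_eqI[of _ _ t2]) auto
    qed
  next
    fix u assume "u \<in> h ` supp g"
    then obtain t where t: "t \<in> supp g" "u = h t" by auto
    then have t01: "0 \<le> t" "t \<le> 1" by (auto simp: supp_def)
    show "u \<in> supp f"
      unfolding supp_def
    proof (intro CollectI conjI allI impI)
      show "u \<in> {0..1}" using h01[OF t01] t(2) by simp
      fix e :: real assume e: "0 < e"
      define d where "d = e / (\<bar>M\<bar> + 1)"
      have d: "d > 0" using e by (simp add: d_def)
      have Md: "M * d \<le> e"
      proof -
        have "M * d \<le> (\<bar>M\<bar> + 1) * d" by (rule mult_right_mono) (use d in auto)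
        also have "\<dots> = e" by (simp add: d_def)
        finally show ?thesis .
      qed
      let ?a = "max 0 (t - d)" and ?b = "min 1 (t + d)"
      have ab: "0 \<le> ?a" "?a \<le> t" "t \<le> ?b" "?b \<le> 1" "t - ?a \<le> d" "?b - t \<le> d" using d t01 by auto
      have "h t - h ?a \<le> M * (t - ?a)" "h ?b - h t \<le> M * (?b - t)"
        using niceD(2)[OF h(1), of ?a t] niceD(2)[OF h(1), of t ?b] ab t01 by auto
      moreover have "M * (t - ?a) \<le> e"
      proof (cases "0 \<le> M")
        case True
        then show ?thesis using mult_left_mono[OF ab(5) True] Md by linarith
      next
        case False
        then have "M * (t - ?a) \<le> 0" using ab(2) by (simp add: mult_nonpos_nonneg)
        then show ?thesis using e by linarith
      qed
      moreover have "M * (?b - t) \<le> e"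
      proof (cases "0 \<le> M")
        case True
        then show ?thesis using mult_left_mono[OF ab(6) True] Md by linarith
      next
        case False
        then have "M * (?b - t) \<le> 0" using ab(3) by (simp add: mult_nonpos_nonneg)
        then show ?thesis using e by linarith
      qed
      ultimately have hab: "u - e \<le> h ?a" "h ?b \<le> u + e" using t(2) by linarith+
      have "f (max 0 (u - e)) \<le> f (h ?a)"
        by (rule f) (use hab h01[of ?a] ab t01 in auto)
      also have "\<dots> = g ?a" using g[of ?a] ab t01 by simp
      also have "\<dots> < g ?b" using t(1) d by (simp add: supp_def)
      also have "\<dots> = f (h ?b)" using g[of ?b] ab t01 by simp
      also have "\<dots> \<le> f (min 1 (u + e))"
        by (rule f) (use hab h01[of ?b] ab t01 in auto)
      finally show "f (max 0 (u - e)) < f (min 1 (u + e))" .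
    qed
  qed
qed

lemma circle_image_circ:
  assumes "S \<subseteq> {0..1}" "h 0 = 0" "h 1 = 1"
  shows "circle_image h (circ ` S) = circ ` h ` S"
proof (intro equalityI subsetI)
  fix z assume "z \<in> circle_image h (circ ` S)"
  then obtain t u where t: "z = circ (h t)" "0 \<le> t" "t \<le> 1" "circ t = circ u" "u \<in> S"
    unfolding circle_image_def by auto
  have u: "0 \<le> u" "u \<le> 1" using t(5) assms(1) by auto
  have "circ (h t) = circ (h u)"
  proof (cases "t = u")
    case False
    then have "\<not> \<bar>t - u\<bar> < 1" using circ_inj[OF t(4)] by blast
    then have "(t = 0 \<and> u = 1) \<or> (t = 1 \<and> u = 0)" using t u by linarith
    then show ?thesis using assms(2,3) by auto
  qed simp
  then show "z \<in> circ ` h ` S" using t by auto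
next
  fix z assume "z \<in> circ ` h ` S"
  then show "z \<in> circle_image h (circ ` S)" using assms(1) unfolding circle_image_def by force
qed

lemma nth_insert_list:
  assumes "i < length xs" "b < length xs + length ys - 1"
  shows "insert_list i xs ys ! b =
    (if b < i then xs ! b else if b < i + length ys then ys ! (b - i) else xs ! (b + 1 - length ys))"
  using assms unfolding insert_list_def by (auto simp: nth_append min_def Suc_diff_le)

lemma length_insert_list: "i < length xs ==> length (insert_list i xs ys) = length xs + length ys - 1"
  unfolding insert_list_def by auto

text \<open>The interior points on the left are points of increase of the composite function, and
  they are dense among these: where it increases, the part of \<open>y\<close> has an interior
  position u, and the part of \<open>x\<close> has an interior point whose position is just below u,
  still interior for \<open>y\<close>.\<close>

lemma nested_part:
  assumes x: "x \<in> cacti m" and y: "y \<in> cacti n" and i: "i < m" and s: "s < n"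
  shows "closure {circ t | t. t \<in> {0..1} \<and> circ t \<in> circle_interior (x ! i) \<and> lobe_map x i t \<in> circle_interior (y ! s)}
    = circ ` supp (\<lambda>t. lobe y s (lobe x i t))"
proof -
  have m: "m \<noteq> 0" and n: "n \<noteq> 0" using i s by auto
  let ?L = "lobe x i" and ?g = "\<lambda>t. lobe y s (lobe x i t)"
  note fx = lobe_cactus_fun[OF x m] lobe_treelike[OF x m] and fy = lobe_cactus_fun[OF y n] lobe_treelike[OF y n]
  have Lm: "?L a \<le> ?L b" if "0 \<le> a" "a \<le> b" for a b by (rule lobe_mono[OF x m i that])
  have L01: "0 \<le> ?L t" "?L t \<le> 1" if "0 \<le> t" "t \<le> 1" for t using cactus_fun_mem[OF fx(1) i that] by auto
  have gm: "?g a \<le> ?g b" if "0 \<le> a" "a \<le> b" "b \<le> 1" for a b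
    by (rule lobe_mono[OF y n s L01(1) Lm]) (use that in auto)
  have L_ends: "?L 0 = 0" "?L 1 = 1" using fx(1) i by (auto simp: cactus_fun_def)
  let ?S = "{circ t | t. t \<in> {0..1} \<and> circ t \<in> circle_interior (x ! i) \<and> lobe_map x i t \<in> circle_interior (y ! s)}"
  have map: "lobe_map x i t = circ (?L t)" for t by (simp add: lobe_map_def lobe_def)
  note xs = cactus_supp[OF x m i] and ys = cactus_supp[OF y n s]
  have "?S \<subseteq> circ ` supp ?g"
  proof
    fix z assume "z \<in> ?S"
    then obtain t' where t': "z = circ t'" "0 \<le> t'" "t' \<le> 1" "circ t' \<in> circle_interior (x ! i)" "circ (?L t') \<in> circle_interior (y ! s)"
      unfolding map by auto
    \<comment> \<open>The base point is represented by 0, which leaves room to the right.\<close>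
    define t where "t = (if t' = 1 then 0 else t')"
    have t: "z = circ t" "0 \<le> t" "t < 1" "circ t \<in> circle_interior (x ! i)" "circ (?L t) \<in> circle_interior (y ! s)"
      using t' L_ends by (auto simp: t_def)
    have inc: "?g t < ?g b" if b: "t < b" "b \<le> 1" for b
    proof -
      have lt: "?L t < ?L b" by (rule interior_increasing[OF fx m i t(4)[unfolded xs] t(2) b])
      show ?thesis
        by (rule interior_increasing[OF fy n s t(5)[unfolded ys] L01(1) lt L01(2)]) (use t b in auto)
    qed
    have "t \<in> supp ?g"
      unfolding supp_def
    proof (intro CollectI conjI allI impI)
      fix e :: real assume e: "0 < e"
      have "?g (max 0 (t - e)) \<le> ?g t" by (rule gm) (use t e in auto)
      also have "\<dots> < ?g (min 1 (t + e))" by (rule inc) (use t e in auto)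
      finally show "?g (max 0 (t - e)) < ?g (min 1 (t + e))" .
    qed (use t in auto)
    then show "z \<in> circ ` supp ?g" using t(1) by blast
  qed
  moreover have "closed (circ ` supp ?g)"
  proof -
    have "compact ({0..1} \<inter> supp ?g)" by (intro compact_Int_closed closed_supp gm) auto
    moreover have "{0..1} \<inter> supp ?g = supp ?g" by (auto simp: supp_def)
    ultimately show ?thesis by (simp add: compact_imp_closed compact_continuous_image continuous_circ)
  qed
  ultimately have 1: "closure ?S \<subseteq> circ ` supp ?g" by (rule closure_minimal)
  have "circ t \<in> closure ?S" if t: "t \<in> supp ?g" for t
    unfolding closure_approachable
  proof (intro allI impI)
    fix \<epsilon> :: real assume "\<epsilon> > 0"
    then obtain e where e: "e > 0" "\<And>t'. dist t' t < e ==> dist (circ t') (circ t) < \<epsilon>"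
      using continuous_circ[of UNIV] unfolding continuous_on_iff by (metis UNIV_I)
    let ?a = "max 0 (t - e / 2)" and ?b = "min 1 (t + e / 2)"
    have t01: "0 \<le> t" "t \<le> 1" using t by (auto simp: supp_def)
    have ab: "0 \<le> ?a" "?a \<le> ?b" "?b \<le> 1" using t01 e by auto
    have "?g ?a < ?g ?b" using t e(1) by (simp add: supp_def)
    then obtain u where u: "?L ?a < u" "u < ?L ?b" "circ u \<in> circle_interior (y ! s)"
      using interior_between[OF y n s L01(1)[of ?a] L01(2)[of ?b]] ab by auto
    obtain d where d: "d > 0" "circ ` {u - d<..<u + d} \<subseteq> y ! s" using u(3) circle_interior_iff by blast
    have near: "circ u' \<in> circle_interior (y ! s)" if u': "\<bar>u' - u\<bar> < d" for u'
    proof -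
      have "{u' - (d - \<bar>u' - u\<bar>)<..<u' + (d - \<bar>u' - u\<bar>)} \<subseteq> {u - d<..<u + d}" by (auto simp: abs_if split: if_splits)
      then have "circ ` {u' - (d - \<bar>u' - u\<bar>)<..<u' + (d - \<bar>u' - u\<bar>)} \<subseteq> y ! s" using d(2) by blast
      then show ?thesis unfolding circle_interior_iff using u' by (intro exI[of _ "d - \<bar>u' - u\<bar>"]) auto
    qed
    define u1 where "u1 = max ((?L ?a + u) / 2) (u - d / 2)"
    have u1: "?L ?a < u1" "u1 < u" "u - d / 2 \<le> u1" using u(1) d(1) unfolding u1_def by (simp_all add: less_max_iff_disj)
    have o: "onto ?L" by (rule cactus_fun_onto[OF fx(1) i])
    have La: "0 \<le> ?L ?a" "?L ?b \<le> 1" using L01[of ?a] L01[of ?b] ab by auto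
    let ?p = "inv_into {0..1} ?L u1" and ?q = "inv_into {0..1} ?L u"
    have p: "0 \<le> ?p" "?p \<le> 1" "?L ?p = u1" and q: "0 \<le> ?q" "?q \<le> 1" "?L ?q = u"
    proof -
      have "0 \<le> u1" "u1 \<le> 1" "0 \<le> u" "u \<le> 1" using u1 u(1,2) La by linarith+
      then show "0 \<le> ?p" "?p \<le> 1" "?L ?p = u1" "0 \<le> ?q" "?q \<le> 1" "?L ?q = u"
        using ontoD[OF o] by blast+
    qed
    have ap: "?a < ?p"
    proof (rule ccontr)
      assume "\<not> ?thesis"
      then have "?L ?p \<le> ?L ?a" by (intro Lm[OF p(1)]) linarith
      then show False using p(3) u1(1) by linarith
    qed
    have qb: "?q < ?b"
    proof (rule ccontr)
      assume "\<not> ?thesis"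
      moreover have "0 \<le> ?b" using ab(1,2) by (rule order_trans)
      ultimately have "?L ?b \<le> ?L ?q" by (intro Lm) linarith+
      then show False using q(3) u(2) by linarith
    qed
    have "?L ?p < ?L ?q" using p q u1 by simp
    then obtain t' where t': "?p < t'" "t' < ?q" "circ t' \<in> circle_interior (x ! i)"
      using interior_between[OF x m i p(1) q(2)] by blast
    have "u1 \<le> ?L t'" "?L t' \<le> u" using Lm[of ?p t'] Lm[of t' ?q] p q t' by auto
    then have "circ (?L t') \<in> circle_interior (y ! s)" using near[of "?L t'"] u1(3) d(1) by simp
    then have "circ t' \<in> ?S" using t' p q map by auto
    moreover have "dist t' t < e" using t' ap qb e(1) by (auto simp: dist_real_def)
    ultimately show "\<exists>z\<in>?S. dist z (circ t) < \<epsilon>" using e(2) by blast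
  qed
  then have "circ ` supp ?g \<subseteq> closure ?S" by blast
  with 1 show ?thesis by blast
qed

text \<open>Both sides are compared part by part through their points of increase. So it suffices
  that the functions of the composite, after rescaling the circle, are the lobe functions of
  \<open>x\<close> with the one at \<open>i\<close> followed by those of \<open>y\<close>.\<close>

lemma cactus_comp_eq:
  assumes x: "x \<in> cacti m" and y: "y \<in> cacti n" and i: "i < m" and N: "m + n - 1 \<noteq> 0"
    and h: "nice M (rescale i n x)" "rescale i n x 0 = 0" "rescale i n x 1 = 1"
    and f: "cactus_fun (m + n - 1) f"
    and fh: "\<And>b t. b < m + n - 1 ==> 0 \<le> t ==> t \<le> 1 ==> f b (rescale i n x t) =
      (if b < i then lobe x b t else if b < i + n then lobe y (b - i) (lobe x i t) else lobe x (b + 1 - n) t)"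
  shows "cactus_of (m + n - 1) f = cactus_comp i x y"
proof -
  have m: "m \<noteq> 0" using i by simp
  have lx: "length x = m" by (rule cactus_length[OF x m])
  have ly: "length y = n"
  proof (cases "n = 0")
    case True
    then show ?thesis using y by (simp add: cacti_def)
  qed (rule cactus_length[OF y])
  let ?h = "rescale i n x"
  let ?xs = "map (circle_image ?h) x"
  let ?ys = "map (\<lambda>A. circle_image ?h (closure {circ t | t. t \<in> {0..1} \<and>
                 circ t \<in> circle_interior (x ! i) \<and> lobe_map x i t \<in> circle_interior A})) y"
  have comp: "cactus_comp i x y = insert_list i ?xs ?ys" by (simp add: cactus_comp_def Let_def ly)
  have sub: "supp g \<subseteq> {0..1}" for g by (auto simp: supp_def)
  have part: "circle_image ?h (circ ` supp g) = circ ` supp (f b)"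
    if b: "b < m + n - 1" and g: "\<And>t. 0 \<le> t ==> t \<le> 1 ==> g t = f b (?h t)" for b g
  proof -
    have "supp (f b) = ?h ` supp g"
      by (rule supp_repar[where f = "f b" and g = g, OF h _ g]) (use f b in \<open>auto simp: cactus_fun_def mono_on_def\<close>)
    then show ?thesis using circle_image_circ[OF sub h(2,3)] by simp
  qed
  show ?thesis
    unfolding comp
  proof (rule nth_equalityI)
    show "length (cactus_of (m + n - 1) f) = length (insert_list i ?xs ?ys)"
      using length_insert_list[of i ?xs ?ys] i lx ly by (simp add: cactus_of_def)
    fix b assume "b < length (cactus_of (m + n - 1) f)"
    then have b: "b < m + n - 1" by (simp add: cactus_of_def)
    have nth: "insert_list i ?xs ?ys ! b = (if b < i then ?xs ! b else if b < i + n then ?ys ! (b - i) else ?xs ! (b + 1 - n))"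
      using nth_insert_list[of i ?xs b ?ys] i b lx ly by simp
    have L: "cactus_of (m + n - 1) f ! b = circ ` supp (f b)" using b by (simp add: cactus_of_def)
    show "cactus_of (m + n - 1) f ! b = insert_list i ?xs ?ys ! b"
    proof (cases "b < i + n \<and> \<not> b < i")
      case False
      define r where "r = (if b < i then b else b + 1 - n)"
      have r: "r < m" using False b i by (auto simp: r_def)
      have "circle_image ?h (x ! r) = circ ` supp (f b)"
        unfolding cactus_supp[OF x m r] by (rule part[OF b]) (use fh[OF b] False in \<open>auto simp: r_def\<close>)
      moreover have "insert_list i ?xs ?ys ! b = ?xs ! r" using nth False by (auto simp: r_def)
      ultimately show ?thesis using L r lx by simp
    next
      case True
      define s where "s = b - i"
      have s: "s < n" using True by (auto simp: s_def)
      have "?ys ! s = circle_image ?h (circ ` supp (\<lambda>t. lobe y s (lobe x i t)))"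
        using nested_part[OF x y i s] s ly by simp
      also have "\<dots> = circ ` supp (f b)"
        by (rule part[OF b]) (use fh[OF b] True in \<open>auto simp: s_def\<close>)
      finally show ?thesis using L nth True by (auto simp: s_def)
    qed
  qed
qed

section \<open>Connected vertex sets\<close>

primrec vdist :: "'v ptree \<Rightarrow> bool" where
  "vdist (Leaf a) \<longleftrightarrow> True"
| "vdist (Vertex v ts) \<longleftrightarrow> v \<notin> (\<Union>M\<in>set ts. vertices M) \<and>
     (\<forall>j<length ts. \<forall>k<length ts. j \<noteq> k \<longrightarrow> vertices (ts ! j) \<inter> vertices (ts ! k) = {}) \<and> list_all vdist ts"

lemma vdist_child:
  assumes "vdist (Vertex v ts)" "M \<in> set ts"
  shows "vdist M" "v \<notin> vertices M"
  using assms by (auto simp: list_all_iff)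

lemma vdist_same_child:
  assumes "vdist (Vertex v ts)" "M \<in> set ts" "M' \<in> set ts" "a \<in> vertices M" "a \<in> vertices M'"
  shows "M = M'"
proof -
  obtain j k where "j < length ts" "k < length ts" "M = ts ! j" "M' = ts ! k" using assms(2,3) by (auto simp: in_set_conv_nth)
  then show ?thesis using assms(1,4,5) by auto
qed

lemma set_arity_list: "fst ` set (arity_list T) = vertices T"
  by (induction T) (auto simp: image_UN)

lemma arity_list_subs: "Vertex v ts \<in> subs T ==> (v, length ts) \<in> set (arity_list T)"
  by (induction T) auto

lemma distinct_vdist: "distinct (map fst (arity_list T)) ==> vdist T"
proof (induction T)
  case (Vertex v ts)
  have d: "distinct (concat (map (\<lambda>M. map fst (arity_list M)) ts))" and v: "v \<notin> (\<Union>M\<in>set ts. vertices M)"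
    using Vertex.prems by (auto simp: map_concat comp_def set_arity_list[symmetric])
  have "vertices (ts ! j) \<inter> vertices (ts ! k) = {}" if "j < length ts" "k < length ts" "j \<noteq> k" for j k
    using distinct_concat_nth[OF d that] by (simp add: set_arity_list)
  moreover have "vdist M" if "M \<in> set ts" for M
    by (rule Vertex.IH[OF that distinct_concat_child[OF d that]])
  ultimately show ?case using v by (auto simp: list_all_iff)
qed simp

lemma subs_vertices_Vertex: "M \<in> subs (Vertex v ts) ==> M = Vertex v ts \<or> (\<exists>C\<in>set ts. M \<in> subs C)"
  by auto

lemma rooted_disjoint: "A \<inter> vertices N = {} ==> rooted N A"
  by (induction N) auto

lemma rooted_all: "vertices N \<subseteq> A ==> rooted N A"
  by (induction N) (auto simp: list_all_iff)

text \<open>A recursive form of \<open>subtrees\<close>: the recursion follows the only branch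
  containing \<open>S\<close> until it meets the root of \<open>S\<close>, and from there on
  \<open>S\<close> has to be \<open>rooted\<close>.\<close>

fun conn :: "'v ptree \<Rightarrow> 'v set \<Rightarrow> bool" where
  "conn (Leaf a) S \<longleftrightarrow> False"
| "conn (Vertex v ts) S \<longleftrightarrow> (if v \<in> S then list_all (\<lambda>M. rooted M S) ts
     else (\<exists>M\<in>set ts. conn M S \<and> S \<subseteq> vertices M))"

lemma rooted_conn: "rooted N A ==> A \<inter> vertices N \<noteq> {} ==> conn N A"
  by (cases N) (auto split: if_splits)

lemma inner_edges_vertices: "(a, b) \<in> inner_edges N ==> a \<in> vertices N \<and> b \<in> vertices N"
  by (induction N) (auto intro: bexI[of _ "Vertex b _"])

lemma root_in_subs:
  "vdist (Vertex v ts) ==> M \<in> subs (Vertex v ts) ==> v \<in> vertices M ==> M = Vertex v ts"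
  using vertices_subs vdist_child(2) by (metis subs_vertices_Vertex subsetD)

text \<open>The tree above an edge is joined to the rest by that edge alone, which ends at its
  root.\<close>

lemma edge_into_subtree:
  "\<lbrakk>vdist N; M \<in> subs N; (a, b) \<in> inner_edges N\<rbrakk> \<Longrightarrow>
    (a \<in> vertices M \<longrightarrow> b \<in> vertices M) \<and> (b \<in> vertices M \<and> a \<notin> vertices M \<longrightarrow> (\<exists>us. M = Vertex b us))"
proof (induction N)
  case (Vertex v ts)
  show ?case
  proof (cases "M = Vertex v ts")
    case True
    then show ?thesis using inner_edges_vertices[OF Vertex.prems(3)] by simp
  next
    case False
    then obtain C where C: "C \<in> set ts" "M \<in> subs C" using Vertex.prems(2) by auto
    note VC = vertices_subs[OF C(2)]
    consider us where "a = v" "Vertex b us \<in> set ts" | C' where "C' \<in> set ts" "(a, b) \<in> inner_edges C'"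
      using Vertex.prems(3) by auto
    then show ?thesis
    proof cases
      case 1
      have "a \<notin> vertices M" using 1 VC vdist_child(2)[OF Vertex.prems(1) C(1)] by auto
      moreover have "M = Vertex b us" if "b \<in> vertices M"
      proof -
        have "C = Vertex b us" using vdist_same_child[OF Vertex.prems(1) C(1) 1(2), of b] VC that by auto
        then show ?thesis using root_in_subs[of b us M] C that vdist_child(1)[OF Vertex.prems(1) C(1)] by simp
      qed
      ultimately show ?thesis by blast
    next
      case 2
      note ab = inner_edges_vertices[OF 2(2)]
      show ?thesis
      proof (cases "C' = C")
        case True
        then show ?thesis using Vertex.IH[OF C(1) vdist_child(1)[OF Vertex.prems(1) C(1)] C(2)] 2 by simp
      next
        case False
        then have "a \<notin> vertices M" "b \<notin> vertices M"
          using vdist_same_child[OF Vertex.prems(1) C(1) 2(1)] ab VC by blast+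
        then show ?thesis by simp
      qed
    qed
  qed
qed simp

lemma rtrancl_crossing: "(x, y) \<in> R\<^sup>* ==> x \<notin> X ==> y \<in> X ==> \<exists>a b. (a, b) \<in> R \<and> a \<notin> X \<and> b \<in> X"
  by (induction rule: rtrancl_induct) blast+

text \<open>A path in \<open>S\<close> from outside \<open>M\<close> into \<open>M\<close> passes
  through the root of \<open>M\<close>. If this root is not in \<open>S\<close>, then
  \<open>S\<close> does not meet \<open>M\<close>.\<close>

lemma subtrees_rooted:
  assumes N: "vdist N" and S: "S \<in> subtrees N"
  shows "M \<in> subs N ==> \<not> S \<subseteq> vertices M ==> rooted M S"
proof (induction M)
  case (Vertex p ps)
  let ?R = "(inner_edges N \<union> (inner_edges N)\<inverse>) \<inter> S \<times> S"
  show ?case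
  proof (cases "p \<in> S")
    case True
    have "rooted C S" if "C \<in> set ps" for C
    proof (rule Vertex.IH[OF that])
      show "C \<in> subs N" by (rule subs_trans[OF Vertex.prems(1)]) (use that in \<open>auto intro: bexI[of _ C]\<close>)
      have "vdist (Vertex p ps)" using N Vertex.prems(1)
      proof (induction N)
        case (Vertex v ts)
        then show ?case using vdist_child(1)[OF Vertex.prems(1)] by (metis subs_vertices_Vertex)
      qed simp
      then show "\<not> S \<subseteq> vertices C" using True vdist_child(2)[OF _ that] by blast
    qed
    then show ?thesis using True by (simp add: list_all_iff)
  next
    case False
    have "S \<inter> vertices (Vertex p ps) = {}"
    proof (rule ccontr)
      assume "\<not> ?thesis"
      then obtain x y where xy: "x \<in> S" "x \<notin> vertices (Vertex p ps)" "y \<in> S" "y \<in> vertices (Vertex p ps)"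
        using Vertex.prems(2) by blast
      have "(x, y) \<in> ?R\<^sup>*" using S xy(1,3) unfolding subtrees_def by simp
      then obtain a b where ab: "(a, b) \<in> ?R" "a \<notin> vertices (Vertex p ps)" "b \<in> vertices (Vertex p ps)"
        using rtrancl_crossing[OF _ xy(2,4)] by blast
      have "(b, a) \<notin> inner_edges N" using edge_into_subtree[OF N Vertex.prems(1)] ab(2,3) by blast
      then have "(a, b) \<in> inner_edges N" "b \<in> S" using ab(1) by auto
      then have "b = p" using edge_into_subtree[OF N Vertex.prems(1)] ab(2,3) by blast
      then show False using False \<open>b \<in> S\<close> by simp
    qed
    then show ?thesis using False by simp
  qed
qed simp

lemma subtrees_conn: "vdist N ==> S \<in> subtrees N ==> conn N S"
proof (induction N)
  case (Leaf a)
  then show ?case by (auto simp: subtrees_def)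
next
  case (Vertex v ts)
  note N = Vertex.prems(1)
  have S: "S \<noteq> {}" "S \<subseteq> vertices (Vertex v ts)" using Vertex.prems(2) by (simp_all add: subtrees_def)
  show ?case
  proof (cases "v \<in> S")
    case True
    have "rooted M S" if "M \<in> set ts" for M
      by (rule subtrees_rooted[OF Vertex.prems]) (use that True vdist_child(2)[OF N that] in \<open>auto intro: bexI[of _ M]\<close>)
    then show ?thesis using True by (simp add: list_all_iff)
  next
    case False
    let ?R = "(inner_edges (Vertex v ts) \<union> (inner_edges (Vertex v ts))\<inverse>) \<inter> S \<times> S"
    obtain y where yS: "y \<in> S" using S(1) by blast
    then have "y \<in> (\<Union>M\<in>set ts. vertices M)" using S(2) False by auto
    then obtain C where y: "y \<in> S" "C \<in> set ts" "y \<in> vertices C" using yS by blast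
    have edge: "b \<in> vertices C ==> a \<in> S ==> a \<in> vertices C \<and> (a, b) \<in> inner_edges C"
      and edge': "a \<in> vertices C ==> a \<in> S ==> b \<in> vertices C \<and> (a, b) \<in> inner_edges C"
      if ab: "(a, b) \<in> inner_edges (Vertex v ts)" for a b
    proof -
      have "\<exists>C'\<in>set ts. (a, b) \<in> inner_edges C'" if "a \<in> S" using ab that False by auto
      then show "b \<in> vertices C ==> a \<in> S ==> a \<in> vertices C \<and> (a, b) \<in> inner_edges C"
        "a \<in> vertices C ==> a \<in> S ==> b \<in> vertices C \<and> (a, b) \<in> inner_edges C"
        using vdist_same_child[OF N _ y(2)] inner_edges_vertices by metis+
    qed
    have SC: "S \<subseteq> vertices C"
    proof (rule ccontr)
      assume "\<not> ?thesis"
      then obtain x where x: "x \<in> S" "x \<notin> vertices C" by blast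
      have "(x, y) \<in> ?R\<^sup>*" using Vertex.prems(2) x y unfolding subtrees_def by blast
      then obtain a b where ab: "(a, b) \<in> ?R" "a \<notin> vertices C" "b \<in> vertices C"
        using rtrancl_crossing[OF _ x(2) y(3)] by blast
      then show False using edge[of a b] edge'[of b a] by blast
    qed
    have "?R \<subseteq> (inner_edges C \<union> (inner_edges C)\<inverse>) \<inter> S \<times> S" using edge' SC by blast
    then have "?R\<^sup>* \<subseteq> ((inner_edges C \<union> (inner_edges C)\<inverse>) \<inter> S \<times> S)\<^sup>*" by (rule rtrancl_mono)
    then have "S \<in> subtrees C" using Vertex.prems(2) SC unfolding subtrees_def by blast
    then have "conn C S" by (rule Vertex.IH[OF y(2) vdist_child(1)[OF N y(2)]])
    then show ?thesis using False SC y(2) by auto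
  qed
qed

lemma rooted_path:
  "\<lbrakk>rooted N S; w \<in> S; w \<in> vertices N; inner_edges N \<subseteq> E\<rbrakk> \<Longrightarrow>
    \<exists>v ts. N = Vertex v ts \<and> v \<in> S \<and> (v, w) \<in> (E \<inter> S \<times> S)\<^sup>*"
proof (induction N)
  case (Vertex v ts)
  have v: "v \<in> S" using Vertex.prems(1-3) by (auto split: if_splits)
  show ?case
  proof (cases "w = v")
    case False
    then obtain C where C: "C \<in> set ts" "w \<in> vertices C" using Vertex.prems(3) by auto
    have "rooted C S" using Vertex.prems(1) v C by (simp add: list_all_iff)
    moreover have "inner_edges C \<subseteq> E" using Vertex.prems(4) C by auto
    ultimately obtain u us where u: "C = Vertex u us" "u \<in> S" "(u, w) \<in> (E \<inter> S \<times> S)\<^sup>*"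
      using Vertex.IH[OF C(1) _ Vertex.prems(2) C(2)] by blast
    have "(v, u) \<in> E \<inter> S \<times> S" using Vertex.prems(4) v u C(1) by auto
    then have "(v, w) \<in> (E \<inter> S \<times> S)\<^sup>*" using u(3) by (rule converse_rtrancl_into_rtrancl)
    then show ?thesis using v by blast
  qed (use v in simp)
qed simp

lemma conn_path:
  "\<lbrakk>conn N S; S \<subseteq> vertices N; inner_edges N \<subseteq> E\<rbrakk> \<Longrightarrow> \<exists>v\<in>S. \<forall>w\<in>S. (v, w) \<in> (E \<inter> S \<times> S)\<^sup>*"
proof (induction N)
  case (Vertex v ts)
  show ?case
  proof (cases "v \<in> S")
    case True
    then have "rooted (Vertex v ts) S" using Vertex.prems(1) by simp
    then have "(v, w) \<in> (E \<inter> S \<times> S)\<^sup>*" if "w \<in> S" for w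
      using rooted_path[of "Vertex v ts" S w E] Vertex.prems(2,3) that by blast
    then show ?thesis using True by blast
  next
    case False
    then obtain C where C: "C \<in> set ts" "conn C S" "S \<subseteq> vertices C" using Vertex.prems(1) by auto
    have "inner_edges C \<subseteq> E" using Vertex.prems(3) C(1) by auto
    then show ?thesis by (rule Vertex.IH[OF C])
  qed
qed simp

lemma conn_subtrees:
  assumes "conn N S" "S \<subseteq> vertices N"
  shows "S \<in> subtrees N"
proof -
  let ?E = "inner_edges N"
  let ?R = "(?E \<union> ?E\<inverse>) \<inter> S \<times> S"
  obtain v where v: "v \<in> S" "\<And>w. w \<in> S ==> (v, w) \<in> (?E \<inter> S \<times> S)\<^sup>*"
    using conn_path[OF assms order.refl] by blast
  have le: "(?E \<inter> S \<times> S)\<^sup>* \<subseteq> ?R\<^sup>*" by (intro rtrancl_mono) auto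
  have sym: "sym (?R\<^sup>*)" by (rule sym_rtrancl) (auto simp: sym_def)
  have "(a, b) \<in> ?R\<^sup>*" if "a \<in> S" "b \<in> S" for a b
    using v(2)[OF that(1)] v(2)[OF that(2)] le sym by (meson rtrancl_trans subsetD symD)
  then show ?thesis unfolding subtrees_def using v(1) assms(2) by blast
qed

lemma rooted_subs:
  "\<lbrakk>rooted N S; Vertex v ts \<in> subs N; v \<in> S; M \<in> set ts\<rbrakk> \<Longrightarrow> rooted M S"
proof (induction N)
  case (Vertex p ps)
  have "v \<in> vertices (Vertex p ps)" using vertices_subs[OF Vertex.prems(2)] by auto
  then have p: "p \<in> S" using Vertex.prems(1,3) by (auto split: if_splits)
  show ?case
  proof (cases "Vertex v ts = Vertex p ps")
    case False
    then obtain C where C: "C \<in> set ps" "Vertex v ts \<in> subs C" using Vertex.prems(2) by auto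
    then show ?thesis using Vertex.IH[OF C(1) _ C(2)] Vertex.prems(1,3,4) p by (simp add: list_all_iff)
  qed (use Vertex.prems p in \<open>simp add: list_all_iff\<close>)
qed simp

lemma rooted_parent:
  "\<lbrakk>rooted N S; Vertex p ps \<in> subs N; Vertex v ts \<in> set ps; v \<in> S\<rbrakk> \<Longrightarrow> p \<in> S"
proof (induction N)
  case (Vertex q qs)
  have "v \<in> vertices (Vertex p ps)" using Vertex.prems(3) by (auto intro!: bexI[of _ "Vertex v ts"])
  then have "v \<in> vertices (Vertex q qs)" using vertices_subs[OF Vertex.prems(2)] by blast
  then have q: "q \<in> S" using Vertex.prems(1,4) by (auto split: if_splits)
  show ?case
  proof (cases "Vertex p ps = Vertex q qs")
    case False
    then obtain C where C: "C \<in> set qs" "Vertex p ps \<in> subs C" using Vertex.prems(2) by auto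
    then show ?thesis using Vertex.IH[OF C(1) _ C(2)] Vertex.prems(1,3,4) q by (simp add: list_all_iff)
  qed (use q in simp)
qed simp

lemma conn_down:
  "\<lbrakk>vdist T; conn T S; S \<subseteq> vertices T; Vertex v ts \<in> subs T; v \<in> S; M \<in> set ts\<rbrakk> \<Longrightarrow> rooted M S"
proof (induction T)
  case (Vertex p ps)
  show ?case
  proof (cases "p \<in> S")
    case True
    then have "rooted (Vertex p ps) S" using Vertex.prems(2) by simp
    then show ?thesis using rooted_subs Vertex.prems(4-6) by metis
  next
    case False
    then obtain C where C: "C \<in> set ps" "conn C S" "S \<subseteq> vertices C" using Vertex.prems(2) by auto
    obtain C' where C': "C' \<in> set ps" "Vertex v ts \<in> subs C'" using Vertex.prems(4,5) False by auto
    have "v \<in> vertices C'" using vertices_subs[OF C'(2)] by auto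
    then have "C' = C" using vdist_same_child[OF Vertex.prems(1) C'(1) C(1)] C(3) Vertex.prems(5) by blast
    then show ?thesis using Vertex.IH[OF C(1) vdist_child(1)[OF Vertex.prems(1) C(1)] C(2,3)] C' Vertex.prems(5,6) by blast
  qed
qed simp

lemma conn_up:
  "\<lbrakk>vdist T; conn T S; S \<subseteq> vertices T; Vertex p ps \<in> subs T; Vertex v ts \<in> set ps; v \<in> S;
    \<not> S \<subseteq> vertices (Vertex v ts)\<rbrakk> \<Longrightarrow> p \<in> S"
proof (induction T)
  case (Vertex q qs)
  show ?case
  proof (cases "q \<in> S")
    case True
    then have "rooted (Vertex q qs) S" using Vertex.prems(2) by simp
    then show ?thesis using rooted_parent Vertex.prems(4-6) by metis
  next
    case False
    then obtain C where C: "C \<in> set qs" "conn C S" "S \<subseteq> vertices C" using Vertex.prems(2) by auto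
    have vC: "v \<in> vertices C" using C(3) Vertex.prems(6) by blast
    have "Vertex p ps \<noteq> Vertex q qs"
    proof
      assume "Vertex p ps = Vertex q qs"
      then have "Vertex v ts = C"
        using vdist_same_child[OF Vertex.prems(1) _ C(1) _ vC, of "Vertex v ts"] Vertex.prems(5) by simp
      then show False using C(3) Vertex.prems(7) by simp
    qed
    then obtain C' where C': "C' \<in> set qs" "Vertex p ps \<in> subs C'" using Vertex.prems(4) by auto
    have "v \<in> vertices (Vertex p ps)" using Vertex.prems(5) by (auto intro!: bexI[of _ "Vertex v ts"])
    then have "v \<in> vertices C'" using vertices_subs[OF C'(2)] by blast
    then have "C' = C" using vdist_same_child[OF Vertex.prems(1) C'(1) C(1) _ vC] by blast
    then show ?thesis
      using Vertex.IH[OF C(1) vdist_child(1)[OF Vertex.prems(1) C(1)] C(2,3)] C' Vertex.prems(5-7) by blast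
  qed
qed simp

section \<open>Connectedness under insertion\<close>

lemma rooted_graft:
  "\<lbrakk>vertices N \<subseteq> A; \<forall>a\<in>set (leaf_list N). rooted (ts ! a) A\<rbrakk> \<Longrightarrow> rooted (graft N ts) A"
  by (induction N) (auto simp: list_all_iff, blast)

lemma conn_graft:
  "\<lbrakk>a \<in> set (leaf_list N); conn (ts ! a) A; A \<subseteq> vertices (ts ! a); A \<inter> vertices N = {}\<rbrakk> \<Longrightarrow> conn (graft N ts) A"
proof (induction N)
  case (Vertex p ps)
  obtain C where C: "C \<in> set ps" "a \<in> set (leaf_list C)" using Vertex.prems(1) by auto
  have "conn (graft C ts) A" by (rule Vertex.IH[OF C Vertex.prems(2,3)]) (use Vertex.prems(4) C in auto)
  moreover have "A \<subseteq> vertices (graft C ts)" using Vertex.prems(3) C(2) by (auto simp: vertices_graft)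
  moreover have "p \<notin> A" using Vertex.prems(4) by auto
  ultimately show ?case using C(1) by auto
qed simp

lemma rooted_graft_relabel:
  "\<lbrakk>rooted N S; inj_on g V; vertices N \<subseteq> V; S \<subseteq> V; \<forall>a\<in>set (leaf_list N). vertices (ts ! a) \<inter> g ` V = {}\<rbrakk>
    \<Longrightarrow> rooted (graft (relabel g N) ts) (g ` S)"
proof (induction N)
  case (Leaf a)
  then have "g ` S \<inter> vertices (ts ! a) = {}" by fastforce
  then show ?case by (simp add: rooted_disjoint)
next
  case (Vertex p ps)
  have pV: "p \<in> V" using Vertex.prems(3) by simp
  show ?case
  proof (cases "p \<in> S")
    case True
    have "rooted (graft (relabel g C) ts) (g ` S)" if "C \<in> set ps" for C
      by (rule Vertex.IH[OF that _ Vertex.prems(2)]) (use Vertex.prems that True in \<open>auto simp: list_all_iff\<close>)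
    then show ?thesis using True by (simp add: list_all_iff)
  next
    case False
    then have "S \<inter> vertices (Vertex p ps) = {}" using Vertex.prems(1) by simp
    then have "g ` S \<inter> g ` vertices (Vertex p ps) = {}"
      using Vertex.prems(2-4) by (metis image_empty inj_on_image_Int)
    then have "g ` S \<inter> vertices (graft (relabel g (Vertex p ps)) ts) = {}"
      using Vertex.prems(4,5) unfolding vertices_graft ptree.set_map leaf_list_relabel by blast
    then show ?thesis by (rule rooted_disjoint)
  qed
qed

lemma conn_graft_relabel:
  "\<lbrakk>conn N S; S \<subseteq> vertices N; inj_on g V; vertices N \<subseteq> V; \<forall>a\<in>set (leaf_list N). vertices (ts ! a) \<inter> g ` V = {}\<rbrakk>
    \<Longrightarrow> conn (graft (relabel g N) ts) (g ` S)"
proof (induction N)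
  case (Vertex p ps)
  have pV: "p \<in> V" using Vertex.prems(4) by simp
  have SV: "S \<subseteq> V" using Vertex.prems(2,4) by blast
  show ?case
  proof (cases "p \<in> S")
    case True
    have "rooted (graft (relabel g C) ts) (g ` S)" if "C \<in> set ps" for C
      by (rule rooted_graft_relabel[OF _ Vertex.prems(3) _ SV]) (use Vertex.prems that True in \<open>auto simp: list_all_iff\<close>)
    then show ?thesis using True by (simp add: list_all_iff)
  next
    case False
    then obtain C where C: "C \<in> set ps" "conn C S" "S \<subseteq> vertices C" using Vertex.prems(1) by auto
    have "conn (graft (relabel g C) ts) (g ` S)"
      by (rule Vertex.IH[OF C Vertex.prems(3)]) (use Vertex.prems C in auto)
    moreover have "g p \<notin> g ` S" using False Vertex.prems(3) SV pV by (simp add: inj_on_image_mem_iff)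
    moreover have "g ` S \<subseteq> vertices (graft (relabel g C) ts)" using C(3) by (auto simp: vertices_graft ptree.set_map)
    ultimately show ?thesis using C(1) by auto
  qed
qed simp

locale tree_pair = tree_substitution +
  assumes T: "vdist T" and U: "vdist U" and iT: "i \<in> vertices T"
begin

lemma sub_cases:
  assumes "z \<in> sub S"
  obtains v where "v \<in> S" "v \<noteq> i" "z = f v" | u where "u \<in> vertices U" "i \<in> S" "z = i + u"
  using assms by (auto simp: subst_subtree_def split: if_splits)

lemma sub_disjoint: "A \<inter> B = {} ==> sub A \<inter> sub B = {}"
proof (rule ccontr)
  assume AB: "A \<inter> B = {}" and "sub A \<inter> sub B \<noteq> {}"
  then obtain z where z: "z \<in> sub A" "z \<in> sub B" by blast
  show False using z(1)
  proof (cases rule: sub_cases)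
    case (1 v)
    then show False using AB z(2) f_in_sub[of v B] by blast
  next
    case (2 u)
    then show False using AB z(2) new_in_sub[of u B] by blast
  qed
qed

lemma child_subs: "Vertex v ts \<in> subs T ==> M \<in> set ts ==> M \<in> subs T"
  by (rule subs_trans, assumption) (auto intro: bexI[of _ M])

lemma rooted_comp: "N \<in> subs T ==> rooted N S ==> rooted (tree_comp i N U) (sub S)"
proof (induction N)
  case (Vertex v ts)
  have IH: "rooted (tree_comp i M U) (sub S)" if "M \<in> set ts" "v \<in> S" for M
    by (rule Vertex.IH[OF that(1) child_subs[OF Vertex.prems(1) that(1)]]) (use Vertex.prems(2) that in \<open>simp add: list_all_iff\<close>)
  show ?case
  proof (cases "v \<in> S")
    case False
    then have "S \<inter> vertices (Vertex v ts) = {}" using Vertex.prems(2) by simp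
    then have "sub S \<inter> vertices (tree_comp i (Vertex v ts) U) = {}"
      unfolding vertices_comp[OF Vertex.prems(1)] by (rule sub_disjoint)
    then show ?thesis by (rule rooted_disjoint)
  next
    case vS: True
    show ?thesis
    proof (cases "v = i")
      case False
      then show ?thesis using IH vS f_in_sub[OF False] by (simp add: list_all_iff)
    next
      case True
      have set: "set (leaf_list U) = {..<length ts}" using arity Vertex.prems(1) True by (auto simp: arity_fits_def)
      have "rooted (graft (relabel ((+) i) U) (map (\<lambda>t. tree_comp i t U) ts)) (sub S)"
        by (rule rooted_graft) (use vS True set IH in \<open>auto simp: ptree.set_map subst_subtree_def\<close>)
      then show ?thesis using True by simp
    qed
  qed
qed simp

lemma conn_comp:
  "\<lbrakk>N \<in> subs T; conn N S; S \<subseteq> vertices N; sub S \<noteq> {}\<rbrakk> \<Longrightarrow> conn (tree_comp i N U) (sub S)"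
proof (induction N)
  case (Vertex v ts)
  let ?ts = "map (\<lambda>t. tree_comp i t U) ts"
  show ?case
  proof (cases "v \<in> S")
    case True
    then have "rooted (Vertex v ts) S" using Vertex.prems(2) by simp
    then have "rooted (tree_comp i (Vertex v ts) U) (sub S)" by (rule rooted_comp[OF Vertex.prems(1)])
    moreover have "sub S \<subseteq> vertices (tree_comp i (Vertex v ts) U)"
      using sub_mono[OF Vertex.prems(3)] vertices_comp[OF Vertex.prems(1)] by simp
    then have "sub S \<inter> vertices (tree_comp i (Vertex v ts) U) \<noteq> {}" using Vertex.prems(4) by blast
    ultimately show ?thesis by (rule rooted_conn)
  next
    case False
    then obtain C where C: "C \<in> set ts" "conn C S" "S \<subseteq> vertices C" using Vertex.prems(2) by auto
    note CT = child_subs[OF Vertex.prems(1) C(1)]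
    have cC: "conn (tree_comp i C U) (sub S)" by (rule Vertex.IH[OF C(1) CT C(2,3) Vertex.prems(4)])
    have le: "sub S \<subseteq> vertices (tree_comp i C U)" using sub_mono[OF C(3)] vertices_comp[OF CT] by simp
    show ?thesis
    proof (cases "v = i")
      case vi: False
      then show ?thesis using cC le C(1) False f_in_sub[OF vi] by auto
    next
      case True
      have set: "set (leaf_list U) = {..<length ts}" using arity Vertex.prems(1) True by (auto simp: arity_fits_def)
      obtain a where a: "a < length ts" "C = ts ! a" using C(1) by (auto simp: in_set_conv_nth)
      have "conn (graft (relabel ((+) i) U) ?ts) (sub S)"
      proof (rule conn_graft[of a])
        show "sub S \<inter> vertices (relabel ((+) i) U) = {}"
          using new_in_sub False True by (auto simp: ptree.set_map)
      qed (use a set cC le in auto)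
      then show ?thesis using True by simp
    qed
  qed
qed simp

lemma conn_new:
  assumes S: "conn U S" "S \<subseteq> vertices U"
  shows "conn (tree_comp i T U) ((+) i ` S)"
proof -
  have gen: "N \<in> subs T ==> i \<in> vertices N ==> conn (tree_comp i N U) ((+) i ` S)" for N
  proof (induction N)
    case (Vertex v ts)
    let ?ts = "map (\<lambda>t. tree_comp i t U) ts"
    show ?case
    proof (cases "v = i")
      case False
      then obtain C where C: "C \<in> set ts" "i \<in> vertices C" using Vertex.prems(2) by auto
      note CT = child_subs[OF Vertex.prems(1) C(1)]
      have "conn (tree_comp i C U) ((+) i ` S)" by (rule Vertex.IH[OF C(1) CT C(2)])
      moreover have "f v \<notin> (+) i ` S" using shift_new[OF False] new_less S(2) by blast
      moreover have "(+) i ` S \<subseteq> vertices (tree_comp i C U)"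
        unfolding vertices_comp[OF CT] using S(2) C(2) by (auto simp: subst_subtree_def)
      ultimately show ?thesis using False C(1) by auto
    next
      case True
      have set: "set (leaf_list U) = {..<length ts}" using arity Vertex.prems(1) True by (auto simp: arity_fits_def)
      have "vdist (Vertex v ts)"
        using T Vertex.prems(1)
      proof (induction T)
        case (Vertex q qs)
        then show ?case using vdist_child(1)[OF Vertex.prems(1)] by (metis subs_vertices_Vertex)
      qed simp
      then have i: "i \<notin> vertices M" if "M \<in> set ts" for M using vdist_child(2)[OF \<open>vdist (Vertex v ts)\<close> that] True by simp
      have "conn (graft (relabel ((+) i) U) ?ts) ((+) i ` S)"
      proof (rule conn_graft_relabel[OF S, of _ "vertices U"], simp, simp, rule ballI)
        fix a assume "a \<in> set (leaf_list U)"
        then have a: "a < length ts" using set by simp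
        have "ts ! a \<in> set ts" using a by simp
        then have "vertices (tree_comp i (ts ! a) U) \<inter> (+) i ` vertices U = {}"
          using vertices_comp[OF child_subs[OF Vertex.prems(1)]] new_in_sub i by auto
        then show "vertices (?ts ! a) \<inter> (+) i ` vertices U = {}" using a by simp
      qed
      then show ?thesis using True by simp
    qed
  qed simp
  show ?thesis by (rule gen[OF subs_refl iT])
qed

lemma conn_whole_new: "vertices U \<noteq> {} ==> conn (tree_comp i T U) ((+) i ` vertices U)"
proof (rule conn_new)
  assume "vertices U \<noteq> {}"
  then show "conn U (vertices U)" by (intro rooted_conn rooted_all) auto
qed simp

end

section \<open>Realizations of posets of bracketings\<close>

definition bracket_mass :: "('a set \<Rightarrow> real) \<Rightarrow> 'a \<Rightarrow> real" where
  "bracket_mass u S = (\<Sum>B | u B \<noteq> 0 \<and> S \<in> B. u B)"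

lemma realizationD:
  assumes "u \<in> realization P"
  shows "0 \<le> u a" "u a \<noteq> 0 ==> a \<in> P" "sum u P = 1" "finite P"
    and "u a \<noteq> 0 ==> u b \<noteq> 0 ==> a \<le> b \<or> b \<le> a" "finite {a. u a \<noteq> 0}" "(\<Sum>a | u a \<noteq> 0. u a) = 1"
proof -
  show "0 \<le> u a" "u a \<noteq> 0 ==> a \<in> P" "u a \<noteq> 0 ==> u b \<noteq> 0 ==> a \<le> b \<or> b \<le> a" and s: "sum u P = 1"
    using assms unfolding realization_def by blast+
  show P: "finite P" using s by (metis sum.infinite zero_neq_one)
  have le: "{a. u a \<noteq> 0} \<subseteq> P" using assms unfolding realization_def by blast
  show "finite {a. u a \<noteq> 0}" by (rule finite_subset[OF le P])
  have "(\<Sum>a | u a \<noteq> 0. u a) = sum u P" by (rule sum.mono_neutral_left[OF P le]) auto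
  then show "(\<Sum>a | u a \<noteq> 0. u a) = 1" using s by simp
qed

text \<open>This is summation over the fibres of \<open>f\<close>; since masses are nonnegative, no
  value of the push-forward vanishes by cancellation.\<close>

lemma sum_realize_map:
  assumes fin: "finite {p. w p \<noteq> 0}" and nonneg: "\<And>p. 0 \<le> w p"
  shows "(\<Sum>b | realize_map f w b \<noteq> 0 \<and> Q b. realize_map f w b) = (\<Sum>p | w p \<noteq> 0 \<and> Q (f p). w p)"
proof -
  let ?D = "{b. realize_map f w b \<noteq> 0 \<and> Q b}" and ?S = "{p. w p \<noteq> 0 \<and> Q (f p)}"
  have fin': "finite {p. w p \<noteq> 0 \<and> R p}" for R by (rule finite_subset[OF _ fin]) auto
  have nz: "realize_map f w (f p) \<noteq> 0" if "w p \<noteq> 0" for p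
  proof -
    have "w p \<le> realize_map f w (f p)" unfolding realize_map_def
      by (rule member_le_sum) (use that nonneg fin' in auto)
    then show ?thesis using nonneg[of p] that by auto
  qed
  have D: "?D \<subseteq> f ` ?S"
  proof
    fix b assume b: "b \<in> ?D"
    then have "{p. w p \<noteq> 0 \<and> f p = b} \<noteq> {}" unfolding realize_map_def by (metis (mono_tags, lifting) mem_Collect_eq sum.empty)
    then show "b \<in> f ` ?S" using b by auto
  qed
  have fD: "f ` ?S \<subseteq> ?D" using nz by auto
  have finD: "finite ?D" by (rule finite_subset[OF D]) (use fin'[of "\<lambda>p. Q (f p)"] in simp)
  have "(\<Sum>b\<in>?D. \<Sum>p\<in>{p\<in>?S. f p = b}. w p) = sum w ?S"
    by (rule sum.group[OF fin' finD fD])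
  moreover have "(\<Sum>p\<in>{p\<in>?S. f p = b}. w p) = realize_map f w b" if "b \<in> ?D" for b
    unfolding realize_map_def by (rule sum.cong) (use that in auto)
  ultimately show ?thesis by simp
qed

lemma bracket_mass_realize_map:
  assumes "finite {p. w p \<noteq> 0}" "\<And>p. 0 \<le> w p"
  shows "bracket_mass (realize_map f w) S = (\<Sum>p | w p \<noteq> 0 \<and> S \<in> f p. w p)"
  unfolding bracket_mass_def by (rule sum_realize_map[OF assms])

lemma bracket_mass_mem:
  assumes "u \<in> realization P"
  shows "0 \<le> bracket_mass u S" "bracket_mass u S \<le> 1"
proof -
  note u = realizationD[OF assms]
  show "0 \<le> bracket_mass u S" unfolding bracket_mass_def by (rule sum_nonneg) (use u(1) in auto)
  have "bracket_mass u S \<le> (\<Sum>a | u a \<noteq> 0. u a)" unfolding bracket_mass_def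
    by (rule sum_mono2) (use u in auto)
  then show "bracket_mass u S \<le> 1" using u(7) by simp
qed

lemma bracket_mass_pos:
  "0 < bracket_mass u S ==> \<exists>B. u B \<noteq> 0 \<and> S \<in> B"
  unfolding bracket_mass_def by (metis (mono_tags, lifting) less_irrefl mem_Collect_eq sum.neutral)

text \<open>The support of \<open>w\<close> is a chain, so the conditions on the two components
  select nested subsets of it, and their intersection has the smaller mass. The joint distribution
  function is the minimum of the marginal ones, as for a monotone coupling.\<close>

lemma chain_mass:
  fixes w :: "'a::order \<times> 'b::order \<Rightarrow> real"
  assumes w: "w \<in> realization R"
  shows "(\<Sum>p | w p \<noteq> 0 \<and> p \<le> (a, b). w p) =
    min (\<Sum>a' | realize_map fst w a' \<noteq> 0 \<and> a' \<le> a. realize_map fst w a') (\<Sum>b' | realize_map snd w b' \<noteq> 0 \<and> b' \<le> b. realize_map snd w b')"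
proof -
  note W = realizationD[OF w]
  let ?A = "{p. w p \<noteq> 0 \<and> fst p \<le> a}" and ?B = "{p. w p \<noteq> 0 \<and> snd p \<le> b}"
  have fin: "finite ?A" "finite ?B" by (rule finite_subset[OF _ W(6)], blast)+
  have "?A \<subseteq> ?B \<or> ?B \<subseteq> ?A"
  proof (rule ccontr)
    assume "\<not> ?thesis"
    then obtain p q where pq: "p \<in> ?A" "p \<notin> ?B" "q \<in> ?B" "q \<notin> ?A" by blast
    then have "p \<le> q \<or> q \<le> p" using W(5) by blast
    then have "(fst p \<le> fst q \<and> snd p \<le> snd q) \<or> (fst q \<le> fst p \<and> snd q \<le> snd p)" by (simp add: less_eq_prod_def)
    then show False using pq by auto
  qed
  moreover have eq: "{p. w p \<noteq> 0 \<and> p \<le> (a, b)} = ?A \<inter> ?B" by (auto simp: less_eq_prod_def)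
  have "sum w (?A \<inter> ?B) = min (sum w ?A) (sum w ?B)" if le: "?A \<subseteq> ?B"
  proof -
    have "sum w ?A \<le> sum w ?B" by (rule sum_mono2[OF fin(2) le]) (use W(1) in auto)
    moreover have "?A \<inter> ?B = ?A" using le by (rule Int_absorb2)
    ultimately show ?thesis by simp
  qed
  moreover have "sum w (?A \<inter> ?B) = min (sum w ?A) (sum w ?B)" if le: "?B \<subseteq> ?A"
  proof -
    have "sum w ?B \<le> sum w ?A" by (rule sum_mono2[OF fin(1) le]) (use W(1) in auto)
    moreover have "?A \<inter> ?B = ?B" using le by (rule Int_absorb1)
    ultimately show ?thesis by simp
  qed
  ultimately have "(\<Sum>p | w p \<noteq> 0 \<and> p \<le> (a, b). w p) = min (sum w ?A) (sum w ?B)"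
    unfolding eq by blast
  then show ?thesis
    using sum_realize_map[OF W(6,1), of fst "\<lambda>a'. a' \<le> a"] sum_realize_map[OF W(6,1), of snd "\<lambda>b'. b' \<le> b"] by simp
qed

text \<open>Equal marginals give equal distribution functions. At a minimal point where
  \<open>w\<close> and \<open>w'\<close> differ all smaller masses agree, so the masses there agree
  too.\<close>

lemma realize_marginals_inj:
  "inj_on (\<lambda>w. (realize_map fst w, realize_map snd w)) (realization (P \<times> Q))"
proof (rule inj_onI, rule ccontr)
  fix w w' assume w: "w \<in> realization (P \<times> Q)" and w': "w' \<in> realization (P \<times> Q)"
    and eq: "(realize_map fst w, realize_map snd w) = (realize_map fst w', realize_map snd w')" and ne: "w \<noteq> w'"
  note W = realizationD[OF w] and W' = realizationD[OF w']
  let ?D = "{p. w p \<noteq> w' p}"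
  have "finite ?D" by (rule finite_subset[OF _ finite_UnI[OF W(6) W'(6)]]) auto
  moreover have "?D \<noteq> {}" using ne by auto
  ultimately obtain p where p: "p \<in> ?D" "\<And>q. q \<in> ?D ==> q \<le> p ==> q = p"
    using finite_has_minimal[of ?D] by metis
  let ?K = "{q. q \<le> p \<and> (w q \<noteq> 0 \<or> w' q \<noteq> 0 \<or> q = p)}"
  have finK: "finite ?K"
    by (rule finite_subset[of _ "insert p ({q. w q \<noteq> 0} \<union> {q. w' q \<noteq> 0})"]) (use W(6) W'(6) in auto)
  obtain a b where ab: "p = (a, b)" by (cases p)
  have "sum w ?K = (\<Sum>q | w q \<noteq> 0 \<and> q \<le> p. w q)"
    by (rule sum.mono_neutral_right[OF finK]) auto
  moreover have "sum w' ?K = (\<Sum>q | w' q \<noteq> 0 \<and> q \<le> p. w' q)"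
    by (rule sum.mono_neutral_right[OF finK]) auto
  ultimately have "sum w ?K = sum w' ?K" using chain_mass[OF w, of a b] chain_mass[OF w', of a b] eq ab by simp
  moreover have "sum w (?K - {p}) = sum w' (?K - {p})"
    by (rule sum.cong) (use p(2) in auto)
  moreover have "p \<in> ?K" by simp
  note sum.remove[OF finK this, of w] sum.remove[OF finK this, of w']
  ultimately have "w p = w' p" by linarith
  then show False using p(1) by blast
qed

text \<open>A point of the realization cuts the unit interval into consecutive slots, one for each
  element of its chain and as long as the mass of that element. This is the quantile description of
  a distribution.\<close>

locale chain_measure =
  fixes u :: "'a::order \<Rightarrow> real" and P
  assumes u: "u \<in> realization P"
begin

definition "upper a = (\<Sum>a' | u a' \<noteq> 0 \<and> a' \<le> a. u a')"
definition "slot a = {upper a - u a<..upper a}"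

lemmas U = realizationD[OF u]

lemma upper_split: "upper a = (\<Sum>a' | u a' \<noteq> 0 \<and> a' < a. u a') + u a"
proof -
  have fin: "finite {a'. u a' \<noteq> 0 \<and> a' < a}" by (rule finite_subset[OF _ U(6)]) auto
  show ?thesis
  proof (cases "u a = 0")
    case True
    then have "{a'. u a' \<noteq> 0 \<and> a' \<le> a} = {a'. u a' \<noteq> 0 \<and> a' < a}" by (auto simp: less_le)
    then show ?thesis using True by (simp add: upper_def)
  next
    case False
    then have "{a'. u a' \<noteq> 0 \<and> a' \<le> a} = insert a {a'. u a' \<noteq> 0 \<and> a' < a}" by (auto simp: less_le)
    then show ?thesis using fin by (simp add: upper_def)
  qed
qed

lemma upper_less: "a < b ==> upper a \<le> upper b - u b"
proof -
  assume ab: "a < b"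
  have "upper a \<le> (\<Sum>a' | u a' \<noteq> 0 \<and> a' < b. u a')" unfolding upper_def
    by (rule sum_mono2) (use U(1) ab in \<open>auto intro: finite_subset[OF _ U(6)]\<close>)
  then show ?thesis using upper_split[of b] by simp
qed

lemma upper_range: "0 \<le> upper a - u a" "upper a \<le> 1"
proof -
  show "0 \<le> upper a - u a" using upper_split[of a] U(1) by (simp add: sum_nonneg)
  have "upper a \<le> (\<Sum>a | u a \<noteq> 0. u a)" unfolding upper_def by (rule sum_mono2) (use U in auto)
  then show "upper a \<le> 1" using U(7) by simp
qed

lemma slot_sets[simp, measurable]: "slot a \<in> sets lborel" and slot_unit: "slot a \<subseteq> {0<..1}"
  using upper_range[of a] by (auto simp: slot_def)

lemma measure_slot: "measure lborel (slot a) = u a"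
  using U(1)[of a] by (simp add: slot_def)

lemma slot_disjoint: "disjoint_family_on slot {a. u a \<noteq> 0}"
  unfolding disjoint_family_on_def
proof (intro ballI impI)
  fix a b assume "a \<in> {a. u a \<noteq> 0}" "b \<in> {a. u a \<noteq> 0}" "a \<noteq> b"
  then have "a < b \<or> b < a" using U(5)[of a b] by (auto simp: less_le)
  then show "slot a \<inter> slot b = {}" using upper_less[of a b] upper_less[of b a] by (force simp: slot_def)
qed

lemma fm: "X \<in> sets lborel ==> X \<subseteq> {0<..1::real} ==> X \<in> fmeasurable lborel"
  by (rule fmeasurableI2[of "{0<..1}"]) (auto simp: fmeasurable_def)

text \<open>The slots are disjoint subsets of the unit interval with total length 1, so they miss
  only a null set.\<close>

lemma sum_slots:
  assumes X: "X \<in> sets lborel" "X \<subseteq> {0<..1}"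
  shows "(\<Sum>a | u a \<noteq> 0. measure lborel (X \<inter> slot a)) = measure lborel X"
proof -
  let ?A = "{a. u a \<noteq> 0}" and ?J = "\<Union>a\<in>{a. u a \<noteq> 0}. slot a"
  have sum: "(\<Sum>a\<in>?A. measure lborel (Y \<inter> slot a)) = measure lborel (Y \<inter> ?J)" if Y: "Y \<in> sets lborel" for Y
  proof -
    have "measure lborel (\<Union>a\<in>?A. Y \<inter> slot a) = (\<Sum>a\<in>?A. measure lborel (Y \<inter> slot a))"
    proof (rule measure_finite_Union)
      show "disjoint_family_on (\<lambda>a. Y \<inter> slot a) ?A" using slot_disjoint by (fastforce simp: disjoint_family_on_def)
      show "emeasure lborel (Y \<inter> slot a) \<noteq> \<infinity>" if "a \<in> ?A" for a
        using fm[of "Y \<inter> slot a"] slot_unit[of a] Y by (auto simp: fmeasurable_def top_unique less_top)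
    qed (use Y U(6) in auto)
    moreover have "(\<Union>a\<in>?A. Y \<inter> slot a) = Y \<inter> ?J" by blast
    ultimately show ?thesis by simp
  qed
  have "?J \<in> sets lborel" by (rule sets.finite_UN[OF U(6) slot_sets])
  moreover have "?J \<subseteq> {0<..1}" using slot_unit by blast
  ultimately have J: "?J \<in> sets lborel" "?J \<subseteq> {0<..1}" .
  have "measure lborel ({0<..1} \<inter> ?J) = 1"
    using sum[of "{0<..1}"] U(7) measure_slot slot_unit by (simp add: Int_absorb1)
  then have "measure lborel ?J = 1" using J(2) by (simp add: Int_absorb1)
  then have "measure lborel ({0<..1} - ?J) = 0"
    using measurable_measure_Diff[of "{0<..1}" lborel ?J] J by (auto simp: fmeasurable_def)
  moreover have "measure lborel (X - ?J) \<le> measure lborel ({0<..1} - ?J)"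
    by (rule measure_mono_fmeasurable) (use X J in \<open>auto intro!: fm\<close>)
  ultimately have "measure lborel (X - ?J) = 0" by (simp add: antisym)
  moreover have "measure lborel (X - ?J) = measure lborel X - measure lborel (X \<inter> ?J)"
  proof -
    have "measure lborel (X - X \<inter> ?J) = measure lborel X - measure lborel (X \<inter> ?J)"
      by (rule measurable_measure_Diff) (use X J in \<open>auto intro!: fm\<close>)
    moreover have "X - X \<inter> ?J = X - ?J" by blast
    ultimately show ?thesis by (simp only:)
  qed
  ultimately show ?thesis using sum[OF X(1)] by simp
qed

end

text \<open>The mass of a pair is the length of the overlap of its two slots. The slots of both
  chains are passed in increasing order, so the overlapping pairs form a chain, and summing overlaps
  recovers the marginals.\<close>

lemma realize_marginals_surj:
  fixes P :: "'a::order set" and Q :: "'b::order set"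
  assumes u: "u \<in> realization P" and v: "v \<in> realization Q"
  shows "\<exists>w\<in>realization (P \<times> Q). realize_map fst w = u \<and> realize_map snd w = v"
proof -
  interpret u: chain_measure u P by unfold_locales (rule u)
  interpret v: chain_measure v Q by unfold_locales (rule v)
  define w where "w = (\<lambda>(a, b). if u a \<noteq> 0 \<and> v b \<noteq> 0 then measure lborel (u.slot a \<inter> v.slot b) else 0)"
  have w_supp: "u a \<noteq> 0 \<and> v b \<noteq> 0 \<and> u.slot a \<inter> v.slot b \<noteq> {}" if "w (a, b) \<noteq> 0" for a b
    using that by (auto simp: w_def split: if_splits)
  have mono: "b \<le> b'" if ab: "w (a, b) \<noteq> 0" "w (a', b') \<noteq> 0" "a < a'" for a b a' b'
  proof (rule ccontr)
    assume "\<not> ?thesis"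
    then have b: "b' < b" using v.U(5)[of b b'] w_supp[OF ab(1)] w_supp[OF ab(2)] by (auto simp: less_le)
    obtain s where s: "s \<in> u.slot a" "s \<in> v.slot b" using w_supp[OF ab(1)] by blast
    obtain s' where s': "s' \<in> u.slot a'" "s' \<in> v.slot b'" using w_supp[OF ab(2)] by blast
    show False using u.upper_less[OF ab(3)] v.upper_less[OF b] s s' by (auto simp: u.slot_def v.slot_def)
  qed
  have row: "realize_map fst w a = u a" for a
  proof (cases "u a = 0")
    case True
    then have "{p. w p \<noteq> 0 \<and> fst p = a} = {}" using w_supp by force
    then have "realize_map fst w a = 0" unfolding realize_map_def by (rule ssubst) (rule sum.empty)
    then show ?thesis using True by simp
  next
    case False
    have "realize_map fst w a = sum w (Pair a ` {b. v b \<noteq> 0})" unfolding realize_map_def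
      by (rule sum.mono_neutral_left) (use v.U(6) w_supp in auto)
    also have "\<dots> = (\<Sum>b | v b \<noteq> 0. measure lborel (u.slot a \<inter> v.slot b))"
      using False by (subst sum.reindex) (auto simp: inj_on_def w_def intro!: sum.cong)
    also have "\<dots> = u a" using v.sum_slots[OF u.slot_sets u.slot_unit] u.measure_slot by simp
    finally show ?thesis .
  qed
  have col: "realize_map snd w b = v b" for b
  proof (cases "v b = 0")
    case True
    then have "{p. w p \<noteq> 0 \<and> snd p = b} = {}" using w_supp by force
    then have "realize_map snd w b = 0" unfolding realize_map_def by (rule ssubst) (rule sum.empty)
    then show ?thesis using True by simp
  next
    case False
    have "realize_map snd w b = sum w ((\<lambda>a. (a, b)) ` {a. u a \<noteq> 0})" unfolding realize_map_def
      by (rule sum.mono_neutral_left) (use u.U(6) w_supp in auto)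
    also have "\<dots> = (\<Sum>a | u a \<noteq> 0. measure lborel (v.slot b \<inter> u.slot a))"
      using False by (subst sum.reindex) (auto simp: inj_on_def w_def Int_commute intro!: sum.cong)
    also have "\<dots> = v b" using u.sum_slots[OF v.slot_sets v.slot_unit] v.measure_slot by simp
    finally show ?thesis .
  qed
  have fin: "finite {p. w p \<noteq> 0}"
    by (rule finite_subset[OF _ finite_cartesian_product[OF u.U(6) v.U(6)]]) (use w_supp in auto)
  have "w \<in> realization (P \<times> Q)"
    unfolding realization_def mem_Collect_eq
  proof (intro conjI allI impI)
    show w0: "0 \<le> w p" for p by (cases p) (simp add: w_def)
    show "w p = 0" if "p \<notin> P \<times> Q" for p
      using that w_supp u.U(2) v.U(2) by (cases p) blast
    have "(\<Sum>p | w p \<noteq> 0. w p) = (\<Sum>a | realize_map fst w a \<noteq> 0 \<and> True. realize_map fst w a)"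
      using sum_realize_map[OF fin w0, of fst "\<lambda>_. True"] by simp
    also have "\<dots> = 1" using row u.U(7) by simp
    finally have "(\<Sum>p | w p \<noteq> 0. w p) = 1" .
    moreover have "(\<Sum>p | w p \<noteq> 0. w p) = sum w (P \<times> Q)"
      by (rule sum.mono_neutral_left) (use u.U(2,4) v.U(2,4) w_supp in auto)
    ultimately show "sum w (P \<times> Q) = 1" by simp
    fix p q assume pq: "w p \<noteq> 0" "w q \<noteq> 0"
    obtain a b a' b' where ab: "p = (a, b)" "q = (a', b')" by (cases p, cases q)
    have "a \<le> a' \<or> a' \<le> a" "b \<le> b' \<or> b' \<le> b"
      using u.U(5) v.U(5) w_supp pq ab by metis+
    then have "(a, b) \<le> (a', b') \<or> (a', b') \<le> (a, b)"
      using mono[of a b a' b'] mono[of a' b' a b] pq ab by (auto simp: less_eq_prod_def less_le)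
    then show "p \<le> q \<or> q \<le> p" using ab by simp
  qed
  then show ?thesis using row col by blast
qed

lemma realize_prod_marginals:
  fixes P :: "'a::order set" and Q :: "'b::order set"
  assumes "u \<in> realization P" "v \<in> realization Q"
  shows "realize_prod P Q (u, v) \<in> realization (P \<times> Q)"
    "realize_map fst (realize_prod P Q (u, v)) = u" "realize_map snd (realize_prod P Q (u, v)) = v"
proof -
  let ?m = "\<lambda>w. (realize_map fst w, realize_map snd w)" and ?w = "realize_prod P Q (u, v)"
  have im: "(u, v) \<in> ?m ` realization (P \<times> Q)" using realize_marginals_surj[OF assms] by force
  show "?w \<in> realization (P \<times> Q)" unfolding realize_prod_def
    by (rule the_inv_into_into[OF realize_marginals_inj im order.refl])
  have "?m ?w = (u, v)" unfolding realize_prod_def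
    by (rule f_the_inv_into_f[OF realize_marginals_inj im])
  then show "realize_map fst ?w = u" "realize_map snd ?w = v" by simp_all
qed

text \<open>These sets are never brackets but take part in the clamping with weight 1:
  \<open>{}\<close> as the parameter itself, the whole tree for the final normalization, and single
  vertices because the image of a vertex has weight 1 when a tree is inserted there.\<close>

definition unbracketed :: "'v ptree \<Rightarrow> 'v set \<Rightarrow> bool" where
  "unbracketed T S \<longleftrightarrow> S = {} \<or> S = vertices T \<or> (\<exists>v\<in>vertices T. S = {v})"

definition height :: "'v ptree \<Rightarrow> ('v set set \<Rightarrow> real) \<Rightarrow> 'v set \<Rightarrow> real" where
  "height T u S = (if unbracketed T S then 1 else bracket_mass u S)"

lemma large_properI:
  assumes "conn N S" "S \<subseteq> vertices N" "\<not> unbracketed N S"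
  shows "S \<in> large_proper_subtrees N"
proof -
  have "finite S" by (rule finite_subset[OF assms(2) finite_vertices])
  moreover have "card S \<noteq> 1" using assms(2,3) unfolding unbracketed_def by (metis card_1_singletonE insert_subset)
  moreover have "S \<noteq> {}" using assms(3) by (simp add: unbracketed_def)
  ultimately have "2 \<le> card S" by (metis One_nat_def Suc_1 Suc_leI card_0_eq le_neq_implies_less less_one linorder_not_le)
  then show ?thesis using conn_subtrees[OF assms(1,2)] assms(3) by (simp add: large_proper_subtrees_def unbracketed_def)
qed

lemma large_properD:
  assumes "S \<in> large_proper_subtrees N"
  shows "S \<subseteq> vertices N" "S \<noteq> {}" "\<not> unbracketed N S" "S \<in> subtrees N"
proof -
  have c: "2 \<le> card S" and s: "S \<in> subtrees N" "S \<noteq> vertices N" using assms by (auto simp: large_proper_subtrees_def)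
  show "S \<subseteq> vertices N" "S \<noteq> {}" "S \<in> subtrees N" using s by (auto simp: subtrees_def)
  have "S \<noteq> {v}" for v using c by auto
  then show "\<not> unbracketed N S" using \<open>S \<noteq> {}\<close> s by (simp add: unbracketed_def)
qed

lemma bracketingsD:
  assumes "B \<in> bracketings T"
  shows "B \<subseteq> large_proper_subtrees T" "S \<in> B ==> S' \<in> B ==> S \<subseteq> S' \<or> S' \<subseteq> S \<or> S \<inter> S' = {}"
  using assms by (auto simp: bracketings_def)

lemma height_mem:
  assumes "u \<in> realization P"
  shows "0 \<le> height T u S" "height T u S \<le> 1"
  using bracket_mass_mem[OF assms] by (auto simp: height_def)

lemma height_top[simp]: "height T u (vertices T) = 1" "height T u {} = 1"
  by (auto simp: height_def unbracketed_def)

lemma height_supp: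
  assumes u: "u \<in> realization (bracketings T)" and S: "0 < height T u S"
  shows "unbracketed T S \<or> (\<exists>B. u B \<noteq> 0 \<and> S \<in> B \<and> B \<in> bracketings T)"
  using S bracket_mass_pos[of u S] realizationD(2)[OF u] by (auto simp: height_def split: if_splits)

lemma height_conn:
  assumes u: "u \<in> realization (bracketings T)" and T: "vdist T" and S: "0 < height T u S" "S \<noteq> {}"
  shows "S \<subseteq> vertices T" "conn T S"
proof -
  have "S \<subseteq> vertices T \<and> conn T S"
    using height_supp[OF u S(1)]
  proof (elim disjE exE conjE)
    assume "unbracketed T S"
    then consider "S = vertices T" | v where "v \<in> vertices T" "S = {v}" using S(2) by (auto simp: unbracketed_def)
    then show ?thesis
    proof cases
      case 1
      then show ?thesis using rooted_conn[OF rooted_all[of T S]] S(2) by simp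
    next
      case 2
      then have "S \<in> subtrees T" by (simp add: subtrees_def)
      then show ?thesis using subtrees_conn[OF T] 2 by simp
    qed
  next
    fix B assume "S \<in> B" "B \<in> bracketings T"
    then have "S \<in> large_proper_subtrees T" using bracketingsD(1) by blast
    then show ?thesis using large_properD subtrees_conn[OF T] by blast
  qed
  then show "S \<subseteq> vertices T" "conn T S" by auto
qed

text \<open>Two brackets of positive weight occur in bracketings of positive mass. These form a
  chain, so both brackets occur in the larger one and are nested.\<close>

lemma height_weights:
  assumes u: "u \<in> realization (bracketings T)"
  shows "weights (height T u)"
  unfolding weights_def
proof (intro conjI allI impI; (elim conjE)?)
  fix A B assume A: "0 < height T u A" and B: "0 < height T u B"
  have le: "S \<subseteq> vertices T" if "0 < height T u S" for S
    using height_supp[OF u that] bracketingsD(1) large_properD(1) unfolding unbracketed_def by blast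
  show "A \<subseteq> B \<or> B \<subseteq> A \<or> A \<inter> B = {}"
  proof (cases "unbracketed T A \<or> unbracketed T B")
    case True
    then show ?thesis using le[OF A] le[OF B] unfolding unbracketed_def by blast
  next
    case False
    obtain C D where C: "u C \<noteq> 0" "A \<in> C" "C \<in> bracketings T" and D: "u D \<noteq> 0" "B \<in> D" "D \<in> bracketings T"
      using height_supp[OF u A] height_supp[OF u B] False by blast
    have "C \<le> D \<or> D \<le> C" by (rule realizationD(5)[OF u C(1) D(1)])
    then show ?thesis using bracketingsD(2)[OF C(3), of A B] bracketingsD(2)[OF D(3), of A B] C(2) D(2) by blast
  qed
qed (use height_mem[OF u] in auto)

section \<open>Weights on a composite tree\<close>

locale bracket_pair = tree_pair +
  fixes u v :: "nat set set \<Rightarrow> real"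
  assumes u: "u \<in> realization (bracketings T)" and v: "v \<in> realization (bracketings U)"
begin

definition "w = realize_prod (bracketings T) (bracketings U) (u, v)"
abbreviation "T' \<equiv> tree_comp i T U"
abbreviation "bc \<equiv> bracketing_comp i T U"
definition "t' = height T' (realize_map bc w)"

lemmas marginals = realize_prod_marginals[OF u v, folded w_def]
lemmas W = realizationD[OF marginals(1)]
lemmas vertices_T' = vertices_comp[OF subs_refl]

lemma mass_comp: "bracket_mass (realize_map bc w) S = (\<Sum>p | w p \<noteq> 0 \<and> S \<in> bc p. w p)"
  by (rule bracket_mass_realize_map[OF W(6,1)])

lemma mass_left: "bracket_mass u S = (\<Sum>p | w p \<noteq> 0 \<and> S \<in> fst p. w p)"
  using bracket_mass_realize_map[OF W(6,1), of fst] marginals(2) by simp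

lemma mass_right: "bracket_mass v S = (\<Sum>p | w p \<noteq> 0 \<and> S \<in> snd p. w p)"
  using bracket_mass_realize_map[OF W(6,1), of snd] marginals(3) by simp

lemma w_supp: "w p \<noteq> 0 ==> fst p \<in> bracketings T \<and> snd p \<in> bracketings U"
  using W(2) by fastforce

lemma bc_iff:
  assumes "w p \<noteq> 0"
  shows "S \<in> bc p \<longleftrightarrow> S \<in> large_proper_subtrees T' \<and> ((\<exists>A\<in>fst p. A \<in> large_proper_subtrees T \<and> S = sub A) \<or>
    (\<exists>A\<in>snd p. A \<in> large_proper_subtrees U \<and> S = (+) i ` A) \<or> S = (+) i ` vertices U)"
proof -
  have "fst p \<subseteq> large_proper_subtrees T" "snd p \<subseteq> large_proper_subtrees U"
    using w_supp[OF assms] bracketingsD(1) by blast+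
  then show ?thesis unfolding bracketing_comp_def by (cases p) auto
qed

lemma t'_supp:
  assumes "0 < t' S"
  shows "unbracketed T' S \<or> (\<exists>p. w p \<noteq> 0 \<and> S \<in> bc p)"
proof (cases "unbracketed T' S")
  case False
  then have "0 < (\<Sum>p | w p \<noteq> 0 \<and> S \<in> bc p. w p)" using assms mass_comp by (simp add: t'_def height_def)
  then have "{p. w p \<noteq> 0 \<and> S \<in> bc p} \<noteq> {}" by (metis less_irrefl sum.empty)
  then show ?thesis by blast
qed simp

lemma t'_mem: "0 \<le> t' S" "t' S \<le> 1"
proof -
  have "(\<Sum>p | w p \<noteq> 0 \<and> S \<in> bc p. w p) \<le> (\<Sum>p | w p \<noteq> 0. w p)"
    by (rule sum_mono2) (use W in auto)
  moreover have "0 \<le> (\<Sum>p | w p \<noteq> 0 \<and> S \<in> bc p. w p)" by (rule sum_nonneg) (use W in auto)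
  ultimately show "0 \<le> t' S" "t' S \<le> 1" using W(7) by (auto simp: t'_def height_def mass_comp)
qed

lemma t'_left:
  assumes "\<And>p. w p \<noteq> 0 ==> S' \<in> bc p \<longleftrightarrow> S \<in> fst p" "\<not> unbracketed T' S'" "\<not> unbracketed T S"
  shows "t' S' = height T u S"
proof -
  have "{p. w p \<noteq> 0 \<and> S' \<in> bc p} = {p. w p \<noteq> 0 \<and> S \<in> fst p}" using assms(1) by blast
  then show ?thesis using assms(2,3) by (simp add: t'_def height_def mass_comp mass_left)
qed

lemma t'_right:
  assumes "\<And>p. w p \<noteq> 0 ==> S' \<in> bc p \<longleftrightarrow> S \<in> snd p" "\<not> unbracketed T' S'" "\<not> unbracketed U S"
  shows "t' S' = height U v S"
proof -
  have "{p. w p \<noteq> 0 \<and> S' \<in> bc p} = {p. w p \<noteq> 0 \<and> S \<in> snd p}" using assms(1) by blast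
  then show ?thesis using assms(2,3) by (simp add: t'_def height_def mass_comp mass_right)
qed

lemma sub_in_T': "S \<subseteq> vertices T ==> sub S \<subseteq> vertices T'"
  unfolding vertices_T' by (rule sub_mono)

lemma sub_large:
  assumes "S \<in> large_proper_subtrees T" "sub S \<noteq> {}" "\<not> unbracketed T' (sub S)"
  shows "sub S \<in> large_proper_subtrees T'"
proof (rule large_properI)
  note S = large_properD[OF assms(1)]
  show "conn T' (sub S)" by (rule conn_comp[OF subs_refl subtrees_conn[OF T S(4)] S(1) assms(2)])
qed (use assms sub_in_T'[OF large_properD(1)[OF assms(1)]] in auto)

lemma singleton_cases:
  assumes "z \<in> vertices T'"
  obtains x where "x \<in> vertices T" "x \<noteq> i" "{z} = sub {x}" | x where "x \<in> vertices U" "{z} = (+) i ` {x}"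
proof -
  have "z \<in> sub (vertices T)" using assms vertices_T' by simp
  then show ?thesis
  proof (cases rule: sub_cases)
    case (1 x)
    then have "{z} = sub {x}" by (auto simp: subst_subtree_def)
    then show ?thesis using that(1) 1 by blast
  next
    case (2 x)
    then show ?thesis using that(2)[of x] by simp
  qed
qed

context
  assumes ne: "vertices U \<noteq> {}"
begin

lemmas sub_leI = sub_le_iff[OF ne, THEN iffD1]

lemma sub_singleton: "sub {i} = (+) i ` vertices U"
  by (auto simp: subst_subtree_def)

lemma sub_unbracketed:
  assumes "S \<subseteq> vertices T" "unbracketed T' (sub S)"
  shows "unbracketed T S"
  using assms(2) unfolding unbracketed_def[of T']
proof (elim disjE bexE)
  assume "sub S = {}"
  then have "S \<subseteq> {}" by (rule_tac sub_leI) (simp add: subst_subtree_def)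
  then show ?thesis by (simp add: unbracketed_def)
next
  assume "sub S = vertices T'"
  then have "vertices T \<subseteq> S" unfolding vertices_T' by (rule_tac sub_leI) (simp add: subst_subtree_def)
  then show ?thesis using assms(1) by (simp add: unbracketed_def)
next
  fix z assume z: "z \<in> vertices T'" "sub S = {z}"
  have "\<exists>x\<in>vertices T. S \<subseteq> {x}"
    using z(1)
  proof (cases rule: singleton_cases)
    case (1 x)
    then have "S \<subseteq> {x}" using z(2) by (rule_tac sub_leI) (simp add: subst_subtree_def)
    then show ?thesis using 1 by blast
  next
    case (2 x)
    then have "S \<subseteq> {i}" using z(2) by (rule_tac sub_leI) (auto simp: sub_singleton)
    then show ?thesis using iT by blast
  qed
  then show ?thesis unfolding unbracketed_def by blast
qed

text \<open>When the inserted tree is large and proper it belongs to every composite bracketing and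
  has the total mass 1; otherwise its weight is 1 by the definition of
  \<open>height\<close>.\<close>

lemma t'_whole: "t' ((+) i ` vertices U) = 1"
proof (cases "unbracketed T' ((+) i ` vertices U)")
  case False
  have le: "(+) i ` vertices U \<subseteq> vertices T'"
    using sub_in_T'[of "{i}"] iT by (simp add: sub_singleton)
  have "(+) i ` vertices U \<in> large_proper_subtrees T'"
    by (rule large_properI[OF conn_whole_new[OF ne] le False])
  then have "{p. w p \<noteq> 0 \<and> (+) i ` vertices U \<in> bc p} = {p. w p \<noteq> 0}" using bc_iff by blast
  then show ?thesis using False W(7) by (simp add: t'_def height_def mass_comp)
qed (simp add: t'_def height_def)

text \<open>If \<open>S\<close> is not one of the sets of weight 1 by definition, its image is not
  contained in the inserted tree and determines \<open>S\<close>. So it occurs in a composite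
  bracketing exactly when \<open>S\<close> occurs in the first factor, and the marginal of
  \<open>w\<close> gives the mass.\<close>

lemma t'_sub:
  assumes S: "S \<subseteq> vertices T"
  shows "t' (sub S) = height T u S"
proof (cases "unbracketed T S")
  case True
  then have 1: "height T u S = 1" by (simp add: height_def)
  consider "S = {}" | "S = vertices T" | "S = {i}" | x where "x \<in> vertices T" "x \<noteq> i" "S = {x}"
    using True unfolding unbracketed_def by blast
  then have "t' (sub S) = 1"
  proof cases
    case 4
    then have "sub S = {f x}" by (auto simp: subst_subtree_def)
    moreover have "f x \<in> vertices T'" using sub_in_T'[OF S] calculation by simp
    ultimately show ?thesis by (simp add: t'_def height_def unbracketed_def)
  next
    case 1
    then show ?thesis by (simp add: t'_def height_def unbracketed_def subst_subtree_def)
  next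
    case 2
    then show ?thesis using vertices_T' by (simp add: t'_def height_def unbracketed_def)
  next
    case 3
    then show ?thesis using t'_whole sub_singleton by simp
  qed
  then show ?thesis using 1 by simp
next
  case False
  have nb: "\<not> unbracketed T' (sub S)" using sub_unbracketed[OF S] False by blast
  have small: "\<not> sub S \<subseteq> sub {i}"
  proof
    assume "sub S \<subseteq> sub {i}"
    then have "S \<subseteq> {i}" by (rule sub_leI)
    then show False using False iT unfolding unbracketed_def by blast
  qed
  have "sub S \<in> bc p \<longleftrightarrow> S \<in> fst p" if p: "w p \<noteq> 0" for p
  proof
    assume "sub S \<in> bc p"
    note bc_iff[OF p, THEN iffD1, OF this]
    then have "(\<exists>A\<in>fst p. sub S = sub A) \<or> (\<exists>A\<in>snd p. A \<in> large_proper_subtrees U \<and> sub S = (+) i ` A) \<or> sub S = (+) i ` vertices U"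
      by blast
    then show "S \<in> fst p"
    proof (elim disjE bexE conjE)
      fix A assume "A \<in> fst p" "sub S = sub A"
      then show ?thesis using sub_leI[of S A] sub_leI[of A S] by simp
    next
      fix A assume "A \<in> large_proper_subtrees U" "sub S = (+) i ` A"
      then have "sub S \<subseteq> sub {i}" using large_properD(1) unfolding sub_singleton by blast
      then show ?thesis using small by simp
    qed (use small sub_singleton in simp)
  next
    assume "S \<in> fst p"
    moreover from this have "S \<in> large_proper_subtrees T" using w_supp[OF p] bracketingsD(1) by blast
    moreover have "sub S \<noteq> {}" using nb by (auto simp: unbracketed_def)
    ultimately show "sub S \<in> bc p" using sub_large[OF _ _ nb] bc_iff[OF p] by blast
  qed
  then show ?thesis by (rule t'_left[OF _ nb False])
qed

text \<open>A bracket inside the inserted tree cannot be the image of a bracket of \<open>T\<close>,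
  which would have to be contained in \<open>{i}\<close>. So its mass comes from the second factor
  alone.\<close>

lemma t'_new:
  assumes S: "S \<subseteq> vertices U"
  shows "t' ((+) i ` S) = height U v S"
proof (cases "unbracketed U S")
  case True
  then have 1: "height U v S = 1" by (simp add: height_def)
  consider "S = {}" | "S = vertices U" | x where "x \<in> vertices U" "S = {x}"
    using True unfolding unbracketed_def by blast
  then have "t' ((+) i ` S) = 1"
  proof cases
    case 3
    then have "i + x \<in> vertices T'" using sub_in_T'[of "{i}"] iT by (auto simp: sub_singleton)
    then show ?thesis using 3 by (simp add: t'_def height_def unbracketed_def)
  qed (use t'_whole in \<open>simp_all add: t'_def height_def unbracketed_def\<close>)
  then show ?thesis using 1 by simp
next
  case False
  have le: "(+) i ` S \<subseteq> (+) i ` vertices U" "(+) i ` S \<subseteq> vertices T'"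
    using sub_in_T'[of "{i}"] iT S by (auto simp: sub_singleton)
  have ne_whole: "(+) i ` S \<noteq> (+) i ` vertices U" using False S by (auto simp: unbracketed_def inj_image_eq_iff)
  have nb: "\<not> unbracketed T' ((+) i ` S)"
  proof
    assume "unbracketed T' ((+) i ` S)"
    then consider "S = {}" | "(+) i ` S = vertices T'" | z where "(+) i ` S = {z}" unfolding unbracketed_def by blast
    then show False
    proof cases
      case 2
      then have "(+) i ` vertices U \<subseteq> (+) i ` S" using sub_in_T'[of "{i}"] iT by (simp add: sub_singleton)
      then show False using ne_whole le(1) by blast
    next
      case 3
      then obtain x where "x \<in> S" "S \<subseteq> {x}" by (metis add_left_cancel image_eqI image_is_empty insertI1 singletonD subsetI ex_in_conv insert_not_empty)
      then have "S = {x}" by blast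
      then show False using False S by (auto simp: unbracketed_def)
    qed (use False in \<open>auto simp: unbracketed_def\<close>)
  qed
  have "(+) i ` S \<in> bc p \<longleftrightarrow> S \<in> snd p" if p: "w p \<noteq> 0" for p
  proof
    assume "(+) i ` S \<in> bc p"
    note bc_iff[OF p, THEN iffD1, OF this]
    then have "(\<exists>A\<in>fst p. A \<in> large_proper_subtrees T \<and> (+) i ` S = sub A) \<or> (\<exists>A\<in>snd p. (+) i ` S = (+) i ` A) \<or> (+) i ` S = (+) i ` vertices U"
      by blast
    then show "S \<in> snd p"
    proof (elim disjE bexE conjE)
      fix A assume A: "A \<in> large_proper_subtrees T" "(+) i ` S = sub A"
      then have "sub A \<subseteq> sub {i}" using le(1) unfolding sub_singleton by simp
      then have "A \<subseteq> {i}" by (rule sub_leI)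
      then show ?thesis using large_properD[OF A(1)] iT unfolding unbracketed_def by blast
    qed (use ne_whole in \<open>auto simp: inj_image_eq_iff\<close>)
  next
    assume Sp: "S \<in> snd p"
    then have S': "S \<in> large_proper_subtrees U" using w_supp[OF p] bracketingsD(1) by blast
    have "conn T' ((+) i ` S)" by (rule conn_new[OF subtrees_conn[OF U large_properD(4)[OF S']] S])
    then have "(+) i ` S \<in> large_proper_subtrees T'" by (rule large_properI[OF _ le(2) nb])
    then show "(+) i ` S \<in> bc p" using bc_iff[OF p] Sp S' by blast
  qed
  then show ?thesis by (rule t'_right[OF _ nb False])
qed

lemma t'_nonleaf_supp:
  assumes "0 < t' S"
  shows "(\<exists>S0\<subseteq>vertices T. S = sub S0) \<or> (\<exists>S0\<subseteq>vertices U. S = (+) i ` S0)"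
  using t'_supp[OF assms]
proof (elim disjE exE conjE)
  assume "unbracketed T' S"
  then consider "S = {}" | "S = sub (vertices T)" | z where "z \<in> vertices T'" "S = {z}"
    unfolding unbracketed_def vertices_T' by blast
  then show ?thesis
  proof cases
    case 3
    from 3(1) show ?thesis by (cases rule: singleton_cases) (use 3(2) in blast)+
  qed (blast | simp)+
next
  fix p assume "w p \<noteq> 0" "S \<in> bc p"
  note bc_iff[OF this(1), THEN iffD1, OF this(2)]
  then have "(\<exists>A. A \<in> large_proper_subtrees T \<and> S = sub A) \<or> (\<exists>A. A \<in> large_proper_subtrees U \<and> S = (+) i ` A) \<or> S = (+) i ` vertices U"
    by blast
  then show ?thesis
  proof (elim disjE exE conjE)
    fix A assume "A \<in> large_proper_subtrees T" "S = sub A"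
    then show ?thesis using large_properD(1)[of A T] by (intro disjI1 exI[of _ A]) simp
  next
    fix A assume "A \<in> large_proper_subtrees U" "S = (+) i ` A"
    then show ?thesis using large_properD(1)[of A U] by (intro disjI2 exI[of _ A]) simp
  next
    assume "S = (+) i ` vertices U"
    then show ?thesis by (intro disjI2 exI[of _ "vertices U"]) simp
  qed
qed

lemma t'_nonleaf_weights: "weights t'"
  unfolding weights_def
proof (intro conjI allI impI; (elim conjE)?)
  fix A B assume A: "0 < t' A" and B: "0 < t' B"
  have nested: "S \<subseteq> S' \<or> S' \<subseteq> S \<or> S \<inter> S' = {}" if "weights h" "0 < h S" "0 < h S'" for h and S S' :: "nat set"
    using that unfolding weights_def by blast
  have mixed: "sub S \<subseteq> (+) i ` S' \<or> (+) i ` S' \<subseteq> sub S \<or> sub S \<inter> (+) i ` S' = {}" if "S' \<subseteq> vertices U" for S S'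
    using that new_in_sub[of _ S] by blast
  show "A \<subseteq> B \<or> B \<subseteq> A \<or> A \<inter> B = {}"
    using t'_nonleaf_supp[OF A] t'_nonleaf_supp[OF B]
  proof (elim disjE exE conjE)
    fix S S' assume S: "S \<subseteq> vertices T" "A = sub S" "S' \<subseteq> vertices T" "B = sub S'"
    then have "S \<subseteq> S' \<or> S' \<subseteq> S \<or> S \<inter> S' = {}" using nested[OF height_weights[OF u]] A B t'_sub by simp
    then show ?thesis using sub_mono sub_disjoint S(2,4) by metis
  next
    fix S S' assume S: "S \<subseteq> vertices U" "A = (+) i ` S" "S' \<subseteq> vertices U" "B = (+) i ` S'"
    then have "S \<subseteq> S' \<or> S' \<subseteq> S \<or> S \<inter> S' = {}" using nested[OF height_weights[OF v]] A B t'_new by simp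
    then show ?thesis using S(2,4) by auto
  next
    fix S S' assume "A = sub S" "S' \<subseteq> vertices U" "B = (+) i ` S'"
    then show ?thesis using mixed[of S' S] by blast
  next
    fix S S' assume "B = sub S" "S' \<subseteq> vertices U" "A = (+) i ` S'"
    then show ?thesis using mixed[of S' S] by blast
  qed
qed (use t'_mem in \<open>auto simp: t'_def\<close>)

end

context
  assumes empty: "vertices U = {}"
begin

lemma sub_remove: "sub (insert i S) = sub S" "sub (S - {i}) = sub S"
  by (auto simp: subst_subtree_def empty)

text \<open>Bracketings of positive mass form a chain, so those containing \<open>S\<close> and
  those containing \<open>insert i S\<close> are nested collections, and their union has the larger
  of the two masses. If the image has weight 1 by definition, so has one of the two sets.\<close>

lemma t'_merge:
  assumes S: "S \<subseteq> vertices T - {i}"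
  shows "t' (sub S) = max (height T u S) (height T u (insert i S))"
proof (cases "unbracketed T' (sub S)")
  case True
  then have "height T u S = 1 \<or> height T u (insert i S) = 1"
    unfolding unbracketed_def[of T']
  proof (elim disjE bexE)
    assume "sub S = {}"
    then have "S \<subseteq> {}" using sub_leD[of S "{}"] S by auto
    then show ?thesis by simp
  next
    assume "sub S = vertices T'"
    then have "vertices T - {i} \<subseteq> S" unfolding vertices_T' by (rule_tac sub_leD) simp
    then have "insert i S = vertices T" using S iT by blast
    then show ?thesis by simp
  next
    fix z assume z: "z \<in> vertices T'" "sub S = {z}"
    from z(1) show ?thesis
    proof (cases rule: singleton_cases)
      case (1 x)
      then have "S \<subseteq> {x}" "{x} \<subseteq> S" using sub_leD[of S "{x}"] sub_leD[of "{x}" S] S z(2) by auto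
      then have "S = {x}" by blast
      then show ?thesis using 1 by (auto simp: height_def unbracketed_def)
    qed (use empty in simp)
  qed
  then show ?thesis using True height_mem[OF u] by (auto simp: t'_def height_def[of T'] max_def intro: antisym)
next
  case False
  have nS: "\<not> unbracketed T S"
  proof
    assume "unbracketed T S"
    then consider "S = {}" | x where "x \<in> vertices T" "x \<noteq> i" "S = {x}" using S iT unfolding unbracketed_def by blast
    then show False
    proof cases
      case 1
      then show False using False by (simp add: unbracketed_def subst_subtree_def)
    next
      case 2
      then have "sub S = {f x}" by (auto simp: subst_subtree_def)
      moreover have "f x \<in> vertices T'" using sub_in_T'[of S] S calculation by auto
      ultimately show False using False by (simp add: unbracketed_def)
    qed
  qed
  have nS': "\<not> unbracketed T (insert i S)"
  proof
    assume "unbracketed T (insert i S)"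
    then consider "insert i S = vertices T" | "S = {}" using S unfolding unbracketed_def by blast
    then show False
    proof cases
      case 1
      then have "sub S = vertices T'" unfolding vertices_T' using sub_remove by metis
      then show False using False by (simp add: unbracketed_def)
    qed (use nS in \<open>simp add: unbracketed_def\<close>)
  qed
  have ne: "sub S \<noteq> {}" using False by (auto simp: unbracketed_def)
  have iff: "sub S \<in> bc p \<longleftrightarrow> S \<in> fst p \<or> insert i S \<in> fst p" if p: "w p \<noteq> 0" for p
  proof
    assume "sub S \<in> bc p"
    note bc_iff[OF p, THEN iffD1, OF this]
    moreover have "A = {}" if "A \<in> large_proper_subtrees U" for A using large_properD(1)[OF that] empty by blast
    ultimately have "\<exists>A\<in>fst p. sub S = sub A" using ne empty by blast
    then obtain A where A: "A \<in> fst p" "sub S = sub A" by blast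
    have "S - {i} \<subseteq> A" "A - {i} \<subseteq> S" by (rule sub_leD, simp add: A)+
    then have "A = S \<or> A = insert i S" using S by blast
    then show "S \<in> fst p \<or> insert i S \<in> fst p" using A by blast
  next
    assume "S \<in> fst p \<or> insert i S \<in> fst p"
    then obtain A where A: "A \<in> fst p" "sub A = sub S" using sub_remove(1) by blast
    then have "A \<in> large_proper_subtrees T" using w_supp[OF p] bracketingsD(1) by blast
    moreover from this have "sub A \<in> large_proper_subtrees T'" using sub_large[of A] ne False A(2) by simp
    ultimately show "sub S \<in> bc p" using bc_iff[OF p] A by metis
  qed
  let ?A = "{B. u B \<noteq> 0 \<and> S \<in> B}" and ?B = "{B. u B \<noteq> 0 \<and> insert i S \<in> B}"
  note Ur = realizationD[OF u]
  have fin: "finite ?A" "finite ?B" by (rule finite_subset[OF _ Ur(6)], blast)+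
  have "{p. w p \<noteq> 0 \<and> sub S \<in> bc p} = {p. w p \<noteq> 0 \<and> (S \<in> fst p \<or> insert i S \<in> fst p)}" using iff by blast
  then have "t' (sub S) = (\<Sum>p | w p \<noteq> 0 \<and> (S \<in> fst p \<or> insert i S \<in> fst p). w p)"
    using False by (simp add: t'_def height_def mass_comp)
  also have "\<dots> = (\<Sum>B | u B \<noteq> 0 \<and> (S \<in> B \<or> insert i S \<in> B). u B)"
    using sum_realize_map[OF W(6,1), of fst "\<lambda>B. S \<in> B \<or> insert i S \<in> B"] marginals(2) by simp
  also have "{B. u B \<noteq> 0 \<and> (S \<in> B \<or> insert i S \<in> B)} = ?A \<union> ?B" by blast
  also have "sum u (?A \<union> ?B) = max (sum u ?A) (sum u ?B)"
  proof -
    have "?A \<subseteq> ?B \<or> ?B \<subseteq> ?A"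
    proof (rule ccontr)
      assume "\<not> ?thesis"
      then obtain p q where pq: "p \<in> ?A" "p \<notin> ?B" "q \<in> ?B" "q \<notin> ?A" by blast
      then have "p \<le> q \<or> q \<le> p" using Ur(5) by blast
      then show False using pq by blast
    qed
    then show ?thesis
    proof
      assume le: "?A \<subseteq> ?B"
      have "sum u ?A \<le> sum u ?B" by (rule sum_mono2[OF fin(2) le]) (use Ur(1) in auto)
      moreover have "?A \<union> ?B = ?B" using le by (rule Un_absorb1)
      ultimately show ?thesis by simp
    next
      assume le: "?B \<subseteq> ?A"
      have "sum u ?B \<le> sum u ?A" by (rule sum_mono2[OF fin(1) le]) (use Ur(1) in auto)
      moreover have "?A \<union> ?B = ?A" using le by (rule Un_absorb2)
      ultimately show ?thesis by simp
    qed
  qed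
  finally show ?thesis using nS nS' by (simp add: height_def bracket_mass_def)
qed

lemma t'_leaf_supp:
  assumes "0 < t' S"
  shows "\<exists>S0\<subseteq>vertices T - {i}. S = sub S0"
proof -
  have "\<exists>S0\<subseteq>vertices T. S = sub S0"
    using t'_supp[OF assms]
  proof (elim disjE exE conjE)
    assume "unbracketed T' S"
    then consider "S = sub {}" | "S = sub (vertices T)" | z where "z \<in> vertices T'" "S = {z}"
      unfolding unbracketed_def vertices_T' by (auto simp: subst_subtree_def)
    then show ?thesis
    proof cases
      case 3
      from 3(1) show ?thesis by (cases rule: singleton_cases) (use 3(2) empty in blast)+
    qed blast+
  next
    fix p assume p: "w p \<noteq> 0" "S \<in> bc p"
    note bc = bc_iff[OF p(1), THEN iffD1, OF p(2)]
    then have "S \<noteq> {}" using large_properD(2) by blast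
    moreover have "A = {}" if "A \<in> large_proper_subtrees U" for A using large_properD(1)[OF that] empty by blast
    ultimately have "\<exists>A\<in>large_proper_subtrees T. S = sub A" using bc empty by blast
    then show ?thesis using large_properD(1) by blast
  qed
  then obtain S0 where "S0 \<subseteq> vertices T" "S = sub (S0 - {i})" using sub_remove(2) by metis
  then show ?thesis by blast
qed

lemma t'_leaf_weights: "weights t'"
  unfolding weights_def
proof (intro conjI allI impI; (elim conjE)?)
  fix A B assume A: "0 < t' A" and B: "0 < t' B"
  have pre: "\<exists>S. 0 < height T u S \<and> C = sub S" if C: "0 < t' C" for C
  proof -
    obtain S where S: "S \<subseteq> vertices T - {i}" "C = sub S" using t'_leaf_supp[OF C] by blast
    then have "0 < height T u S \<or> 0 < height T u (insert i S)" using C t'_merge[OF S(1)] by (simp add: less_max_iff_disj)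
    then show ?thesis using S(2) sub_remove(1) by metis
  qed
  obtain S S' where S: "0 < height T u S" "A = sub S" "0 < height T u S'" "B = sub S'" using pre[OF A] pre[OF B] by blast
  then have "S \<subseteq> S' \<or> S' \<subseteq> S \<or> S \<inter> S' = {}" using height_weights[OF u] unfolding weights_def by blast
  then show "A \<subseteq> B \<or> B \<subseteq> A \<or> A \<inter> B = {}" using sub_mono sub_disjoint S(2,4) by metis
qed (use t'_mem in \<open>auto simp: t'_def\<close>)

end

end

lemma vertices_relabel: "vertices (relabel g T) = g ` vertices T"
  by (rule ptree.set_map)

lemma height_relabel:
  assumes g: "inj g" and u: "u \<in> realization P"
  shows "height (relabel g T) (realize_map ((`) ((`) g)) u) (g ` S) = height T u S"
proof -
  note U = realizationD[OF u]
  have "unbracketed (relabel g T) (g ` S) \<longleftrightarrow> unbracketed T S"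
  proof -
    have "g ` S = {g x} \<longleftrightarrow> S = {x}" for x using inj_image_eq_iff[OF g, of S "{x}"] by simp
    then show ?thesis by (simp add: unbracketed_def vertices_relabel inj_image_eq_iff[OF g])
  qed
  moreover have "bracket_mass (realize_map ((`) ((`) g)) u) (g ` S) = bracket_mass u S"
  proof -
    have "g ` S \<in> (`) g ` B \<longleftrightarrow> S \<in> B" for B
      by (rule inj_image_mem_iff) (use inj_image_eq_iff[OF g] in \<open>auto simp: inj_def\<close>)
    then show ?thesis unfolding bracket_mass_realize_map[OF U(6,1)] by (simp add: bracket_mass_def)
  qed
  ultimately show ?thesis by (simp add: height_def)
qed

section \<open>The action of trees on cacti\<close>

definition lobes :: "complex set list list \<Rightarrow> nat \<Rightarrow> nat \<Rightarrow> real \<Rightarrow> real" where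
  "lobes xs v = lobe (xs ! v)"

definition tree_action ::
    "nat \<Rightarrow> nat list \<Rightarrow> nat ptree \<times> (nat set set \<Rightarrow> real) \<Rightarrow> complex set list list \<Rightarrow> complex set list" where
  "tree_action c cs p xs = (case p of (T, u) \<Rightarrow> if c = 0 then []
     else cactus_of c (\<lambda>b. flow (height T u) (lobes xs) T (vertices T) (leaf_value b)))"

lemma tree_opsD:
  assumes "T \<in> tree_ops n ms"
  shows "distinct (leaf_list T)" "set (leaf_list T) = {..<n}" "vdist T" "vertices T = {..<length ms}"
    and "Vertex v ts \<in> subs T ==> v < length ms \<and> length ts = ms ! v"
proof -
  show "distinct (leaf_list T)" "set (leaf_list T) = {..<n}" "vdist T"
    using assms distinct_vdist by (auto simp: tree_ops_def)
  have a: "set (arity_list T) = {(v, ms ! v) | v. v < length ms}" using assms by (simp add: tree_ops_def)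
  then show "vertices T = {..<length ms}" unfolding set_arity_list[symmetric] by force
  show "v < length ms \<and> length ts = ms ! v" if "Vertex v ts \<in> subs T"
    using arity_list_subs[OF that] a by auto
qed

lemma fits_vdist:
  "\<lbrakk>vdist N; \<forall>v ts. Vertex v ts \<in> subs N \<and> length ts \<noteq> 0 \<longrightarrow> cactus_fun (length ts) (x v)\<rbrakk> \<Longrightarrow> fits x N"
proof (induction N)
  case (Vertex v ts)
  have "fits x M" if "M \<in> set ts" for M
    by (rule Vertex.IH[OF that vdist_child(1)[OF Vertex.prems(1) that]]) (use Vertex.prems(2) that in auto)
  then show ?case using Vertex.prems by (auto simp: list_all_iff)
qed simp

lemma fits_lobes:
  assumes "T \<in> tree_ops n ms" "\<And>v. v < length ms ==> xs ! v \<in> cacti (ms ! v)"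
  shows "fits (lobes xs) T" "Vertex v ts \<in> subs T ==> treelike {..<length ts} (lobes xs v)"
proof -
  note T = tree_opsD[OF assms(1)]
  show "fits (lobes xs) T"
  proof (rule fits_vdist[OF T(3)], intro allI impI, elim conjE)
    fix v ts assume v: "Vertex v ts \<in> subs T" and ts: "length ts \<noteq> 0"
    have "xs ! v \<in> cacti (length ts)" using T(5)[OF v] assms(2)[of v] by simp
    then show "cactus_fun (length ts) (lobes xs v)" unfolding lobes_def using ts by (rule lobe_cactus_fun)
  qed
  assume v: "Vertex v ts \<in> subs T"
  show "treelike {..<length ts} (lobes xs v)"
  proof (cases "length ts = 0")
    case True
    then show ?thesis by (auto simp: treelike_def axis_parallel_def noncrossing_def)
  next
    case False
    have "xs ! v \<in> cacti (length ts)" using T(5)[OF v] assms(2)[of v] by simp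
    then show ?thesis unfolding lobes_def using False by (rule lobe_treelike)
  qed
qed

context
  fixes T u and n :: nat and ms xs
  assumes T: "T \<in> tree_ops n ms" and u: "u \<in> realization (bracketings T)"
    and xs: "\<And>v. v < length ms ==> xs ! v \<in> cacti (ms ! v)"
begin

abbreviation "action_lobe b \<equiv> flow (height T u) (lobes xs) T (vertices T) (leaf_value b)"

lemma action_cactus_fun: "n \<noteq> 0 ==> cactus_fun n action_lobe"
  by (rule flow_cactus_fun[OF height_weights[OF u] height_top(1) fits_lobes(1)[OF T xs] tree_opsD(1,2)[OF T]])

lemma action_treelike: "treelike {..<n} action_lobe"
  using flow_treelike[OF height_weights[OF u] fits_lobes(1)[OF T xs] order.refl tree_opsD(1)[OF T] fits_lobes(2)[OF T xs]]
    tree_opsD(2)[OF T] by simp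

lemma tree_action_in_cacti: "tree_action n ms (T, u) xs \<in> cacti n"
  using cactus_of_in_cacti[OF action_cactus_fun action_treelike] by (simp add: tree_action_def cacti_def[of 0])

lemma lobe_tree_action:
  "b < n ==> 0 \<le> r ==> r \<le> 1 ==> lobe (tree_action n ms (T, u) xs) b r = action_lobe b r"
  using lobe_cactus_of[OF action_cactus_fun action_treelike] by (simp add: tree_action_def)

end

lemma subs_leaf_list: "M \<in> subs N ==> set (leaf_list M) \<subseteq> set (leaf_list N)"
  by (induction N) auto

lemma graft_leaves: "set (leaf_list N) \<subseteq> {..<n} ==> graft N (map Leaf [0..<n]) = N"
  by (induction N) (auto intro!: map_idI)

text \<open>An instance of \<open>flow_embed\<close> with all labels as \<open>V\<close>; the leaves
  are grafted onto themselves to bring the relabelled tree into the required form.\<close>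

lemma tree_action_relabel:
  assumes \<sigma>: "\<sigma> permutes {..<length ms}" and T: "T \<in> tree_ops n ms" and u: "u \<in> realization (bracketings T)"
    and len: "length xs = length ms" and xs: "\<And>v. v < length ms ==> xs ! v \<in> cacti (ms ! v)"
  shows "tree_action n (permute_list \<sigma> ms) (relabel (inv \<sigma>) T, realize_map ((`) ((`) (inv \<sigma>))) u) (permute_list \<sigma> xs)
    = tree_action n ms (T, u) xs"
proof -
  define g where "g = inv \<sigma>"
  define t' where "t' = height (relabel g T) (realize_map ((`) ((`) g)) u)"
  have bij: "bij g" unfolding g_def by (rule permutes_bij[OF permutes_inv[OF \<sigma>]])
  then have inj: "inj g" and surj: "surj g" by (auto simp: bij_def)
  have t': "t' (g ` S) = height T u S" for S unfolding t'_def by (rule height_relabel[OF inj u])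
  note w = height_weights[OF u]
  have w': "weights t'"
    unfolding weights_def
  proof (intro conjI allI impI; (elim conjE)?)
    have im: "g ` (g -` A) = A" for A by (rule surj_image_vimage_eq[OF surj])
    show "t' {} = 1" using t'[of "{}"] by simp
    show "0 \<le> t' A" "t' A \<le> 1" for A using t'[of "g -` A"] im[of A] height_mem[OF u] by metis+
    fix A B assume "0 < t' A" "0 < t' B"
    then have "g -` A \<subseteq> g -` B \<or> g -` B \<subseteq> g -` A \<or> g -` A \<inter> g -` B = {}"
      using w t'[of "g -` A"] t'[of "g -` B"] im unfolding weights_def by metis
    then show "A \<subseteq> B \<or> B \<subseteq> A \<or> A \<inter> B = {}" using surj by (metis im image_Int inj image_empty image_mono)
  qed
  have graft: "graft (relabel g N) (map Leaf [0..<n]) = relabel g N" if "N \<in> subs T" for N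
    by (rule graft_leaves) (use subs_leaf_list[OF that] tree_opsD(2)[OF T] leaf_list_relabel[of g N] in auto)
  have "flow t' (lobes (permute_list \<sigma> xs)) (relabel g T) (g ` vertices T) (leaf_value b) s
    = flow (height T u) (lobes xs) T (vertices T) (leaf_value b) s" if s: "0 \<le> s" "s \<le> 1" for b s
  proof -
    have "flow t' (lobes (permute_list \<sigma> xs)) (graft (relabel g T) (map Leaf [0..<n])) (g ` vertices T) (leaf_value b) s
      = flow (height T u) (lobes xs) T (vertices T) (leaf_value b) s"
    proof (rule flow_embed[OF w w' fits_lobes(1)[OF T xs] inj subset_UNIV t' _ _ _ subset_UNIV s])
      fix v assume "v \<in> vertices T"
      then have v: "v < length ms" using tree_opsD(4)[OF T] by simp
      have gv: "\<sigma> (g v) = v" unfolding g_def by (rule permutes_inverses(1)[OF \<sigma>])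
      moreover have "g v < length xs" using permutes_in_image[OF \<sigma>, of "g v"] gv v len by simp
      ultimately show "lobes (permute_list \<sigma> xs) (g v) = lobes xs v"
        using permute_list_nth[of \<sigma> xs "g v"] \<sigma> len by (simp add: lobes_def)
    next
      fix a assume "a \<in> set (leaf_list T)"
      then show "vertices (map Leaf [0..<n] ! a) \<inter> g ` UNIV = {}" using tree_opsD(2)[OF T] by simp
    next
      fix A show "\<exists>B\<subseteq>UNIV. A = g ` B" by (rule exI[of _ "g -` A"]) (simp add: surj)
    next
      fix M r assume M: "M \<in> subs T"
      show "leaf_value b (graft (relabel g M) (map Leaf [0..<n])) r = leaf_value b M r"
        unfolding graft[OF M] by (cases M) auto
    qed
    then show ?thesis using graft[OF subs_refl] by simp
  qed
  then have "cactus_of n (\<lambda>b. flow t' (lobes (permute_list \<sigma> xs)) (relabel g T) (g ` vertices T) (leaf_value b))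
    = cactus_of n (\<lambda>b. flow (height T u) (lobes xs) T (vertices T) (leaf_value b))"
    by (intro cactus_of_cong) auto
  then show ?thesis unfolding tree_action_def t'_def g_def by (simp add: ptree.set_map)
qed

section \<open>Corollas and trees with two vertices\<close>

lemma repar_leaves:
  assumes t: "weights t" and x: "ls \<noteq> [] ==> cactus_fun (length ls) (x v)" and r: "0 \<le> r" "r \<le> 1"
  shows "repar t x v (map Leaf ls) r = r"
  unfolding repar_def
proof (rule mix_const[OF finite_family empty_in_family[OF t] t])
  fix A assume A: "A \<in> family t v (map Leaf ls)"
  show "exit_mean t x v (map Leaf ls) A r = r"
  proof (cases "A = {}")
    case False
    then have e: "exits A (Vertex v (map Leaf ls)) \<noteq> 0" "v \<in> A" using A by (auto simp: family_def)
    have ex: "exits A (Vertex v (map Leaf ls)) = length ls" using e(2) by (simp add: comp_def sum_list_triv)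
    then have ls: "ls \<noteq> []" using e(1) by auto
    have "branches t x v (map Leaf ls) A (\<lambda>_ s. s) r = (\<Sum>j<length ls. x v j r)" by (simp add: branches_def)
    also have "\<dots> = real (length ls) * r" using x[OF ls] r by (simp add: cactus_fun_def)
    finally show ?thesis using False ls by (simp add: exit_mean_def ex del: exits.simps)
  qed (simp add: exit_mean_def)
qed

text \<open>At a vertex with only leaves above it, the mean over the exits is the parameter itself,
  so all clamps have the same centre and nothing is reparametrized.\<close>

lemma flow_leaves_Vertex:
  assumes t: "weights t" and x: "ls \<noteq> [] ==> cactus_fun (length ls) (x v)" and s: "0 \<le> s" "s \<le> 1" and v: "v \<in> A"
  shows "flow t x (Vertex v (map Leaf ls)) A F s = (\<Sum>j<length ls. F (Leaf (ls ! j)) (x v j s))"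
proof -
  have id: "repar t x v (map Leaf ls) r = r" if "r \<in> {0..1}" for r
    using repar_leaves[of t ls x v r, OF t x] that by simp
  have "inj_on (repar t x v (map Leaf ls)) {0..1}" by (rule inj_onI) (simp add: id)
  then have "unrepar t x v (map Leaf ls) s = s" using inv_into_f_f[of "repar t x v (map Leaf ls)" "{0..1}" s] id s by simp
  then show ?thesis using v by (simp add: branches_def)
qed

lemma point_mass_realization: "T \<in> tree_ops n ms ==> point_mass {} \<in> realization (bracketings T)"
proof -
  have "{} \<in> bracketings T" by (simp add: bracketings_def)
  moreover have "finite (bracketings T)"
    by (rule finite_subset[of _ "Pow (Pow (vertices T))"]) (use large_properD(1) in \<open>auto simp: bracketings_def\<close>)
  ultimately show ?thesis by (auto simp: realization_def point_mass_def sum.delta)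
qed

lemma corolla_tree_ops: "distinct ls ==> set ls = {..<n} ==> corolla ls \<in> tree_ops n [n]"
proof -
  assume ls: "distinct ls" "set ls = {..<n}"
  have "concat (map (\<lambda>a. [a]) xs) = xs" "concat (map (\<lambda>a. []) xs) = []" for xs :: "nat list"
    by (induction xs) auto
  then have "leaf_list (corolla ls) = ls" "arity_list (corolla ls) = [(0, length ls)]"
    by (simp_all add: corolla_def comp_def)
  moreover have "length ls = n" using distinct_card[OF ls(1)] ls(2) by simp
  ultimately show ?thesis using ls by (simp add: tree_ops_def)
qed

lemma tree_action_corolla:
  assumes ls: "distinct ls" "set ls = {..<n}" and x: "x \<in> cacti n" and n: "n \<noteq> 0"
    and b: "j < n" and r: "0 \<le> r" "r \<le> 1"
  shows "lobe (tree_action n [n] (corolla ls, point_mass {}) [x]) (ls ! j) r = lobe x j r"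
proof -
  note T = corolla_tree_ops[OF ls]
  note u = point_mass_realization[OF T]
  have len: "length ls = n" using distinct_card[OF ls(1)] ls(2) by simp
  have lsj: "ls ! j < n" using nth_mem[of j ls] ls(2) len b by auto
  have "lobe (tree_action n [n] (corolla ls, point_mass {}) [x]) (ls ! j) r
    = flow (height (corolla ls) (point_mass {})) (lobes [x]) (corolla ls) (vertices (corolla ls)) (leaf_value (ls ! j)) r"
    by (rule lobe_tree_action[OF T u _ lsj r]) (use x in simp)
  also have "\<dots> = (\<Sum>k<length ls. leaf_value (ls ! j) (Leaf (ls ! k) :: nat ptree) (lobes [x] 0 k r))"
    unfolding corolla_def by (rule flow_leaves_Vertex[OF _ _ r])
      (use height_weights[OF u] lobe_cactus_fun[OF x n] len in \<open>auto simp: corolla_def lobes_def\<close>)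
  also have "\<dots> = (\<Sum>k<n. if k = j then lobe x k r else 0)"
    using len b ls(1) by (intro sum.cong) (auto simp: lobes_def nth_eq_iff_index_eq)
  finally show ?thesis using b by simp
qed

lemma cactus_part_eq:
  assumes x: "x \<in> cacti n" "i < n" and y: "y \<in> cacti m" "j < m" and eq: "\<And>r. 0 \<le> r ==> r \<le> 1 ==> lobe x i r = lobe y j r"
  shows "x ! i = y ! j"
proof -
  have "supp (lobe x i) = supp (lobe y j)" unfolding supp_def using eq by auto
  then show ?thesis using cactus_supp[OF x(1) _ x(2)] cactus_supp[OF y(1) _ y(2)] x(2) y(2) by simp
qed

lemma tree_action_corolla_nth:
  assumes "distinct ls" "set ls = {..<n}" "x \<in> cacti n" "j < n"
  shows "tree_action n [n] (corolla ls, point_mass {}) [x] ! (ls ! j) = x ! j"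
proof (rule cactus_part_eq)
  note T = corolla_tree_ops[OF assms(1,2)]
  show "tree_action n [n] (corolla ls, point_mass {}) [x] \<in> cacti n"
    by (rule tree_action_in_cacti[OF T point_mass_realization[OF T]]) (use assms(3) in simp)
  show "ls ! j < n" using nth_mem[of j ls] distinct_card[OF assms(1)] assms(2,4) by auto
  show "lobe (tree_action n [n] (corolla ls, point_mass {}) [x]) (ls ! j) r = lobe x j r" if "0 \<le> r" "r \<le> 1" for r
    by (rule tree_action_corolla[OF assms(1-3) _ assms(4) that]) (use assms(4) in simp)
qed (use assms in auto)

lemma cacti_length: "x \<in> cacti n ==> length x = n"
  by (auto simp: cacti_def split: if_splits)

lemma tree_action_unit:
  assumes x: "x \<in> cacti n"
  shows "tree_action n [n] (corolla [0..<n], point_mass {}) [x] = x"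
proof (rule nth_equalityI)
  have ls: "distinct [0..<n]" "set [0..<n] = {..<n}" by auto
  note T = corolla_tree_ops[OF ls]
  have len: "length (tree_action n [n] (corolla [0..<n], point_mass {}) [x]) = n"
    by (rule cacti_length, rule tree_action_in_cacti[OF T point_mass_realization[OF T]]) (use x in simp)
  then show "length (tree_action n [n] (corolla [0..<n], point_mass {}) [x]) = length x" using cacti_length[OF x] by simp
  fix j assume "j < length (tree_action n [n] (corolla [0..<n], point_mass {}) [x])"
  then show "tree_action n [n] (corolla [0..<n], point_mass {}) [x] ! j = x ! j"
    using tree_action_corolla_nth[OF ls x, of j] len by simp
qed

text \<open>The whole tree has weight 1, so the root parameter is the mean over all leaves. The
  leaves of the upper vertex together count n times the lobe \<open>i\<close>, which makes this mean
  equal to \<open>rescale\<close>; at the upper vertex nothing is reparametrized.\<close>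

lemma tree_action_two_vertex_tree:
  assumes i: "i < m" and x1: "x1 \<in> cacti m" and x2: "x2 \<in> cacti n"
  shows "tree_action (m + n - 1) [m, n] (two_vertex_tree m n i, point_mass {}) [x1, x2] = cactus_comp i x1 x2"
proof (cases "m + n - 1 = 0")
  case True
  then have "length (cactus_comp i x1 x2) = 0"
    unfolding cactus_comp_def Let_def using i cacti_length[OF x1] cacti_length[OF x2] by (subst length_insert_list) auto
  then show ?thesis using True by (simp add: tree_action_def)
next
  case k: False
  define ts :: "nat ptree list" where
    "ts = map Leaf [0..<i] @ [Vertex 1 (map Leaf [i..<i + n])] @ map Leaf [i + n..<m + n - 1]"
  define T where "T = two_vertex_tree m n i"
  have T_eq: "T = Vertex 0 ts" by (simp add: T_def two_vertex_tree_def ts_def)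
  have len: "length ts = m" using i by (simp add: ts_def)
  have nth: "ts ! j = (if j < i then Leaf j else if j = i then Vertex 1 (map Leaf [i..<i + n]) else Leaf (j + n - 1))"
    if "j < m" for j
    using that i by (auto simp: ts_def nth_append nth_Cons split: nat.splits)
  have ll: "leaf_list T = [0..<m + n - 1]"
  proof -
    have c: "concat (map (\<lambda>a. [a]) xs) = xs" for xs :: "nat list" by (induction xs) auto
    have "leaf_list T = [0..<i] @ [i..<i + n] @ [i + n..<m + n - 1]" by (simp add: T_eq ts_def comp_def c)
    also have "\<dots> = [0..<m + n - 1]" using i upt_add_eq_append[of 0 i n] upt_add_eq_append[of 0 "i + n" "m - 1 - i"] by (simp add: add.commute[of n m])
    finally show ?thesis .
  qed
  have al: "arity_list T = [(0, m), (1, n)]"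
  proof -
    have c: "concat (map (\<lambda>a. []) xs) = []" for xs :: "nat list" by (induction xs) auto
    show ?thesis using len by (simp add: T_eq ts_def comp_def c)
  qed
  have T: "T \<in> tree_ops (m + n - 1) [m, n]"
    unfolding tree_ops_def mem_Collect_eq ll al
    by (auto simp: less_Suc_eq)
  define t where "t = height T (point_mass {})"
  note u = point_mass_realization[OF T]
  have w: "weights t" and top: "t (vertices T) = 1" unfolding t_def by (simp_all add: height_weights[OF u])
  let ?x = "lobes [x1, x2]" and ?V = "vertices T"
  have V: "?V = {0, 1}" unfolding tree_opsD(4)[OF T] by (auto simp: less_Suc_eq)
  have xs: "[x1, x2] ! v \<in> cacti ([m, n] ! v)" if "v < length [m, n]" for v
    using that x1 x2 by (auto simp: less_Suc_eq)
  note fits = fits_lobes(1)[OF T xs]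
  let ?f = "\<lambda>b. flow t ?x T ?V (leaf_value b)"
  have cf: "cactus_fun (m + n - 1) ?f" unfolding t_def by (rule action_cactus_fun[OF T u xs k])
  have inner: "flow t ?x (Vertex 1 (map Leaf [i..<i + n])) ?V F s = (\<Sum>a<n. F (Leaf (i + a)) (lobe x2 a s))"
    if s: "0 \<le> s" "s \<le> 1" for F :: "nat ptree \<Rightarrow> real \<Rightarrow> real" and s
  proof -
    have "flow t ?x (Vertex 1 (map Leaf [i..<i + n])) ?V F s
      = (\<Sum>j<length [i..<i + n]. F (Leaf ([i..<i + n] ! j)) (?x 1 j s))"
      by (rule flow_leaves_Vertex[OF w _ s]) (use lobe_cactus_fun[OF x2] in \<open>auto simp: V lobes_def\<close>)
    then show ?thesis by (simp add: lobes_def)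
  qed
  have m: "m \<noteq> 0" using i by simp
  note cf1 = lobe_cactus_fun[OF x1 m]
  have mem: "0 \<le> lobe x1 j r \<and> lobe x1 j r \<le> 1" if "j < m" "0 \<le> r" "r \<le> 1" for j r
    using cf1 that monotone_onD[of "{0..1}" "(\<le>)" "(\<le>)" "lobe x1 j" 0 r] monotone_onD[of "{0..1}" "(\<le>)" "(\<le>)" "lobe x1 j" r 1]
    unfolding cactus_fun_def by auto
  have br: "branches t ?x 0 ts ?V F r =
    (\<Sum>j<m. if j < i then F (Leaf j) (lobe x1 j r) else if j = i then (\<Sum>a<n. F (Leaf (i + a)) (lobe x2 a (lobe x1 i r)))
       else F (Leaf (j + n - 1)) (lobe x1 j r))" if r: "0 \<le> r" "r \<le> 1" for F r
    unfolding branches_def len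
    by (rule sum.cong) (use nth inner[OF mem[THEN conjunct1] mem[THEN conjunct2]] r in \<open>auto simp: lobes_def simp del: flow_Vertex\<close>)
  have rep: "repar t ?x 0 ts r = rescale i n x1 r" if r: "0 \<le> r" "r \<le> 1" for r
  proof -
    have sum2: "(\<Sum>a<n. lobe x2 a (lobe x1 i r)) = real n * lobe x1 i r"
    proof (cases "n = 0")
      case False
      then show ?thesis using lobe_cactus_fun[OF x2 False] mem[OF i r] by (simp add: cactus_fun_def)
    qed simp
    have "repar t ?x 0 ts r = exit_mean t ?x 0 ts ?V r"
      using repar_normalized[OF w, of 0 ts] top k by (simp add: T_eq[symmetric] ll del: leaf_list.simps ptree.set)
    also have "\<dots> = (\<Sum>j<m. (if j = i then real n else 1) * lobe x1 j r) / real (m + n - 1)"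
    proof -
      have "exits ?V (Vertex 0 ts) = m + n - 1"
        using exits_all[of T ?V] by (simp add: T_eq[symmetric] ll)
      moreover have "branches t ?x 0 ts ?V (\<lambda>_ s. s) r = (\<Sum>j<m. (if j = i then real n else 1) * lobe x1 j r)"
        unfolding br[OF r] by (rule sum.cong) (use sum2 in auto)
      ultimately show ?thesis by (simp add: exit_mean_def V)
    qed
    also have "\<dots> = rescale i n x1 r"
      unfolding rescale_def Let_def cacti_length[OF x1] sum_divide_distrib
      by (rule sum.cong) (auto simp: lobe_def cacti_length[OF x1])
    finally show ?thesis .
  qed
  note rn = repar_nice'[OF w fits[unfolded T_eq]]
  have "cactus_of (m + n - 1) ?f = cactus_comp i x1 x2"
  proof (rule cactus_comp_eq[OF x1 x2 i k _ _ _ cf])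
    show "nice (Suc (length ts * sum_list (map lip ts))) (rescale i n x1)"
      using rn(1) unfolding nice_def using rep by (smt (verit, best))
    show "rescale i n x1 0 = 0" "rescale i n x1 1 = 1" using rn rep[of 0] rep[of 1] by auto
    fix b r assume b: "b < m + n - 1" and r: "0 \<le> r" "r \<le> (1::real)"
    have "?f b (rescale i n x1 r) = branches t ?x 0 ts ?V (leaf_value b) r"
      using flow_repar[OF w fits[unfolded T_eq] _ _ good_leaf_value r, of ?V b] rep[OF r] V
        compatible_all[of T ?V t] by (simp add: T_eq[symmetric])
    also have "\<dots> = (\<Sum>j<m. if j = (if b < i then b else if b < i + n then i else b + 1 - n) then
      (if b < i then lobe x1 b r else if b < i + n then lobe x2 (b - i) (lobe x1 i r) else lobe x1 (b + 1 - n) r) else 0)"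
      unfolding br[OF r]
    proof (rule sum.cong)
      fix j assume "j \<in> {..<m}"
      have "(\<Sum>a<n. leaf_value b (Leaf (i + a) :: nat ptree) (lobe x2 a (lobe x1 i r)))
        = (if i \<le> b \<and> b < i + n then lobe x2 (b - i) (lobe x1 i r) else 0)"
      proof -
        have "(\<Sum>a<n. leaf_value b (Leaf (i + a) :: nat ptree) (lobe x2 a (lobe x1 i r)))
          = (\<Sum>a<n. if a = b - i then (if i \<le> b then lobe x2 (b - i) (lobe x1 i r) else 0) else 0)"
          by (rule sum.cong) auto
        then show ?thesis by auto
      qed
      then show "(if j < i then leaf_value b (Leaf j :: nat ptree) (lobe x1 j r)
          else if j = i then (\<Sum>a<n. leaf_value b (Leaf (i + a) :: nat ptree) (lobe x2 a (lobe x1 i r)))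
          else leaf_value b (Leaf (j + n - 1) :: nat ptree) (lobe x1 j r)) =
        (if j = (if b < i then b else if b < i + n then i else b + 1 - n) then
          (if b < i then lobe x1 b r else if b < i + n then lobe x2 (b - i) (lobe x1 i r) else lobe x1 (b + 1 - n) r) else 0)"
        by auto
    qed simp
    also have "\<dots> = (if b < i then lobe x1 b r else if b < i + n then lobe x2 (b - i) (lobe x1 i r) else lobe x1 (b + 1 - n) r)"
      using i b by (subst sum.delta) auto
    finally show "?f b (rescale i n x1 r)
      = (if b < i then lobe x1 b r else if b < i + n then lobe x2 (b - i) (lobe x1 i r) else lobe x1 (b + 1 - n) r)" .
  qed
  then show ?thesis using k by (simp add: tree_action_def t_def T_def)
qed

section \<open>Associativity\<close>

lemma fits_graft:
  "\<lbrakk>fits (\<lambda>v. x (g v)) N; inj g; \<forall>a\<in>set (leaf_list N). fits x (ts ! a) \<and> vertices (ts ! a) \<inter> g ` V = {}; vertices N \<subseteq> V\<rbrakk>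
    \<Longrightarrow> fits x (graft (relabel g N) ts)"
proof (induction N)
  case (Vertex v us)
  have "fits x (graft (relabel g M) ts)" if "M \<in> set us" for M
    by (rule Vertex.IH[OF that]) (use Vertex.prems that in \<open>auto simp: list_all_iff\<close>)
  moreover have "g v \<notin> vertices (graft (relabel g M) ts)" if M: "M \<in> set us" for M
  proof -
    have "g v \<notin> g ` vertices M" using Vertex.prems(1,2) M by (simp add: inj_image_mem_iff)
    moreover have "g v \<notin> vertices (ts ! a)" if "a \<in> set (leaf_list M)" for a
      using Vertex.prems(3,4) M that by auto
    ultimately show ?thesis by (auto simp: vertices_graft vertices_relabel)
  qed
  ultimately show ?case using Vertex.prems(1) by (auto simp: list_all_iff)
qed simp

context tree_pair
begin

lemma fits_comp:
  assumes x_old: "\<And>v. v \<in> vertices T ==> v \<noteq> i ==> x' (f v) = x v"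
    and x_new: "\<And>u. u \<in> vertices U ==> x' (i + u) = xU u" and xU: "fits xU U"
  shows "\<lbrakk>N \<in> subs T; fits x N\<rbrakk> \<Longrightarrow> fits x' (tree_comp i N U)"
proof (induction N)
  case (Vertex v ts)
  let ?ts = "map (\<lambda>t. tree_comp i t U) ts"
  have vT: "v \<in> vertices T" using vertices_subs[OF Vertex.prems(1)] by auto
  have IH: "fits x' (tree_comp i M U)" if "M \<in> set ts" for M
    by (rule Vertex.IH[OF that child_subs[OF Vertex.prems(1) that]]) (use Vertex.prems(2) that in \<open>simp add: list_all_iff\<close>)
  have root: "v \<notin> vertices M" if "M \<in> set ts" for M using Vertex.prems(2) that by auto
  show ?case
  proof (cases "v = i")
    case False
    have "f v \<notin> vertices (tree_comp i M U)" if "M \<in> set ts" for M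
      unfolding vertices_comp[OF child_subs[OF Vertex.prems(1) that]] f_in_sub[OF False] by (rule root[OF that])
    then show ?thesis using False IH x_old[OF vT False] Vertex.prems(2) by (simp add: list_all_iff)
  next
    case True
    have set: "set (leaf_list U) = {..<length ts}" using arity Vertex.prems(1) True by (auto simp: arity_fits_def)
    have "fits x' (graft (relabel ((+) i) U) ?ts)"
    proof (rule fits_graft[where V = "vertices U"])
      have "fits (\<lambda>u. x' (i + u)) N \<longleftrightarrow> fits xU N" if "vertices N \<subseteq> vertices U" for N
        using that
      proof (induction N)
        case (Vertex w ws)
        have "fits (\<lambda>u. x' (i + u)) M \<longleftrightarrow> fits xU M" if "M \<in> set ws" for M
          by (rule Vertex.IH[OF that]) (use Vertex.prems that in auto)
        then show ?case using Vertex.prems by (simp add: x_new list_all_iff)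
      qed simp
      then show "fits (\<lambda>u. x' (i + u)) U" using xU by simp
      show "\<forall>a\<in>set (leaf_list U). fits x' (?ts ! a) \<and> vertices (?ts ! a) \<inter> (+) i ` vertices U = {}"
      proof
        fix a assume "a \<in> set (leaf_list U)"
        then have a: "a < length ts" "ts ! a \<in> set ts" using set by auto
        have "i \<notin> vertices (ts ! a)" using root[OF a(2)] True by simp
        then have "vertices (tree_comp i (ts ! a) U) \<inter> (+) i ` vertices U = {}"
          unfolding vertices_comp[OF child_subs[OF Vertex.prems(1) a(2)]] using new_in_sub by blast
        then show "fits x' (?ts ! a) \<and> vertices (?ts ! a) \<inter> (+) i ` vertices U = {}" using IH[OF a(2)] a(1) by simp
      qed
    qed auto
    then show ?thesis using True by simp
  qed
qed simp

end

text \<open>The functions are known to agree on the unit interval only. The stability estimate with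
  equal weights and distance 0 takes care of this.\<close>

lemma flow_cong_inputs:
  assumes t: "weights t" and fits: "fits x T" "fits x' T"
    and eq: "\<And>v ts j r. \<lbrakk>Vertex v ts \<in> subs T; j < length ts; 0 \<le> r; r \<le> 1\<rbrakk> \<Longrightarrow> x v j r = x' v j r"
    and F: "good F" and s: "0 \<le> s" "s \<le> 1"
  shows "flow t x T (vertices T) F s = flow t x' T (vertices T) F s"
proof -
  obtain \<kappa> where \<kappa>: "\<forall>t t' x x' A F e s. weights t \<and> weights t' \<and> fits x T \<and> fits x' T \<and>
    compatible t T A \<and> compatible t' T A \<and> good F \<and> 0 \<le> e \<and> (\<forall>S. \<bar>t S - t' S\<bar> \<le> e) \<and> close e x x' T \<and>
    0 \<le> s \<and> s \<le> 1 \<longrightarrow> \<bar>flow t x T A F s - flow t' x' T A F s\<bar> \<le> \<kappa> * e"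
    using flow_stable[of T] by blast
  have "close 0 x x' T" unfolding close_def
    by (intro allI impI; elim conjE) (use eq in force)
  then have "\<bar>flow t x T (vertices T) F s - flow t x' T (vertices T) F s\<bar> \<le> \<kappa> * 0"
    using t fits compatible_all[of T, OF order.refl] F s by (intro \<kappa>[rule_format]) auto
  then show ?thesis by simp
qed

theorem tree_action_assoc:
  assumes i: "i < length cs" and hT: "T \<in> tree_ops c cs" and hu: "u \<in> realization (bracketings T)"
    and hU: "U \<in> tree_ops (cs ! i) ds" and hv: "v \<in> realization (bracketings U)"
    and xs: "length xs = length cs" "\<And>j. j < length cs ==> xs ! j \<in> cacti (cs ! j)"
    and ys: "length ys = length ds" "\<And>j. j < length ds ==> ys ! j \<in> cacti (ds ! j)"
  shows "tree_action c (insert_list i cs ds) (tree_comp i T U,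
      realize_map (bracketing_comp i T U) (realize_prod (bracketings T) (bracketings U) (u, v))) (insert_list i xs ys)
    = tree_action c cs (T, u) (xs[i := tree_action (cs ! i) ds (U, v) ys])"
proof (cases "c = 0")
  case True
  then show ?thesis by (simp add: tree_action_def)
next
  case c: False
  note TD = tree_opsD[OF hT] and UD = tree_opsD[OF hU]
  have cU: "card (vertices U) = length ds" using UD(4) by simp
  have arity: "arity_fits i U T" unfolding arity_fits_def using TD(5) UD(2) by metis
  interpret bracket_pair i T U u v
    by unfold_locales (use arity TD(3,4) UD(3,4) i hu hv in auto)
  define z where "z = tree_action (cs ! i) ds (U, v) ys"
  \<comment> \<open>At \<open>i\<close> the flow through \<open>U\<close> itself is used, as
    \<open>insertion\<close> demands. It agrees with the lobe functions of the composite cactus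
    \<open>z\<close> on the unit interval, and the exchange is made at the end.\<close>
  define x where "x = (lobes xs)(i := \<lambda>a. flow (height U v) (lobes ys) U (vertices U) (leaf_value a))"
  define x' where "x' = lobes (insert_list i xs ys)"
  have zc: "z \<in> cacti (cs ! i)" unfolding z_def by (rule tree_action_in_cacti[OF hU hv ys(2)])
  note w = height_weights[OF hu] and wU = height_weights[OF hv]
  note fitsU = fits_lobes(1)[OF hU ys(2)]
  have fits_x: "fits x T"
  proof (rule fits_vdist[OF TD(3)], intro allI impI, elim conjE)
    fix p ts assume p: "Vertex p ts \<in> subs T" and ts: "length ts \<noteq> 0"
    note TD(5)[OF p]
    then show "cactus_fun (length ts) (x p)"
      using action_cactus_fun[OF hU hv ys(2)] lobe_cactus_fun[of "xs ! p" "length ts"] xs(2)[of p] ts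
      by (auto simp: x_def lobes_def)
  qed
  have x_old: "x' (f p) = x p" if "p \<in> vertices T" "p \<noteq> i" for p
  proof -
    have "p < length xs" using that(1) TD(4) xs(1) by simp
    then have "insert_list i xs ys ! f p = xs ! p"
      using that(2) i xs(1) ys(1) unfolding shift_def cU
      by (subst nth_insert_list) auto
    then show ?thesis using that(2) by (simp add: x_def x'_def lobes_def)
  qed
  have x_new: "x' (i + a) = lobes ys a" if "a \<in> vertices U" for a
  proof -
    have "a < length ys" using that UD(4) ys(1) by simp
    then have "insert_list i xs ys ! (i + a) = ys ! a"
      using i xs(1) by (subst nth_insert_list) auto
    then show ?thesis by (simp add: x'_def lobes_def)
  qed
  have fits_x': "fits x' T'" by (rule fits_comp[OF x_old x_new fitsU subs_refl fits_x])
  have weights_t': "weights t'" by (cases "vertices U = {}") (use t'_nonleaf_weights t'_leaf_weights in auto)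
  have ins: "insertion (height T u) x (height U v) (lobes ys) t' x' i T U"
    by unfold_locales (use w wU weights_t' fits_x fitsU fits_x' arity UD(1) vU x_old x_new in \<open>auto simp: x_def\<close>)
  have key: "flow t' x' T' (vertices T') (leaf_value b) s = flow (height T u) (lobes (xs[i := z])) T (vertices T) (leaf_value b) s"
    if s: "0 \<le> s" "s \<le> 1" for b s
  proof -
    \<comment> \<open>The two flows end in subtrees of different trees, so the boundary function is
      transported along the insertion. On leaves, which insertion does not change, it is
      \<open>leaf_value\<close> again.\<close>
    define F where "F = (\<lambda>M r. leaf_value b (tree_comp i M U) r)"
    have "good (leaf_value b :: nat ptree \<Rightarrow> real \<Rightarrow> real)" by (rule good_leaf_value)
    then have F: "good F" unfolding good_def F_def by blast
    have comp: "compatible (height T u) T (vertices T)" by (rule compatible_all[OF order.refl])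
    have "flow t' x' T' (sub (vertices T)) (leaf_value b) s = flow (height T u) x T (vertices T) F s"
    proof (cases U)
      case (Vertex w0 us)
      then have ne: "vertices U \<noteq> {}" by simp
      interpret ni: nonleaf_insertion "height T u" x "height U v" "lobes ys" t' x' i T U w0 us
        by (intro nonleaf_insertion.intro ins nonleaf_insertion_axioms.intro Vertex)
          (use t'_sub[OF ne] t'_new[OF ne] t'_nonleaf_supp[OF ne] in auto)
      show ?thesis by (rule ni.flow_insertion[OF subs_refl order.refl comp F s]) (simp add: F_def)
    next
      case (Leaf a)
      then have e: "vertices U = {}" by simp
      have eq: "{a} = {..<cs ! i}" using UD(2) Leaf by simp
      then have "a < cs ! i" by blast
      then have "0 \<in> {..<cs ! i}" by simp
      then have "0 \<in> {a}" by (simp only: eq)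
      then have a: "a = 0" by simp
      have pos: "S \<noteq> {}" if "x \<in> S" for x and S :: "nat set" using that by blast
      interpret li: leaf_insertion "height T u" x "height U v" "lobes ys" t' x' i T U
      proof (intro leaf_insertion.intro ins leaf_insertion_axioms.intro)
        show "U = Leaf 0" using Leaf a by simp
        show "i \<in> vertices T" by (rule iT)
        show "t' (sub S) = max (height T u S) (height T u (insert i S))" if "S \<subseteq> vertices T - {i}" for S
          by (rule t'_merge[OF e that])
        show "\<exists>S0\<subseteq>vertices T - {i}. S = sub S0" if "0 < t' S" for S by (rule t'_leaf_supp[OF e that])
        show "rooted M S" if "0 < height T u S" "Vertex p ts \<in> subs T" "p \<in> S" "M \<in> set ts" for S p ts M
          by (rule conn_down[OF TD(3) height_conn(2,1)[OF hu TD(3) that(1) pos[OF that(3)]] that(2-4)])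
        show "p \<in> S" if "0 < height T u S" "Vertex p ps \<in> subs T" "Vertex q qs \<in> set ps" "q \<in> S"
          "\<not> S \<subseteq> vertices (Vertex q qs)" for S p ps q qs
          by (rule conn_up[OF TD(3) height_conn(2,1)[OF hu TD(3) that(1) pos[OF that(4)]] that(2-5)])
      qed
      have "li.detached T" unfolding li.detached_def using iT by blast
      then show ?thesis
        by (rule li.flow_leaf_insertion[OF subs_refl order.refl comp rooted_all[OF order.refl] _ F s]) (simp add: F_def)
    qed
    also have "\<dots> = flow (height T u) x T (vertices T) (leaf_value b) s"
      by (rule flow_cong_leaves) (auto simp: F_def)
    also have "\<dots> = flow (height T u) (lobes (xs[i := z])) T (vertices T) (leaf_value b) s"
    proof (rule flow_cong_inputs[OF w fits_x _ _ good_leaf_value s])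
      have "xs[i := z] ! j \<in> cacti (cs ! j)" if "j < length cs" for j
        using that xs zc by (cases "j = i") auto
      then show "fits (lobes (xs[i := z])) T" by (rule fits_lobes(1)[OF hT])
      fix p ts j and r :: real assume p: "Vertex p ts \<in> subs T" "j < length ts" and r: "0 \<le> r" "r \<le> 1"
      show "x p j r = lobes (xs[i := z]) p j r"
      proof (cases "p = i")
        case True
        then have "lobe z j r = flow (height U v) (lobes ys) U (vertices U) (leaf_value j) r"
          unfolding z_def using lobe_tree_action[OF hU hv ys(2) _ r, of j] TD(5)[OF p(1)] p(2) by simp
        then show ?thesis using True i xs(1) by (simp add: x_def lobes_def)
      qed (simp add: x_def lobes_def)
    qed
    finally show ?thesis using vertices_T' by simp
  qed
  have "cactus_of c (\<lambda>b. flow t' x' T' (vertices T') (leaf_value b))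
    = cactus_of c (\<lambda>b. flow (height T u) (lobes (xs[i := z])) T (vertices T) (leaf_value b))"
    by (rule cactus_of_cong) (rule key)
  then show ?thesis using c unfolding tree_action_def t'_def w_def x'_def z_def by simp
qed

section \<open>Continuity of the action\<close>

lemma topspace_Cact: "topspace (Cact k) = cacti k"
  unfolding Cact_def by (rule Metric_space.topspace_mtopology[OF Metric_space_cacti])

lemma bracket_mass_stable:
  fixes e :: real
  assumes u: "u \<in> realization P" "u' \<in> realization P" and e: "\<And>B. B \<in> P ==> \<bar>u B - u' B\<bar> \<le> e" "0 \<le> e"
  shows "\<bar>bracket_mass u S - bracket_mass u' S\<bar> \<le> card P * e"
proof -
  note P = realizationD(4)[OF u(1)]
  have eq: "bracket_mass w S = (\<Sum>B\<in>P. if S \<in> B then w B else 0)" if "w \<in> realization P" for w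
    unfolding bracket_mass_def using realizationD(2)[OF that]
    by (subst sum.inter_filter[symmetric, OF P], intro sum.mono_neutral_left) (use P in auto)
  have "bracket_mass u S - bracket_mass u' S = (\<Sum>B\<in>P. if S \<in> B then u B - u' B else 0)"
    unfolding eq[OF u(1)] eq[OF u(2)] sum_subtractf[symmetric] by (rule sum.cong) auto
  also have "\<bar>\<dots>\<bar> \<le> (\<Sum>B\<in>P. e)"
    by (rule order.trans[OF sum_abs sum_mono]) (use e in auto)
  finally show ?thesis by simp
qed

lemma realization_nhd:
  assumes u: "u \<in> realization P" and e: "0 < e"
  shows "openin (top_of_set (realization P)) {u' \<in> realization P. \<forall>B\<in>P. \<bar>u B - u' B\<bar> < e}"
proof -
  note P = realizationD(4)[OF u]
  have "open {u'. \<bar>u B - u' B\<bar> < e}" for B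
    by (rule open_Collect_less) (intro continuous_intros continuous_on_product_coordinates)+
  then have "open (\<Inter>B\<in>P. {u'. \<bar>u B - u' B\<bar> < e})" using P by (intro open_INT) auto
  moreover have "{u' \<in> realization P. \<forall>B\<in>P. \<bar>u B - u' B\<bar> < e} = realization P \<inter> (\<Inter>B\<in>P. {u'. \<bar>u B - u' B\<bar> < e})"
    by blast
  ultimately show ?thesis unfolding openin_open by blast
qed

lemma action_lobe_stable:
  assumes T: "T \<in> tree_ops c cs"
  shows "\<exists>\<kappa>\<ge>0. \<forall>u u' xs xs' e b s. u \<in> realization (bracketings T) \<and> u' \<in> realization (bracketings T) \<and>
    (\<forall>j<length cs. xs ! j \<in> cacti (cs ! j) \<and> xs' ! j \<in> cacti (cs ! j) \<and> real (cs ! j) * cactus_dist (cs ! j) (xs ! j) (xs' ! j) \<le> e) \<and>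
    0 \<le> e \<and> (\<forall>B\<in>bracketings T. \<bar>u B - u' B\<bar> \<le> e) \<and> 0 \<le> s \<and> s \<le> 1 \<longrightarrow>
    \<bar>flow (height T u) (lobes xs) T (vertices T) (leaf_value b) s -
      flow (height T u') (lobes xs') T (vertices T) (leaf_value b) s\<bar> \<le> \<kappa> * e"
proof -
  obtain \<kappa> where k0: "0 \<le> \<kappa>" and \<kappa>: "\<forall>t t' x x' A F e s. weights t \<and> weights t' \<and> fits x T \<and> fits x' T \<and>
    compatible t T A \<and> compatible t' T A \<and> good F \<and> 0 \<le> e \<and> (\<forall>S. \<bar>t S - t' S\<bar> \<le> e) \<and> close e x x' T \<and>
    0 \<le> s \<and> s \<le> 1 \<longrightarrow> \<bar>flow t x T A F s - flow t' x' T A F s\<bar> \<le> \<kappa> * e"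
    using flow_stable[of T] by blast
  \<comment> \<open>A weight is a sum of coordinates, at most one for each bracketing; the added 1
    makes the factor also cover the error e of the lobe functions.\<close>
  let ?N = "real (card (bracketings T)) + 1"
  show ?thesis
  proof (intro exI[of _ "\<kappa> * ?N"] conjI allI impI; (elim conjE)?)
    show "0 \<le> \<kappa> * ?N" using k0 by simp
    fix u u' xs xs' and e :: real and b and s :: real
    assume u: "u \<in> realization (bracketings T)" "u' \<in> realization (bracketings T)"
      and xs: "\<forall>j<length cs. xs ! j \<in> cacti (cs ! j) \<and> xs' ! j \<in> cacti (cs ! j) \<and> real (cs ! j) * cactus_dist (cs ! j) (xs ! j) (xs' ! j) \<le> e"
      and e: "0 \<le> e" and eB: "\<forall>B\<in>bracketings T. \<bar>u B - u' B\<bar> \<le> e" and s: "0 \<le> s" "s \<le> 1"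
    have le: "e \<le> ?N * e" using e by (simp add: algebra_simps)
    have h: "\<bar>height T u S - height T u' S\<bar> \<le> ?N * e" for S
    proof -
      have "\<bar>bracket_mass u S - bracket_mass u' S\<bar> \<le> card (bracketings T) * e"
        by (rule bracket_mass_stable[OF u]) (use eB e in auto)
      then show ?thesis using e by (auto simp: height_def algebra_simps)
    qed
    have fits: "fits (lobes xs) T" "fits (lobes xs') T" by (rule fits_lobes(1)[OF T], use xs in blast)+
    have close: "close (?N * e) (lobes xs) (lobes xs') T"
      unfolding close_def
    proof (intro allI impI, elim conjE)
      fix v ts j and r :: real assume v: "Vertex v ts \<in> subs T" "j < length ts" and r: "0 \<le> r" "r \<le> 1"
      have v': "v < length cs" "j < cs ! v" using tree_opsD(5)[OF T v(1)] v(2) by auto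
      have "\<bar>lobe (xs ! v) j r - lobe (xs' ! v) j r\<bar> \<le> real (cs ! v) * cactus_dist (cs ! v) (xs ! v) (xs' ! v)"
        by (rule lobe_dist[OF _ _ v'(2) r]) (use xs v'(1) in auto)
      then show "\<bar>lobes xs v j r - lobes xs' v j r\<bar> \<le> ?N * e"
        using xs[rule_format, OF v'(1)] le by (simp add: lobes_def)
    qed
    have "\<bar>flow (height T u) (lobes xs) T (vertices T) (leaf_value b) s -
      flow (height T u') (lobes xs') T (vertices T) (leaf_value b) s\<bar> \<le> \<kappa> * (?N * e)"
      using height_weights[OF u(1)] height_weights[OF u(2)] fits compatible_all[OF order.refl] good_leaf_value h close s e
      by (intro \<kappa>[rule_format]) auto
    then show "\<bar>flow (height T u) (lobes xs) T (vertices T) (leaf_value b) s -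
      flow (height T u') (lobes xs') T (vertices T) (leaf_value b) s\<bar> \<le> \<kappa> * ?N * e" by (simp add: mult.assoc)
  qed
qed

lemma tree_action_continuous:
  "continuous_map
     (prod_topology (sum_topology (\<lambda>T. top_of_set (realization (bracketings T))) (tree_ops c cs))
       (product_topology (\<lambda>j. Cact (cs ! j)) {..<length cs}))
     (Cact c) (\<lambda>(p, x). tree_action c cs p (map x [0..<length cs]))"
proof (cases "c = 0")
  case True
  then have "(\<lambda>(p, x). tree_action c cs p (map x [0..<length cs])) = (\<lambda>_. [])" by (auto simp: tree_action_def)
  then show ?thesis using True by (simp add: topspace_Cact cacti_def)
next
  case c: False
  interpret C: Metric_space "cacti c" "cactus_dist c" by (rule Metric_space_cacti)
  let ?n = "length cs"
  let ?X = "sum_topology (\<lambda>T. top_of_set (realization (bracketings T))) (tree_ops c cs)"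
  let ?Y = "product_topology (\<lambda>j. Cact (cs ! j)) {..<?n}"
  show ?thesis
    unfolding Cact_def[of c] C.continuous_map_to_metric
  proof (intro ballI allI impI)
    fix px and \<epsilon> :: real
    assume px: "px \<in> topspace (prod_topology ?X ?Y)" and \<epsilon>: "0 < \<epsilon>"
    obtain T u x where px_eq: "px = ((T, u), x)" by (cases px, cases "fst px") auto
    have T: "T \<in> tree_ops c cs" and u: "u \<in> realization (bracketings T)" and x: "x \<in> (\<Pi>\<^sub>E j\<in>{..<?n}. cacti (cs ! j))"
      using px by (auto simp: px_eq topspace_Cact)
    define z where "z = (\<lambda>T u x. tree_action c cs (T, u) (map x [0..<?n]))"
    have xc: "map x [0..<?n] ! j \<in> cacti (cs ! j)" if "j < ?n" "x \<in> (\<Pi>\<^sub>E j\<in>{..<?n}. cacti (cs ! j))" for j x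
      using that by (auto simp: PiE_iff)
    have zc: "z T u x \<in> cacti c" if "T \<in> tree_ops c cs" "u \<in> realization (bracketings T)" "x \<in> (\<Pi>\<^sub>E j\<in>{..<?n}. cacti (cs ! j))" for T u x
      unfolding z_def by (rule tree_action_in_cacti[OF that(1,2) xc[OF _ that(3)]])
    obtain \<delta> where \<delta>: "\<delta> > 0" "\<forall>y\<in>cacti c. (\<forall>r<c. \<forall>t. 0 \<le> t \<and> t \<le> 1 \<longrightarrow> \<bar>lobe (z T u x) r t - lobe y r t\<bar> \<le> \<delta>) \<longrightarrow> cactus_dist c (z T u x) y < \<epsilon>"
      using cactus_dist_small[OF zc[OF T u x] c \<epsilon>] by blast
    obtain \<kappa> where k0: "0 \<le> \<kappa>" and \<kappa>: "\<forall>u u' xs xs' e b s. u \<in> realization (bracketings T) \<and> u' \<in> realization (bracketings T) \<and>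
      (\<forall>j<length cs. xs ! j \<in> cacti (cs ! j) \<and> xs' ! j \<in> cacti (cs ! j) \<and> real (cs ! j) * cactus_dist (cs ! j) (xs ! j) (xs' ! j) \<le> e) \<and>
      0 \<le> e \<and> (\<forall>B\<in>bracketings T. \<bar>u B - u' B\<bar> \<le> e) \<and> 0 \<le> s \<and> s \<le> 1 \<longrightarrow>
      \<bar>flow (height T u) (lobes xs) T (vertices T) (leaf_value b) s -
        flow (height T u') (lobes xs') T (vertices T) (leaf_value b) s\<bar> \<le> \<kappa> * e"
      using action_lobe_stable[OF T] by blast
    \<comment> \<open>The added 1 avoids division by 0, here and in the radii below, which
      compensate the factor by which \<open>lobe_dist\<close> bounds lobe functions through the
      distance.\<close>
    define e where "e = \<delta> / (\<kappa> + 1)"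
    have e: "0 < e" "\<kappa> * e \<le> \<delta>" using \<delta>(1) k0 by (auto simp: e_def field_simps)
    define V1 where "V1 = {u' \<in> realization (bracketings T). \<forall>B\<in>bracketings T. \<bar>u B - u' B\<bar> < e}"
    define b where "b j = Metric_space.mball (cacti (cs ! j)) (cactus_dist (cs ! j)) (x j) (e / (real (cs ! j) + 1))" for j
    have bD: "y \<in> cacti (cs ! j) \<and> real (cs ! j) * cactus_dist (cs ! j) (x j) y \<le> e" if "y \<in> b j" for j y
    proof -
      interpret J: Metric_space "cacti (cs ! j)" "cactus_dist (cs ! j)" by (rule Metric_space_cacti)
      have y: "y \<in> cacti (cs ! j)" "cactus_dist (cs ! j) (x j) y < e / (real (cs ! j) + 1)"
        using that unfolding b_def by (auto simp: J.in_mball)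
      have "real (cs ! j) * cactus_dist (cs ! j) (x j) y \<le> (real (cs ! j) + 1) * cactus_dist (cs ! j) (x j) y"
        by (rule mult_right_mono) (use J.nonneg in auto)
      also have "\<dots> \<le> e" using y(2) by (simp add: field_simps)
      finally show ?thesis using y(1) by blast
    qed
    have "openin ?X (Pair T ` V1)"
      unfolding openin_sum_topology
    proof (intro conjI ballI)
      show "Pair T ` V1 \<subseteq> Sigma (tree_ops c cs) (topspace \<circ> (\<lambda>T. top_of_set (realization (bracketings T))))"
        using T by (auto simp: V1_def)
      fix T' assume "T' \<in> tree_ops c cs"
      have "{u'. (T', u') \<in> Pair T ` V1} = (if T' = T then V1 else {})" by auto
      then show "openin (top_of_set (realization (bracketings T'))) {u'. (T', u') \<in> Pair T ` V1}"
        using realization_nhd[OF u e(1)] by (simp add: V1_def)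
    qed
    moreover have "openin ?Y (PiE {..<?n} b)"
    proof -
      have "openin (Cact (cs ! j)) (b j)" for j
        unfolding Cact_def b_def by (rule Metric_space.openin_mball[OF Metric_space_cacti])
      then show ?thesis by (simp add: openin_PiE)
    qed
    ultimately have op: "openin (prod_topology ?X ?Y) (Pair T ` V1 \<times> PiE {..<?n} b)"
      by (simp add: openin_prod_Times_iff)
    have "u \<in> V1" using u e(1) by (simp add: V1_def)
    moreover have "x \<in> PiE {..<?n} b"
    proof -
      have "x j \<in> b j" if "j < ?n" for j
      proof -
        interpret J: Metric_space "cacti (cs ! j)" "cactus_dist (cs ! j)" by (rule Metric_space_cacti)
        show ?thesis unfolding b_def using x that e(1) by (intro J.centre_in_mball_iff[THEN iffD2]) (auto simp: PiE_iff)
      qed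
      then show ?thesis using x by (auto simp: PiE_iff)
    qed
    ultimately have mem: "px \<in> Pair T ` V1 \<times> PiE {..<?n} b" by (simp add: px_eq)
    show "\<exists>V. openin (prod_topology ?X ?Y) V \<and> px \<in> V \<and>
      (\<forall>q\<in>V. (case q of (p, x) \<Rightarrow> tree_action c cs p (map x [0..<?n])) \<in>
        C.mball (case px of (p, x) \<Rightarrow> tree_action c cs p (map x [0..<?n])) \<epsilon>)"
    proof (intro exI[of _ "Pair T ` V1 \<times> PiE {..<?n} b"] conjI op mem ballI)
      fix q assume "q \<in> Pair T ` V1 \<times> PiE {..<?n} b"
      then obtain u' x' where q: "q = ((T, u'), x')" "u' \<in> V1" "x' \<in> PiE {..<?n} b" by blast
      have u': "u' \<in> realization (bracketings T)" using q(2) by (simp add: V1_def)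
      have x': "x' \<in> (\<Pi>\<^sub>E j\<in>{..<?n}. cacti (cs ! j))" using q(3) bD by (auto simp: PiE_iff)
      have "\<bar>lobe (z T u x) r t - lobe (z T u' x') r t\<bar> \<le> \<delta>" if r: "r < c" and t: "0 \<le> t" "t \<le> 1" for r t
      proof -
        have "\<bar>flow (height T u) (lobes (map x [0..<?n])) T (vertices T) (leaf_value r) t -
          flow (height T u') (lobes (map x' [0..<?n])) T (vertices T) (leaf_value r) t\<bar> \<le> \<kappa> * e"
        proof (intro \<kappa>[rule_format] conjI allI impI ballI u u' t)
          fix j assume j: "j < ?n"
          show "map x [0..<?n] ! j \<in> cacti (cs ! j)" "map x' [0..<?n] ! j \<in> cacti (cs ! j)"
            by (rule xc[OF j x], rule xc[OF j x'])
          show "real (cs ! j) * cactus_dist (cs ! j) (map x [0..<?n] ! j) (map x' [0..<?n] ! j) \<le> e"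
            using bD[of "x' j" j] q(3) j by (auto simp: PiE_iff)
        next
          fix B assume "B \<in> bracketings T"
          then show "\<bar>u B - u' B\<bar> \<le> e" using q(2) by (auto simp: V1_def intro: less_imp_le)
        qed (use e in simp)
        then show ?thesis
          unfolding z_def using lobe_tree_action[OF T u xc[OF _ x] r t] lobe_tree_action[OF T u' xc[OF _ x'] r t] e(2) by simp
      qed
      then have "cactus_dist c (z T u x) (z T u' x') < \<epsilon>" using \<delta>(2) zc[OF T u' x'] by blast
      then show "(case q of (p, x) \<Rightarrow> tree_action c cs p (map x [0..<?n])) \<in>
        C.mball (case px of (p, x) \<Rightarrow> tree_action c cs p (map x [0..<?n])) \<epsilon>"
        using zc[OF T u x] zc[OF T u' x'] unfolding C.in_mball by (simp add: q(1) px_eq z_def)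
    qed
  qed
qed

theorem theorem1:
  shows "\<exists>\<theta>. operad_algebra BO Cact \<theta> \<and>
    (\<forall>n ls x. distinct ls \<and> set ls = {..<n} \<and> x \<in> cacti n \<longrightarrow>
       (\<forall>j<n. \<theta> n [n] (corolla ls, point_mass {}) [x] ! (ls ! j) = x ! j)) \<and>
    (\<forall>m n i x1 x2. i < m \<and> x1 \<in> cacti m \<and> x2 \<in> cacti n \<longrightarrow>
       \<theta> (m + n - 1) [m, n] (two_vertex_tree m n i, point_mass {}) [x1, x2] = cactus_comp i x1 x2)"
proof (intro exI[of _ tree_action] conjI allI impI; (elim conjE)?)
  show "operad_algebra BO Cact tree_action"
  proof
    show "continuous_map (prod_topology (op_space BO c cs) (product_topology (\<lambda>j. Cact (cs ! j)) {..<length cs}))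
      (Cact c) (\<lambda>(p, x). tree_action c cs p (map x [0..<length cs]))" for c cs
      using tree_action_continuous[of c cs] by (simp add: BO_def)
  next
    fix i cs p c q ds xs ys
    assume i: "i < length cs" and p: "p \<in> topspace (op_space BO c cs)" and q: "q \<in> topspace (op_space BO (cs ! i) ds)"
      and xs: "list_all2 (\<lambda>x a. x \<in> topspace (Cact a)) xs cs" and ys: "list_all2 (\<lambda>y a. y \<in> topspace (Cact a)) ys ds"
    obtain T u U v where pq: "p = (T, u)" "q = (U, v)" by (cases p, cases q)
    have "T \<in> tree_ops c cs" "u \<in> realization (bracketings T)" "U \<in> tree_ops (cs ! i) ds" "v \<in> realization (bracketings U)"
      using p q by (auto simp: pq BO_def)
    then have "tree_action c (insert_list i cs ds) (tree_comp i T U,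
      realize_map (bracketing_comp i T U) (realize_prod (bracketings T) (bracketings U) (u, v))) (insert_list i xs ys)
      = tree_action c cs (T, u) (xs[i := tree_action (cs ! i) ds (U, v) ys])"
      using xs ys by (intro tree_action_assoc[OF i]) (auto simp: list_all2_conv_all_nth topspace_Cact)
    then show "tree_action c (insert_list i cs ds) (op_comp BO i p q) (insert_list i xs ys)
      = tree_action c cs p (xs[i := tree_action (cs ! i) ds q ys])"
      by (simp add: BO_def pq)
  next
    show "tree_action c [c] (op_unit BO c) [x] = x" if "x \<in> topspace (Cact c)" for x c
      using tree_action_unit[of x c] that by (simp add: BO_def topspace_Cact)
  next
    fix \<sigma> cs p c xs
    assume \<sigma>: "\<sigma> permutes {..<length cs}" and p: "p \<in> topspace (op_space BO c cs)"
      and xs: "list_all2 (\<lambda>x a. x \<in> topspace (Cact a)) xs cs"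
    obtain T u where pT: "p = (T, u)" by (cases p)
    then have "T \<in> tree_ops c cs" "u \<in> realization (bracketings T)" using p by (auto simp: BO_def)
    then have "tree_action c (permute_list \<sigma> cs) (relabel (inv \<sigma>) T, realize_map ((`) ((`) (inv \<sigma>))) u) (permute_list \<sigma> xs)
      = tree_action c cs (T, u) xs"
      using xs by (intro tree_action_relabel[OF \<sigma>]) (auto simp: list_all2_conv_all_nth topspace_Cact)
    then show "tree_action c (permute_list \<sigma> cs) (op_act BO \<sigma> p) (permute_list \<sigma> xs) = tree_action c cs p xs"
      by (simp add: BO_def pT)
  qed
qed (use tree_action_corolla_nth tree_action_two_vertex_tree in auto)

end
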